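(* Let $\nu=(\nu_1,\dots,\nu_{m(\nu)})$ be a finite tuple of positive integers with $|\nu|=\nu_1+\dots+\nu_{m(\nu)}$ even, let $x_1,\dots,x_{|\nu|}\in V$ be vertices (not necessarily distinct), and let $F:\mathbb{R}^V\to\mathbb{R}$ be bounded measurable. Let $\Phi$ be the $E_{\beta,n}$-valued Gaussian free field on the electrical network $\mathcal G=(V,E)$. (1) If $\beta\in\{1,2\}$ and $A(k,\sigma(k))$, $1\le k\le|\nu|$, are deterministic $n\times n$ complex matrices, then $$\Big\langle \Big(\prod_{l=1}^{m(\nu)}\operatorname{Tr}\big(\Pi_{\nu,l}(\Phi,A)\big)\Big)F(\operatorname{Tr}(\Phi^2)/2)\Big\rangle_{\beta,n}=\int_{\gamma_1,\dots,\gamma_{|\nu|/2}}\Big\langle F\big(\operatorname{Tr}(\Phi^2)/2+L(\gamma_1)+\dots+L(\gamma_{|\nu|/2})\big)\Big\rangle_{\beta,n}\,\mu_{\nu,\beta,n,A}^{x_1,\dots,x_{|\nu|}}(d\gamma_1,\dots,d\gamma_{|\nu|/2}).$$ (2) If $\beta=4$ and $\widetilde A(k,\sigma(k))$, $1\le k\le|\nu|$, are deterministic $n\times n$ quaternionic matrices, then $$\Big\langle \Big(\prod_{l=1}^{m(\nu)}\operatorname{Re}\big(\operatorname{Tr}\big(\Pi_{\nu,l}(\Phi,\widetilde A)\big)\big)\Big)F(\operatorname{Tr}(\Phi^2)/2)\Big\rangle_{4,n}=\int_{\gamma_1,\dots,\gamma_{|\nu|/2}}\Big\langle F\big(\operatorname{Tr}(\Phi^2)/2+L(\gamma_1)+\dots+L(\gamma_{|\nu|/2})\big)\Big\rangle_{4,n}\,\mu_{\nu,4,n,\widetilde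 A}^{x_1,\dots,x_{|\nu|}}(d\gamma_1,\dots,d\gamma_{|\nu|/2}).$$
   Context: **Network and path measures.** $\mathcal G=(V,E)$ is a finite undirected connected graph without multiple edges or self-loops, with conductances $C(x,y)=C(y,x)>0$ for $\{x,y\}\in E$ and a killing measure $\kappa:V\to[0,\infty)$, not identically zero. $(X_t)$ is the Markov jump process on $V$ jumping from $x$ to a neighbour $y$ at rate $C(x,y)$ and killed at $x$ at rate $\kappa(x)$; $\zeta$ is the killing time; $p_t(x,y)=\mathbb P(X_t=y,t<\zeta\mid X_0=x)$. $\mathbb P_t^{x,y}$ is the bridge law, i.e. the law of $(X_s)_{0\le s\le t}$ started at $x$ and conditioned on $X_t=y$, $t<\zeta$. Set $\mu^{x,y}(d\gamma)=\int_0^\infty \mathbb P_t^{x,y}(d\gamma)\,p_t(x,y)\,dt$, a finite measure on paths from $x$ to $y$ of finite lifetime. For a path $\gamma$ of lifetime $T(\gamma)$, $L(\gamma)\in\mathbb R^V$ is its occupation field, $L(\gamma)(x)=\int_0^{T(\gamma)}\mathbf 1_{\{\gamma(t)=x\}}dt$. For a partition in pairs $\mathbf p=\{\{a_1,b_1\},\dots,\{a_r,b_r\}\}$ of $\{1,\dots,2r\}$ ($a_i<b_i$; the ordering of the pairs is fixed arbitrarily and is immaterial), $\mu_{\mathbf p}^{x_1,\dots,x_{2r}}(d\gamma_1,\dots,d\gamma_r)=\prod_{i=1}^r\mu^{x_{a_i},x_{b_i}}(d\gamma_i)$. **Matrix-valued field.** $n\ge1$ is an integer. $E_{\beta,n}$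 is the real vector space of $n\times n$ real symmetric ($\beta=1$), complex Hermitian ($\beta=2$), quaternionic Hermitian ($\beta=4$) matrices, with real inner product $(M,M')\mapsto\operatorname{Re}(\operatorname{Tr}(MM'))$. $\operatorname{Tr}(M)=\sum_i M_{ii}$, $\operatorname{Re}$ is the real part (of a quaternion if $\beta=4$), ${}^{\mathsf T}$ is the transpose, and for quaternionic matrices $(M^* )_{ij}=\overline{M_{ji}}$. The matrix-valued Gaussian free field $\Phi:V\to E_{\beta,n}$ is the random field with density proportional to $$\exp\Big(-\tfrac12\sum_{x\in V}\kappa(x)\operatorname{Tr}(M(x)^2)-\tfrac12\sum_{\{x,y\}\in E}C(x,y)\operatorname{Tr}((M(y)-M(x))^2)\Big)$$ with respect to Lebesgue measure $\prod_{x\in V}dM(x)$ on $(E_{\beta,n})^V$; $\langle\cdot\rangle_{\beta,n}$ is the expectation for it. $\operatorname{Tr}(\Phi^2)$ is the field $x\mapsto\operatorname{Tr}(\Phi(x)^2)$. **Ribbon pairings and trails.** Given $\nu$, there are $m(\nu)$ vertices; the $l$-th carries $\nu_l$ ribbon half-edges labelled $\nu_1+\dots+\nu_{l-1}+1,\dots,\nu_1+\dots+\nu_l$ in this (clockwise) cyclic order. Let $\sigma$ be the permutation of $\{1,\dots,|\nu|\}$ sending each label to the next one in the cyclic order around its vertex (so $\sigma(k)=k$ if the vertex has one half-edge). A ribbon pairing $\rho\in\mathcal R_\nu$ is a partition in pairs $\mathbf p_\nu(\rho)$ of $\{1,\dots,|\nu|\}$ together with a choice, for each pair, of "straight" or "twisted".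 Each half-edge $k$ has two sides $(k,+)$ and $(k,-)$. At vertices, the side $(k,+)$ is joined to $(\sigma(k),-)$ for every $k$. For a straight pair $\{k,k'\}$, $(k,+)$ is glued to $(k',-)$ and $(k,-)$ to $(k',+)$; for a twisted pair, $(k,+)$ is glued to $(k',+)$ and $(k,-)$ to $(k',-)$. The sides form disjoint cycles (boundary cycles), alternating vertex-joins and gluings; $f_\nu(\rho)$ is their number, and $\chi_\nu(\rho)=m(\nu)-|\nu|/2+f_\nu(\rho)$. Traversing a boundary cycle in either direction from any starting point gives a cyclic sequence of labels and symbols: a vertex-join traversed from $(k,+)$ to $(\sigma(k),-)$ is recorded as $k\rightarrow\sigma(k)$; traversed from $(\sigma(k),-)$ to $(k,+)$ it is recorded as $\sigma(k)\leftarrow k$; a gluing traversed from $k$ to $k'$ is recorded as $k\doteq k'$. This sequence, up to cyclic permutation and reversal of direction (reversal exchanges $\rightarrow$ and $\leftarrow$), is the trail of the cycle; $\mathcal T_\nu(\rho)$ is the set of the $f_\nu(\rho)$ trails of $\rho$. The weights are $$w_{\nu,1}(\rho)=2^{-|\nu|/2},\quad w_{\nu,2}(\rho)=\mathbf 1_{\{\rho\text{ has only straight edges}\}},\quad w_{\nu,4}(\rho)=(-2)^{\chi_\nu(\rho)}2^{-2m(\nu)+|\nu|/2}.$$ **Products and measures.** With $s_l=\nu_1+\dots+\nu_l$ ($s_0=0$), $$\Pi_{\nu,l}(\Phi,A)=\Phi(x_{s_{l-1}+1})A(s_{l-1}+1,s_{l-1}+2)\Phi(x_{s_{l-1}+2})\cdots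 A(s_l-1,s_l)\Phi(x_{s_l})A(s_l,s_{l-1}+1)$$ (equal to $\Phi(x_{s_l})A(s_l,s_l)$ if $\nu_l=1$), and $\Pi_{\nu,l}(\Phi,\widetilde A)$ is defined in the same way with $\widetilde A$. For a trail $\mathtt t$, $\Pi_{\mathtt t}(A)$ is the product, in the cyclic order of the trail, of the factors $A(k,k')$ for each $k\rightarrow k'$ and $A(k',k)^{\mathsf T}$ for each $k\leftarrow k'$ (no factor for $\doteq$); $\widetilde\Pi_{\mathtt t}(\widetilde A)$ is the product, in the cyclic order of the trail, of $\widetilde A(k,k')$ for each $k\rightarrow k'$ and $\widetilde A(k',k)^*$ for each $k\leftarrow k'$. ($\operatorname{Tr}(\Pi_{\mathtt t}(A))$ and $\operatorname{Re}\operatorname{Tr}(\widetilde\Pi_{\mathtt t}(\widetilde A))$ do not depend on the representative of the trail.) For $\beta\in\{1,2\}$, $$\mu_{\nu,\beta,n,A}^{x_1,\dots,x_{|\nu|}}=\sum_{\rho\in\mathcal R_\nu}w_{\nu,\beta}(\rho)\Big(\prod_{\mathtt t\in\mathcal T_\nu(\rho)}\operatorname{Tr}(\Pi_{\mathtt t}(A))\Big)\mu_{\mathbf p_\nu(\rho)}^{x_1,\dots,x_{|\nu|}},$$ and $$\mu_{\nu,4,n,\widetilde A}^{x_1,\dots,x_{|\nu|}}=\sum_{\rho\in\mathcal R_\nu}w_{\nu,4}(\rho)\Big(\prod_{\mathtt t\in\mathcal T_\nu(\rho)}\operatorname{Re}(\operatorname{Tr}(\widetilde\Pi_{\mathtt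 t}(\widetilde A)))\Big)\mu_{\mathbf p_\nu(\rho)}^{x_1,\dots,x_{|\nu|}}.$$ On the right-hand sides of the identities, the field and the paths are taken under the product measure. *)

theory Defs
  imports "HOL-Probability.Probability" "HOL-Combinatorics.Combinatorics"
begin

section \<open>Quaternions\<close>

datatype quat = Quat (qRe: real) (qIm1: real) (qIm2: real) (qIm3: real)

lemma quat_eq_iff:
  "a = b \<longleftrightarrow> qRe a = qRe b \<and> qIm1 a = qIm1 b \<and> qIm2 a = qIm2 b \<and> qIm3 a = qIm3 b"
  by (cases a; cases b) simp

instantiation quat :: ring_1
begin

definition "0 = Quat 0 0 0 0"
definition "1 = Quat 1 0 0 0"
definition "- a = Quat (- qRe a) (- qIm1 a) (- qIm2 a) (- qIm3 a)"
definition "a + b = Quat (qRe a + qRe b) (qIm1 a + qIm1 b) (qIm2 a + qIm2 b) (qIm3 a + qIm3 b)"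
definition "a - b = Quat (qRe a - qRe b) (qIm1 a - qIm1 b) (qIm2 a - qIm2 b) (qIm3 a - qIm3 b)"
definition "a * b = Quat
  (qRe a * qRe b - qIm1 a * qIm1 b - qIm2 a * qIm2 b - qIm3 a * qIm3 b)
  (qRe a * qIm1 b + qIm1 a * qRe b + qIm2 a * qIm3 b - qIm3 a * qIm2 b)
  (qRe a * qIm2 b - qIm1 a * qIm3 b + qIm2 a * qRe b + qIm3 a * qIm1 b)
  (qRe a * qIm3 b + qIm1 a * qIm2 b - qIm2 a * qIm1 b + qIm3 a * qRe b)"

instance
  by standard
    (simp_all add: quat_eq_iff zero_quat_def one_quat_def uminus_quat_def plus_quat_def
      minus_quat_def times_quat_def algebra_simps)

end

lemma quat_sel_simps [simp]:
  "qRe 0 = 0" "qIm1 0 = 0" "qIm2 0 = 0" "qIm3 0 = 0"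
  "qRe 1 = 1" "qIm1 1 = 0" "qIm2 1 = 0" "qIm3 1 = 0"
  "qRe (- a) = - qRe a" "qIm1 (- a) = - qIm1 a" "qIm2 (- a) = - qIm2 a" "qIm3 (- a) = - qIm3 a"
  "qRe (a + b) = qRe a + qRe b" "qIm1 (a + b) = qIm1 a + qIm1 b"
  "qIm2 (a + b) = qIm2 a + qIm2 b" "qIm3 (a + b) = qIm3 a + qIm3 b"
  "qRe (a - b) = qRe a - qRe b" "qIm1 (a - b) = qIm1 a - qIm1 b"
  "qIm2 (a - b) = qIm2 a - qIm2 b" "qIm3 (a - b) = qIm3 a - qIm3 b"
  by (simp_all add: zero_quat_def one_quat_def uminus_quat_def plus_quat_def minus_quat_def)

definition qcnj :: "quat \<Rightarrow> quat" where
  "qcnj a = Quat (qRe a) (- qIm1 a) (- qIm2 a) (- qIm3 a)"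

instantiation quat :: real_algebra_1
begin

definition "scaleR r a = Quat (r * qRe a) (r * qIm1 a) (r * qIm2 a) (r * qIm3 a)" for r :: real

instance
  by standard (simp_all add: quat_eq_iff scaleR_quat_def times_quat_def algebra_simps)

end

instantiation quat :: real_inner
begin

definition "inner a b = qRe a * qRe b + qIm1 a * qIm1 b + qIm2 a * qIm2 b + qIm3 a * qIm3 b"
definition "norm (a :: quat) = sqrt (inner a a)"
definition "sgn (a :: quat) = a /\<^sub>R norm a"
definition "dist (a :: quat) b = norm (a - b)"
definition "uniformity = (INF e\<in>{0<..}. principal {(a :: quat, b). dist a b < e})"
definition "open U \<longleftrightarrow> (\<forall>a\<in>U. \<forall>\<^sub>F (a', b) in uniformity. a' = a \<longrightarrow> b \<in> U)"
  for U :: "quat set"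

instance
proof
  fix a :: quat
  show "0 \<le> inner a a"
    by (simp add: inner_quat_def)
  have "inner a a = (qRe a)\<^sup>2 + (qIm1 a)\<^sup>2 + (qIm2 a)\<^sup>2 + (qIm3 a)\<^sup>2"
    by (simp add: inner_quat_def power2_eq_square)
  then show "inner a a = 0 \<longleftrightarrow> a = 0"
    by (simp add: quat_eq_iff add_nonneg_eq_0_iff)
qed (simp_all add: quat_eq_iff scaleR_quat_def inner_quat_def norm_quat_def sgn_quat_def
    dist_quat_def uniformity_quat_def open_quat_def algebra_simps)

end

instantiation quat :: euclidean_space
begin

definition "Basis = {Quat 1 0 0 0, Quat 0 1 0 0, Quat 0 0 1 0, Quat 0 0 0 1}"

instance
proof
  show "(Basis :: quat set) \<noteq> {}" "finite (Basis :: quat set)"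
    by (simp_all add: Basis_quat_def)
next
  fix u v :: quat
  assume "u \<in> Basis" "v \<in> Basis"
  then show "inner u v = (if u = v then 1 else 0)"
    unfolding Basis_quat_def by (elim insertE emptyE; simp add: inner_quat_def)
next
  fix a :: quat
  show "(\<forall>u\<in>Basis. inner a u = 0) \<longleftrightarrow> a = 0"
    by (cases a) (simp add: Basis_quat_def inner_quat_def zero_quat_def)
qed

end


section \<open>Electrical networks and the killed Markov jump process\<close>

text \<open>The vertex set is the (finite) universe of the type \<open>'v\<close>. The values of \<open>C\<close> off the
  edges are irrelevant.\<close>

locale electrical_network =
  fixes E :: "'v::finite set set" and C :: "'v \<Rightarrow> 'v \<Rightarrow> real" and \<kappa> :: "'v \<Rightarrow> real"
  assumes simple: "e \<in> E \<Longrightarrow> card e = 2"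
    and connected: "(x, y) \<in> {(u, v). {u, v} \<in> E}\<^sup>*"
    and conductance_sym: "{x, y} \<in> E \<Longrightarrow> C x y = C y x"
    and conductance_pos: "{x, y} \<in> E \<Longrightarrow> 0 < C x y"
    and killing_nonneg: "0 \<le> \<kappa> x"
    and killing_nonzero: "\<exists>x. \<kappa> x \<noteq> 0"

definition total_rate :: "'v::finite set set \<Rightarrow> ('v \<Rightarrow> 'v \<Rightarrow> real) \<Rightarrow> ('v \<Rightarrow> real) \<Rightarrow> 'v \<Rightarrow> real" where
  "total_rate E C \<kappa> x = \<kappa> x + (\<Sum>y | {x, y} \<in> E. C x y)"

text \<open>\<open>None\<close> is the cemetery.\<close>

definition jump_pmf ::
    "'v::finite set set \<Rightarrow> ('v \<Rightarrow> 'v \<Rightarrow> real) \<Rightarrow> ('v \<Rightarrow> real) \<Rightarrow> 'v \<Rightarrow> 'v option pmf" where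
  "jump_pmf E C \<kappa> x = embed_pmf (\<lambda>z. case z of
      None \<Rightarrow> \<kappa> x / total_rate E C \<kappa> x
    | Some y \<Rightarrow> if {x, y} \<in> E then C x y / total_rate E C \<kappa> x else 0)"

text \<open>The process is realised on a space of i.i.d. pairs \<open>(g\<^sub>n, \<tau>\<^sub>n)\<close>, where the \<open>g\<^sub>n v\<close>
  (\<open>v\<close> a vertex) are independent with laws \<open>jump_pmf E C \<kappa> v\<close>, and \<open>\<tau>\<^sub>n\<close> is an independent
  standard exponential variable: from its \<open>n\<close>-th state \<open>v\<close> the process jumps to \<open>g\<^sub>n v\<close> after
  the holding time \<open>\<tau>\<^sub>n / total_rate E C \<kappa> v\<close>.\<close>

type_synonym 'v driver = "(('v \<Rightarrow> 'v option) \<times> real) stream"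

definition driver_measure ::
    "'v::finite set set \<Rightarrow> ('v \<Rightarrow> 'v \<Rightarrow> real) \<Rightarrow> ('v \<Rightarrow> real) \<Rightarrow> 'v driver measure" where
  "driver_measure E C \<kappa> = stream_space
     (measure_pmf (Pi_pmf UNIV None (jump_pmf E C \<kappa>)) \<Otimes>\<^sub>M
      density lborel (\<lambda>s. ennreal (exponential_density 1 s)))"

primrec jump_chain :: "'v \<Rightarrow> 'v driver \<Rightarrow> nat \<Rightarrow> 'v option" where
  "jump_chain x \<omega> 0 = Some x"
| "jump_chain x \<omega> (Suc n) =
     (case jump_chain x \<omega> n of None \<Rightarrow> None | Some v \<Rightarrow> fst (\<omega> !! n) v)"

text \<open>In the cemetery the holding times are set to \<open>0\<close>, so that the jump times stay constant after
  the killing time.\<close>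

definition holding_time ::
    "'v::finite set set \<Rightarrow> ('v \<Rightarrow> 'v \<Rightarrow> real) \<Rightarrow> ('v \<Rightarrow> real) \<Rightarrow> 'v \<Rightarrow> 'v driver \<Rightarrow> nat \<Rightarrow> real" where
  "holding_time E C \<kappa> x \<omega> n =
     (case jump_chain x \<omega> n of None \<Rightarrow> 0 | Some v \<Rightarrow> snd (\<omega> !! n) / total_rate E C \<kappa> v)"

definition jump_time ::
    "'v::finite set set \<Rightarrow> ('v \<Rightarrow> 'v \<Rightarrow> real) \<Rightarrow> ('v \<Rightarrow> real) \<Rightarrow> 'v \<Rightarrow> 'v driver \<Rightarrow> nat \<Rightarrow> real" where
  "jump_time E C \<kappa> x \<omega> n = (\<Sum>i<n. holding_time E C \<kappa> x \<omega> i)"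

text \<open>\<open>X\<^sub>t\<close> started at \<open>x\<close>, with \<open>X\<^sub>t = None\<close> for \<open>t \<ge> \<zeta>\<close>; so \<open>X\<^sub>t = Some y\<close> is the event
  \<open>{X\<^sub>t = y, t < \<zeta>}\<close>.\<close>

definition jump_process ::
    "'v::finite set set \<Rightarrow> ('v \<Rightarrow> 'v \<Rightarrow> real) \<Rightarrow> ('v \<Rightarrow> real) \<Rightarrow> 'v \<Rightarrow> real \<Rightarrow> 'v driver \<Rightarrow> 'v option" where
  "jump_process E C \<kappa> x t \<omega> =
     (if \<exists>n. t < jump_time E C \<kappa> x \<omega> (Suc n)
      then jump_chain x \<omega> (LEAST n. t < jump_time E C \<kappa> x \<omega> (Suc n))
      else None)"

definition trans_prob ::
    "'v::finite set set \<Rightarrow> ('v \<Rightarrow> 'v \<Rightarrow> real) \<Rightarrow> ('v \<Rightarrow> real) \<Rightarrow> real \<Rightarrow> 'v \<Rightarrow> 'v \<Rightarrow> real" where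
  "trans_prob E C \<kappa> t x y = measure (driver_measure E C \<kappa>)
     {\<omega> \<in> space (driver_measure E C \<kappa>). jump_process E C \<kappa> x t \<omega> = Some y}"


section \<open>Path measures and occupation fields\<close>

text \<open>A path is a pair of its lifetime \<open>T\<close> and a right-continuous function \<open>[0,T] \<rightarrow> V\<close>; the
  \<open>\<sigma>\<close>-algebra is generated by the lifetime and the evaluations. Right-continuity makes occupation
  times measurable.\<close>

type_synonym 'v path = "real \<times> (real \<Rightarrow> 'v)"

definition path_space :: "'v::finite path measure" where
  "path_space = restrict_space (borel \<Otimes>\<^sub>M (\<Pi>\<^sub>M s\<in>UNIV. count_space UNIV))
     {(T, \<gamma>). 0 \<le> T \<and> \<gamma> \<in> extensional {0..T} \<and>
       (\<forall>s. 0 \<le> s \<and> s < T \<longrightarrow> (\<exists>\<epsilon>>0. \<forall>u. s \<le> u \<and> u < s + \<epsilon> \<and> u \<le> T \<longrightarrow> \<gamma> u = \<gamma> s))}"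

definition occupation :: "'v::finite path \<Rightarrow> real ^ 'v" where
  "occupation \<gamma> = (\<chi> x. LINT t:{0..fst \<gamma>}|lborel. indicator {x} (snd \<gamma> t))"

definition bridge_law ::
    "'v::finite set set \<Rightarrow> ('v \<Rightarrow> 'v \<Rightarrow> real) \<Rightarrow> ('v \<Rightarrow> real) \<Rightarrow> real \<Rightarrow> 'v \<Rightarrow> 'v \<Rightarrow> 'v path measure" where
  "bridge_law E C \<kappa> t x y = distr
     (uniform_measure (driver_measure E C \<kappa>)
       {\<omega> \<in> space (driver_measure E C \<kappa>). jump_process E C \<kappa> x t \<omega> = Some y})
     path_space
     (\<lambda>\<omega>. (t, \<lambda>s\<in>{0..t}. the (jump_process E C \<kappa> x s \<omega>)))"

definition path_measure ::
    "'v::finite set set \<Rightarrow> ('v \<Rightarrow> 'v \<Rightarrow> real) \<Rightarrow> ('v \<Rightarrow> real) \<Rightarrow> 'v \<Rightarrow> 'v \<Rightarrow> 'v path measure" where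
  "path_measure E C \<kappa> x y = measure_of (space path_space) (sets path_space)
     (\<lambda>B. \<integral>\<^sup>+t\<in>{0..}. (emeasure (bridge_law E C \<kappa> t x y) B * ennreal (trans_prob E C \<kappa> t x y)) \<partial>lborel)"

definition partner :: "nat set set \<Rightarrow> nat \<Rightarrow> nat" where
  "partner p k = (THE k'. k' \<noteq> k \<and> {k, k'} \<in> p)"

text \<open>The pairs \<open>{a\<^sub>i, b\<^sub>i}\<close>, \<open>a\<^sub>i < b\<^sub>i\<close>, of \<open>p\<close> are ordered by increasing \<open>a\<^sub>i\<close> and numbered
  from \<open>0\<close>.\<close>

definition pair_fst :: "nat set set \<Rightarrow> nat \<Rightarrow> nat" where
  "pair_fst p i = sorted_list_of_set (Min ` p) ! i"

definition pair_snd :: "nat set set \<Rightarrow> nat \<Rightarrow> nat" where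
  "pair_snd p i = partner p (pair_fst p i)"

definition pairing_measure ::
    "'v::finite set set \<Rightarrow> ('v \<Rightarrow> 'v \<Rightarrow> real) \<Rightarrow> ('v \<Rightarrow> real) \<Rightarrow> (nat \<Rightarrow> 'v) \<Rightarrow> nat set set \<Rightarrow>
     (nat \<Rightarrow> 'v path) measure" where
  "pairing_measure E C \<kappa> x p =
     (\<Pi>\<^sub>M i\<in>{..<card p}. path_measure E C \<kappa> (x (pair_fst p i)) (x (pair_snd p i)))"


section \<open>The matrix-valued Gaussian free field\<close>

text \<open>For \<open>\<beta> = 1\<close> the real symmetric matrices are regarded as complex matrices with real entries.\<close>

definition herm_space :: "nat \<Rightarrow> (complex ^ 'n ^ 'n) set" where
  "herm_space \<beta> = (if \<beta> = 1
     then {M. \<forall>i j. M $ i $ j \<in> \<real> \<and> M $ i $ j = M $ j $ i}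
     else {M. \<forall>i j. M $ i $ j = cnj (M $ j $ i)})"

definition qherm_space :: "(quat ^ 'n ^ 'n) set" where
  "qherm_space = {M. \<forall>i j. M $ i $ j = qcnj (M $ j $ i)}"

text \<open>\<open>Tr(M\<^sup>2)\<close>, which is real for Hermitian \<open>M\<close>.\<close>

definition tr_sq :: "complex ^ 'n ^ 'n \<Rightarrow> real" where
  "tr_sq M = Re (trace (M ** M))"

definition qtr_sq :: "quat ^ 'n ^ 'n \<Rightarrow> real" where
  "qtr_sq M = qRe (trace (M ** M))"

text \<open>Lebesgue measure on a linear subspace, as a measure on the ambient space: the image of the
  product Lebesgue measure under the coordinate map of an orthonormal basis. On Hermitian matrices
  the inner product of the ambient space is \<open>Re (Tr (M M'))\<close>.\<close>

definition lborel_subspace :: "'a::euclidean_space set \<Rightarrow> 'a measure" where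
  "lborel_subspace S =
     (let B = SOME B. B \<subseteq> S \<and> pairwise orthogonal B \<and> (\<forall>b\<in>B. norm b = 1) \<and> span B = S
      in distr (\<Pi>\<^sub>M b\<in>B. lborel) borel (\<lambda>c. \<Sum>b\<in>B. c b *\<^sub>R b))"

text \<open>The second sum runs over ordered pairs, so each edge is counted twice.\<close>

definition gff_energy ::
    "'v::finite set set \<Rightarrow> ('v \<Rightarrow> 'v \<Rightarrow> real) \<Rightarrow> ('v \<Rightarrow> real) \<Rightarrow> ('a::minus \<Rightarrow> real) \<Rightarrow> ('v \<Rightarrow> 'a) \<Rightarrow> real" where
  "gff_energy E C \<kappa> q M =
     1/2 * (\<Sum>x\<in>UNIV. \<kappa> x * q (M x)) +
     1/2 * (1/2 * (\<Sum>x\<in>UNIV. \<Sum>y | {x, y} \<in> E. C x y * q (M y - M x)))"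

definition gff ::
    "'v::finite set set \<Rightarrow> ('v \<Rightarrow> 'v \<Rightarrow> real) \<Rightarrow> ('v \<Rightarrow> real) \<Rightarrow> 'a::euclidean_space set \<Rightarrow> ('a \<Rightarrow> real) \<Rightarrow>
     ('v \<Rightarrow> 'a) measure" where
  "gff E C \<kappa> S q =
     (let N = (\<Pi>\<^sub>M x\<in>UNIV. lborel_subspace S);
          Z = (\<integral>M. exp (- gff_energy E C \<kappa> q M) \<partial>N)
      in density N (\<lambda>M. ennreal (exp (- gff_energy E C \<kappa> q M) / Z)))"


section \<open>Ribbon pairings and trails\<close>

text \<open>The vertices are numbered from \<open>0\<close>; vertex \<open>l\<close> carries the labels
  \<open>psum \<nu> l + 1, \<dots>, psum \<nu> (Suc l)\<close>.\<close>

definition psum :: "nat list \<Rightarrow> nat \<Rightarrow> nat" where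
  "psum \<nu> l = sum_list (take l \<nu>)"

definition vertex_of :: "nat list \<Rightarrow> nat \<Rightarrow> nat" where
  "vertex_of \<nu> k = (LEAST l. k \<le> psum \<nu> (Suc l))"

definition next_label :: "nat list \<Rightarrow> nat \<Rightarrow> nat" where
  "next_label \<nu> k =
     (if k = psum \<nu> (Suc (vertex_of \<nu> k)) then psum \<nu> (vertex_of \<nu> k) + 1 else k + 1)"

text \<open>A ribbon pairing is a pair \<open>(p, T)\<close> of a partition in pairs and the set of its twisted
  pairs.\<close>

type_synonym ribbon_pairing = "nat set set \<times> nat set set"

definition ribbon_pairings :: "nat list \<Rightarrow> ribbon_pairing set" where
  "ribbon_pairings \<nu> =
     {(p, T). partition_on {1..sum_list \<nu>} p \<and> (\<forall>e\<in>p. card e = 2) \<and> T \<subseteq> p}"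

text \<open>\<open>(k, True)\<close> is the side \<open>(k,+)\<close> and \<open>(k, False)\<close> is the side \<open>(k,-)\<close>.\<close>

type_synonym side = "nat \<times> bool"

definition sides :: "nat list \<Rightarrow> side set" where
  "sides \<nu> = {1..sum_list \<nu>} \<times> UNIV"

fun vertex_join :: "nat list \<Rightarrow> side \<Rightarrow> side" where
  "vertex_join \<nu> (k, True) = (next_label \<nu> k, False)"
| "vertex_join \<nu> (k, False) = (inv_into {1..sum_list \<nu>} (next_label \<nu>) k, True)"

fun glue :: "ribbon_pairing \<Rightarrow> side \<Rightarrow> side" where
  "glue (p, T) (k, b) = (partner p k, if {k, partner p k} \<in> T then b else \<not> b)"

definition boundary_cycles :: "nat list \<Rightarrow> ribbon_pairing \<Rightarrow> side set set" where
  "boundary_cycles \<nu> \<rho> =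
     sides \<nu> // (\<Union>s\<in>sides \<nu>. {(s, vertex_join \<nu> s), (s, glue \<rho> s)})\<^sup>*"

definition euler_char :: "nat list \<Rightarrow> ribbon_pairing \<Rightarrow> int" where
  "euler_char \<nu> \<rho> =
     int (length \<nu>) - int (sum_list \<nu> div 2) + int (card (boundary_cycles \<nu> \<rho>))"

text \<open>\<open>Fwd k k'\<close>, \<open>Bwd k k'\<close> and \<open>Glue k k'\<close> stand for \<open>k \<rightarrow> k'\<close>, \<open>k \<leftarrow> k'\<close> and \<open>k \<doteq> k'\<close>.\<close>

datatype step = Fwd nat nat | Bwd nat nat | Glue nat nat

fun flip :: "step \<Rightarrow> step" where
  "flip (Fwd k k') = Bwd k' k"
| "flip (Bwd k k') = Fwd k' k"
| "flip (Glue k k') = Glue k' k"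

definition join_step :: "nat list \<Rightarrow> side \<Rightarrow> step" where
  "join_step \<nu> s =
     (if snd s then Fwd (fst s) (fst (vertex_join \<nu> s)) else Bwd (fst s) (fst (vertex_join \<nu> s)))"

definition glue_step :: "ribbon_pairing \<Rightarrow> side \<Rightarrow> step" where
  "glue_step \<rho> s = Glue (fst s) (fst (glue \<rho> s))"

text \<open>The boundary cycle through \<open>s\<close> read once around, beginning with the vertex-join at \<open>s\<close>.
  \<open>support f s\<close> lists the orbit \<open>s, f s, f (f s), \<dots>\<close> up to its first return to \<open>s\<close>.\<close>

definition trail_word :: "nat list \<Rightarrow> ribbon_pairing \<Rightarrow> side \<Rightarrow> step list" where
  "trail_word \<nu> \<rho> s = concat (map (\<lambda>u. [join_step \<nu> u, glue_step \<rho> (vertex_join \<nu> u)])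
     (support (glue \<rho> \<circ> vertex_join \<nu>) s))"

definition trail_class :: "step list \<Rightarrow> step list set" where
  "trail_class w = (\<lambda>i. rotate i w) ` UNIV \<union> (\<lambda>i. rotate i (rev (map flip w))) ` UNIV"

definition trails :: "nat list \<Rightarrow> ribbon_pairing \<Rightarrow> step list set set" where
  "trails \<nu> \<rho> = (\<lambda>s. trail_class (trail_word \<nu> \<rho> s)) ` sides \<nu>"

definition ribbon_weight :: "nat list \<Rightarrow> nat \<Rightarrow> ribbon_pairing \<Rightarrow> real" where
  "ribbon_weight \<nu> \<beta> \<rho> =
     (if \<beta> = 1 then 2 powi (- int (sum_list \<nu> div 2))
      else if \<beta> = 2 then (if snd \<rho> = {} then 1 else 0)
      else (-2) powi euler_char \<nu> \<rho> * 2 powi (- 2 * int (length \<nu>) + int (sum_list \<nu> div 2)))"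


section \<open>Products along vertices and trails, and the weighted path measures\<close>

definition vertex_prod ::
    "nat list \<Rightarrow> (nat \<Rightarrow> 'v) \<Rightarrow> ('v \<Rightarrow> 'a::semiring_1 ^ 'n ^ 'n) \<Rightarrow> (nat \<Rightarrow> nat \<Rightarrow> 'a ^ 'n ^ 'n) \<Rightarrow>
     nat \<Rightarrow> 'a ^ 'n ^ 'n" where
  "vertex_prod \<nu> x \<Phi> A l =
     foldr (\<lambda>k M. \<Phi> (x k) ** A k (next_label \<nu> k) ** M) [psum \<nu> l + 1..<psum \<nu> (Suc l) + 1] (mat 1)"

fun step_factor ::
    "('a::semiring_1 ^ 'n ^ 'n \<Rightarrow> 'a ^ 'n ^ 'n) \<Rightarrow> (nat \<Rightarrow> nat \<Rightarrow> 'a ^ 'n ^ 'n) \<Rightarrow> step \<Rightarrow> 'a ^ 'n ^ 'n" where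
  "step_factor adj A (Fwd k k') = A k k'"
| "step_factor adj A (Bwd k k') = adj (A k' k)"
| "step_factor adj A (Glue k k') = mat 1"

definition word_prod ::
    "('a::semiring_1 ^ 'n ^ 'n \<Rightarrow> 'a ^ 'n ^ 'n) \<Rightarrow> (nat \<Rightarrow> nat \<Rightarrow> 'a ^ 'n ^ 'n) \<Rightarrow> step list \<Rightarrow> 'a ^ 'n ^ 'n" where
  "word_prod adj A w = foldr (\<lambda>s M. step_factor adj A s ** M) w (mat 1)"

definition qadjoint :: "quat ^ 'n ^ 'n \<Rightarrow> quat ^ 'n ^ 'n" where
  "qadjoint M = (\<chi> i j. qcnj (M $ j $ i))"

text \<open>The product for an arbitrary representative of the trail; its trace (for quaternions, the real
  part of its trace) is independent of this choice.\<close>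

definition trail_prod :: "(nat \<Rightarrow> nat \<Rightarrow> complex ^ 'n ^ 'n) \<Rightarrow> step list set \<Rightarrow> complex ^ 'n ^ 'n" where
  "trail_prod A t = word_prod transpose A (SOME w. w \<in> t)"

definition qtrail_prod :: "(nat \<Rightarrow> nat \<Rightarrow> quat ^ 'n ^ 'n) \<Rightarrow> step list set \<Rightarrow> quat ^ 'n ^ 'n" where
  "qtrail_prod A t = word_prod qadjoint A (SOME w. w \<in> t)"

text \<open>The integral of \<open>f\<close> against the (complex or signed) measure \<open>\<Sum>i\<in>I. c i * M i\<close>.\<close>

definition lincomb_integral ::
    "'i set \<Rightarrow> ('i \<Rightarrow> 'b::real_normed_field) \<Rightarrow> ('i \<Rightarrow> 'a measure) \<Rightarrow> ('a \<Rightarrow> real) \<Rightarrow> 'b" where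
  "lincomb_integral I c M f = (\<Sum>i\<in>I. c i * of_real (\<integral>z. f z \<partial>M i))"

definition ribbon_integral ::
    "'v::finite set set \<Rightarrow> ('v \<Rightarrow> 'v \<Rightarrow> real) \<Rightarrow> ('v \<Rightarrow> real) \<Rightarrow> nat list \<Rightarrow> nat \<Rightarrow>
     (nat \<Rightarrow> nat \<Rightarrow> complex ^ 'n ^ 'n) \<Rightarrow> (nat \<Rightarrow> 'v) \<Rightarrow> ((nat \<Rightarrow> 'v path) \<Rightarrow> real) \<Rightarrow> complex" where
  "ribbon_integral E C \<kappa> \<nu> \<beta> A x = lincomb_integral (ribbon_pairings \<nu>)
     (\<lambda>\<rho>. of_real (ribbon_weight \<nu> \<beta> \<rho>) * (\<Prod>t\<in>trails \<nu> \<rho>. trace (trail_prod A t)))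
     (\<lambda>\<rho>. pairing_measure E C \<kappa> x (fst \<rho>))"

definition qribbon_integral ::
    "'v::finite set set \<Rightarrow> ('v \<Rightarrow> 'v \<Rightarrow> real) \<Rightarrow> ('v \<Rightarrow> real) \<Rightarrow> nat list \<Rightarrow>
     (nat \<Rightarrow> nat \<Rightarrow> quat ^ 'n ^ 'n) \<Rightarrow> (nat \<Rightarrow> 'v) \<Rightarrow> ((nat \<Rightarrow> 'v path) \<Rightarrow> real) \<Rightarrow> real" where
  "qribbon_integral E C \<kappa> \<nu> A x = lincomb_integral (ribbon_pairings \<nu>)
     (\<lambda>\<rho>. ribbon_weight \<nu> 4 \<rho> * (\<Prod>t\<in>trails \<nu> \<rho>. qRe (trace (qtrail_prod A t))))
     (\<lambda>\<rho>. pairing_measure E C \<kappa> x (fst \<rho>))"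

end

theory Submission imports Defs begin

text \<open>In an orthonormal basis of the space of Hermitian matrices the components of the field are
  independent real Gaussian free fields, whose covariance is the Green function of the killed jump
  process. After adding a killing rate \<open>lam\<close>, Wick's theorem expresses a monomial in the components,
  weighted by \<open>exp (- \<Sum>v. lam v * Tr (\<Phi> v)\<^sup>2 / 2)\<close>, as a sum over pairings of products of Green
  functions with killing \<open>\<kappa> + lam\<close>; by the Markov property these are the Laplace transforms of the
  occupation fields under the path measures. Both sides of the isomorphism are therefore signed
  measures on the positive orthant with equal Laplace transforms at integer arguments, and the
  substitution \<open>y \<mapsto> exp (- y)\<close> together with the Weierstrass theorem identifies them.

  It remains to sum over the basis elements assigned to the pairs. Contracting one pair merges two
  cyclic words, splits one, or reverses a part of one, according to the two-point identities of the
  trace; contracting all pairs leaves the boundary cycles of the ribbon pairings.\<close>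

section \<open>Trace contractions of paired factors\<close>

text \<open>The three values of \<beta> go through one argument with parameters \<open>u\<close>,
  \<open>u'\<close>, \<open>v\<close>: a straight pair contributes \<open>u\<close>, a twisted pair
  \<open>u'\<close>, and \<open>v\<close> is raised to the change in the number of closed words. The
  values \<open>(1/2, 1/2, 1)\<close>, \<open>(1, 0, 1)\<close> and \<open>(-1, -1, -2)\<close> are
  the source of the three ribbon weights. The obstacle is orientation. A boundary cycle can be read
  in two directions, and a contraction that reverses part of a word needs matrices fixed by the
  adjoint in use. Real symmetric and quaternionic Hermitian matrices are fixed; complex Hermitian
  ones are not fixed by transposition, but there \<open>u' = 0\<close>, and all words can keep their
  original direction. Words therefore list each vertex-join in one direction only, and the type of a
  gluing is measured against these directions. On the probabilistic side, process and field are
  compared through a linear system: a first-jump decomposition shows that the discounted Green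
  functions satisfy the equations that define the Gaussian covariance. Their finiteness comes from
  an explicit positive supersolution, the mean lifetime.\<close>

definition cross :: "nat \<times> bool \<Rightarrow> nat \<times> bool" where
  "cross s = (fst s, \<not> snd s)"

lemma cross_cross [simp]: "cross (cross s) = s"
  by (simp add: cross_def)

lemma fst_cross [simp]: "fst (cross s) = fst s"
  by (simp add: cross_def)

definition cyclic_walk :: "('s \<Rightarrow> 's) \<Rightarrow> 's list \<Rightarrow> bool" where
  "cyclic_walk f w \<longleftrightarrow> successively (\<lambda>a b. b = f a) w \<and> f (last w) = hd w"

lemma cyclic_walk_append_commute:
  assumes "cyclic_walk f (x @ y)"
  shows "cyclic_walk f (y @ x)"
  using assms unfolding cyclic_walk_def
  by (cases "x = []"; cases "y = []") (auto simp: successively_append_iff)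

section \<open>Closed walks on the sides of half-edges\<close>

locale side_joins =
  fixes join :: "nat \<times> bool \<Rightarrow> nat \<times> bool" and K :: "nat set"
  assumes join_join: "s \<in> K \<times> UNIV \<Longrightarrow> join (join s) = s"
    and join_in: "s \<in> K \<times> UNIV \<Longrightarrow> join s \<in> K \<times> UNIV"
    and snd_join: "s \<in> K \<times> UNIV \<Longrightarrow> snd (join s) = (\<not> snd s)"
begin

text \<open>A side in a word stands for the vertex-join that leaves it. \<open>R\<close> holds the
  labels whose matrix is still present: on arrival there the walk passes to the other side of the
  same half-edge. At a label already contracted it follows the gluing \<open>g\<close>.\<close>

definition nxt :: "nat set \<Rightarrow> (nat \<times> bool \<Rightarrow> nat \<times> bool) \<Rightarrow> nat \<times> bool \<Rightarrow> nat \<times> bool" where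
  "nxt R g s = (if fst (join s) \<in> R then cross (join s) else g (join s))"

text \<open>Each vertex-join is listed in exactly one of its two directions, since a cycle and its
  reversal describe the same trail. Shrinking \<open>R\<close> interpolates between walks around the
  vertices (all labels in \<open>R\<close>) and boundary cycles (\<open>R\<close> empty).\<close>

definition state :: "nat set \<Rightarrow> (nat \<times> bool \<Rightarrow> nat \<times> bool) \<Rightarrow> (nat \<times> bool) list list \<Rightarrow> bool" where
  "state R g ws \<longleftrightarrow> distinct (concat ws) \<and> [] \<notin> set ws \<and> set (concat ws) \<subseteq> K \<times> UNIV \<and>
     (\<forall>s\<in>K \<times> UNIV. (s \<in> set (concat ws)) \<noteq> (join s \<in> set (concat ws))) \<and>
     (\<forall>w\<in>set ws. cyclic_walk (nxt R g) w)"

lemma state_mset: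
  assumes "state R g ws" "mset ws = mset ws'"
  shows "state R g ws'"
proof -
  have m: "mset (concat ws) = mset (concat ws')"
  proof -
    have "mset (concat us) = sum_mset (image_mset mset (mset us))" for us :: "(nat \<times> bool) list list"
      by (induction us) auto
    then show ?thesis using assms(2) by simp
  qed
  have "set ws = set ws'" "set (concat ws) = set (concat ws')"
    using assms(2) m by (metis set_mset_mset)+
  moreover have "distinct (concat ws) \<longleftrightarrow> distinct (concat ws')"
    using m by (rule mset_eq_imp_distinct_iff)
  ultimately show ?thesis
    using assms(1) unfolding state_def by metis
qed

lemma state_rotate:
  assumes "state R g ((x @ y) # ws)"
  shows "state R g ((y @ x) # ws)"
proof -
  have "set (concat ((y @ x) # ws)) = set (concat ((x @ y) # ws))"
    "distinct (concat ((y @ x) # ws)) = distinct (concat ((x @ y) # ws))"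
    by auto
  moreover have "cyclic_walk (nxt R g) (y @ x)"
    using assms cyclic_walk_append_commute[of "nxt R g" x y] unfolding state_def by simp
  ultimately show ?thesis
    using assms unfolding state_def by (metis append_is_Nil_conv set_ConsD list.set_intros(1,2))
qed

lemma cyclic_walk_pred:
  assumes "cyclic_walk f w" "t \<in> set w"
  shows "\<exists>s\<in>set w. f s = t"
proof -
  obtain x y where w: "w = x @ t # y" using split_list[OF assms(2)] by blast
  show ?thesis
  proof (cases "x = []")
    case True
    then show ?thesis using assms w unfolding cyclic_walk_def
      by (metis append_Nil last_in_set list.distinct(1) list.sel(1))
  next
    case False
    then have "f (last x) = t" using assms w unfolding cyclic_walk_def
      by (auto simp: successively_append_iff)
    then show ?thesis using False w by auto
  qed
qed

lemma cyclic_walk_succ: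
  assumes "cyclic_walk f w" "s \<in> set w"
  shows "f s \<in> set w"
proof -
  obtain x y where w: "w = x @ s # y" using split_list[OF assms(2)] by blast
  show ?thesis
  proof (cases "y = []")
    case True
    then have "f s = hd w" using assms w unfolding cyclic_walk_def by simp
    then show ?thesis using w by (cases x) auto
  next
    case False
    then have "f s = hd y" using assms w unfolding cyclic_walk_def
      by (cases y) (auto simp: successively_append_iff)
    then show ?thesis using False w by auto
  qed
qed

text \<open>The vertex-join at the side \<open>(k, True)\<close> is listed in one direction. Either
  that direction arrives at \<open>k\<close>, or it leaves from there and its predecessor in the
  cyclic word arrives at \<open>k\<close>, because \<open>g\<close> does not lead from outside
  \<open>R\<close> into \<open>R\<close>.\<close>

lemma arrival_exists:
  assumes st: "state R g ws" and k: "k \<in> R" "k \<in> K"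
    and g: "\<And>t. t \<in> K \<times> UNIV \<Longrightarrow> fst t \<notin> R \<Longrightarrow> fst (g t) \<notin> R"
  shows "\<exists>s\<in>set (concat ws). fst (join s) = k"
proof (cases "join (k, True) \<in> set (concat ws)")
  case True
  then show ?thesis using k join_join[of "(k, True)"] by (intro bexI[of _ "join (k, True)"]) auto
next
  case False
  then have "(k, True) \<in> set (concat ws)"
    using st k unfolding state_def by blast
  then obtain w where w: "w \<in> set ws" "(k, True) \<in> set w" by auto
  then obtain s where s: "s \<in> set w" "nxt R g s = (k, True)"
    using cyclic_walk_pred[of "nxt R g" w] st unfolding state_def by blast
  have sK: "s \<in> K \<times> UNIV" using s(1) w(1) st unfolding state_def by auto
  have "fst (join s) = k"
  proof (cases "fst (join s) \<in> R")
    case True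
    then show ?thesis using s(2) by (simp add: nxt_def cross_def)
  next
    case False
    then show ?thesis using s(2) g[OF join_in[OF sK]] k by (simp add: nxt_def)
  qed
  then show ?thesis using s w by auto
qed

text \<open>A second arrival would end on the opposite side of the half-edge \<open>k\<close>. The
  walk continues from exactly that side after the first arrival, so one vertex-join would be listed
  in both directions.\<close>

lemma arrival_unique:
  assumes st: "state R g ws" and k: "k \<in> R"
    and s: "s \<in> set (concat ws)" "fst (join s) = k"
    and s': "s' \<in> set (concat ws)" "fst (join s') = k"
  shows "s = s'"
proof (rule ccontr)
  assume ne: "s \<noteq> s'"
  have K: "s \<in> K \<times> UNIV" "s' \<in> K \<times> UNIV" using s s' st unfolding state_def by auto
  have "join s \<noteq> join s'" using ne join_join K by metis
  then have "join s' = cross (join s)" using s(2) s'(2)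
    by (cases "join s"; cases "join s'") (auto simp: cross_def)
  then have "join s' = nxt R g s" using s(2) k by (simp add: nxt_def)
  moreover obtain w where "w \<in> set ws" "s \<in> set w" using s(1) by auto
  then have "nxt R g s \<in> set (concat ws)"
    using cyclic_walk_succ[of "nxt R g" w s] st unfolding state_def by auto
  ultimately have "join s' \<in> set (concat ws)" by simp
  then show False using s'(1) st K unfolding state_def by blast
qed

text \<open>Crossing a half-edge and gluing are involutions, so a walk read backwards, with every
  vertex-join reversed, follows the same successor map.\<close>

lemma successively_nxt_reverse:
  assumes "successively (\<lambda>a b. b = nxt R g a) y" "set y \<subseteq> K \<times> UNIV"
    and g: "\<And>t. t \<in> K \<times> UNIV \<Longrightarrow> fst t \<notin> R \<Longrightarrow> fst (g t) \<notin> R \<and> g (g t) = t"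
  shows "successively (\<lambda>a b. b = nxt R g a) (map join (rev y))"
proof -
  have "successively (\<lambda>a b. join a = nxt R g (join b)) y"
    using assms(1)
  proof (rule successively_mono)
    fix a b assume ab: "a \<in> set y" "b \<in> set y" "b = nxt R g a"
    have K: "a \<in> K \<times> UNIV" "b \<in> K \<times> UNIV" using ab assms(2) by auto
    show "join a = nxt R g (join b)"
      using ab(3) g[OF join_in[OF K(1)]] join_join[OF K(2)]
      by (auto simp: nxt_def)
  qed
  then show ?thesis by (simp add: successively_map successively_rev)
qed

text \<open>Contracting the pair \<open>k\<close>, \<open>k'\<close> changes the successor only
  where the walk arrives at one of them, and within the segment only the last side may do
  so.\<close>

lemma successively_nxt_close:
  assumes "successively (\<lambda>a b. b = nxt (insert k (insert k' R)) g a) y" "set y \<subseteq> K \<times> UNIV"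
    and "\<And>s. s \<in> set (butlast y) \<Longrightarrow> fst (join s) \<noteq> k \<and> fst (join s) \<noteq> k'"
    and g: "\<And>t. t \<in> K \<times> UNIV \<Longrightarrow> fst t \<notin> insert k (insert k' R) \<Longrightarrow> g' t = g t"
  shows "successively (\<lambda>a b. b = nxt R g' a) y"
  using assms(1-3)
proof (induction y rule: induct_list012)
  case (3 a b zs)
  have "nxt R g' a = nxt (insert k (insert k' R)) g a"
    using 3(4,5) g[OF join_in[of a]] by (auto simp: nxt_def)
  then show ?case using 3 by auto
qed auto

end


text \<open>The exponent of \<open>v\<close> in the two contraction identities is the change in the
  number of words: merging loses one, splitting gains one, reversing a part keeps it. The terms with
  \<open>u'\<close> carry an adjoint and need basis elements fixed by \<open>adj\<close>. The
  alternative \<open>u' = u\<close> or \<open>u' = 0\<close> is there because reading one of the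
  words backwards exchanges straight and twisted gluings.\<close>

locale trace_contraction = side_joins join K for join K +
  fixes tr :: "'a::semiring_1 ^ 'n ^ 'n \<Rightarrow> 'f::field"
    and adj :: "'a ^ 'n ^ 'n \<Rightarrow> 'a ^ 'n ^ 'n" and B :: "('a ^ 'n ^ 'n) set" and u u' v :: 'f
    and a :: "nat \<times> bool \<Rightarrow> 'a ^ 'n ^ 'n"
  assumes tr_comm: "tr (X ** Y) = tr (Y ** X)"
    and tr_adj: "tr (adj X) = tr X"
    and adj_mult: "adj (X ** Y) = adj Y ** adj X"
    and adj_one: "adj (mat 1) = mat 1"
    and finite_B: "finite B"
    and adj_B: "u' \<noteq> 0 \<Longrightarrow> b \<in> B \<Longrightarrow> adj b = b"
    and v_nz: "v \<noteq> 0"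
    and u_cases: "u' = u \<or> u' = 0"
    and contract_two: "(\<Sum>b\<in>B. tr (X ** b) * tr (Y ** b)) = u / v * tr (X ** Y) + u' / v * tr (X ** adj Y)"
    and contract_one: "(\<Sum>b\<in>B. tr (X ** b ** Y ** b)) = u * v * tr X * tr Y + u' * tr (X ** adj Y)"
    and adj_a: "s \<in> K \<times> UNIV \<Longrightarrow> adj (a s) = a (join s)"
begin

text \<open>The matrix \<open>e\<close> follows the vertex-join and is taken at the label of
  arrival. If the last side of a block arrives at \<open>k\<close>, the matrix at \<open>k\<close>
  is thus the last factor of the block.\<close>

definition val :: "(nat \<Rightarrow> 'a ^ 'n ^ 'n) \<Rightarrow> (nat \<times> bool) list \<Rightarrow> 'a ^ 'n ^ 'n" where
  "val e w = foldr (\<lambda>s M. a s ** e (fst (join s)) ** M) w (mat 1)"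

definition tval :: "(nat \<Rightarrow> 'a ^ 'n ^ 'n) \<Rightarrow> (nat \<times> bool) list list \<Rightarrow> 'f" where
  "tval e ws = prod_list (map (\<lambda>w. tr (val e w)) ws)"

lemma val_simps [simp]: "val e [] = mat 1" "val e (s # w) = a s ** e (fst (join s)) ** val e w"
  by (simp_all add: val_def)

lemma val_append [simp]: "val e (x @ y) = val e x ** val e y"
  by (induction x) (simp_all add: matrix_mul_assoc)

lemma val_cong: "(\<And>s. s \<in> set w \<Longrightarrow> e (fst (join s)) = e' (fst (join s))) \<Longrightarrow> val e w = val e' w"
  by (induction w) auto

lemma tval_simps [simp]: "tval e [] = 1" "tval e (w # ws) = tr (val e w) * tval e ws"
  by (simp_all add: tval_def)

lemma tval_cong:
  "(\<And>s. s \<in> set (concat ws) \<Longrightarrow> e (fst (join s)) = e' (fst (join s))) \<Longrightarrow> tval e ws = tval e' ws"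
proof (induction ws)
  case (Cons w ws)
  have "val e w = val e' w" by (rule val_cong) (use Cons.prems in auto)
  moreover have "tval e ws = tval e' ws" by (rule Cons.IH) (use Cons.prems in auto)
  ultimately show ?case by simp
qed simp

lemma tval_mset: "mset ws = mset ws' \<Longrightarrow> tval e ws = tval e ws'"
proof -
  have "tval e us = prod_mset (image_mset (\<lambda>w. tr (val e w)) (mset us))" for us
    by (induction us) auto
  then show "mset ws = mset ws' \<Longrightarrow> tval e ws = tval e ws'" by simp
qed

lemma tval_rotate: "tval e ((x @ y) # ws) = tval e ((y @ x) # ws)"
  by (simp add: tr_comm[of "val e x"])

text \<open>Reversal exchanges the order of the factors \<open>a\<close> and \<open>e\<close>, so
  the matrices \<open>e\<close> move by one place; the two boundary factors compensate for this. The
  first hypothesis says that the matrix met on arrival is also the one at the label of the next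
  departure.\<close>

lemma adj_val_reverse:
  assumes "successively (\<lambda>a b. e (fst b) = e (fst (join a))) y" "y \<noteq> []" "set y \<subseteq> K \<times> UNIV"
    and "\<And>l. adj (e l) = e l"
  shows "adj (val e y) ** e (fst (hd y)) = e (fst (join (last y))) ** val e (map join (rev y))"
  using assms(1-3)
proof (induction y rule: induct_list012)
  case (2 s)
  then show ?case by (simp add: adj_mult adj_one adj_a assms(4) join_join matrix_mul_assoc)
next
  case (3 s s' y)
  have K: "s \<in> K \<times> UNIV" using 3 by auto
  have IH: "adj (val e (s' # y)) ** e (fst s') = e (fst (join (last (s' # y)))) ** val e (map join (rev (s' # y)))"
    using "3.IH"(2) 3(3,5) by simp
  have "adj (val e (s # s' # y)) ** e (fst s) =
     adj (val e (s' # y)) ** e (fst (join s)) ** a (join s) ** e (fst s)"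
    by (subst val_simps) (simp add: adj_mult adj_a[OF K] assms(4) matrix_mul_assoc del: val_simps)
  also have "e (fst (join s)) = e (fst s')" using 3(3) by simp
  also have "adj (val e (s' # y)) ** e (fst s') ** a (join s) ** e (fst s) =
     e (fst (join (last (s' # y)))) ** (val e (map join (rev (s' # y))) ** (a (join s) ** e (fst s)))"
    by (simp only: IH matrix_mul_assoc)
  also have "val e (map join (rev (s' # y))) ** (a (join s) ** e (fst s)) =
     val e (map join (rev (s # s' # y)))"
    by (simp add: join_join[OF K] matrix_mul_assoc)
  finally show ?case by simp
qed simp

definition equivalent :: "nat set \<Rightarrow> (nat \<times> bool \<Rightarrow> nat \<times> bool) \<Rightarrow>
    (nat \<times> bool) list list \<Rightarrow> (nat \<times> bool) list list \<Rightarrow> bool" where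
  "equivalent R g ws ws' \<longleftrightarrow> (state R g ws \<longrightarrow> state R g ws') \<and> length ws = length ws' \<and>
     set (concat ws) = set (concat ws') \<and> (\<forall>e. tval e ws = tval e ws')"

lemma equivalent_trans: "equivalent R g ws ws' \<Longrightarrow> equivalent R g ws' ws'' \<Longrightarrow> equivalent R g ws ws''"
  unfolding equivalent_def by simp

lemma equivalent_mset: "mset ws = mset ws' \<Longrightarrow> equivalent R g ws ws'"
  unfolding equivalent_def using state_mset[of R g ws ws'] tval_mset[of ws ws']
  by (metis mset_eq_length set_concat set_mset_mset)

lemma equivalent_rotate: "equivalent R g ((x @ y) # ws) ((y @ x) # ws)"
  unfolding equivalent_def using state_rotate[of R g x y ws] tval_rotate[of _ x y ws] by auto

lemma bring_to_front:
  assumes "s \<in> set (concat ws)"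
  shows "\<exists>x rest. equivalent R g ws ((x @ [s]) # rest)"
proof -
  obtain w where w: "w \<in> set ws" "s \<in> set w" using assms by auto
  obtain r1 r2 where r: "ws = r1 @ w # r2" using split_list[OF w(1)] by blast
  obtain x y where x: "w = x @ s # y" using split_list[OF w(2)] by blast
  have "equivalent R g ws (w # r1 @ r2)" by (rule equivalent_mset) (simp add: r)
  moreover have "equivalent R g (w # r1 @ r2) ((y @ (x @ [s])) # r1 @ r2)"
    using equivalent_rotate[of R g "x @ [s]" y "r1 @ r2"] by (simp add: x)
  ultimately show ?thesis using equivalent_trans by (metis append_assoc)
qed

text \<open>Permuting and rotating words changes neither the product of traces nor the state
  property. The two arrivals can therefore be moved to the ends of blocks, and only the alternative
  between one word and two words remains.\<close>

lemma normal_form: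
  assumes "s \<in> set (concat ws)" "s' \<in> set (concat ws)" "s \<noteq> s'"
  shows "(\<exists>x y rest. equivalent R g ws (((x @ [s]) @ (y @ [s'])) # rest)) \<or>
    (\<exists>x y rest. equivalent R g ws ((x @ [s]) # (y @ [s']) # rest))"
proof -
  obtain x rest where e: "equivalent R g ws ((x @ [s]) # rest)"
    using bring_to_front[OF assms(1), of R g] by blast
  have "set (concat ws) = set (concat ((x @ [s]) # rest))"
    using e unfolding equivalent_def by (elim conjE)
  then have "s' \<in> set (concat ((x @ [s]) # rest))" using assms(2) by (elim subst)
  then have "s' \<in> set x \<or> s' \<in> set (concat rest)" using assms(3) by simp
  then consider "s' \<in> set x" | "s' \<in> set (concat rest)" by blast
  then show ?thesis
  proof cases
    case 1
    obtain x1 x2 where x: "x = x1 @ s' # x2" using split_list[OF 1] by blast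
    have "equivalent R g ((x @ [s]) # rest) (((x2 @ [s]) @ (x1 @ [s'])) # rest)"
      using equivalent_rotate[of R g "x1 @ [s']" "x2 @ [s]"] by (simp add: x)
    from equivalent_trans[OF e this] show ?thesis by blast
  next
    case 2
    then obtain w where w: "w \<in> set rest" "s' \<in> set w" by auto
    obtain r1 r2 where r: "rest = r1 @ w # r2" using split_list[OF w(1)] by blast
    obtain y1 y2 where y: "w = y1 @ s' # y2" using split_list[OF w(2)] by blast
    have "equivalent R g ((x @ [s]) # rest) ((y1 @ [s'] @ y2) # ((x @ [s]) # r1 @ r2))"
      by (rule equivalent_mset) (simp add: r y)
    moreover have "equivalent R g ((y1 @ [s'] @ y2) # ((x @ [s]) # r1 @ r2))
        ((y2 @ y1 @ [s']) # ((x @ [s]) # r1 @ r2))"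
      using equivalent_rotate[of R g "y1 @ [s']" y2] by simp
    moreover have "equivalent R g ((y2 @ y1 @ [s']) # ((x @ [s]) # r1 @ r2))
        ((x @ [s]) # ((y2 @ y1) @ [s']) # r1 @ r2)"
      by (rule equivalent_mset) simp
    ultimately have "equivalent R g ((x @ [s]) # rest) ((x @ [s]) # ((y2 @ y1) @ [s']) # r1 @ r2)"
      using equivalent_trans by metis
    from equivalent_trans[OF e this] show ?thesis by blast
  qed
qed

end

lemma cyclic_walk_cong:
  assumes "\<And>s. s \<in> set w \<Longrightarrow> f s = f' s" "w \<noteq> []"
  shows "cyclic_walk f w \<longleftrightarrow> cyclic_walk f' w"
proof -
  have "successively (\<lambda>a b. b = f a) w \<longleftrightarrow> successively (\<lambda>a b. b = f' a) w"
    by (rule successively_cong) (use assms in auto)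
  then show ?thesis unfolding cyclic_walk_def using assms by simp
qed

context trace_contraction
begin

definition compat :: "nat set \<Rightarrow> nat \<Rightarrow> nat \<Rightarrow> (nat \<times> bool \<Rightarrow> nat \<times> bool) \<Rightarrow> (nat \<times> bool \<Rightarrow> nat \<times> bool) \<Rightarrow> bool" where
  "compat R k k' g g' \<longleftrightarrow> (\<forall>t\<in>K \<times> UNIV. fst t \<notin> insert k (insert k' R) \<longrightarrow> g' t = g t) \<and>
     (\<forall>t\<in>K \<times> UNIV. fst t \<notin> R \<longrightarrow> fst (g' t) \<notin> R \<and> g' (g' t) = t)"

lemma nxt_compat:
  assumes "compat R k k' g g'" "t \<in> K \<times> UNIV" "fst (join t) \<noteq> k" "fst (join t) \<noteq> k'"
  shows "nxt R g' t = nxt (insert k (insert k' R)) g t"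
  using assms join_in[OF assms(2)] unfolding compat_def nxt_def by auto

text \<open>Reversing \<open>Y\<close> replaces each of its sides by the other end of the same
  vertex-join, so every vertex-join is still listed in exactly one direction.\<close>

lemma state_reverse:
  assumes st: "state R g ws" and eq: "set (concat ws) = set X \<union> set Y \<union> set (concat rest)"
    "distinct (X @ Y @ concat rest)" "[] \<notin> set rest" "X \<noteq> []"
    and cyc: "cyclic_walk (nxt R' g') (X @ map join (rev Y))"
      "\<And>w. w \<in> set rest \<Longrightarrow> cyclic_walk (nxt R' g') w"
  shows "state R' g' ((X @ map join (rev Y)) # rest)"
proof -
  let ?U = "set X \<union> set (concat rest)" and ?V = "set Y"
  have K: "?U \<subseteq> K \<times> UNIV" "?V \<subseteq> K \<times> UNIV"
    and half: "\<And>t. t \<in> K \<times> UNIV \<Longrightarrow> (t \<in> ?U \<or> t \<in> ?V) \<noteq> (join t \<in> ?U \<or> join t \<in> ?V)"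
    using st eq(1) unfolding state_def by blast+
  have disj: "?U \<inter> ?V = {}" using eq(2) by auto
  have J: "t \<in> join ` ?V \<longleftrightarrow> join t \<in> ?V" if "t \<in> K \<times> UNIV" for t
    using join_join[OF that] K(2) join_join by (metis (no_types, lifting) image_iff subsetD)
  have JK: "join ` ?V \<subseteq> K \<times> UNIV" using K(2) join_in by blast
  have "(t \<in> ?U \<union> join ` ?V) \<noteq> (join t \<in> ?U \<union> join ` ?V)" if t: "t \<in> K \<times> UNIV" for t
    using half[OF t] J[OF t] J[OF join_in[OF t]] join_join[OF t] disj by auto
  moreover have "?U \<inter> join ` ?V = {}"
    using half J K disj by blast
  moreover have "distinct (map join (rev Y))"
    using eq(2) K(2) by (auto simp: distinct_map intro!: inj_on_inverseI[of _ join] join_join)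
  ultimately show ?thesis
    using eq K JK cyc unfolding state_def by auto
qed

context
  fixes k k' R g ws
  assumes k: "k \<noteq> k'" "k \<notin> R" "k' \<notin> R"
    and st: "state (insert k (insert k' R)) g ws"
    and g: "\<And>t. t \<in> K \<times> UNIV \<Longrightarrow> fst t \<notin> insert k (insert k' R) \<Longrightarrow>
          fst (g t) \<notin> insert k (insert k' R)"
begin

abbreviation "R0 \<equiv> insert k (insert k' R)"

lemma other_arrivals:
  assumes "s \<in> set (concat ws)" "s' \<in> set (concat ws)" "fst (join s) = k" "fst (join s') = k'"
    and "t \<in> set (concat ws)" "t \<noteq> s" "t \<noteq> s'"
  shows "fst (join t) \<noteq> k" "fst (join t) \<noteq> k'"
  using arrival_unique[OF st, of k t s] arrival_unique[OF st, of k' t s'] assms by auto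

lemma val_update:
  assumes "fst (join s) = k \<or> fst (join s) = k'" "e k = mat 1" "e k' = mat 1"
    and "\<And>t. t \<in> set x \<Longrightarrow> fst (join t) \<noteq> k \<and> fst (join t) \<noteq> k'"
  shows "val (e(k := c, k' := c)) (x @ [s]) = val e (x @ [s]) ** c"
proof -
  have "val (e(k := c, k' := c)) x = val e x" by (rule val_cong) (use assms(4) in auto)
  moreover have "val (e(k := c, k' := c)) [s] = val e [s] ** c"
    using assms(1-3) by auto
  ultimately show ?thesis by (simp only: val_append matrix_mul_assoc)
qed

text \<open>Both ends of the segment lie at labels outside \<open>R\<close>, where \<open>e\<close>
  is the identity, so the boundary factors of \<open>adj_val_reverse\<close> disappear.\<close>

lemma adj_val_segment:
  assumes "y \<noteq> []" "set y \<subseteq> K \<times> UNIV" "successively (\<lambda>a b. b = nxt R0 g a) y"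
    and "\<And>l. l \<notin> R \<Longrightarrow> e l = mat 1" "\<And>l. adj (e l) = e l"
    and "fst (hd y) \<notin> R" "fst (join (last y)) \<notin> R"
  shows "adj (val e y) = val e (map join (rev y))"
proof -
  have "successively (\<lambda>a b. e (fst b) = e (fst (join a))) y"
    using assms(3)
  proof (rule successively_mono)
    fix a b assume ab: "a \<in> set y" "b \<in> set y" "b = nxt R0 g a"
    then have "join a \<in> K \<times> UNIV" using assms(2) join_in by blast
    from g[OF this] ab(3) show "e (fst b) = e (fst (join a))"
      by (cases "fst (join a) \<in> R0") (auto simp: nxt_def assms(4))
  qed
  from adj_val_reverse[OF this assms(1,2,5)] show ?thesis
    by (simp add: assms(4)[OF assms(6)] assms(4)[OF assms(7)])
qed

lemma other_word:
  assumes "compat R k k' g g'" "w \<in> set ws"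
    and "\<And>t. t \<in> set w \<Longrightarrow> fst (join t) \<noteq> k \<and> fst (join t) \<noteq> k'"
  shows "cyclic_walk (nxt R g') w"
proof -
  have w: "cyclic_walk (nxt R0 g) w" "w \<noteq> []" "set w \<subseteq> K \<times> UNIV"
    using assms(2) st unfolding state_def by auto
  have "nxt R0 g t = nxt R g' t" if "t \<in> set w" for t
    using nxt_compat[OF assms(1), of t] assms(3)[OF that] w(3) that by auto
  then show ?thesis using cyclic_walk_cong[of w "nxt R0 g" "nxt R g'"] w by blast
qed

text \<open>Each block departs from the side opposite to the arrival of the other block. Gluing the
  arrival at \<open>k\<close> to the departure side at \<open>k'\<close>, and conversely, closes
  each block into a word of its own. Gluing the two arrival sides lets the first block continue into
  the second one backwards.\<close>

lemma contract_same_word: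
  assumes ws: "ws = ((x @ [s]) @ (y @ [s'])) # rest"
    and s: "join s = (k, d)" and s': "join s' = (k', d')"
  shows "compat R k k' g g1 \<Longrightarrow> g1 (k, d) = (k', \<not> d') \<Longrightarrow> g1 (k', d') = (k, \<not> d) \<Longrightarrow>
      state R g1 ((x @ [s]) # (y @ [s']) # rest)"
    and "compat R k k' g g2 \<Longrightarrow> g2 (k, d) = (k', d') \<Longrightarrow> g2 (k, \<not> d) = (k', \<not> d') \<Longrightarrow>
      state R g2 (((x @ [s]) @ map join (rev (y @ [s']))) # rest)"
    and "(\<And>l. l \<notin> R \<Longrightarrow> e l = mat 1) \<Longrightarrow> (u' \<noteq> 0 \<Longrightarrow> (\<And>l. adj (e l) = e l)) \<Longrightarrow>
      (\<Sum>c\<in>B. tval (e(k := c, k' := c)) ws) =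
        u * v * tval e ((x @ [s]) # (y @ [s']) # rest) +
        u' * tval e (((x @ [s]) @ map join (rev (y @ [s']))) # rest)"
proof -
  let ?X = "x @ [s]" and ?Y = "y @ [s']"
  have in_K: "set (concat ws) \<subseteq> K \<times> UNIV" and dist: "distinct (concat ws)"
    and half: "\<And>t. t \<in> K \<times> UNIV \<Longrightarrow> (t \<in> set (concat ws)) \<noteq> (join t \<in> set (concat ws))"
    and cyc: "\<And>w. w \<in> set ws \<Longrightarrow> cyclic_walk (nxt R0 g) w"
    using st unfolding state_def by blast+
  have XY: "set ?X \<subseteq> K \<times> UNIV" "set ?Y \<subseteq> K \<times> UNIV" using in_K by (auto simp: ws)
  have walk: "cyclic_walk (nxt R0 g) (?X @ ?Y)" using cyc by (simp add: ws)
  have sX: "successively (\<lambda>a b. b = nxt R0 g a) ?X" and sY: "successively (\<lambda>a b. b = nxt R0 g a) ?Y"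
    and hY: "hd ?Y = nxt R0 g (last ?X)"
    using walk unfolding cyclic_walk_def successively_append_iff[of _ ?X ?Y] by blast+
  have hX: "nxt R0 g (last (?X @ ?Y)) = hd (?X @ ?Y)"
    using walk unfolding cyclic_walk_def by (rule conjunct2)
  \<comment> \<open>Before the contraction the walk arrives at \<open>(k, d)\<close> and crosses the
    half-edge, which fixes the departure side of the second block.\<close>
  have hdY: "hd ?Y = (k, \<not> d)" using hY s by (simp add: nxt_def cross_def)
  have "hd (?X @ ?Y) = hd ?X" by (simp only: hd_append) simp
  then have hdX: "hd ?X = (k', \<not> d')" using hX s' by (simp add: nxt_def cross_def)
  have oth: "fst (join t) \<noteq> k \<and> fst (join t) \<noteq> k'"
    if "t \<in> set x \<union> set y \<union> set (concat rest)" for t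
  proof -
    have "t \<noteq> s" "t \<noteq> s'" using that dist by (auto simp: ws)
    moreover have "t \<in> set (concat ws)" "s \<in> set (concat ws)" "s' \<in> set (concat ws)"
      using that by (auto simp: ws)
    ultimately show ?thesis using other_arrivals[of s s' t] s s' by auto
  qed
  have rest: "cyclic_walk (nxt R g') w" if "compat R k k' g g'" "w \<in> set rest" for g' w
    by (rule other_word[OF that(1)]) (use that(2) oth in \<open>auto simp: ws\<close>)
  have g': "g' t = g t" if "compat R k k' g g'" "t \<in> K \<times> UNIV" "fst t \<notin> R0" for g' t
    using that unfolding compat_def by blast
  have close: "successively (\<lambda>a b. b = nxt R g' a) ?X" "successively (\<lambda>a b. b = nxt R g' a) ?Y"
    if "compat R k k' g g'" for g'
    by (rule successively_nxt_close[OF sX XY(1) _ g'[OF that]], use oth in simp, assumption+)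
      (rule successively_nxt_close[OF sY XY(2) _ g'[OF that]], use oth in simp, assumption+)
  {
    assume c: "compat R k k' g g1" and g1: "g1 (k, d) = (k', \<not> d')" "g1 (k', d') = (k, \<not> d)"
    have "nxt R g1 (last ?X) = hd ?X" "nxt R g1 (last ?Y) = hd ?Y"
      using k s s' g1 unfolding hdX hdY by (simp_all add: nxt_def)
    then have "cyclic_walk (nxt R g1) ?X" "cyclic_walk (nxt R g1) ?Y"
      unfolding cyclic_walk_def using close[OF c] by blast+
    then show "state R g1 ((x @ [s]) # (y @ [s']) # rest)" using st rest[OF c] unfolding state_def by (auto simp: ws)
  }
  {
    assume c: "compat R k k' g g2" and g2: "g2 (k, d) = (k', d')" "g2 (k, \<not> d) = (k', \<not> d')"
    let ?Z = "map join (rev ?Y)"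
    have sZ: "successively (\<lambda>a b. b = nxt R g2 a) ?Z"
      by (rule successively_nxt_reverse[OF close(2)[OF c] XY(2)]) (use c in \<open>auto simp: compat_def\<close>)
    have l: "last ?Z = join (hd ?Y)" and h: "hd ?Z = join s'"
      by (simp_all add: last_map last_rev)
    have XZ: "hd ?Z = nxt R g2 (last ?X)" using h k s s' g2 by (simp add: nxt_def)
    have "join (join (hd ?Y)) = hd ?Y"
      by (rule join_join) (use XY(2) hd_in_set[of ?Y] in blast)
    then have ZX: "nxt R g2 (last ?Z) = hd ?X" using k g2 unfolding l hdX hdY by (simp add: nxt_def)
    have "last (?X @ ?Z) = last ?Z" by (simp only: last_append) simp
    moreover have "hd (?X @ ?Z) = hd ?X" by (simp only: hd_append) simp
    ultimately have "cyclic_walk (nxt R g2) (?X @ ?Z)"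
      unfolding cyclic_walk_def successively_append_iff[of _ ?X ?Z] using close(1)[OF c] sZ XZ ZX
      by presburger
    moreover have "state R g2 ((?X @ ?Z) # rest)" if "cyclic_walk (nxt R g2) (?X @ ?Z)"
    proof (rule state_reverse[OF st])
      show "distinct (?X @ ?Y @ concat rest)" using dist by (simp add: ws)
      show "[] \<notin> set rest" using st unfolding state_def by (simp add: ws)
    qed (use that rest[OF c] in \<open>auto simp: ws\<close>)
    ultimately show "state R g2 (((x @ [s]) @ map join (rev (y @ [s']))) # rest)" by blast
  }
  {
    assume e: "\<And>l. l \<notin> R \<Longrightarrow> e l = mat 1" and ae: "u' \<noteq> 0 \<Longrightarrow> (\<And>l. adj (e l) = e l)"
    have e1: "e k = mat 1" "e k' = mat 1" using e k by auto
    have "tval (e(k := c, k' := c)) ws = tr (val e ?X ** c ** val e ?Y ** c) * tval e rest" for c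
    proof -
      have "val (e(k := c, k' := c)) ?X = val e ?X ** c" "val (e(k := c, k' := c)) ?Y = val e ?Y ** c"
        by (rule val_update; use e1 s s' oth in auto)+
      moreover have "tval (e(k := c, k' := c)) rest = tval e rest"
        by (rule tval_cong) (use oth in auto)
      ultimately show ?thesis
        unfolding ws tval_simps val_append[of _ ?X ?Y] by (simp add: matrix_mul_assoc)
    qed
    then have "(\<Sum>c\<in>B. tval (e(k := c, k' := c)) ws) =
        (\<Sum>c\<in>B. tr (val e ?X ** c ** val e ?Y ** c)) * tval e rest"
      by (simp add: sum_distrib_right)
    also have "\<dots> = (u * v * tr (val e ?X) * tr (val e ?Y) + u' * tr (val e ?X ** adj (val e ?Y))) * tval e rest"
      by (simp only: contract_one)
    also have "u' * tr (val e ?X ** adj (val e ?Y)) = u' * tr (val e (?X @ map join (rev ?Y)))"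
    \<comment> \<open>For \<open>u' = 0\<close> the matrices \<open>e\<close> may fail to be fixed
      by \<open>adj\<close>, but then the term is multiplied by zero.\<close>
    proof (cases "u' = 0")
      case False
      have "adj (val e ?Y) = val e (map join (rev ?Y))"
        by (rule adj_val_segment) (use XY sY e ae[OF False] hdY s' k in auto)
      then show ?thesis by (simp only: val_append)
    qed simp
    finally show "(\<Sum>c\<in>B. tval (e(k := c, k' := c)) ws) =
        u * v * tval e ((x @ [s]) # (y @ [s']) # rest) +
        u' * tval e (((x @ [s]) @ map join (rev (y @ [s']))) # rest)" by (simp only: tval_simps ring_distribs mult.assoc)
  }
qed

text \<open>Here each word returns to the side opposite to its own arrival. Gluing arrivals to
  departures of the other word concatenates the two; gluing arrival to arrival concatenates the
  first with the reversal of the second. One word is lost either way, hence the common denominator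
  \<open>v\<close>.\<close>

lemma contract_two_words:
  assumes ws: "ws = (x @ [s]) # (y @ [s']) # rest"
    and s: "join s = (k, d)" and s': "join s' = (k', d')"
  shows "compat R k k' g g1 \<Longrightarrow> g1 (k, d) = (k', \<not> d') \<Longrightarrow> g1 (k', d') = (k, \<not> d) \<Longrightarrow>
      state R g1 (((x @ [s]) @ (y @ [s'])) # rest)"
    and "compat R k k' g g2 \<Longrightarrow> g2 (k, d) = (k', d') \<Longrightarrow> g2 (k', \<not> d') = (k, \<not> d) \<Longrightarrow>
      state R g2 (((x @ [s]) @ map join (rev (y @ [s']))) # rest)"
    and "(\<And>l. l \<notin> R \<Longrightarrow> e l = mat 1) \<Longrightarrow> (u' \<noteq> 0 \<Longrightarrow> (\<And>l. adj (e l) = e l)) \<Longrightarrow>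
      (\<Sum>c\<in>B. tval (e(k := c, k' := c)) ws) =
        u / v * tval e (((x @ [s]) @ (y @ [s'])) # rest) +
        u' / v * tval e (((x @ [s]) @ map join (rev (y @ [s']))) # rest)"
proof -
  let ?X = "x @ [s]" and ?Y = "y @ [s']"
  have in_K: "set (concat ws) \<subseteq> K \<times> UNIV" and dist: "distinct (concat ws)"
    and half: "\<And>t. t \<in> K \<times> UNIV \<Longrightarrow> (t \<in> set (concat ws)) \<noteq> (join t \<in> set (concat ws))"
    and cyc: "\<And>w. w \<in> set ws \<Longrightarrow> cyclic_walk (nxt R0 g) w"
    using st unfolding state_def by blast+
  have XY: "set ?X \<subseteq> K \<times> UNIV" "set ?Y \<subseteq> K \<times> UNIV" using in_K by (auto simp: ws)
  have walk: "cyclic_walk (nxt R0 g) ?X" "cyclic_walk (nxt R0 g) ?Y" using cyc by (auto simp: ws)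
  then have sX: "successively (\<lambda>a b. b = nxt R0 g a) ?X" and sY: "successively (\<lambda>a b. b = nxt R0 g a) ?Y"
    and hX: "nxt R0 g (last ?X) = hd ?X" and hY: "nxt R0 g (last ?Y) = hd ?Y"
    unfolding cyclic_walk_def by blast+
  have hdX: "hd ?X = (k, \<not> d)" using hX s by (simp add: nxt_def cross_def)
  have hdY: "hd ?Y = (k', \<not> d')" using hY s' by (simp add: nxt_def cross_def)
  have oth: "fst (join t) \<noteq> k \<and> fst (join t) \<noteq> k'"
    if "t \<in> set x \<union> set y \<union> set (concat rest)" for t
  proof -
    have "t \<noteq> s" "t \<noteq> s'" using that dist by (auto simp: ws)
    moreover have "t \<in> set (concat ws)" "s \<in> set (concat ws)" "s' \<in> set (concat ws)"
      using that by (auto simp: ws)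
    ultimately show ?thesis using other_arrivals[of s s' t] s s' by auto
  qed
  have rest: "cyclic_walk (nxt R g') w" if "compat R k k' g g'" "w \<in> set rest" for g' w
    by (rule other_word[OF that(1)]) (use that(2) oth in \<open>auto simp: ws\<close>)
  have g': "g' t = g t" if "compat R k k' g g'" "t \<in> K \<times> UNIV" "fst t \<notin> R0" for g' t
    using that unfolding compat_def by blast
  have close: "successively (\<lambda>a b. b = nxt R g' a) ?X" "successively (\<lambda>a b. b = nxt R g' a) ?Y"
    if "compat R k k' g g'" for g'
    by (rule successively_nxt_close[OF sX XY(1) _ g'[OF that]], use oth in simp, assumption+)
      (rule successively_nxt_close[OF sY XY(2) _ g'[OF that]], use oth in simp, assumption+)
  {
    assume c: "compat R k k' g g1" and g1: "g1 (k, d) = (k', \<not> d')" "g1 (k', d') = (k, \<not> d)"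
    have XY1: "hd ?Y = nxt R g1 (last ?X)" and YX1: "nxt R g1 (last ?Y) = hd ?X"
      using k s s' g1 unfolding hdX hdY by (simp_all add: nxt_def)
    have "last (?X @ ?Y) = last ?Y" by (simp only: last_append) simp
    moreover have "hd (?X @ ?Y) = hd ?X" by (simp only: hd_append) simp
    ultimately have "cyclic_walk (nxt R g1) (?X @ ?Y)"
      unfolding cyclic_walk_def successively_append_iff[of _ ?X ?Y] using close[OF c] XY1 YX1
      by presburger
    then show "state R g1 (((x @ [s]) @ (y @ [s'])) # rest)" using st rest[OF c] unfolding state_def by (auto simp: ws)
  }
  {
    assume c: "compat R k k' g g2" and g2: "g2 (k, d) = (k', d')" "g2 (k', \<not> d') = (k, \<not> d)"
    let ?Z = "map join (rev ?Y)"
    have sZ: "successively (\<lambda>a b. b = nxt R g2 a) ?Z"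
      by (rule successively_nxt_reverse[OF close(2)[OF c] XY(2)]) (use c in \<open>auto simp: compat_def\<close>)
    have l: "last ?Z = join (hd ?Y)" and h: "hd ?Z = join s'"
      by (simp_all add: last_map last_rev)
    have XZ: "hd ?Z = nxt R g2 (last ?X)" using h k s s' g2 by (simp add: nxt_def)
    have "join (join (hd ?Y)) = hd ?Y"
      by (rule join_join) (use XY(2) hd_in_set[of ?Y] in blast)
    then have ZX: "nxt R g2 (last ?Z) = hd ?X" using k g2 unfolding l hdX hdY by (simp add: nxt_def)
    have "last (?X @ ?Z) = last ?Z" by (simp only: last_append) simp
    moreover have "hd (?X @ ?Z) = hd ?X" by (simp only: hd_append) simp
    ultimately have "cyclic_walk (nxt R g2) (?X @ ?Z)"
      unfolding cyclic_walk_def successively_append_iff[of _ ?X ?Z] using close(1)[OF c] sZ XZ ZX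
      by presburger
    moreover have "state R g2 ((?X @ ?Z) # rest)" if "cyclic_walk (nxt R g2) (?X @ ?Z)"
    proof (rule state_reverse[OF st])
      show "distinct (?X @ ?Y @ concat rest)" using dist by (simp add: ws)
      show "[] \<notin> set rest" using st unfolding state_def by (simp add: ws)
    qed (use that rest[OF c] in \<open>auto simp: ws\<close>)
    ultimately show "state R g2 (((x @ [s]) @ map join (rev (y @ [s']))) # rest)" by blast
  }
  {
    assume e: "\<And>l. l \<notin> R \<Longrightarrow> e l = mat 1" and ae: "u' \<noteq> 0 \<Longrightarrow> (\<And>l. adj (e l) = e l)"
    have e1: "e k = mat 1" "e k' = mat 1" using e k by auto
    have "tval (e(k := c, k' := c)) ws = tr (val e ?X ** c) * tr (val e ?Y ** c) * tval e rest" for c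
    proof -
      have "val (e(k := c, k' := c)) ?X = val e ?X ** c" "val (e(k := c, k' := c)) ?Y = val e ?Y ** c"
        by (rule val_update; use e1 s s' oth in auto)+
      moreover have "tval (e(k := c, k' := c)) rest = tval e rest"
        by (rule tval_cong) (use oth in auto)
      ultimately show ?thesis
        unfolding ws tval_simps by simp
    qed
    then have "(\<Sum>c\<in>B. tval (e(k := c, k' := c)) ws) =
        (\<Sum>c\<in>B. tr (val e ?X ** c) * tr (val e ?Y ** c)) * tval e rest"
      by (simp add: sum_distrib_right)
    also have "\<dots> = (u / v * tr (val e ?X ** val e ?Y) + u' / v * tr (val e ?X ** adj (val e ?Y))) * tval e rest"
      by (simp only: contract_two)
    also have "u' / v * tr (val e ?X ** adj (val e ?Y)) = u' / v * tr (val e (?X @ map join (rev ?Y)))"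
    proof (cases "u' = 0")
      case False
      have "adj (val e ?Y) = val e (map join (rev ?Y))"
        by (rule adj_val_segment) (use XY sY e ae[OF False] hdY s' k in auto)
      then show ?thesis by (simp only: val_append)
    qed simp
    finally show "(\<Sum>c\<in>B. tval (e(k := c, k' := c)) ws) =
        u / v * tval e (((x @ [s]) @ (y @ [s'])) # rest) +
        u' / v * tval e (((x @ [s]) @ map join (rev (y @ [s']))) # rest)" by (simp only: tval_simps val_append ring_distribs mult.assoc)
  }
qed

end

end

section \<open>Pairings and the contraction of all pairs\<close>

definition pairings :: "'b set \<Rightarrow> 'b set set set" where
  "pairings K = {p. partition_on K p \<and> (\<forall>e\<in>p. card e = 2)}"

lemma pairingsD:
  assumes "p \<in> pairings K"
  shows "\<Union>p = K" "\<And>e. e \<in> p \<Longrightarrow> card e = 2"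
    "\<And>e e' k. e \<in> p \<Longrightarrow> e' \<in> p \<Longrightarrow> k \<in> e \<Longrightarrow> k \<in> e' \<Longrightarrow> e = e'"
  using assms unfolding pairings_def partition_on_def disjoint_def by auto

lemma partner_eq:
  assumes "p \<in> pairings K" "{k, k'} \<in> p"
  shows "partner p k = k'" "k \<noteq> k'"
proof -
  show ne: "k \<noteq> k'" using pairingsD(2)[OF assms] by auto
  show "partner p k = k'" unfolding partner_def
  proof (rule the_equality)
    show "k' \<noteq> k \<and> {k, k'} \<in> p" using ne assms by auto
    fix l assume "l \<noteq> k \<and> {k, l} \<in> p"
    then show "l = k'" using pairingsD(3)[OF assms(1) _ assms(2), of "{k, l}" k] by auto
  qed
qed

lemma partner_pair:
  assumes "p \<in> pairings K" "k \<in> K"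
  shows "{k, partner p k} \<in> p" "partner p k \<in> K" "partner p (partner p k) = k"
proof -
  obtain e where e: "e \<in> p" "k \<in> e" using pairingsD(1)[OF assms(1)] assms(2) by blast
  then obtain k' where "e = {k, k'}" using pairingsD(2)[OF assms(1) e(1)]
    by (metis card_2_iff insertE insert_commute singletonD)
  then have p: "{k, k'} \<in> p" using e by simp
  then show "{k, partner p k} \<in> p" "partner p (partner p k) = k" "partner p k \<in> K"
    using partner_eq[OF assms(1) p] partner_eq[OF assms(1), of k' k] pairingsD(1)[OF assms(1)]
    by (auto simp: insert_commute)
qed

lemma glue_eq:
  "glue (p, T) s = (partner p (fst s), if {fst s, partner p (fst s)} \<in> T then snd s else \<not> snd s)"
  by (cases s) simp

lemma glue_glue:
  assumes "p \<in> pairings K" "fst s \<in> K"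
  shows "glue (p, T) (glue (p, T) s) = s"
  using partner_pair[OF assms] by (auto simp: glue_eq insert_commute prod_eq_iff)

lemma sum_PiE_insert:
  assumes "x \<notin> A" "finite A" "finite B"
  shows "(\<Sum>b\<in>Pi\<^sub>E (insert x A) (\<lambda>_. B). f b) = (\<Sum>b\<in>Pi\<^sub>E A (\<lambda>_. B). \<Sum>c\<in>B. f (b(x := c)))"
proof -
  have "(\<Sum>b\<in>Pi\<^sub>E (insert x A) (\<lambda>_. B). f b) = (\<Sum>(c, b)\<in>B \<times> Pi\<^sub>E A (\<lambda>_. B). f (b(x := c)))"
    unfolding PiE_insert_eq
    by (subst sum.reindex[OF inj_combinator[OF assms(1)]]) (simp add: case_prod_unfold)
  also have "\<dots> = (\<Sum>c\<in>B. \<Sum>b\<in>Pi\<^sub>E A (\<lambda>_. B). f (b(x := c)))"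
    by (simp add: sum.cartesian_product)
  finally show ?thesis by (simp add: sum.swap[of _ B])
qed

lemma sum_Pow_insert:
  assumes "x \<notin> A" "finite A"
  shows "(\<Sum>T\<in>Pow (insert x A). f T) = (\<Sum>T\<in>Pow A. f T) + (\<Sum>T\<in>Pow A. f (insert x T))"
proof -
  have "inj_on (insert x) (Pow A)" using assms(1) by (auto simp: inj_on_def)
  moreover have "Pow A \<inter> insert x ` Pow A = {}" using assms(1) by auto
  ultimately show ?thesis
    using assms(2) by (simp add: Pow_insert sum.union_disjoint sum.reindex)
qed

context trace_contraction
begin

text \<open>Gluings are described relative to the arrival sides \<open>d\<close> and
  \<open>d'\<close>, because the agreement of these two signs decides which of the two terms belongs
  to the straight gluing. The last conjunct shows that the branch \<open>ws1\<close> preserves the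
  original direction of all vertex-joins.\<close>

lemma contract:
  assumes k: "k \<noteq> k'" "k \<notin> R" "k' \<notin> R" "k \<in> K" "k' \<in> K"
    and st: "state (insert k (insert k' R)) g ws"
    and gR: "\<forall>t\<in>K \<times> UNIV. fst t \<notin> insert k (insert k' R) \<longrightarrow>
          fst (g t) \<notin> insert k (insert k' R)"
  shows "\<exists>d d' ws1 ws2.
     (\<forall>g1. compat R k k' g g1 \<longrightarrow> g1 (k, d) = (k', \<not> d') \<longrightarrow> g1 (k', d') = (k, \<not> d) \<longrightarrow> state R g1 ws1) \<and>
     (\<forall>g2. compat R k k' g g2 \<longrightarrow> g2 (k, d) = (k', d') \<longrightarrow> g2 (k, \<not> d) = (k', \<not> d') \<longrightarrow>
        g2 (k', \<not> d') = (k, \<not> d) \<longrightarrow> state R g2 ws2) \<and>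
     (\<forall>e. (\<forall>l. l \<notin> R \<longrightarrow> e l = mat 1) \<longrightarrow> (u' \<noteq> 0 \<longrightarrow> (\<forall>l. adj (e l) = e l)) \<longrightarrow>
        (\<Sum>c\<in>B. tval (e(k := c, k' := c)) ws) =
          u * v powi (int (length ws1) - int (length ws)) * tval e ws1 +
          u' * v powi (int (length ws2) - int (length ws)) * tval e ws2) \<and>
     ((\<forall>s\<in>set (concat ws). snd s) \<longrightarrow> d = d' \<and> (\<forall>s\<in>set (concat ws1). snd s))"
proof -
  let ?R0 = "insert k (insert k' R)"
  have g: "fst (g t) \<notin> ?R0" if "t \<in> K \<times> UNIV" "fst t \<notin> ?R0" for t
    using gR that by blast
  obtain s where s: "s \<in> set (concat ws)" "fst (join s) = k"
    using arrival_exists[OF st _ k(4) g] by auto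
  obtain s' where s': "s' \<in> set (concat ws)" "fst (join s') = k'"
    using arrival_exists[OF st _ k(5) g] by auto
  have "s \<noteq> s'" using s s' k(1) by auto
  have sK: "s \<in> K \<times> UNIV" "s' \<in> K \<times> UNIV" using s s' st unfolding state_def by auto
  define d d' where "d = (\<not> snd s)" and "d' = (\<not> snd s')"
  have js: "join s = (k, d)" "join s' = (k', d')"
    using s s' snd_join[OF sK(1)] snd_join[OF sK(2)] by (auto simp: d_def d'_def prod_eq_iff)
  from normal_form[OF s(1) s'(1) \<open>s \<noteq> s'\<close>, of ?R0 g] show ?thesis
  proof (elim disjE exE)
    fix x y rest
    let ?ws = "((x @ [s]) @ (y @ [s'])) # rest"
    assume eq: "equivalent ?R0 g ws ?ws"
    then have st': "state ?R0 g ?ws" and len: "length ws = length ?ws"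
      and set: "set (concat ws) = set (concat ?ws)" and tv: "\<And>e. tval e ws = tval e ?ws"
      using st unfolding equivalent_def by blast+
    note c = contract_same_word[OF k(1-3) st' g refl js]
    show ?thesis
    proof (rule exI[of _ d], rule exI[of _ d'], rule exI[of _ "(x @ [s]) # (y @ [s']) # rest"],
        rule exI[of _ "((x @ [s]) @ map join (rev (y @ [s']))) # rest"], intro conjI allI impI)
      fix e assume e: "\<forall>l. l \<notin> R \<longrightarrow> e l = mat 1" "u' \<noteq> 0 \<longrightarrow> (\<forall>l. adj (e l) = e l)"
      show "(\<Sum>c\<in>B. tval (e(k := c, k' := c)) ws) =
          u * v powi (int (length ((x @ [s]) # (y @ [s']) # rest)) - int (length ws)) *
            tval e ((x @ [s]) # (y @ [s']) # rest) +
          u' * v powi (int (length (((x @ [s]) @ map join (rev (y @ [s']))) # rest)) - int (length ws)) *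
            tval e (((x @ [s]) @ map join (rev (y @ [s']))) # rest)"
        unfolding tv using c(3)[of e] e by (simp add: len)
    next
      assume a: "\<forall>s\<in>set (concat ws). snd s"
      then show "d = d'" using s s' by (auto simp: d_def d'_def)
      show "\<forall>s\<in>set (concat ((x @ [s]) # (y @ [s']) # rest)). snd s"
        using a unfolding set by auto
    qed (use c(1,2) in blast)+
  next
    fix x y rest
    let ?ws = "(x @ [s]) # (y @ [s']) # rest"
    assume eq: "equivalent ?R0 g ws ?ws"
    then have st': "state ?R0 g ?ws" and len: "length ws = length ?ws"
      and set: "set (concat ws) = set (concat ?ws)" and tv: "\<And>e. tval e ws = tval e ?ws"
      using st unfolding equivalent_def by blast+
    note c = contract_two_words[OF k(1-3) st' g refl js]
    show ?thesis
    proof (rule exI[of _ d], rule exI[of _ d'], rule exI[of _ "((x @ [s]) @ (y @ [s'])) # rest"],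
        rule exI[of _ "((x @ [s]) @ map join (rev (y @ [s']))) # rest"], intro conjI allI impI)
      fix e assume e: "\<forall>l. l \<notin> R \<longrightarrow> e l = mat 1" "u' \<noteq> 0 \<longrightarrow> (\<forall>l. adj (e l) = e l)"
      show "(\<Sum>c\<in>B. tval (e(k := c, k' := c)) ws) =
          u * v powi (int (length (((x @ [s]) @ (y @ [s'])) # rest)) - int (length ws)) *
            tval e (((x @ [s]) @ (y @ [s'])) # rest) +
          u' * v powi (int (length (((x @ [s]) @ map join (rev (y @ [s']))) # rest)) - int (length ws)) *
            tval e (((x @ [s]) @ map join (rev (y @ [s']))) # rest)"
        unfolding tv using c(3)[of e] e by (simp add: len power_int_minus divide_inverse del: tval_simps)
    next
      assume a: "\<forall>s\<in>set (concat ws). snd s"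
      then show "d = d'" using s s' by (auto simp: d_def d'_def)
      show "\<forall>s\<in>set (concat (((x @ [s]) @ (y @ [s'])) # rest)). snd s"
        using a unfolding set by auto
    qed (use c(1,2) in blast)+
  qed
qed

text \<open>Pairs in \<open>q\<close> are still to be contracted and carry their basis element at
  both ends; at the other labels the matrix has been summed out and the identity is left.\<close>

definition pair_val :: "nat set set \<Rightarrow> nat set set \<Rightarrow> (nat set \<Rightarrow> 'a ^ 'n ^ 'n) \<Rightarrow> nat \<Rightarrow> 'a ^ 'n ^ 'n" where
  "pair_val p q b l = (if l \<in> \<Union>q then b {l, partner p l} else mat 1)"

text \<open>If both arrivals have the same sign, the term with \<open>u\<close> belongs to the
  straight gluing and the term with \<open>u'\<close> to the twisted one. If the signs differ, the
  roles are exchanged, and the statement survives because then \<open>u' = u\<close>.\<close>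

lemma contract_pair:
  assumes p: "p \<in> pairings K" and q: "insert e q \<subseteq> p" "e \<notin> q" and Tc: "Tc \<subseteq> p - insert e q"
    and st: "state (\<Union>(insert e q)) (glue (p, Tc)) ws"
    and orient: "u' = u \<or> (\<forall>s\<in>set (concat ws). snd s)"
  shows "\<exists>ws1 ws2. state (\<Union>q) (glue (p, Tc)) ws1 \<and> state (\<Union>q) (glue (p, insert e Tc)) ws2 \<and>
     (u' = u \<or> (\<forall>s\<in>set (concat ws1). snd s)) \<and>
     (\<forall>b\<in>Pi\<^sub>E q (\<lambda>_. B). (\<Sum>c\<in>B. tval (pair_val p (insert e q) (b(e := c))) ws) =
          u * v powi (int (length ws1) - int (length ws)) * tval (pair_val p q b) ws1 +
          u' * v powi (int (length ws2) - int (length ws)) * tval (pair_val p q b) ws2)"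
proof -
  obtain k k' where e: "e = {k, k'}" and kk: "k \<noteq> k'"
    using pairingsD(2)[OF p, of e] q(1) by (auto simp: card_2_iff)
  have eP: "{k, k'} \<in> p" "{k', k} \<in> p" using q(1) e by (auto simp: insert_commute)
  have pk: "partner p k = k'" "partner p k' = k" using partner_eq[OF p] eP by auto
  have kK: "k \<in> K" "k' \<in> K" using eP pairingsD(1)[OF p] by auto
  let ?R = "\<Union>q"
  have kq: "k \<notin> ?R" "k' \<notin> ?R"
    using pairingsD(3)[OF p _ eP(1)] q e by fast+
  have R0: "\<Union>(insert e q) = insert k (insert k' ?R)" by (auto simp: e)
  have partner_q: "{l, partner p l} \<in> q" if l: "l \<in> \<Union>q" for l
  proof -
    obtain h where h: "h \<in> q" "l \<in> h" using l by auto
    have "l \<in> K" using h q(1) pairingsD(1)[OF p] by auto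
    then show ?thesis using pairingsD(3)[OF p _ partner_pair(1)[OF p], of h l l] h q(1) by auto
  qed
  have partner_nq: "partner p l \<notin> \<Union>q" if "l \<in> K" "l \<notin> \<Union>q" for l
    using partner_q[of "partner p l"] partner_pair[OF p that(1)] that by auto
  have partner_nR0: "partner p l \<notin> insert k (insert k' ?R)" if "l \<in> K" "l \<notin> insert k (insert k' ?R)" for l
    using partner_nq[of l] pk partner_pair(3)[OF p that(1)] that by auto
  have comp: "compat ?R k k' (glue (p, Tc)) (glue (p, Tc'))" if "Tc' = Tc \<or> Tc' = insert e Tc" for Tc'
    unfolding compat_def
  proof (intro conjI ballI impI)
    fix t :: "nat \<times> bool" assume t: "t \<in> K \<times> UNIV"
    then have tK: "fst t \<in> K" by auto
    {
      assume "fst t \<notin> insert k (insert k' ?R)"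
      then have "{fst t, partner p (fst t)} \<noteq> e" unfolding e by (metis insertI1 insertI2 insertE singletonD)
      then show "glue (p, Tc') t = glue (p, Tc) t" using that by (auto simp: glue_eq)
    }
    show "fst (glue (p, Tc') t) \<notin> ?R" if "fst t \<notin> ?R"
      unfolding glue_eq fst_conv by (rule partner_nq[OF tK that])
    show "glue (p, Tc') (glue (p, Tc') t) = t" by (rule glue_glue[OF p tK])
  qed
  have eT: "{k, k'} \<notin> Tc" "{k', k} \<notin> Tc" using Tc e by (auto simp: insert_commute)
  have gl: "glue (p, Tc) (k, b) = (k', \<not> b)" "glue (p, Tc) (k', b) = (k, \<not> b)"
    "glue (p, insert e Tc) (k, b) = (k', b)" "glue (p, insert e Tc) (k', b) = (k, b)" for b
    using eT by (auto simp: glue_eq pk e insert_commute)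
  have gR: "\<forall>t\<in>K \<times> UNIV. fst t \<notin> insert k (insert k' ?R) \<longrightarrow>
      fst (glue (p, Tc) t) \<notin> insert k (insert k' ?R)"
    using partner_nR0 unfolding glue_eq by auto
  obtain d d' ws1 ws2 where
    c: "\<forall>g1. compat ?R k k' (glue (p, Tc)) g1 \<longrightarrow> g1 (k, d) = (k', \<not> d') \<longrightarrow> g1 (k', d') = (k, \<not> d) \<longrightarrow> state ?R g1 ws1"
      "\<forall>g2. compat ?R k k' (glue (p, Tc)) g2 \<longrightarrow> g2 (k, d) = (k', d') \<longrightarrow> g2 (k, \<not> d) = (k', \<not> d') \<longrightarrow>
        g2 (k', \<not> d') = (k, \<not> d) \<longrightarrow> state ?R g2 ws2"
      "\<forall>e. (\<forall>l. l \<notin> ?R \<longrightarrow> e l = mat 1) \<longrightarrow> (u' \<noteq> 0 \<longrightarrow> (\<forall>l. adj (e l) = e l)) \<longrightarrow>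
        (\<Sum>c\<in>B. tval (e(k := c, k' := c)) ws) =
          u * v powi (int (length ws1) - int (length ws)) * tval e ws1 +
          u' * v powi (int (length ws2) - int (length ws)) * tval e ws2"
      "(\<forall>s\<in>set (concat ws). snd s) \<longrightarrow> d = d' \<and> (\<forall>s\<in>set (concat ws1). snd s)"
    using contract[OF kk kq kK st[unfolded R0] gR] by (elim exE conjE) (rule that; assumption)
  note s1 = c(1)[rule_format] and s2 = c(2)[rule_format] and sm = c(3)[THEN spec, THEN mp, THEN mp]
    and or = c(4)[THEN mp]
  have upd: "pair_val p (insert e q) (b(e := c)) = (pair_val p q b)(k := c, k' := c)" for b c
  proof
    fix l
    show "pair_val p (insert e q) (b(e := c)) l = ((pair_val p q b)(k := c, k' := c)) l"
    proof (cases "l \<in> e")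
      case True
      then have "{l, partner p l} = e" using pk e by auto
      then show ?thesis using True by (auto simp: pair_val_def e)
    next
      case False
      then have "l \<noteq> k" "l \<noteq> k'" "l \<in> \<Union>(insert e q) \<longleftrightarrow> l \<in> \<Union>q" by (auto simp: e)
      moreover have "{l, partner p l} \<noteq> e" using False by blast
      ultimately show ?thesis by (simp add: pair_val_def)
    qed
  qed
  have sum: "(\<Sum>c\<in>B. tval (pair_val p (insert e q) (b(e := c))) ws) =
          u * v powi (int (length ws1) - int (length ws)) * tval (pair_val p q b) ws1 +
          u' * v powi (int (length ws2) - int (length ws)) * tval (pair_val p q b) ws2"
    if b: "b \<in> Pi\<^sub>E q (\<lambda>_. B)" for b
    unfolding upd
  proof (rule sm)
    show "\<forall>l. l \<notin> ?R \<longrightarrow> pair_val p q b l = mat 1" by (simp add: pair_val_def)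
    show "u' \<noteq> 0 \<longrightarrow> (\<forall>l. adj (pair_val p q b l) = pair_val p q b l)"
      using b partner_q adj_B adj_one by (auto simp: pair_val_def PiE_iff)
  qed
  show ?thesis
  proof (cases "d = d'")
    case True
    have "state ?R (glue (p, Tc)) ws1" by (rule s1[OF comp[OF disjI1[OF refl]]]) (simp_all only: gl True not_not)
    moreover have "state ?R (glue (p, insert e Tc)) ws2" by (rule s2[OF comp[OF disjI2[OF refl]]]) (simp_all only: gl True not_not)
    ultimately show ?thesis using sum orient or by blast
  next
    case False
    then have d': "d' = (\<not> d)" by auto
    have "state ?R (glue (p, insert e Tc)) ws1" by (rule s1[OF comp[OF disjI2[OF refl]]]) (simp_all only: gl d' not_not)
    moreover have "state ?R (glue (p, Tc)) ws2" by (rule s2[OF comp[OF disjI1[OF refl]]]) (simp_all only: gl d' not_not)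
    \<comment> \<open>Different arrival signs cannot occur while all sides in the words are
      \<open>+\<close>, so the orientation condition leaves only this alternative.\<close>
    moreover have "u' = u" using orient or False by blast
    ultimately show ?thesis using sum by (intro exI[of _ ws2] exI[of _ ws1]) (simp add: add.commute)
  qed
qed

text \<open>\<open>Tc\<close> records the pairs contracted earlier with a twist. For
  \<open>u' = 0\<close> nothing is claimed about \<open>fs T\<close> with \<open>T\<close> nonempty:
  these summands contain the factor 0, and a word with a reversed part could not be contracted
  further.\<close>

lemma contraction_expansion:
  assumes p: "p \<in> pairings K"
  shows "finite q \<Longrightarrow> q \<subseteq> p \<Longrightarrow> Tc \<subseteq> p - q \<Longrightarrow> state (\<Union>q) (glue (p, Tc)) ws \<Longrightarrow>
    u' = u \<or> (\<forall>s\<in>set (concat ws). snd s) \<Longrightarrow>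
    \<exists>fs. (\<forall>T. T \<subseteq> q \<longrightarrow> u' \<noteq> 0 \<or> T = {} \<longrightarrow> state {} (glue (p, Tc \<union> T)) (fs T)) \<and>
      (\<Sum>b\<in>Pi\<^sub>E q (\<lambda>_. B). tval (pair_val p q b) ws) =
      (\<Sum>T\<in>Pow q. u ^ card (q - T) * u' ^ card T * v powi (int (length (fs T)) - int (length ws)) *
         tval (\<lambda>_. mat 1) (fs T))"
proof (induction q arbitrary: Tc ws rule: finite_induct)
  case empty
  have "pair_val p {} b = (\<lambda>_. mat 1)" for b by (auto simp: pair_val_def)
  then show ?case using empty by (intro exI[of _ "\<lambda>_. ws"]) auto
next
  case (insert e q)
  obtain ws1 ws2 where st1: "state (\<Union>q) (glue (p, Tc)) ws1"
    and st2: "state (\<Union>q) (glue (p, insert e Tc)) ws2"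
    and or: "u' = u \<or> (\<forall>s\<in>set (concat ws1). snd s)"
    and sm: "\<And>b. b\<in>Pi\<^sub>E q (\<lambda>_. B) \<Longrightarrow> (\<Sum>c\<in>B. tval (pair_val p (insert e q) (b(e := c))) ws) =
          u * v powi (int (length ws1) - int (length ws)) * tval (pair_val p q b) ws1 +
          u' * v powi (int (length ws2) - int (length ws)) * tval (pair_val p q b) ws2"
    using contract_pair[OF p insert.prems(1) insert.hyps(2) insert.prems(2,3,4)] by metis
  let ?S = "\<lambda>q fs ws. \<Sum>T\<in>Pow q. u ^ card (q - T) * u' ^ card T * v powi (int (length (fs T)) - int (length ws)) *
         tval (\<lambda>_. mat 1) (fs T)"
  have "Tc \<subseteq> p - q" using insert.prems(2) by auto
  from insert.IH[OF _ this st1 or] insert.prems(1) obtain f1 where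
    f1: "\<And>T. T \<subseteq> q \<Longrightarrow> u' \<noteq> 0 \<or> T = {} \<Longrightarrow> state {} (glue (p, Tc \<union> T)) (f1 T)"
    and F1: "(\<Sum>b\<in>Pi\<^sub>E q (\<lambda>_. B). tval (pair_val p q b) ws1) = ?S q f1 ws1" by auto
  \<comment> \<open>If \<open>u' = 0\<close> the twisted branch is multiplied by zero and any
    \<open>f2\<close> will do. Otherwise \<open>u' = u\<close>, so the orientation condition of the
    induction hypothesis holds although \<open>ws2\<close> may mix directions.\<close>
  have "\<exists>f2. (\<forall>T. T \<subseteq> q \<longrightarrow> u' \<noteq> 0 \<longrightarrow> state {} (glue (p, insert e Tc \<union> T)) (f2 T)) \<and>
      u' * (\<Sum>b\<in>Pi\<^sub>E q (\<lambda>_. B). tval (pair_val p q b) ws2) = u' * ?S q f2 ws2"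
  proof (cases "u' = 0")
    case False
    then have "u' = u" using u_cases by auto
    moreover have "insert e Tc \<subseteq> p - q" using insert.prems insert.hyps by auto
    ultimately obtain f2 where "\<And>T. T \<subseteq> q \<Longrightarrow> u' \<noteq> 0 \<or> T = {} \<Longrightarrow> state {} (glue (p, insert e Tc \<union> T)) (f2 T)"
      and "(\<Sum>b\<in>Pi\<^sub>E q (\<lambda>_. B). tval (pair_val p q b) ws2) = ?S q f2 ws2"
      using insert.IH[OF _ _ st2] insert.prems(1) by auto
    then show ?thesis by (intro exI[of _ f2]) simp
  qed simp
  then obtain f2 where
    f2: "\<And>T. T \<subseteq> q \<Longrightarrow> u' \<noteq> 0 \<Longrightarrow> state {} (glue (p, insert e Tc \<union> T)) (f2 T)"
    and F2: "u' * (\<Sum>b\<in>Pi\<^sub>E q (\<lambda>_. B). tval (pair_val p q b) ws2) = u' * ?S q f2 ws2" by auto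
  define f where "f T = (if e \<in> T then f2 (T - {e}) else f1 T)" for T
  have "state {} (glue (p, Tc \<union> T)) (f T)" if "T \<subseteq> insert e q" "u' \<noteq> 0 \<or> T = {}" for T
  proof (cases "e \<in> T")
    case True
    then have "Tc \<union> T = insert e Tc \<union> (T - {e})" by auto
    then show ?thesis using f2[of "T - {e}"] that True by (auto simp: f_def)
  next
    case False
    then show ?thesis using f1[of T] that by (auto simp: f_def)
  qed
  moreover have "(\<Sum>b\<in>Pi\<^sub>E (insert e q) (\<lambda>_. B). tval (pair_val p (insert e q) b) ws) =
      ?S (insert e q) f ws"
  proof -
    have "(\<Sum>b\<in>Pi\<^sub>E (insert e q) (\<lambda>_. B). tval (pair_val p (insert e q) b) ws) =
       u * v powi (int (length ws1) - int (length ws)) * (\<Sum>b\<in>Pi\<^sub>E q (\<lambda>_. B). tval (pair_val p q b) ws1) +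
       v powi (int (length ws2) - int (length ws)) * (u' * (\<Sum>b\<in>Pi\<^sub>E q (\<lambda>_. B). tval (pair_val p q b) ws2))"
      by (simp add: sum_PiE_insert[OF insert.hyps(2,1) finite_B] sm sum.distrib sum_distrib_left mult_ac)
    also have "\<dots> = u * v powi (int (length ws1) - int (length ws)) * ?S q f1 ws1 +
       v powi (int (length ws2) - int (length ws)) * (u' * ?S q f2 ws2)" by (simp only: F1 F2)
    also have "u * v powi (int (length ws1) - int (length ws)) * ?S q f1 ws1 =
      (\<Sum>T\<in>Pow q. u ^ card (insert e q - T) * u' ^ card T * v powi (int (length (f T)) - int (length ws)) *
         tval (\<lambda>_. mat 1) (f T))"
      unfolding sum_distrib_left
    proof (rule sum.cong[OF refl])
      fix T assume T: "T \<in> Pow q"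
      then have "e \<notin> T" "insert e q - T = insert e (q - T)" "finite (q - T)" "e \<notin> q - T"
        using insert.hyps by auto
      moreover have "v powi (int (length ws1) - int (length ws)) * v powi (int (length (f1 T)) - int (length ws1)) =
         v powi (int (length (f1 T)) - int (length ws))"
        using v_nz by (simp flip: power_int_add)
      ultimately show "u * v powi (int (length ws1) - int (length ws)) *
         (u ^ card (q - T) * u' ^ card T * v powi (int (length (f1 T)) - int (length ws1)) *
          tval (\<lambda>_. mat 1) (f1 T)) =
         u ^ card (insert e q - T) * u' ^ card T * v powi (int (length (f T)) - int (length ws)) *
         tval (\<lambda>_. mat 1) (f T)"
        by (simp add: f_def mult_ac)
    qed
    also have "v powi (int (length ws2) - int (length ws)) * (u' * ?S q f2 ws2) =
      (\<Sum>T\<in>Pow q. u ^ card (insert e q - insert e T) * u' ^ card (insert e T) *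
         v powi (int (length (f (insert e T))) - int (length ws)) * tval (\<lambda>_. mat 1) (f (insert e T)))"
      unfolding sum_distrib_left
    proof (rule sum.cong[OF refl])
      fix T assume T: "T \<in> Pow q"
      then have "e \<notin> T" "insert e q - insert e T = q - T" "finite T" "insert e T - {e} = T"
        using insert.hyps finite_subset[of T q] by auto
      moreover have "v powi (int (length ws2) - int (length ws)) * v powi (int (length (f2 T)) - int (length ws2)) =
         v powi (int (length (f2 T)) - int (length ws))"
        using v_nz by (simp flip: power_int_add)
      ultimately show "v powi (int (length ws2) - int (length ws)) *
         (u' * (u ^ card (q - T) * u' ^ card T * v powi (int (length (f2 T)) - int (length ws2)) *
          tval (\<lambda>_. mat 1) (f2 T))) =
         u ^ card (insert e q - insert e T) * u' ^ card (insert e T) *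
         v powi (int (length (f (insert e T))) - int (length ws)) * tval (\<lambda>_. mat 1) (f (insert e T))"
        by (simp add: f_def mult_ac)
    qed
    finally show ?thesis by (simp only: sum_Pow_insert[OF insert.hyps(2,1)])
  qed
  ultimately show ?case by blast
qed

end

section \<open>Ribbon vertices and trails\<close>

lemma psum_Suc: "l < length \<nu> \<Longrightarrow> psum \<nu> (Suc l) = psum \<nu> l + \<nu> ! l"
  by (simp add: psum_def take_Suc_conv_app_nth)

lemma psum_0 [simp]: "psum \<nu> 0 = 0"
  by (simp add: psum_def)

lemma psum_length [simp]: "psum \<nu> (length \<nu>) = sum_list \<nu>"
  by (simp add: psum_def)

lemma psum_mono: "i \<le> j \<Longrightarrow> psum \<nu> i \<le> psum \<nu> j"
proof -
  assume "i \<le> j"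
  then obtain d where "j = i + d" using le_Suc_ex by blast
  then show ?thesis by (simp add: psum_def take_add)
qed

locale ribbon_vertices =
  fixes \<nu> :: "nat list"
  assumes pos: "\<forall>k\<in>set \<nu>. 0 < k"
begin

abbreviation "labels \<equiv> {1..sum_list \<nu>}"

lemma psum_strict: "l < length \<nu> \<Longrightarrow> psum \<nu> l < psum \<nu> (Suc l)"
  using pos by (simp add: psum_Suc)

lemma vertex_of_eq: "psum \<nu> l < k \<Longrightarrow> k \<le> psum \<nu> (Suc l) \<Longrightarrow> vertex_of \<nu> k = l"
  unfolding vertex_of_def
proof (rule Least_equality)
  fix y assume k: "psum \<nu> l < k" "k \<le> psum \<nu> (Suc y)"
  show "l \<le> y"
  proof (rule ccontr)
    assume "\<not> l \<le> y"
    then have "psum \<nu> (Suc y) \<le> psum \<nu> l" by (intro psum_mono) simp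
    then show False using k by simp
  qed
qed

lemma vertex_exists:
  assumes "k \<in> labels"
  shows "\<exists>l<length \<nu>. psum \<nu> l < k \<and> k \<le> psum \<nu> (Suc l)"
proof -
  let ?P = "\<lambda>l. k \<le> psum \<nu> l"
  have P: "?P (length \<nu>)" using assms by simp
  define j where "j = (LEAST l. ?P l)"
  have "?P j" unfolding j_def using P by (rule LeastI)
  have "j \<le> length \<nu>" unfolding j_def using P by (rule Least_le)
  have "j \<noteq> 0" using \<open>?P j\<close> assms by (metis atLeastAtMost_iff not_one_le_zero order_trans psum_0)
  then obtain i where j: "j = Suc i" using not0_implies_Suc by blast
  have "\<not> ?P i" using not_less_Least[of i ?P] j by (simp add: j_def)
  then show ?thesis using \<open>?P j\<close> \<open>j \<le> length \<nu>\<close> j by (intro exI[of _ i]) auto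
qed

lemma next_label_block:
  assumes "psum \<nu> l < k" "k \<le> psum \<nu> (Suc l)"
  shows "next_label \<nu> k = (if k = psum \<nu> (Suc l) then psum \<nu> l + 1 else k + 1)"
  unfolding next_label_def vertex_of_eq[OF assms] ..

lemma next_label_in: "k \<in> labels \<Longrightarrow> next_label \<nu> k \<in> labels"
proof -
  assume "k \<in> labels"
  then obtain l where l: "l < length \<nu>" "psum \<nu> l < k" "k \<le> psum \<nu> (Suc l)"
    using vertex_exists by blast
  have "psum \<nu> (Suc l) \<le> sum_list \<nu>" using psum_mono[of "Suc l" "length \<nu>" \<nu>] l(1) by simp
  then show ?thesis using next_label_block[OF l(2,3)] l psum_strict[OF l(1)] by (auto split: if_splits)
qed

text \<open>The successor stays in the interval of labels of its vertex, and these intervals are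
  disjoint, so labels of different vertices cannot collide.\<close>

lemma inj_on_next_label: "inj_on (next_label \<nu>) labels"
proof (rule inj_onI)
  fix k k' assume k: "k \<in> labels" "k' \<in> labels" and eq: "next_label \<nu> k = next_label \<nu> k'"
  obtain l where l: "l < length \<nu>" "psum \<nu> l < k" "k \<le> psum \<nu> (Suc l)"
    using vertex_exists k by blast
  obtain l' where l': "l' < length \<nu>" "psum \<nu> l' < k'" "k' \<le> psum \<nu> (Suc l')"
    using vertex_exists k by blast
  consider "l = l'" | "l < l'" | "l' < l" by linarith
  then show "k = k'"
  proof cases
    case 1
    then show ?thesis using eq next_label_block[OF l(2,3)] next_label_block[OF l'(2,3)] l l'
      by (auto split: if_splits)
  next
    case 2
    then have "psum \<nu> (Suc l) \<le> psum \<nu> l'" by (intro psum_mono) simp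
    then show ?thesis using eq next_label_block[OF l(2,3)] next_label_block[OF l'(2,3)] l l'
      by (auto split: if_splits)
  next
    case 3
    then have "psum \<nu> (Suc l') \<le> psum \<nu> l" by (intro psum_mono) simp
    then show ?thesis using eq next_label_block[OF l(2,3)] next_label_block[OF l'(2,3)] l l'
      by (auto split: if_splits)
  qed
qed

lemma next_label_image: "next_label \<nu> ` labels = labels"
  by (rule endo_inj_surj) (use next_label_in inj_on_next_label in auto)

lemma prev_next: "k \<in> labels \<Longrightarrow> inv_into labels (next_label \<nu>) (next_label \<nu> k) = k"
  by (rule inv_into_f_f[OF inj_on_next_label])

lemma next_prev: "k \<in> labels \<Longrightarrow> next_label \<nu> (inv_into labels (next_label \<nu>) k) = k"
  by (rule f_inv_into_f) (simp only: next_label_image)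

lemma prev_in: "k \<in> labels \<Longrightarrow> inv_into labels (next_label \<nu>) k \<in> labels"
  by (rule inv_into_into) (simp only: next_label_image)

lemma vertex_join_eq:
  "vertex_join \<nu> s = (if snd s then (next_label \<nu> (fst s), False)
     else (inv_into labels (next_label \<nu>) (fst s), True))"
  by (cases s; cases "snd s") auto

sublocale side_joins "vertex_join \<nu>" labels
proof
  fix s assume "s \<in> labels \<times> (UNIV :: bool set)"
  then have s: "fst s \<in> labels" by auto
  show "vertex_join \<nu> (vertex_join \<nu> s) = s"
    using prev_next[OF s] next_prev[OF s] by (simp add: vertex_join_eq prod_eq_iff)
  show "vertex_join \<nu> s \<in> labels \<times> UNIV"
    using next_label_in[OF s] prev_in[OF s] by (simp add: vertex_join_eq)
  show "snd (vertex_join \<nu> s) = (\<not> snd s)" by (simp add: vertex_join_eq)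
qed

text \<open>All sides have sign \<open>+\<close>: initially every vertex-join is traversed forwards
  and every arrival is on a \<open>-\<close> side.\<close>

definition vertex_word :: "nat \<Rightarrow> (nat \<times> bool) list" where
  "vertex_word l = map (\<lambda>k. (k, True)) [psum \<nu> l + 1..<psum \<nu> (Suc l) + 1]"

definition vertex_words :: "(nat \<times> bool) list list" where
  "vertex_words = map vertex_word [0..<length \<nu>]"

lemma concat_vertex_words: "concat vertex_words = map (\<lambda>k. (k, True)) [1..<sum_list \<nu> + 1]"
proof -
  have "concat (map vertex_word [0..<m]) = map (\<lambda>k. (k, True)) [1..<psum \<nu> m + 1]" for m
  proof (induction m)
    case (Suc m)
    have "[1..<psum \<nu> (Suc m) + 1] = [1..<psum \<nu> m + 1] @ [psum \<nu> m + 1..<psum \<nu> (Suc m) + 1]"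
      using upt_add_eq_append[of 1 "psum \<nu> m + 1" "psum \<nu> (Suc m) - psum \<nu> m"] psum_mono[of m "Suc m" \<nu>]
      by simp
    then show ?case using Suc by (simp add: vertex_word_def)
  qed simp
  then show ?thesis by (simp add: vertex_words_def)
qed

lemma successively_upt:
  "(\<And>k. i \<le> k \<Longrightarrow> Suc k < j \<Longrightarrow> P k (Suc k)) \<Longrightarrow> successively P [i..<j]"
proof (induction j)
  case (Suc j)
  have "P (last [i..<j]) j" if "i < j" using Suc.prems[of "j - 1"] that by simp
  moreover have "successively P [i..<j]" by (rule Suc.IH) (use Suc.prems in simp)
  ultimately show ?case by (cases "i < j") (auto simp: successively_append_iff)
qed simp

lemma vertex_block:
  assumes "l < length \<nu>"
  shows "successively (\<lambda>a b. b = next_label \<nu> a) [psum \<nu> l + 1..<psum \<nu> (Suc l) + 1]"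
    "next_label \<nu> (last [psum \<nu> l + 1..<psum \<nu> (Suc l) + 1]) = hd [psum \<nu> l + 1..<psum \<nu> (Suc l) + 1]"
    "[psum \<nu> l + 1..<psum \<nu> (Suc l) + 1] \<noteq> []"
proof -
  note lt = psum_strict[OF assms]
  show "successively (\<lambda>a b. b = next_label \<nu> a) [psum \<nu> l + 1..<psum \<nu> (Suc l) + 1]"
    by (rule successively_upt) (use next_label_block[of l] in auto)
  show "next_label \<nu> (last [psum \<nu> l + 1..<psum \<nu> (Suc l) + 1]) = hd [psum \<nu> l + 1..<psum \<nu> (Suc l) + 1]"
    using lt next_label_block[OF lt order_refl] by (simp add: hd_append)
  show "[psum \<nu> l + 1..<psum \<nu> (Suc l) + 1] \<noteq> []" using lt by simp
qed

text \<open>While all labels are uncontracted the gluing \<open>g\<close> is never consulted: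
  arriving on the \<open>-\<close> side of the next label, the walk crosses to its \<open>+\<close>
  side and goes on around the vertex.\<close>

lemma state_vertex_words: "state labels g vertex_words"
proof -
  have W: "set (concat vertex_words) = labels \<times> {True}"
    unfolding concat_vertex_words by auto
  have nx: "nxt labels g (k, True) = (next_label \<nu> k, True)" if "k \<in> labels" for k
    using next_label_in[OF that] by (simp add: nxt_def cross_def)
  have "cyclic_walk (nxt labels g) (vertex_word l)" if "l < length \<nu>" for l
  proof -
    let ?ks = "[psum \<nu> l + 1..<psum \<nu> (Suc l) + 1]"
    have "psum \<nu> (Suc l) \<le> sum_list \<nu>" using psum_mono[of "Suc l" "length \<nu>" \<nu>] that by simp
    then have ks: "set ?ks \<subseteq> labels" by auto
    have "successively (\<lambda>a b. (b, True) = nxt labels g (a, True)) ?ks"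
      using vertex_block(1)[OF that]
      by (rule successively_mono) (use ks nx in auto)
    moreover have "last ?ks \<in> labels" using ks vertex_block(3)[OF that] last_in_set by blast
    then have "nxt labels g (last ?ks, True) = (hd ?ks, True)"
      using nx vertex_block(2)[OF that] by simp
    ultimately show ?thesis using vertex_block(3)[OF that]
      unfolding cyclic_walk_def vertex_word_def successively_map by (simp add: last_map hd_map)
  qed
  moreover have "[] \<notin> set vertex_words"
    using vertex_block(3) unfolding vertex_words_def vertex_word_def by auto
  moreover have "distinct (concat vertex_words)"
    unfolding concat_vertex_words by (simp add: distinct_map inj_on_def)
  moreover have "(s \<in> labels \<times> {True}) \<noteq> (vertex_join \<nu> s \<in> labels \<times> {True})" if "s \<in> labels \<times> UNIV" for s
    using join_in[OF that] snd_join[OF that] that by (cases s; cases "vertex_join \<nu> s") auto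
  ultimately show ?thesis
    unfolding state_def W by (auto simp: vertex_words_def)
qed

end

text \<open>A vertex product alternates beginning with the field, a word alternates beginning with
  the vertex factor. The two are cyclic rotations of each other, and \<open>core\<close> is their
  common part.\<close>

lemma foldr_rotate_factor:
  fixes P Q :: "nat \<Rightarrow> 'a::semiring_1 ^ 'n ^ 'n"
  assumes "successively (\<lambda>a b. b = nx a) ks" "ks \<noteq> []"
  shows "\<exists>core. foldr (\<lambda>k M. P k ** Q k ** M) ks (mat 1) = P (hd ks) ** core \<and>
     foldr (\<lambda>k M. Q k ** P (nx k) ** M) ks (mat 1) = core ** P (nx (last ks))"
  using assms
proof (induction ks rule: induct_list012)
  case (2 k)
  then show ?case by (intro exI[of _ "Q k"]) simp
next
  case (3 k k' ks)
  then obtain core where c: "foldr (\<lambda>k M. P k ** Q k ** M) (k' # ks) (mat 1) = P k' ** core"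
     "foldr (\<lambda>k M. Q k ** P (nx k) ** M) (k' # ks) (mat 1) = core ** P (nx (last (k' # ks)))"
    by auto
  show ?case
  proof (intro exI[of _ "Q k ** (P k' ** core)"] conjI)
    show "foldr (\<lambda>k M. P k ** Q k ** M) (k # k' # ks) (mat 1) = P (hd (k # k' # ks)) ** (Q k ** (P k' ** core))"
      unfolding foldr_Cons[of _ k] o_def c(1) by (simp add: matrix_mul_assoc)
    show "foldr (\<lambda>k M. Q k ** P (nx k) ** M) (k # k' # ks) (mat 1) =
       Q k ** (P k' ** core) ** P (nx (last (k # k' # ks)))"
      unfolding foldr_Cons[of _ k] o_def c(2) using 3(3) by (simp add: matrix_mul_assoc)
  qed
qed simp

locale trace_algebra =
  fixes tr :: "'a::semiring_1 ^ 'n ^ 'n \<Rightarrow> 'f::field"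
    and adj :: "'a ^ 'n ^ 'n \<Rightarrow> 'a ^ 'n ^ 'n" and B :: "('a ^ 'n ^ 'n) set" and u u' v :: 'f
  assumes tr_comm: "tr (X ** Y) = tr (Y ** X)"
    and tr_adj: "tr (adj X) = tr X"
    and adj_mult: "adj (X ** Y) = adj Y ** adj X"
    and adj_one: "adj (mat 1) = mat 1"
    and adj_adj: "adj (adj X) = X"
    and finite_B: "finite B"
    and adj_B: "u' \<noteq> 0 \<Longrightarrow> b \<in> B \<Longrightarrow> adj b = b"
    and v_nz: "v \<noteq> 0"
    and u_cases: "u' = u \<or> u' = 0"
    and contract_two: "(\<Sum>b\<in>B. tr (X ** b) * tr (Y ** b)) = u / v * tr (X ** Y) + u' / v * tr (X ** adj Y)"
    and contract_one: "(\<Sum>b\<in>B. tr (X ** b ** Y ** b)) = u * v * tr X * tr Y + u' * tr (X ** adj Y)"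

definition side_factor ::
    "('a::semiring_1 ^ 'n ^ 'n \<Rightarrow> 'a ^ 'n ^ 'n) \<Rightarrow> (nat \<Rightarrow> nat \<Rightarrow> 'a ^ 'n ^ 'n) \<Rightarrow> nat list \<Rightarrow> nat \<times> bool \<Rightarrow> 'a ^ 'n ^ 'n" where
  "side_factor adj A \<nu> s = step_factor adj A (join_step \<nu> s)"

locale ribbon_traces = ribbon_vertices \<nu> + trace_algebra tr adj B u u' v
  for \<nu> and tr :: "'a::semiring_1 ^ 'n ^ 'n \<Rightarrow> 'f::field" and adj B u u' v +
  fixes A :: "nat \<Rightarrow> nat \<Rightarrow> 'a ^ 'n ^ 'n"
begin

text \<open>Backward steps contribute the adjoint of the factor, so passing to the other end of a
  vertex-join applies \<open>adj\<close>; for a join that is already backward this uses that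
  \<open>adj\<close> is an involution.\<close>

sublocale trace_contraction "vertex_join \<nu>" labels tr adj B u u' v "side_factor adj A \<nu>"
proof unfold_locales
  fix s assume s: "s \<in> labels \<times> (UNIV :: bool set)"
  have [simp]: "vertex_join \<nu> (vertex_join \<nu> s) = s" using join_join[OF s] .
  show "adj (side_factor adj A \<nu> s) = side_factor adj A \<nu> (vertex_join \<nu> s)"
    using snd_join[OF s] adj_adj by (simp add: side_factor_def join_step_def)
qed (fact tr_comm tr_adj adj_mult adj_one finite_B adj_B v_nz u_cases contract_two contract_one)+

lemma tval_vertex_words:
  "tval e vertex_words = (\<Prod>l<length \<nu>. tr (vertex_prod \<nu> (\<lambda>k. k) e A l))"
proof -
  have "tr (val e (vertex_word l)) = tr (vertex_prod \<nu> (\<lambda>k. k) e A l)" if l: "l < length \<nu>" for l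
  proof -
    let ?ks = "[psum \<nu> l + 1..<psum \<nu> (Suc l) + 1]"
    obtain core where c: "foldr (\<lambda>k M. e k ** A k (next_label \<nu> k) ** M) ?ks (mat 1) = e (hd ?ks) ** core"
      "foldr (\<lambda>k M. A k (next_label \<nu> k) ** e (next_label \<nu> k) ** M) ?ks (mat 1) = core ** e (next_label \<nu> (last ?ks))"
      using foldr_rotate_factor[OF vertex_block(1,3)[OF l], of e "\<lambda>k. A k (next_label \<nu> k)"] by blast
    have "val e (vertex_word l) = core ** e (hd ?ks)"
      unfolding val_def vertex_word_def foldr_map o_def vertex_block(2)[OF l, symmetric] c(2)[symmetric]
      by (simp add: side_factor_def join_step_def)
    moreover have "vertex_prod \<nu> (\<lambda>k. k) e A l = e (hd ?ks) ** core"
      unfolding vertex_prod_def c(1) ..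
    ultimately show ?thesis by (simp add: tr_comm)
  qed
  then show ?thesis unfolding tval_def vertex_words_def
    by (auto simp: prod.distinct_set_conv_list[symmetric] atLeast0LessThan o_def intro!: prod.cong)
qed

end

section \<open>Trails and boundary cycles read off from the final words\<close>

lemma support_cyclic_walk:
  assumes "cyclic_walk f w" "distinct w" "w \<noteq> []"
  shows "support f (hd w) = w"
proof -
  have step: "f (w ! i) = w ! Suc i" if "Suc i < length w" for i
    using assms(1) that unfolding cyclic_walk_def successively_conv_nth by simp
  have pow: "(f ^^ i) (hd w) = w ! i" if "i < length w" for i
    using that
  proof (induction i)
    case 0 then show ?case using assms(3) by (simp add: hd_conv_nth)
  next
    case (Suc i) then show ?case using step by simp
  qed
  have len: "0 < length w" using assms(3) by simp
  have last: "(f ^^ length w) (hd w) = hd w"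
  proof -
    obtain m where m: "length w = Suc m" using len by (cases "length w") auto
    have "f (w ! m) = hd w"
      using assms(1,3) m unfolding cyclic_walk_def by (simp add: last_conv_nth)
    then show ?thesis using pow[of m] m by simp
  qed
  have "least_power f (hd w) = length w"
    unfolding least_power_def
  proof (rule Least_equality)
    fix n assume n: "(f ^^ n) (hd w) = hd w \<and> 0 < n"
    show "length w \<le> n"
    proof (rule ccontr)
      assume "\<not> length w \<le> n"
      then have "w ! n = w ! 0" "n < length w" using pow[of n] n assms(3) by (auto simp: hd_conv_nth)
      then show False using n assms(2) len by (metis nth_eq_iff_index_eq less_numeral_extra(3))
    qed
  qed (use last len in simp)
  then show ?thesis using pow by (intro nth_equalityI) auto
qed

lemma rotate_class_eq:
  "range (\<lambda>i. rotate i (rotate1 w)) = range (\<lambda>i. rotate i w)"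
proof (cases "w = []")
  case False
  have r: "rotate i (rotate1 w) = rotate (Suc i) w" for i
    by (simp add: rotate1_rotate_swap)
  have "rotate i w \<in> range (\<lambda>i. rotate (Suc i) w)" for i
  proof -
    have "rotate i w = rotate (Suc (i + (length w - 1))) w"
    proof -
      have "Suc (i + (length w - 1)) = i + length w" using False by (cases w) auto
      then show ?thesis by (metis mod_add_self2 rotate_conv_mod)
    qed
    then show ?thesis by blast
  qed
  then show ?thesis unfolding r by blast
qed simp

lemma rotate_class_append: "range (\<lambda>i. rotate i (x @ y)) = range (\<lambda>i. rotate i (y @ x))"
proof -
  have "range (\<lambda>i. rotate i (rotate n w)) = range (\<lambda>i. rotate i w)" for n and w :: "'a list"
  proof (induction n)
    case (Suc n)
    then show ?case using rotate_class_eq[of "rotate n w"] by simp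
  qed simp
  then show ?thesis using rotate_append[of x y] by metis
qed

lemma flip_flip [simp]: "flip (flip s) = s"
  by (cases s) auto

lemma trail_class_append: "trail_class (x @ y) = trail_class (y @ x)"
  unfolding trail_class_def using rotate_class_append[of x y]
    rotate_class_append[of "rev (map flip y)" "rev (map flip x)"] by simp

lemma trail_class_reverse: "trail_class (rev (map flip w)) = trail_class w"
proof -
  have "map flip (rev (map flip w)) = rev w" by (simp add: rev_map o_def)
  then show ?thesis unfolding trail_class_def by (simp add: Un_commute)
qed

lemma self_in_trail_class: "w \<in> trail_class w"
  unfolding trail_class_def by (metis UnI1 rangeI rotate0 id_apply)

lemma word_prod_append: "word_prod adj A (x @ y) = word_prod adj A x ** word_prod adj A y"
  unfolding word_prod_def by (induction x) (simp_all add: matrix_mul_assoc)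

context ribbon_vertices
begin

definition steps_of :: "ribbon_pairing \<Rightarrow> (nat \<times> bool) list \<Rightarrow> step list" where
  "steps_of \<rho> w = concat (map (\<lambda>u. [join_step \<nu> u, glue_step \<rho> (vertex_join \<nu> u)]) w)"

lemma steps_of_simps [simp]: "steps_of \<rho> [] = []"
  "steps_of \<rho> (u # w) = join_step \<nu> u # glue_step \<rho> (vertex_join \<nu> u) # steps_of \<rho> w"
  "steps_of \<rho> (x @ y) = steps_of \<rho> x @ steps_of \<rho> y"
  by (simp_all add: steps_of_def)

lemma flip_join_step: "s \<in> labels \<times> UNIV \<Longrightarrow> flip (join_step \<nu> s) = join_step \<nu> (vertex_join \<nu> s)"
  using join_join[of s] snd_join[of s] by (auto simp: join_step_def)

text \<open>The index \<open>k\<close> of the factor attached to this vertex-join. It does not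
  depend on the direction and determines the vertex-join up to direction.\<close>

definition label_of :: "nat \<times> bool \<Rightarrow> nat" where
  "label_of s = (if snd s then fst s else fst (vertex_join \<nu> s))"

lemma label_of_eq:
  assumes "s \<in> labels \<times> UNIV" "s' \<in> labels \<times> UNIV" "label_of s = label_of s'"
  shows "s' = s \<or> s' = vertex_join \<nu> s"
proof (cases "snd s = snd s'")
  case True
  then have "s = s' \<or> vertex_join \<nu> s = vertex_join \<nu> s'"
    using assms snd_join by (auto simp: label_of_def prod_eq_iff split: if_splits)
  then show ?thesis using join_join assms by metis
next
  case False
  then show ?thesis using assms snd_join[OF assms(1)] snd_join[OF assms(2)] join_join[OF assms(2)]
    by (auto simp: label_of_def prod_eq_iff split: if_splits)
qed

end

text \<open>Which factor a step contributes, regardless of its direction. Being invariant under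
  \<open>flip\<close>, the set of these labels is an invariant of a trail and separates trails that
  come from different words.\<close>

fun step_label :: "step \<Rightarrow> nat option" where
  "step_label (Fwd k k') = Some k"
| "step_label (Bwd k k') = Some k'"
| "step_label (Glue k k') = None"

lemma step_label_flip [simp]: "step_label (flip s) = step_label s"
  by (cases s) auto

lemma step_label_trail_class: "w' \<in> trail_class w \<Longrightarrow> step_label ` set w' = step_label ` set w"
  unfolding trail_class_def by (auto simp: image_image)

context ribbon_vertices
begin

lemma step_label_steps_of:
  "step_label ` set (steps_of \<rho> w) - {None} = Some ` label_of ` set w"
proof (induction w)
  case (Cons u w)
  have "step_label (join_step \<nu> u) = Some (label_of u)" "step_label (glue_step \<rho> (vertex_join \<nu> u)) = None"
    by (simp_all add: join_step_def glue_step_def label_of_def)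
  then show ?case using Cons by auto
qed simp

context
  fixes p T fs
  assumes p: "p \<in> pairings labels" and st: "state {} (glue (p, T)) fs"
begin

abbreviation "rho \<equiv> (p, T)"
abbreviation "walk_map \<equiv> glue (p, T) \<circ> vertex_join \<nu>"

lemma nxt_empty: "nxt {} (glue (p, T)) = walk_map"
  by (auto simp: nxt_def fun_eq_iff simp del: glue.simps)

lemma glue_glue': "t \<in> labels \<times> UNIV \<Longrightarrow> glue (p, T) (glue (p, T) t) = t"
  by (rule glue_glue[OF p]) auto

lemma word_in_state:
  assumes "w \<in> set fs"
  shows "cyclic_walk walk_map w" "distinct w" "w \<noteq> []" "set w \<subseteq> labels \<times> UNIV"
  using st assms unfolding state_def nxt_empty by (auto simp: distinct_concat_iff)

lemma half: "s \<in> labels \<times> UNIV \<Longrightarrow> (s \<in> set (concat fs)) \<noteq> (vertex_join \<nu> s \<in> set (concat fs))"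
  using st unfolding state_def by blast

lemma word_unique: "w \<in> set fs \<Longrightarrow> w' \<in> set fs \<Longrightarrow> s \<in> set w \<Longrightarrow> s \<in> set w' \<Longrightarrow> w = w'"
  using st unfolding state_def by (metis IntI distinct_concat_iff empty_iff)

text \<open>Half of all sides are absent from the words of a state. They are covered by the reversed
  words, which are walks of the same map and have the same trails.\<close>

lemma reverse_word:
  assumes "cyclic_walk walk_map w" "w \<noteq> []" "set w \<subseteq> labels \<times> UNIV"
  shows "cyclic_walk walk_map (map (vertex_join \<nu>) (rev w))"
    "trail_class (steps_of rho (map (vertex_join \<nu>) (rev w))) = trail_class (steps_of rho w)"
proof -
  have ch: "successively (\<lambda>a b. b = walk_map a) w" and cl: "walk_map (last w) = hd w"
    using assms(1) unfolding cyclic_walk_def by auto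
  have hl: "hd w \<in> labels \<times> UNIV" "last w \<in> labels \<times> UNIV" using assms(2,3) by auto
  have "successively (\<lambda>a b. b = nxt {} (glue (p, T)) a) (map (vertex_join \<nu>) (rev w))"
    by (rule successively_nxt_reverse) (use ch assms(3) glue_glue' in \<open>auto simp: nxt_empty simp del: glue.simps\<close>)
  moreover have "walk_map (last (map (vertex_join \<nu>) (rev w))) = hd (map (vertex_join \<nu>) (rev w))"
    using assms(2) join_join[OF hl(1)] cl[symmetric] glue_glue'[OF join_in[OF hl(2)]]
    by (simp add: last_map last_rev hd_map hd_rev del: glue.simps)
  ultimately show "cyclic_walk walk_map (map (vertex_join \<nu>) (rev w))"
    unfolding cyclic_walk_def nxt_empty by blast
  have flip_glue: "flip (glue_step rho t) = glue_step rho (glue rho t)" if "t \<in> labels \<times> UNIV" for t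
    using glue_glue'[OF that] by (simp add: glue_step_def del: glue.simps)
  \<comment> \<open>Flipping and reversing displaces the gluing steps by one position relative to
    the vertex-joins. The additional gluing step on each side of the equation accounts for this, and
    on a closed word the two additional steps coincide.\<close>
  have key: "rev (map flip (steps_of rho w)) @ [glue_step rho (hd w)] =
      flip (glue_step rho (vertex_join \<nu> (last w))) # steps_of rho (map (vertex_join \<nu>) (rev w))"
    using ch assms(2,3)
  proof (induction w rule: induct_list012)
    case (2 s)
    then show ?case using join_join[of s] flip_join_step[of s] by simp
  next
    case (3 s s' w)
    have s: "s \<in> labels \<times> UNIV" using 3 by simp
    have "flip (glue_step rho (vertex_join \<nu> s)) = glue_step rho s'"
      using flip_glue[OF join_in[OF s]] 3(3) by (simp del: glue.simps)
    then have g: "flip (glue_step rho (vertex_join \<nu> s)) = glue_step rho (hd (s' # w))" by simp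
    have IH: "rev (map flip (steps_of rho (s' # w))) @ [glue_step rho (hd (s' # w))] =
      flip (glue_step rho (vertex_join \<nu> (last (s' # w)))) # steps_of rho (map (vertex_join \<nu>) (rev (s' # w)))"
      by (rule "3.IH"(2)) (use 3(3,5) in auto)
    have "rev (map flip (steps_of rho (s # s' # w))) @ [glue_step rho (hd (s # s' # w))] =
      (rev (map flip (steps_of rho (s' # w))) @ [glue_step rho (hd (s' # w))]) @
        [join_step \<nu> (vertex_join \<nu> s), glue_step rho s]"
      unfolding steps_of_simps(2)[of rho s] by (simp only: g flip_join_step[OF s] list.map rev.simps append_assoc append.simps list.sel)
    also have "\<dots> = flip (glue_step rho (vertex_join \<nu> (last (s' # w)))) #
        (steps_of rho (map (vertex_join \<nu>) (rev (s' # w))) @ [join_step \<nu> (vertex_join \<nu> s), glue_step rho s])"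
      unfolding IH by (simp only: append.simps)
    also have "[join_step \<nu> (vertex_join \<nu> s), glue_step rho s] = steps_of rho [vertex_join \<nu> s]"
      by (simp add: join_join[OF s])
    also have "steps_of rho (map (vertex_join \<nu>) (rev (s' # w))) @ steps_of rho [vertex_join \<nu> s] =
        steps_of rho (map (vertex_join \<nu>) (rev (s # s' # w)))"
      unfolding steps_of_simps(3)[symmetric] by simp
    finally show ?case by (simp only: last.simps list.distinct if_False)
  qed simp
  let ?c = "glue_step rho (hd w)"
  have "flip (glue_step rho (vertex_join \<nu> (last w))) = ?c"
    using flip_glue[OF join_in[OF hl(2)]] cl by (simp del: glue.simps)
  with key have key: "rev (map flip (steps_of rho w)) @ [?c] = [?c] @ steps_of rho (map (vertex_join \<nu>) (rev w))"
    by simp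
  have ne: "rev (map flip (steps_of rho w)) \<noteq> []" using assms(2) by (cases w) auto
  then obtain r where r: "rev (map flip (steps_of rho w)) = [?c] @ r"
    using key by (cases "rev (map flip (steps_of rho w))") auto
  then have "steps_of rho (map (vertex_join \<nu>) (rev w)) = r @ [?c]" using key by simp
  then have "trail_class (steps_of rho (map (vertex_join \<nu>) (rev w))) = trail_class (rev (map flip (steps_of rho w)))"
    using trail_class_append[of r "[?c]"] r by simp
  then show "trail_class (steps_of rho (map (vertex_join \<nu>) (rev w))) = trail_class (steps_of rho w)"
    by (simp add: trail_class_reverse)
qed

lemma trail_word_of_word:
  assumes w: "cyclic_walk walk_map w" "distinct w" and s: "s \<in> set w"
  shows "trail_class (trail_word \<nu> rho s) = trail_class (steps_of rho w)"
proof -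
  obtain x y where xy: "w = x @ s # y" using split_list[OF s] by blast
  have "cyclic_walk walk_map ((s # y) @ x)" using cyclic_walk_append_commute w(1) xy by blast
  moreover have "distinct ((s # y) @ x)" using w(2) xy by auto
  ultimately have "support walk_map s = (s # y) @ x"
    using support_cyclic_walk[of walk_map "(s # y) @ x"] by simp
  then have "trail_word \<nu> rho s = steps_of rho (s # y) @ steps_of rho x"
    unfolding trail_word_def by (simp add: steps_of_def)
  then show ?thesis using trail_class_append[of "steps_of rho x" "steps_of rho (s # y)"] xy by simp
qed

text \<open>Exactly one of a side and its vertex-join partner occurs in the words. For a side that
  does not occur, the reversed word passes through it and gives the same trail.\<close>

lemma trails_eq: "trails \<nu> rho = (\<lambda>w. trail_class (steps_of rho w)) ` set fs"
proof (rule set_eqI, rule iffI)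
  fix t assume "t \<in> trails \<nu> rho"
  then obtain s where s: "s \<in> labels \<times> UNIV" and t: "t = trail_class (trail_word \<nu> rho s)"
    unfolding trails_def sides_def by auto
  show "t \<in> (\<lambda>w. trail_class (steps_of rho w)) ` set fs"
  proof (cases "s \<in> set (concat fs)")
    case True
    then obtain w where w: "w \<in> set fs" "s \<in> set w" by auto
    then show ?thesis using trail_word_of_word[OF word_in_state(1,2)[OF w(1)] w(2)] t by blast
  next
    case False
    then obtain w where w: "w \<in> set fs" "vertex_join \<nu> s \<in> set w" using half[OF s] by auto
    note ww = word_in_state[OF w(1)]
    let ?r = "map (vertex_join \<nu>) (rev w)"
    have "vertex_join \<nu> (vertex_join \<nu> s) \<in> set ?r" using w(2) by simp
    then have "s \<in> set ?r" by (simp only: join_join[OF s])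
    moreover have "distinct ?r"
      using ww(2,4) join_join by (auto simp: distinct_map intro!: inj_on_inverseI[of _ "vertex_join \<nu>"])
    ultimately have "trail_class (trail_word \<nu> rho s) = trail_class (steps_of rho ?r)"
      using trail_word_of_word[OF reverse_word(1)[OF ww(1,3,4)]] by blast
    then show ?thesis using reverse_word(2)[OF ww(1,3,4)] t w(1) by blast
  qed
next
  fix t assume "t \<in> (\<lambda>w. trail_class (steps_of rho w)) ` set fs"
  then obtain w where w: "w \<in> set fs" and t: "t = trail_class (steps_of rho w)" by blast
  note ww = word_in_state[OF w]
  have "hd w \<in> set w" using ww(3) by simp
  then show "t \<in> trails \<nu> rho"
    using trail_word_of_word[OF ww(1,2), of "hd w"] ww(4) t unfolding trails_def sides_def by blast
qed

text \<open>Trails form a set, so a product over trails equals the product over words only if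
  different words have different trails. Two words with the same trail would share a vertex-join,
  and each vertex-join is listed once.\<close>

lemma trail_class_inj: "inj_on (\<lambda>w. trail_class (steps_of rho w)) (set fs)"
proof (rule inj_onI)
  fix w w' assume w: "w \<in> set fs" "w' \<in> set fs"
    and eq: "trail_class (steps_of rho w) = trail_class (steps_of rho w')"
  have "step_label ` set (steps_of rho w) = step_label ` set (steps_of rho w')"
    using step_label_trail_class self_in_trail_class eq by metis
  then have "Some ` label_of ` set w = Some ` label_of ` set w'"
    using step_label_steps_of by metis
  then have lab: "label_of ` set w = label_of ` set w'" by (simp add: inj_image_eq_iff)
  note ww = word_in_state[OF w(1)] and ww' = word_in_state[OF w(2)]
  have h: "hd w \<in> set w" using ww(3) by simp
  then obtain s where s: "s \<in> set w'" "label_of (hd w) = label_of s" using lab by (metis imageE imageI)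
  have K: "hd w \<in> labels \<times> UNIV" "s \<in> labels \<times> UNIV" using h s ww(4) ww'(4) by auto
  have "s = hd w \<or> s = vertex_join \<nu> (hd w)" using label_of_eq[OF K s(2)] .
  moreover have "s \<noteq> vertex_join \<nu> (hd w)" using half[OF K(1)] h s(1) w by auto
  ultimately show "w = w'" using word_unique[OF w h] s by blast
qed

lemma distinct_words: "distinct fs"
  using st unfolding state_def by (simp add: distinct_concat_iff)
   (metis distinct_concat_iff distinct_removeAll removeAll_id)

text \<open>The equivalence class of a side consists of a word together with its reversal: the sides
  of the word and the other ends of their vertex-joins.\<close>

lemma card_boundary_cycles: "card (boundary_cycles \<nu> rho) = length fs"
proof -
  let ?R = "\<Union>s\<in>sides \<nu>. {(s, vertex_join \<nu> s), (s, glue rho s)}"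
  let ?h = "\<lambda>w. set w \<union> vertex_join \<nu> ` set w"
  have R: "(s, t) \<in> ?R \<longleftrightarrow> s \<in> labels \<times> UNIV \<and> (t = vertex_join \<nu> s \<or> t = glue rho s)" for s t
    by (auto simp: sides_def simp del: glue.simps)
  have cls: "?R\<^sup>* `` {s} = ?h w" if w: "w \<in> set fs" and s: "s \<in> ?h w" for w s
  proof
    note ww = word_in_state[OF w]
    have hK: "?h w \<subseteq> labels \<times> UNIV" using ww(4) join_in by blast
    have clo: "t' \<in> ?h w" if t: "t \<in> ?h w" and r: "(t, t') \<in> ?R" for t t'
    proof -
      have tK: "t \<in> labels \<times> UNIV" using t hK by blast
      from r consider "t' = vertex_join \<nu> t" | "t' = glue rho t" using R by blast
      then show ?thesis
      proof cases
        case 1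
        then show ?thesis using t ww(4) join_join by auto
      next
        case 2
        show ?thesis
        proof (cases "t \<in> set w")
          case True
          then obtain a where a: "a \<in> set w" "walk_map a = t" using cyclic_walk_pred[OF ww(1)] by blast
          then have "t' = vertex_join \<nu> a" using 2 glue_glue'[OF join_in, of a] ww(4) by auto
          then show ?thesis using a by blast
        next
          case False
          then obtain a where a: "a \<in> set w" "t = vertex_join \<nu> a" using t by blast
          then have "t' = walk_map a" using 2 by simp
          then show ?thesis using cyclic_walk_succ[OF ww(1) a(1)] by blast
        qed
      qed
    qed
    show "?R\<^sup>* `` {s} \<subseteq> ?h w"
    proof
      fix t assume "t \<in> ?R\<^sup>* `` {s}"
      then have "(s, t) \<in> ?R\<^sup>*" by simp
      then show "t \<in> ?h w" by (induction rule: rtrancl_induct) (use s clo in blast)+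
    qed
    have stepR: "(a, walk_map a) \<in> ?R\<^sup>*" and joinR: "(a, vertex_join \<nu> a) \<in> ?R\<^sup>*" if "a \<in> labels \<times> UNIV" for a
    proof -
      show "(a, vertex_join \<nu> a) \<in> ?R\<^sup>*" using that R by blast
      moreover have "(vertex_join \<nu> a, walk_map a) \<in> ?R" using R join_in[OF that] by simp
      ultimately show "(a, walk_map a) \<in> ?R\<^sup>*" by (rule rtrancl_into_rtrancl)
    qed
    have reach: "(a, b) \<in> ?R\<^sup>*" if ab: "a \<in> set w" "b \<in> set w" for a b
    proof -
      obtain x y where xy: "w = x @ a # y" using split_list[OF ab(1)] by blast
      \<comment> \<open>With the word rotated to start at \<open>a\<close>, every other side is
        reached by forward steps alone.\<close>
      have cw: "cyclic_walk walk_map ((a # y) @ x)" using cyclic_walk_append_commute ww(1) xy by blast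
      have "b \<in> set ((a # y) @ x)" using ab(2) xy by auto
      moreover have "set ((a # y) @ x) \<subseteq> labels \<times> UNIV" using ww(4) xy by auto
      moreover have "successively (\<lambda>a b. b = walk_map a) ((a # y) @ x)" using cw unfolding cyclic_walk_def by blast
      moreover have "successively (\<lambda>a b. b = walk_map a) (a # z) \<Longrightarrow> set (a # z) \<subseteq> labels \<times> UNIV \<Longrightarrow>
          b \<in> set (a # z) \<Longrightarrow> (a, b) \<in> ?R\<^sup>*" for z
      proof (induction z arbitrary: a)
        case (Cons c z)
        have ac: "c = walk_map a" using Cons.prems(1) by (simp del: o_apply)
        have "(a, c) \<in> ?R\<^sup>*" unfolding ac by (rule stepR) (use Cons.prems(2) in simp)
        show ?case
        proof (cases "b = a")
          case False
          then have "(c, b) \<in> ?R\<^sup>*" by (intro Cons.IH) (use Cons.prems in auto)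
          with \<open>(a, c) \<in> ?R\<^sup>*\<close> show ?thesis by (rule rtrancl_trans)
        qed simp
      qed simp
      ultimately show ?thesis by simp
    qed
    show "?h w \<subseteq> ?R\<^sup>* `` {s}"
    proof -
      obtain a where a: "a \<in> set w" "(s, a) \<in> ?R\<^sup>*"
      proof (cases "s \<in> set w")
        case False
        then obtain a where a: "a \<in> set w" "s = vertex_join \<nu> a" using s by blast
        then have aK: "a \<in> labels \<times> UNIV" using ww(4) by blast
        have "(s, a) \<in> ?R\<^sup>*" using joinR[OF join_in[OF aK]] unfolding join_join[OF aK] a(2) .
        then show ?thesis using that a(1) by blast
      qed (use that in blast)
      have sb: "(s, b) \<in> ?R\<^sup>*" if "b \<in> set w" for b
        using rtrancl_trans[OF a(2) reach[OF a(1) that]] .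
      have "(s, vertex_join \<nu> b) \<in> ?R\<^sup>*" if b: "b \<in> set w" for b
      proof -
        have "b \<in> labels \<times> UNIV" using ww(4) b by blast
        from rtrancl_trans[OF sb[OF b] joinR[OF this]] show ?thesis .
      qed
      with sb show ?thesis by blast
    qed
  qed
  have "boundary_cycles \<nu> rho = ?h ` set fs"
  proof (rule set_eqI, rule iffI)
    fix c assume "c \<in> boundary_cycles \<nu> rho"
    then obtain s where s: "s \<in> labels \<times> UNIV" "c = ?R\<^sup>* `` {s}"
      unfolding boundary_cycles_def quotient_def sides_def by auto
    have "s \<in> set (concat fs) \<or> vertex_join \<nu> s \<in> set (concat fs)" using half[OF s(1)] by blast
    then obtain w where w: "w \<in> set fs" "s \<in> set w \<or> vertex_join \<nu> s \<in> set w" by auto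
    then have "s \<in> ?h w" using join_join[OF s(1)] by (metis UnCI imageI)
    then show "c \<in> ?h ` set fs" using cls[OF w(1)] s(2) w(1) by blast
  next
    fix c assume "c \<in> ?h ` set fs"
    then obtain w where w: "w \<in> set fs" "c = ?h w" by blast
    have h: "hd w \<in> set w" using word_in_state(3)[OF w(1)] by simp
    then have "c = ?R\<^sup>* `` {hd w}" using cls[OF w(1), of "hd w"] w(2) by simp
    moreover have "hd w \<in> sides \<nu>" using word_in_state(4)[OF w(1)] h unfolding sides_def by blast
    ultimately show "c \<in> boundary_cycles \<nu> rho" unfolding boundary_cycles_def quotient_def by blast
  qed
  moreover have "inj_on ?h (set fs)"
  proof (rule inj_onI)
    fix w w' assume w: "w \<in> set fs" "w' \<in> set fs" and eq: "?h w = ?h w'"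
    have h: "hd w \<in> set w" using word_in_state(3)[OF w(1)] by simp
    have hK: "hd w \<in> labels \<times> UNIV" using word_in_state(4)[OF w(1)] h by blast
    have "hd w \<notin> vertex_join \<nu> ` set w'"
    proof
      assume "hd w \<in> vertex_join \<nu> ` set w'"
      then obtain a where a: "a \<in> set w'" "hd w = vertex_join \<nu> a" by blast
      then have "vertex_join \<nu> (hd w) = a" using join_join[of a] word_in_state(4)[OF w(2)] by auto
      then show False using half[OF hK] h a(1) w by auto
    qed
    then have "hd w \<in> set w'" using eq h by blast
    then show "w = w'" using word_unique[OF w h] by blast
  qed
  ultimately show ?thesis using distinct_words by (simp add: card_image distinct_card)
qed

end

end

context ribbon_traces
begin

text \<open>This makes the choice of a representative by \<open>SOME\<close> immaterial. Rotations
  are covered by cyclicity of \<open>tr\<close>, and reversal turns the product into its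
  adjoint.\<close>

lemma tr_word_prod_trail_class:
  assumes "w' \<in> trail_class w"
  shows "tr (word_prod adj A w') = tr (word_prod adj A w)"
proof -
  have rot: "tr (word_prod adj A (rotate i w)) = tr (word_prod adj A w)" for i w
    using word_prod_append[of adj A "drop (i mod length w) w" "take (i mod length w) w"]
      word_prod_append[of adj A "take (i mod length w) w" "drop (i mod length w) w"]
    by (simp add: rotate_drop_take tr_comm)
  have "step_factor adj A (flip s) = adj (step_factor adj A s)" for s
    by (cases s) (auto simp: adj_adj adj_one)
  then have "word_prod adj A (rev (map flip w)) = adj (word_prod adj A w)"
    by (induction w) (simp_all add: word_prod_append, simp_all add: word_prod_def adj_one adj_mult)
  then show ?thesis using assms rot tr_adj unfolding trail_class_def by auto
qed

lemma word_prod_steps_of: "word_prod adj A (steps_of \<rho> w) = val (\<lambda>_. mat 1) w"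
  by (induction w) (simp_all add: word_prod_def side_factor_def[symmetric] glue_step_def)

lemma tval_final_state:
  assumes p: "p \<in> pairings labels" and st: "state {} (glue (p, T)) fs"
  shows "tval (\<lambda>_. mat 1) fs = (\<Prod>t\<in>trails \<nu> (p, T). tr (word_prod adj A (SOME w. w \<in> t)))"
proof -
  have "tr (word_prod adj A (SOME w'. w' \<in> trail_class (steps_of (p, T) w))) = tr (val (\<lambda>_. mat 1) w)" for w
  proof -
    have "(SOME w'. w' \<in> trail_class (steps_of (p, T) w)) \<in> trail_class (steps_of (p, T) w)"
      using self_in_trail_class by (rule someI)
    from tr_word_prod_trail_class[OF this] show ?thesis by (simp add: word_prod_steps_of)
  qed
  then have "(\<Prod>t\<in>trails \<nu> (p, T). tr (word_prod adj A (SOME w. w \<in> t))) =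
      (\<Prod>w\<in>set fs. tr (val (\<lambda>_. mat 1) w))"
    unfolding trails_eq[OF p st] prod.reindex[OF trail_class_inj[OF p st]] by simp
  then show ?thesis
    unfolding tval_def by (simp add: prod.distinct_set_conv_list[OF distinct_words[OF p st]])
qed

text \<open>At the start the words are the vertices, at the end they are the boundary cycles, one
  per cycle. The exponent of \<open>v\<close> is the telescoped change in the number of
  words.\<close>

theorem pairing_trace_expansion:
  assumes p: "p \<in> pairings labels"
  shows "(\<Sum>b\<in>Pi\<^sub>E p (\<lambda>_. B). \<Prod>l<length \<nu>. tr (vertex_prod \<nu> (\<lambda>k. k) (\<lambda>k. b {k, partner p k}) A l)) =
    (\<Sum>T\<in>Pow p. u ^ card (p - T) * u' ^ card T *
       v powi (int (card (boundary_cycles \<nu> (p, T))) - int (length \<nu>)) *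
       (\<Prod>t\<in>trails \<nu> (p, T). tr (word_prod adj A (SOME w. w \<in> t))))"
proof -
  have U: "\<Union>p = labels" using pairingsD(1)[OF p] .
  have finp: "finite p" using U by (metis finite_atLeastAtMost finite_UnionD)
  have "\<forall>s\<in>set (concat vertex_words). snd s" unfolding concat_vertex_words by auto
  moreover have "state (\<Union>p) (glue (p, {})) vertex_words" unfolding U by (rule state_vertex_words)
  ultimately obtain fs where
    fs: "\<And>T. T \<subseteq> p \<Longrightarrow> u' \<noteq> 0 \<or> T = {} \<Longrightarrow> state {} (glue (p, T)) (fs T)"
    and sm: "(\<Sum>b\<in>Pi\<^sub>E p (\<lambda>_. B). tval (pair_val p p b) vertex_words) =
      (\<Sum>T\<in>Pow p. u ^ card (p - T) * u' ^ card T * v powi (int (length (fs T)) - int (length vertex_words)) *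
         tval (\<lambda>_. mat 1) (fs T))"
    using contraction_expansion[OF p finp, of "{}" vertex_words] by auto
  have "(\<Prod>l<length \<nu>. tr (vertex_prod \<nu> (\<lambda>k. k) (\<lambda>k. b {k, partner p k}) A l)) =
      tval (pair_val p p b) vertex_words" for b
  proof -
    have "tval (pair_val p p b) vertex_words = tval (\<lambda>k. b {k, partner p k}) vertex_words"
    proof (rule tval_cong)
      fix s assume "s \<in> set (concat vertex_words)"
      then have "s \<in> labels \<times> UNIV" unfolding concat_vertex_words by auto
      then have "fst (vertex_join \<nu> s) \<in> labels" using join_in by fastforce
      then show "pair_val p p b (fst (vertex_join \<nu> s)) =
          b {fst (vertex_join \<nu> s), partner p (fst (vertex_join \<nu> s))}"
        by (simp only: pair_val_def U if_True)
    qed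
    then show ?thesis by (simp add: tval_vertex_words)
  qed
  then have "(\<Sum>b\<in>Pi\<^sub>E p (\<lambda>_. B). \<Prod>l<length \<nu>. tr (vertex_prod \<nu> (\<lambda>k. k) (\<lambda>k. b {k, partner p k}) A l)) =
     (\<Sum>b\<in>Pi\<^sub>E p (\<lambda>_. B). tval (pair_val p p b) vertex_words)" by simp
  also note sm
  also have "(\<Sum>T\<in>Pow p. u ^ card (p - T) * u' ^ card T * v powi (int (length (fs T)) - int (length vertex_words)) *
         tval (\<lambda>_. mat 1) (fs T)) = (\<Sum>T\<in>Pow p. u ^ card (p - T) * u' ^ card T *
       v powi (int (card (boundary_cycles \<nu> (p, T))) - int (length \<nu>)) *
       (\<Prod>t\<in>trails \<nu> (p, T). tr (word_prod adj A (SOME w. w \<in> t))))"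
  proof (rule sum.cong[OF refl])
    fix T assume T: "T \<in> Pow p"
    show "u ^ card (p - T) * u' ^ card T * v powi (int (length (fs T)) - int (length vertex_words)) *
         tval (\<lambda>_. mat 1) (fs T) = u ^ card (p - T) * u' ^ card T *
       v powi (int (card (boundary_cycles \<nu> (p, T))) - int (length \<nu>)) *
       (\<Prod>t\<in>trails \<nu> (p, T). tr (word_prod adj A (SOME w. w \<in> t)))"
    proof (cases "u' \<noteq> 0 \<or> T = {}")
      case True
      then have s: "state {} (glue (p, T)) (fs T)" using fs T by blast
      show ?thesis
        by (simp add: card_boundary_cycles[OF p s] tval_final_state[OF p s] vertex_words_def)
    next
      case False
      \<comment> \<open>Here \<open>u' = 0\<close> while some pair is twisted, so both sides are
        zero whatever \<open>fs T\<close> may be.\<close>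
      then have "card T > 0" using T finp finite_subset[of T p] by (auto simp: card_gt_0_iff)
      then show ?thesis using False by simp
    qed
  qed
  finally show ?thesis .
qed

end

section \<open>Contraction identities for Hermitian matrices\<close>

definition orthonormal_basis_of :: "'a::euclidean_space set \<Rightarrow> 'a set \<Rightarrow> bool" where
  "orthonormal_basis_of S B \<longleftrightarrow> B \<subseteq> S \<and> pairwise orthogonal B \<and> (\<forall>b\<in>B. norm b = 1) \<and> span B = S"

lemma orthonormal_basis_finite: "orthonormal_basis_of S B \<Longrightarrow> finite B"
  unfolding orthonormal_basis_of_def
  by (metis independent_imp_finite norm_zero pairwise_orthogonal_independent zero_neq_one)

lemma orthonormal_inner:
  "orthonormal_basis_of S B \<Longrightarrow> b \<in> B \<Longrightarrow> c \<in> B \<Longrightarrow> inner b c = (if b = c then 1 else 0)"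
  unfolding orthonormal_basis_of_def pairwise_def orthogonal_def
  by (auto simp: norm_eq_1)

lemma orthonormal_expansion:
  assumes B: "orthonormal_basis_of S B" and z: "z \<in> S"
  shows "(\<Sum>b\<in>B. inner z b *\<^sub>R b) = z"
proof -
  note fin = orthonormal_basis_finite[OF B]
  have "z \<in> span B" using assms unfolding orthonormal_basis_of_def by simp
  then obtain c where c: "z = (\<Sum>b\<in>B. c b *\<^sub>R b)" unfolding span_finite[OF fin] by auto
  have "inner z b = c b" if "b \<in> B" for b
    unfolding c inner_sum_left using fin that
    by (simp add: orthonormal_inner[OF B _ that] if_distrib cong: if_cong)
  then show ?thesis using c by simp
qed

text \<open>Summing over an orthonormal basis computes the orthogonal projection. The contraction
  identities thus need only a formula \<open>P\<close> for the projection and hold for every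
  orthonormal basis.\<close>

lemma orthonormal_projection:
  assumes B: "orthonormal_basis_of S B" and P: "P \<in> S" "\<And>b. b \<in> S \<Longrightarrow> inner X b = inner P b"
  shows "(\<Sum>b\<in>B. inner X b *\<^sub>R b) = P"
proof -
  have "inner X b = inner P b" if "b \<in> B" for b
    using P(2) B that unfolding orthonormal_basis_of_def by auto
  then show ?thesis using orthonormal_expansion[OF B P(1)] by simp
qed

lemma trace_matrix_mult:
  "trace (X ** Y) = (\<Sum>i\<in>UNIV. \<Sum>j\<in>UNIV. X $ i $ j * Y $ j $ i)"
  by (simp add: trace_def matrix_matrix_mult_def)

lemma trace_four:
  "trace (X ** b ** Y ** c) =
    (\<Sum>i\<in>UNIV. \<Sum>l\<in>UNIV. \<Sum>k\<in>UNIV. \<Sum>j\<in>UNIV. X $ i $ j * b $ j $ k * Y $ k $ l * c $ l $ i)"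
  for X :: "'a::semiring_1 ^ 'n ^ 'n"
  by (simp add: trace_def matrix_matrix_mult_def sum_distrib_right)

lemma trace_comm_field: "trace (X ** Y) = trace (Y ** X)" for X :: "'a::comm_semiring_1 ^ 'n ^ 'n"
  unfolding trace_matrix_mult by (subst sum.swap) (simp add: mult.commute)

definition matrix_unit :: "'n \<Rightarrow> 'n \<Rightarrow> 'a::zero \<Rightarrow> 'a ^ 'n ^ 'n" where
  "matrix_unit k j a = (\<chi> r s. if r = k \<and> s = j then a else 0)"

lemma trace_matrix_unit: "trace (matrix_unit k j a ** b) = a * b $ j $ k" for a :: "'a::semiring_1"
proof -
  have "trace (matrix_unit k j a ** b) = (\<Sum>i\<in>UNIV. \<Sum>m\<in>UNIV. if i = k then (if m = j then a * b $ m $ i else 0) else 0)"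
    unfolding trace_matrix_mult matrix_unit_def by (intro sum.cong refl) auto
  also have "\<dots> = (\<Sum>i\<in>UNIV. if i = k then a * b $ j $ i else 0)"
    by (intro sum.cong refl) (auto simp: sum.delta)
  finally show ?thesis by (simp add: sum.delta)
qed

text \<open>The hypothesis is linear in \<open>X\<close>. Pairing it with the entries of
  \<open>Y\<close> gives the first identity, and inserting matrix units, which isolates single
  entries, gives the second.\<close>

lemma trace_contraction_from_kernel:
  fixes B :: "('a::field ^ 'n ^ 'n) set"
  assumes ker: "\<And>X i j. (\<Sum>b\<in>B. trace (X ** b) * b $ i $ j) = u * X $ i $ j + u' * X $ j $ i"
  shows "(\<Sum>b\<in>B. trace (X ** b) * trace (Y ** b)) = u * trace (X ** Y) + u' * trace (X ** transpose Y)"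
    and "(\<Sum>b\<in>B. trace (X ** b ** Y ** b)) = u * trace X * trace Y + u' * trace (X ** transpose Y)"
proof -
  have "(\<Sum>b\<in>B. trace (X ** b) * trace (Y ** b)) =
     (\<Sum>i\<in>UNIV. \<Sum>j\<in>UNIV. Y $ i $ j * (\<Sum>b\<in>B. trace (X ** b) * b $ j $ i))"
    unfolding trace_matrix_mult[of Y] sum_distrib_left
    by (subst sum.swap, rule sum.cong[OF refl], subst sum.swap, intro sum.cong refl) (simp add: mult_ac)
  also have "\<dots> = u * (\<Sum>i\<in>UNIV. \<Sum>j\<in>UNIV. Y $ i $ j * X $ j $ i) + u' * (\<Sum>i\<in>UNIV. \<Sum>j\<in>UNIV. X $ i $ j * Y $ i $ j)"
    unfolding ker by (simp add: sum_distrib_left sum.distrib algebra_simps)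
  finally have *: "(\<Sum>b\<in>B. trace (X ** b) * trace (Y ** b)) =
      u * (\<Sum>i\<in>UNIV. \<Sum>j\<in>UNIV. Y $ i $ j * X $ j $ i) + u' * (\<Sum>i\<in>UNIV. \<Sum>j\<in>UNIV. X $ i $ j * Y $ i $ j)" .
  show "(\<Sum>b\<in>B. trace (X ** b) * trace (Y ** b)) = u * trace (X ** Y) + u' * trace (X ** transpose Y)"
  proof -
    have "trace (X ** Y) = (\<Sum>i\<in>UNIV. \<Sum>j\<in>UNIV. Y $ i $ j * X $ j $ i)"
      "trace (X ** transpose Y) = (\<Sum>i\<in>UNIV. \<Sum>j\<in>UNIV. X $ i $ j * Y $ i $ j)"
      unfolding trace_comm_field[of X Y] by (simp_all add: trace_matrix_mult transpose_def)
    with * show ?thesis by simp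
  qed
  \<comment> \<open>With a matrix unit in place of \<open>X\<close> the hypothesis becomes the
    covariance of two matrix entries.\<close>
  have two: "(\<Sum>b\<in>B. b $ j $ k * b $ l $ i) = u * (if l = k \<and> i = j then 1 else 0) + u' * (if i = k \<and> l = j then 1 else 0)"
    for i j k l
    using ker[of "matrix_unit k j 1" l i] unfolding trace_matrix_unit mult_1_left
    by (simp only: matrix_unit_def vec_lambda_beta)
  have "(\<Sum>b\<in>B. trace (X ** b ** Y ** b)) =
    (\<Sum>i\<in>UNIV. \<Sum>l\<in>UNIV. \<Sum>k\<in>UNIV. \<Sum>j\<in>UNIV. X $ i $ j * Y $ k $ l * (\<Sum>b\<in>B. b $ j $ k * b $ l $ i))"
    unfolding trace_four sum_distrib_left
    apply (subst sum.swap, rule sum.cong[OF refl])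
    apply (subst sum.swap, rule sum.cong[OF refl])
    apply (subst sum.swap, rule sum.cong[OF refl])
    apply (subst sum.swap, rule sum.cong[OF refl])
    by (simp add: mult_ac)
  also have "\<dots> = (\<Sum>i\<in>UNIV. \<Sum>l\<in>UNIV. \<Sum>k\<in>UNIV. \<Sum>j\<in>UNIV. u * (if j = i then (if k = l then X $ i $ j * Y $ k $ l else 0) else 0)) +
     (\<Sum>i\<in>UNIV. \<Sum>l\<in>UNIV. \<Sum>k\<in>UNIV. \<Sum>j\<in>UNIV. u' * (if j = l then (if k = i then X $ i $ j * Y $ k $ l else 0) else 0))"
    unfolding two sum.distrib[symmetric] by (intro sum.cong refl) (auto simp: algebra_simps)
  also have "\<dots> = u * (\<Sum>i\<in>UNIV. \<Sum>l\<in>UNIV. X $ i $ i * Y $ l $ l) + u' * (\<Sum>i\<in>UNIV. \<Sum>l\<in>UNIV. X $ i $ l * Y $ i $ l)"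
    by (simp add: sum_distrib_left[symmetric] sum.delta)
  finally show "(\<Sum>b\<in>B. trace (X ** b ** Y ** b)) = u * trace X * trace Y + u' * trace (X ** transpose Y)"
    by (simp add: trace_matrix_mult transpose_def) (simp add: trace_def sum_product mult.assoc)
qed

lemma inner_matrix: "inner X Y = (\<Sum>i\<in>UNIV. \<Sum>j\<in>UNIV. inner (X $ i $ j) (Y $ i $ j))"
  by (simp add: inner_vec_def)

text \<open>For complex \<open>X\<close> the real and the imaginary part of
  \<open>trace (X ** b)\<close> are the real inner products of \<open>b\<close> with the conjugate
  transpose of \<open>X\<close> and with \<open>\<i>\<close> times it. Each part then yields one
  projection onto \<open>S\<close>.\<close>

lemma trace_hermitian_kernel:
  fixes B :: "(complex ^ 'n ^ 'n) set"
  assumes B: "orthonormal_basis_of S B"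
    and herm: "\<And>b i j. b \<in> S \<Longrightarrow> b $ i $ j = cnj (b $ j $ i)"
    and P: "\<And>X. P X \<in> S" "\<And>X b. b \<in> S \<Longrightarrow> inner X b = inner (P X) b"
  shows "(\<Sum>b\<in>B. trace (X ** b) * b $ i $ j) =
    P (\<chi> r s. cnj (X $ s $ r)) $ i $ j + \<i> * P (\<chi> r s. \<i> * cnj (X $ s $ r)) $ i $ j"
proof -
  let ?X1 = "(\<chi> r s. cnj (X $ s $ r)) :: complex ^ 'n ^ 'n"
  let ?X2 = "(\<chi> r s. \<i> * cnj (X $ s $ r)) :: complex ^ 'n ^ 'n"
  have tr: "trace (X ** b) = of_real (inner ?X1 b) + \<i> * of_real (inner ?X2 b)" if "b \<in> B" for b
  proof (rule complex_eqI)
    have "Re (trace (X ** b)) = inner ?X1 b"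
      unfolding trace_matrix_mult inner_matrix
      by (subst sum.swap) (simp add: inner_complex_def)
    then show "Re (trace (X ** b)) = Re (of_real (inner ?X1 b) + \<i> * of_real (inner ?X2 b))" by simp
    have "Im (trace (X ** b)) = inner ?X2 b"
      unfolding trace_matrix_mult inner_matrix
      by (subst sum.swap) (simp add: inner_complex_def add.commute)
    then show "Im (trace (X ** b)) = Im (of_real (inner ?X1 b) + \<i> * of_real (inner ?X2 b))" by simp
  qed
  have comp: "(\<Sum>b\<in>B. of_real (inner Z b) * b $ i $ j) = P Z $ i $ j" for Z
  proof -
    have "(\<Sum>b\<in>B. inner Z b *\<^sub>R b) $ i $ j = P Z $ i $ j"
      by (subst orthonormal_projection[OF B P(1) P(2)]) auto
    then show ?thesis by (simp add: scaleR_conv_of_real[where 'a=complex])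
  qed
  have "(\<Sum>b\<in>B. trace (X ** b) * b $ i $ j) =
    (\<Sum>b\<in>B. of_real (inner ?X1 b) * b $ i $ j) + \<i> * (\<Sum>b\<in>B. of_real (inner ?X2 b) * b $ i $ j)"
    unfolding sum_distrib_left sum.distrib[symmetric]
    by (intro sum.cong refl) (simp only: tr distrib_right mult.assoc)
  then show ?thesis unfolding comp .
qed

lemma herm_space_1_iff: "M \<in> herm_space 1 \<longleftrightarrow> (\<forall>i j. M $ i $ j \<in> \<real>) \<and> transpose M = M"
  unfolding herm_space_def transpose_def vec_eq_iff by (simp only: simp_thms if_True mem_Collect_eq vec_lambda_beta) metis

lemma herm_space_2_iff: "M \<in> herm_space 2 \<longleftrightarrow> (\<forall>i j. M $ i $ j = cnj (M $ j $ i))"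
  unfolding herm_space_def by (subst if_not_P) (simp, simp only: mem_Collect_eq)

lemma qherm_space_iff: "M \<in> qherm_space \<longleftrightarrow> qadjoint M = M"
  unfolding qherm_space_def qadjoint_def vec_eq_iff by (simp only: mem_Collect_eq vec_lambda_beta) metis

text \<open>The projection is the Hermitian part. The Hermitian part of the conjugate transpose and
  \<open>\<i>\<close> times the Hermitian part of its multiple by \<open>\<i>\<close> add up to
  \<open>X\<close> itself, so no transposed term survives; this is the origin of
  \<open>u' = 0\<close>.\<close>

lemma herm_space_2_kernel:
  fixes B :: "(complex ^ 'n ^ 'n) set"
  assumes B: "orthonormal_basis_of (herm_space 2) B"
  shows "(\<Sum>b\<in>B. trace (X ** b) * b $ i $ j) = X $ i $ j"
proof -
  define P :: "complex ^ 'n ^ 'n \<Rightarrow> complex ^ 'n ^ 'n"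
    where "P X = (\<chi> r s. (X $ r $ s + cnj (X $ s $ r)) / 2)" for X
  have Pin: "P X \<in> herm_space 2" for X by (simp add: P_def herm_space_def add.commute)
  have Pinner: "inner X b = inner (P X) b" if b: "b \<in> herm_space 2" for X b
  proof -
    have "inner (P X) b = (inner X b + (\<Sum>i\<in>UNIV. \<Sum>j\<in>UNIV. inner (cnj (X $ j $ i)) (b $ i $ j))) / 2"
      unfolding P_def inner_matrix sum.distrib[symmetric] sum_divide_distrib
      by (intro sum.cong refl) (simp add: inner_complex_def field_simps)
    also have "(\<Sum>i\<in>UNIV. \<Sum>j\<in>UNIV. inner (cnj (X $ j $ i)) (b $ i $ j)) = inner X b"
    proof -
      have "b $ i $ j = cnj (b $ j $ i)" for i j using b unfolding herm_space_2_iff by blast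
      moreover have "inner (cnj z) (cnj w) = inner z w" for z w by (simp add: inner_complex_def)
      ultimately have "inner (cnj (X $ j $ i)) (b $ i $ j) = inner (X $ j $ i) (b $ j $ i)" for i j
        by metis
      then have "(\<Sum>i\<in>UNIV. \<Sum>j\<in>UNIV. inner (cnj (X $ j $ i)) (b $ i $ j)) =
          (\<Sum>i\<in>UNIV. \<Sum>j\<in>UNIV. inner (X $ j $ i) (b $ j $ i))" by simp
      also have "\<dots> = inner X b" unfolding inner_matrix by (rule sum.swap)
      finally show ?thesis .
    qed
    finally show ?thesis by simp
  qed
  have herm: "b $ i $ j = cnj (b $ j $ i)" if "b \<in> herm_space 2" for b :: "complex ^ 'n ^ 'n" and i j
    using that unfolding herm_space_2_iff by blast
  show ?thesis
    by (rule trace_hermitian_kernel[OF B, of P, THEN trans]; (erule herm Pinner | rule Pin)?)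
      (simp add: P_def complex_eq_iff field_simps)
qed

text \<open>The projection onto real symmetric matrices takes real parts and symmetrises. The
  symmetrisation leaves both \<open>X\<close> and its transpose, each with weight one half.\<close>

lemma herm_space_1_kernel:
  fixes B :: "(complex ^ 'n ^ 'n) set"
  assumes B: "orthonormal_basis_of (herm_space 1) B"
  shows "(\<Sum>b\<in>B. trace (X ** b) * b $ i $ j) = 1/2 * X $ i $ j + 1/2 * X $ j $ i"
proof -
  define P :: "complex ^ 'n ^ 'n \<Rightarrow> complex ^ 'n ^ 'n"
    where "P X = (\<chi> r s. of_real ((Re (X $ r $ s) + Re (X $ s $ r)) / 2))" for X
  have hs: "b $ i $ j = of_real (Re (b $ i $ j))" "b $ i $ j = b $ j $ i" if "b \<in> herm_space 1" for b i j
    using that unfolding herm_space_1_iff transpose_def vec_eq_iff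
    by (metis of_real_Re, metis vec_lambda_beta)
  have Pin: "P X \<in> herm_space 1" for X by (simp add: P_def herm_space_def add.commute)
  have Pinner: "inner X b = inner (P X) b" if b: "b \<in> herm_space 1" for X b
  proof -
    have im: "Im (b $ i $ j) = 0" and sy: "b $ i $ j = b $ j $ i" for i j
      using hs[OF b] by (metis Im_complex_of_real, metis)
    have "inner (P X) b = (inner X b + (\<Sum>i\<in>UNIV. \<Sum>j\<in>UNIV. Re (X $ j $ i) * Re (b $ j $ i))) / 2"
      unfolding P_def inner_matrix sum.distrib[symmetric] sum_divide_distrib
    proof (intro sum.cong refl)
      fix i j
      have "Re (b $ j $ i) = Re (b $ i $ j)" by (simp only: sy[of j i])
      then show "inner ((\<chi> r s. complex_of_real ((Re (X $ r $ s) + Re (X $ s $ r)) / 2)) $ i $ j) (b $ i $ j) =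
          (inner (X $ i $ j) (b $ i $ j) + Re (X $ j $ i) * Re (b $ j $ i)) / 2"
        by (simp add: inner_complex_def im field_simps)
    qed
    also have "(\<Sum>i\<in>UNIV. \<Sum>j\<in>UNIV. Re (X $ j $ i) * Re (b $ j $ i)) = inner X b"
      unfolding inner_matrix by (subst sum.swap) (simp add: inner_complex_def im)
    finally show ?thesis by simp
  qed
  have herm: "b $ i $ j = cnj (b $ j $ i)" if "b \<in> herm_space 1" for b :: "complex ^ 'n ^ 'n" and i j
  proof -
    have "cnj (b $ j $ i) = b $ j $ i"
      using that unfolding herm_space_1_iff by (simp only: Reals_cnj_iff)
    then show ?thesis by (simp only: hs(2)[OF that, of i j])
  qed
  show ?thesis
    by (rule trace_hermitian_kernel[OF B, of P, THEN trans]; (erule herm Pinner | rule Pin)?)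
      (simp add: P_def complex_eq_iff field_simps)
qed

section \<open>Quaternionic Hermitian matrices\<close>

lemma quat_mult_sel:
  "qRe (a * b) = qRe a * qRe b - qIm1 a * qIm1 b - qIm2 a * qIm2 b - qIm3 a * qIm3 b"
  "qIm1 (a * b) = qRe a * qIm1 b + qIm1 a * qRe b + qIm2 a * qIm3 b - qIm3 a * qIm2 b"
  "qIm2 (a * b) = qRe a * qIm2 b - qIm1 a * qIm3 b + qIm2 a * qRe b + qIm3 a * qIm1 b"
  "qIm3 (a * b) = qRe a * qIm3 b + qIm1 a * qIm2 b - qIm2 a * qIm1 b + qIm3 a * qRe b"
  by (simp_all add: times_quat_def)

lemma quat_cnj_sel [simp]:
  "qRe (qcnj a) = qRe a" "qIm1 (qcnj a) = - qIm1 a" "qIm2 (qcnj a) = - qIm2 a" "qIm3 (qcnj a) = - qIm3 a"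
  by (simp_all add: qcnj_def)

lemma quat_scaleR_sel [simp]:
  "qRe (r *\<^sub>R a) = r * qRe a" "qIm1 (r *\<^sub>R a) = r * qIm1 a"
  "qIm2 (r *\<^sub>R a) = r * qIm2 a" "qIm3 (r *\<^sub>R a) = r * qIm3 a"
  by (simp_all add: scaleR_quat_def)

lemma qcnj_simps [simp]: "qcnj (qcnj a) = a" "qcnj (a * b) = qcnj b * qcnj a" "qcnj (a + b) = qcnj a + qcnj b"
  "qcnj 0 = 0" "qcnj 1 = 1"
  by (simp_all add: quat_eq_iff quat_mult_sel)

lemma qRe_sum: "qRe (sum f A) = (\<Sum>x\<in>A. qRe (f x))"
  by (induction A rule: infinite_finite_induct) auto

lemma qcnj_sum: "qcnj (sum f A) = (\<Sum>x\<in>A. qcnj (f x))"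
  by (induction A rule: infinite_finite_induct) auto

text \<open>Quaternions do not commute, but the real part of a product is symmetric; this is why
  only the real part of the trace is cyclic.\<close>

lemma qRe_mult_commute: "qRe (a * b) = qRe (b * a)"
  by (simp add: quat_mult_sel)

lemma qRe_trace_mult:
  "qRe (trace (X ** Y)) = (\<Sum>i\<in>UNIV. \<Sum>j\<in>UNIV. qRe (X $ i $ j * Y $ j $ i))"
  unfolding trace_matrix_mult qRe_sum ..

lemma qRe_trace_commute: "qRe (trace (X ** Y)) = qRe (trace (Y ** X))"
  unfolding qRe_trace_mult by (subst sum.swap) (simp only: qRe_mult_commute)

lemma qadjoint_mult: "qadjoint (X ** Y) = qadjoint Y ** qadjoint X"
  by (simp add: qadjoint_def matrix_matrix_mult_def vec_eq_iff qcnj_sum)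

lemma qadjoint_one: "qadjoint (mat 1) = mat 1"
  by (auto simp: qadjoint_def mat_def vec_eq_iff)

lemma qadjoint_qadjoint: "qadjoint (qadjoint X) = X"
  by (simp add: qadjoint_def vec_eq_iff)

lemma qRe_trace_qadjoint: "qRe (trace (qadjoint X)) = qRe (trace X)"
  by (simp add: trace_def qadjoint_def qRe_sum)

lemma qRe_trace_inner: "qRe (trace (X ** b)) = inner (qadjoint X) b"
  unfolding qRe_trace_mult inner_matrix
  by (subst sum.swap) (simp add: qadjoint_def inner_quat_def quat_mult_sel)

lemma qherm_kernel:
  fixes B :: "(quat ^ 'n ^ 'n) set"
  assumes B: "orthonormal_basis_of qherm_space B"
  shows "(\<Sum>b\<in>B. qRe (trace (X ** b)) *\<^sub>R b) = (1/2) *\<^sub>R (X + qadjoint X)"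
  unfolding qRe_trace_inner
proof (rule orthonormal_projection[OF B])
  show "(1/2) *\<^sub>R (X + qadjoint X) \<in> qherm_space"
    unfolding qherm_space_iff by (simp add: qadjoint_def vec_eq_iff quat_eq_iff field_simps)
  fix b :: "quat ^ 'n ^ 'n" assume "b \<in> qherm_space"
  then have "qadjoint b = b" unfolding qherm_space_iff .
  moreover have "inner (qadjoint X) (qadjoint b) = inner X b"
    unfolding inner_matrix by (subst sum.swap) (simp add: qadjoint_def inner_quat_def)
  ultimately have "inner (qadjoint X) b = inner X b" by simp
  then show "inner (qadjoint X) b = inner ((1/2) *\<^sub>R (X + qadjoint X)) b"
    by (simp add: inner_add_left)
qed

lemma qRe_trace_scaleR_sum:
  fixes Y :: "quat ^ 'n ^ 'n"
  shows
  "(\<Sum>b\<in>B. f b * qRe (trace (Y ** b))) = qRe (trace (Y ** (\<Sum>b\<in>B. f b *\<^sub>R b)))"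
proof -
  have "qRe (trace (Y ** (\<Sum>b\<in>B. f b *\<^sub>R b))) = inner (qadjoint Y) (\<Sum>b\<in>B. f b *\<^sub>R b)"
    by (rule qRe_trace_inner)
  then show ?thesis by (simp add: inner_sum_right qRe_trace_inner)
qed

text \<open>Summed over 1, i, j, k, the products \<open>qcnj e * q * e\<close> give four times the
  real part of \<open>q\<close>, and the products \<open>e * q * e\<close> give minus two times its
  conjugate. Halved, these are the constants 2 and -1 of the splitting identity.\<close>

lemma quat_basis_sums:
  fixes q :: quat
  shows "(\<Sum>e\<in>Basis. qRe (p * qcnj e * q * e)) = 4 * qRe p * qRe q"
    and "(\<Sum>e\<in>Basis. qRe (p * e * q * e)) = - 2 * qRe (p * qcnj q)"
  by (simp_all add: Basis_quat_def quat_mult_sel algebra_simps)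

text \<open>Inserting the coordinates of \<open>w\<close> turns one of two noncommuting occurrences
  of a basis matrix into a real number, which can be moved next to the other occurrence.\<close>

lemma quat_expand_right:
  fixes a w :: quat
  shows "qRe (a * w) = (\<Sum>e\<in>Basis. qRe (a * e) * qRe (qcnj e * w))"
  by (simp add: Basis_quat_def quat_mult_sel algebra_simps)

lemma qherm_contractions:
  fixes B :: "(quat ^ 'n ^ 'n) set"
  assumes B: "orthonormal_basis_of qherm_space B"
  shows "(\<Sum>b\<in>B. qRe (trace (X ** b)) * qRe (trace (Y ** b))) =
      1/2 * qRe (trace (X ** Y)) + 1/2 * qRe (trace (X ** qadjoint Y))"
    and "(\<Sum>b\<in>B. qRe (trace (X ** b ** Y ** b))) =
      2 * qRe (trace X) * qRe (trace Y) - qRe (trace (X ** qadjoint Y))"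
proof -
  have "qRe (trace (Y ** qadjoint X)) = qRe (trace (X ** qadjoint Y))"
    using qRe_trace_qadjoint[of "Y ** qadjoint X"] by (simp add: qadjoint_mult qadjoint_qadjoint)
  moreover have "qRe (trace (Y ** ((1/2) *\<^sub>R (X + qadjoint X)))) =
      1/2 * (qRe (trace (Y ** X)) + qRe (trace (Y ** qadjoint X)))"
    by (simp add: qRe_trace_inner inner_add_right)
  ultimately show "(\<Sum>b\<in>B. qRe (trace (X ** b)) * qRe (trace (Y ** b))) =
      1/2 * qRe (trace (X ** Y)) + 1/2 * qRe (trace (X ** qadjoint Y))"
    by (simp add: qRe_trace_scaleR_sum qherm_kernel[OF B] qRe_trace_commute[of Y X])
  \<comment> \<open>The real number \<open>qRe (qcnj e * q)\<close> is the coordinate of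
    \<open>q\<close> along \<open>e\<close>, so this is the covariance of one coordinate of an entry
    with another full entry.\<close>
  have two: "(\<Sum>b\<in>B. qRe (qcnj e * b $ l $ i) *\<^sub>R b $ j $ k) =
     (1/2) *\<^sub>R ((if j = i \<and> k = l then qcnj e else 0) + (if k = i \<and> j = l then e else 0))" for e i j k l
  proof -
    have "(\<Sum>b\<in>B. qRe (trace (matrix_unit i l (qcnj e) ** b)) *\<^sub>R b) $ j $ k =
       ((1/2) *\<^sub>R (matrix_unit i l (qcnj e) + qadjoint (matrix_unit i l (qcnj e)))) $ j $ k"
      by (rule arg_cong[OF qherm_kernel[OF B], of "\<lambda>M. M $ j $ k"])
    moreover have "qcnj (if k = i \<and> j = l then qcnj e else 0) = (if k = i \<and> j = l then e else 0)" by simp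
    ultimately show ?thesis
      by (simp only: trace_matrix_unit sum_component vector_scaleR_component vector_add_component)
        (simp only: matrix_unit_def qadjoint_def vec_lambda_beta)
  qed
  have one: "(\<Sum>b\<in>B. qRe (X $ i $ j * b $ j $ k * Y $ k $ l * b $ l $ i)) =
     (if j = i then if k = l then 2 * qRe (X $ i $ j) * qRe (Y $ k $ l) else 0 else 0) -
     (if j = l then if k = i then qRe (X $ i $ j * qcnj (Y $ k $ l)) else 0 else 0)" for i j k l
  proof -
    have "(\<Sum>b\<in>B. qRe (X $ i $ j * b $ j $ k * Y $ k $ l * b $ l $ i)) =
      (\<Sum>e\<in>Basis. \<Sum>b\<in>B. qRe (X $ i $ j * (qRe (qcnj e * b $ l $ i) *\<^sub>R b $ j $ k) * Y $ k $ l * e))"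
    proof (subst sum.swap, rule sum.cong[OF refl])
      fix b
      show "qRe (X $ i $ j * b $ j $ k * Y $ k $ l * b $ l $ i) =
        (\<Sum>e\<in>Basis. qRe (X $ i $ j * (qRe (qcnj e * b $ l $ i) *\<^sub>R b $ j $ k) * Y $ k $ l * e))"
        unfolding quat_expand_right[of "X $ i $ j * b $ j $ k * Y $ k $ l" "b $ l $ i"]
        by (intro sum.cong refl) (simp only: mult_scaleR_left mult_scaleR_right quat_scaleR_sel mult.commute)
    qed
    also have "\<dots> = (\<Sum>e\<in>Basis. qRe (X $ i $ j * (\<Sum>b\<in>B. qRe (qcnj e * b $ l $ i) *\<^sub>R b $ j $ k) * Y $ k $ l * e))"
    proof (rule sum.cong[OF refl])
      have "qRe (x * (\<Sum>b\<in>B. f b) * y * e) = (\<Sum>b\<in>B. qRe (x * f b * y * e))"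
        for x y e :: quat and f :: "quat ^ 'n ^ 'n \<Rightarrow> quat"
        by (simp only: sum_distrib_left sum_distrib_right qRe_sum)
      then show "(\<Sum>b\<in>B. qRe (X $ i $ j * (qRe (qcnj e * b $ l $ i) *\<^sub>R b $ j $ k) * Y $ k $ l * e)) =
        qRe (X $ i $ j * (\<Sum>b\<in>B. qRe (qcnj e * b $ l $ i) *\<^sub>R b $ j $ k) * Y $ k $ l * e)" for e by simp
    qed
    also have "\<dots> = 1/2 * (if j = i \<and> k = l then \<Sum>e\<in>Basis. qRe (X $ i $ j * qcnj e * Y $ k $ l * e) else 0) +
        1/2 * (if k = i \<and> j = l then \<Sum>e\<in>Basis. qRe (X $ i $ j * e * Y $ k $ l * e) else 0)"
    proof -
      have a: "qRe (x * ((1/2) *\<^sub>R ((if P then z else 0) + (if R then z' else 0))) * y * e) =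
        1/2 * (if P then qRe (x * z * y * e) else 0) + 1/2 * (if R then qRe (x * z' * y * e) else 0)"
        for x y z z' e :: quat and P R
        by (cases P; cases R) (simp_all add: distrib_left distrib_right)
      have b: "(\<Sum>e\<in>Basis. if P then h e else 0) = (if P then \<Sum>e\<in>Basis. h e else 0)" for P and h :: "quat \<Rightarrow> real"
        by (cases P) simp_all
      show ?thesis unfolding two a sum.distrib b[symmetric] sum_distrib_left ..
    qed
    finally show ?thesis unfolding quat_basis_sums by auto
  qed
  have "(\<Sum>b\<in>B. qRe (trace (X ** b ** Y ** b))) =
    (\<Sum>i\<in>UNIV. \<Sum>l\<in>UNIV. \<Sum>k\<in>UNIV. \<Sum>j\<in>UNIV. \<Sum>b\<in>B. qRe (X $ i $ j * b $ j $ k * Y $ k $ l * b $ l $ i))"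
    unfolding trace_four qRe_sum
    apply (subst sum.swap, rule sum.cong[OF refl])
    apply (subst sum.swap, rule sum.cong[OF refl])
    apply (subst sum.swap, rule sum.cong[OF refl])
    by (rule sum.swap)
  also have "\<dots> = (\<Sum>i\<in>UNIV. \<Sum>l\<in>UNIV. 2 * qRe (X $ i $ i) * qRe (Y $ l $ l)) -
      (\<Sum>i\<in>UNIV. \<Sum>l\<in>UNIV. qRe (X $ i $ l * qcnj (Y $ i $ l)))"
    unfolding one sum_subtractf by (simp add: sum.delta)
  also have "(\<Sum>i\<in>UNIV. \<Sum>l\<in>UNIV. 2 * qRe (X $ i $ i) * qRe (Y $ l $ l)) = 2 * qRe (trace X) * qRe (trace Y)"
    unfolding trace_def qRe_sum mult.assoc sum_product by (simp only: sum_distrib_left)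
  also have "(\<Sum>i\<in>UNIV. \<Sum>l\<in>UNIV. qRe (X $ i $ l * qcnj (Y $ i $ l))) = qRe (trace (X ** qadjoint Y))"
    unfolding qRe_trace_mult by (simp add: qadjoint_def)
  finally show "(\<Sum>b\<in>B. qRe (trace (X ** b ** Y ** b))) =
      2 * qRe (trace X) * qRe (trace Y) - qRe (trace (X ** qadjoint Y))" .
qed

lemma trace_algebra_herm_1:
  fixes B :: "(complex ^ 'n ^ 'n) set"
  assumes B: "orthonormal_basis_of (herm_space 1) B"
  shows "trace_algebra trace transpose B (1/2) (1/2) 1"
proof
  show "transpose b = b" if "b \<in> B" for b
    using B that herm_space_1_iff unfolding orthonormal_basis_of_def by blast
  note c = trace_contraction_from_kernel[OF herm_space_1_kernel[OF B]]
  show "(\<Sum>b\<in>B. trace (X ** b) * trace (Y ** b)) = 1 / 2 / 1 * trace (X ** Y) + 1 / 2 / 1 * trace (X ** transpose Y)" for X Y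
    by (simp add: c(1))
  show "(\<Sum>b\<in>B. trace (X ** b ** Y ** b)) = 1 / 2 * 1 * trace X * trace Y + 1 / 2 * trace (X ** transpose Y)" for X Y
    by (simp add: c(2))
  show "trace (X ** Y) = trace (Y ** X)" "transpose (X ** Y) = transpose Y ** transpose X" for X Y :: "complex ^ 'n ^ 'n"
    by (rule trace_comm_field, rule matrix_transpose_mul)
  show "trace (transpose X) = trace X" for X :: "complex ^ 'n ^ 'n" by (simp add: trace_def transpose_def)
qed (simp_all add: orthonormal_basis_finite[OF B] transpose_mat)

text \<open>No transposed term occurs, so \<open>u' = 0\<close>. That removes the twisted pairs and
  also releases the basis elements from being symmetric.\<close>

lemma trace_algebra_herm_2:
  fixes B :: "(complex ^ 'n ^ 'n) set"
  assumes B: "orthonormal_basis_of (herm_space 2) B"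
  shows "trace_algebra trace transpose B 1 0 1"
proof
  have k: "(\<Sum>b\<in>B. trace (X ** b) * b $ i $ j) = 1 * X $ i $ j + 0 * X $ j $ i" for X i j
    using herm_space_2_kernel[OF B] by simp
  note c = trace_contraction_from_kernel[OF k]
  show "(\<Sum>b\<in>B. trace (X ** b) * trace (Y ** b)) = 1 / 1 * trace (X ** Y) + 0 / 1 * trace (X ** transpose Y)" for X Y
    by (simp add: c(1))
  show "(\<Sum>b\<in>B. trace (X ** b ** Y ** b)) = 1 * 1 * trace X * trace Y + 0 * trace (X ** transpose Y)" for X Y
    by (simp add: c(2))
  show "trace (X ** Y) = trace (Y ** X)" "transpose (X ** Y) = transpose Y ** transpose X" for X Y :: "complex ^ 'n ^ 'n"
    by (rule trace_comm_field, rule matrix_transpose_mul)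
  show "trace (transpose X) = trace X" for X :: "complex ^ 'n ^ 'n" by (simp add: trace_def transpose_def)
qed (simp_all add: orthonormal_basis_finite[OF B] transpose_mat)

text \<open>The merging identity requires \<open>u / v = u' / v = 1/2\<close>, the splitting
  identity \<open>u * v = 2\<close> and \<open>u' = - 1\<close>; the signs are forced by these
  equations.\<close>

lemma trace_algebra_qherm:
  fixes B :: "(quat ^ 'n ^ 'n) set"
  assumes B: "orthonormal_basis_of qherm_space B"
  shows "trace_algebra (\<lambda>M. qRe (trace M)) qadjoint B (- 1) (- 1) (- 2)"
proof
  show "qadjoint b = b" if "b \<in> B" for b
    using B that qherm_space_iff unfolding orthonormal_basis_of_def by blast
  show "(\<Sum>b\<in>B. qRe (trace (X ** b)) * qRe (trace (Y ** b))) =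
      - 1 / - 2 * qRe (trace (X ** Y)) + - 1 / - 2 * qRe (trace (X ** qadjoint Y))" for X Y
    unfolding qherm_contractions(1)[OF B] by simp
  show "(\<Sum>b\<in>B. qRe (trace (X ** b ** Y ** b))) =
      - 1 * - 2 * qRe (trace X) * qRe (trace Y) + - 1 * qRe (trace (X ** qadjoint Y))" for X Y
    unfolding qherm_contractions(2)[OF B] by simp
qed (fact qRe_trace_commute qRe_trace_qadjoint qadjoint_mult qadjoint_one qadjoint_qadjoint
    orthonormal_basis_finite[OF B] | simp)+

text \<open>With the quadratic function equal to the squared norm, the energy of the field becomes a
  sum over orthonormal coordinates.\<close>

lemma herm_space_norm:
  assumes "M \<in> herm_space 1 \<or> M \<in> herm_space 2"
  shows "tr_sq M = inner M M"
proof -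
  have "Re (M $ i $ j * M $ j $ i) = inner (M $ i $ j) (M $ i $ j)" for i j
  proof -
    have "M $ j $ i = cnj (M $ i $ j)"
      using assms
    proof
      assume M: "M \<in> herm_space 1"
      note m = M[unfolded herm_space_1_iff]
      have t: "transpose M = M" by (rule m[THEN conjunct2])
      have "M $ j $ i = transpose M $ i $ j" by (simp add: transpose_def)
      also have "\<dots> = M $ i $ j" unfolding t ..
      finally have "M $ j $ i = M $ i $ j" .
      moreover have "M $ i $ j \<in> \<real>" by (rule m[THEN conjunct1, rule_format])
      ultimately show ?thesis by (simp add: Reals_cnj_iff)
    qed (unfold herm_space_2_iff, erule allE, erule allE, assumption)
    then show ?thesis by (simp add: inner_complex_def)
  qed
  then show ?thesis unfolding tr_sq_def trace_matrix_mult inner_matrix by simp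
qed

lemma qherm_space_norm:
  assumes "M \<in> qherm_space"
  shows "qtr_sq M = inner M M"
proof -
  have "qadjoint M = M" using assms unfolding qherm_space_iff .
  then show ?thesis unfolding qtr_sq_def qRe_trace_inner by simp
qed

lemma subspace_herm_space: "subspace (herm_space \<beta> :: (complex ^ 'n ^ 'n) set)"
proof (cases "\<beta> = 1")
  case True
  have t: "transpose (X + Y) = transpose X + transpose Y" "transpose (c *\<^sub>R X) = c *\<^sub>R transpose X"
    for X Y :: "complex ^ 'n ^ 'n" and c
    by (simp_all add: transpose_def vec_eq_iff)
  show ?thesis unfolding subspace_def True
  proof (intro conjI ballI allI)
    show "0 \<in> herm_space 1" unfolding herm_space_1_iff by (simp add: transpose_def vec_eq_iff)
    fix X Y :: "complex ^ 'n ^ 'n" and c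
    assume "X \<in> herm_space 1"
    note x = this[unfolded herm_space_1_iff]
    have "(c *\<^sub>R X) $ i $ j \<in> \<real>" for i j
      using x[THEN conjunct1, rule_format, of i j] by (simp add: complex_is_Real_iff)
    then show "c *\<^sub>R X \<in> herm_space 1" unfolding herm_space_1_iff by (simp only: t x[THEN conjunct2] simp_thms)
    assume "Y \<in> herm_space 1"
    note y = this[unfolded herm_space_1_iff]
    have "(X + Y) $ i $ j \<in> \<real>" for i j
      using x[THEN conjunct1, rule_format, of i j] y[THEN conjunct1, rule_format, of i j] by simp
    then show "X + Y \<in> herm_space 1"
      unfolding herm_space_1_iff by (simp only: t x[THEN conjunct2] y[THEN conjunct2] simp_thms)
  qed
next
  case False
  have S: "M \<in> herm_space \<beta> \<longleftrightarrow> (\<forall>i j. M $ i $ j = cnj (M $ j $ i))" for M :: "complex ^ 'n ^ 'n"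
    unfolding herm_space_def using False by (simp only: if_False mem_Collect_eq)
  show ?thesis unfolding subspace_def
  proof (intro conjI ballI allI)
    show "(0 :: complex ^ 'n ^ 'n) \<in> herm_space \<beta>" unfolding S by simp
    fix X Y :: "complex ^ 'n ^ 'n" and c
    assume "X \<in> herm_space \<beta>"
    note x = this[unfolded S, rule_format]
    show "c *\<^sub>R X \<in> herm_space \<beta>" unfolding S
    proof (intro allI)
      fix i j show "(c *\<^sub>R X) $ i $ j = cnj ((c *\<^sub>R X) $ j $ i)" using x[of i j] by simp
    qed
    assume "Y \<in> herm_space \<beta>"
    note y = this[unfolded S, rule_format]
    show "X + Y \<in> herm_space \<beta>" unfolding S
    proof (intro allI)
      fix i j show "(X + Y) $ i $ j = cnj ((X + Y) $ j $ i)" using x[of i j] y[of i j] by simp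
    qed
  qed
qed

lemma subspace_qherm_space: "subspace (qherm_space :: (quat ^ 'n ^ 'n) set)"
proof -
  have q: "qadjoint (X + Y) = qadjoint X + qadjoint Y" "qadjoint (c *\<^sub>R X) = c *\<^sub>R qadjoint X"
    for X Y :: "quat ^ 'n ^ 'n" and c
    by (simp_all add: qadjoint_def vec_eq_iff quat_eq_iff)
  show ?thesis unfolding subspace_def
  proof (intro conjI ballI allI)
    show "0 \<in> qherm_space" unfolding qherm_space_iff by (simp add: qadjoint_def vec_eq_iff quat_eq_iff)
    fix X Y :: "quat ^ 'n ^ 'n" and c
    assume "X \<in> qherm_space"
    note x = this[unfolded qherm_space_iff]
    show "c *\<^sub>R X \<in> qherm_space" unfolding qherm_space_iff by (simp only: q x)
    assume "Y \<in> qherm_space"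
    note y = this[unfolded qherm_space_iff]
    show "X + Y \<in> qherm_space" unfolding qherm_space_iff by (simp only: q x y)
  qed
qed

section \<open>Measures determined by Laplace transforms\<close>

lemma borel_measurable_vec_lambda:
  fixes f :: "'a \<Rightarrow> 'v::finite \<Rightarrow> real"
  assumes "\<And>v. (\<lambda>x. f x v) \<in> borel_measurable M"
  shows "(\<lambda>x. \<chi> v. f x v) \<in> borel_measurable M"
proof (subst borel_measurable_euclidean_space, rule ballI)
  fix i :: "real ^ 'v" assume "i \<in> Basis"
  then obtain v where "i = axis v 1" unfolding Basis_vec_def by auto
  then show "(\<lambda>x. (\<chi> v. f x v) \<bullet> i) \<in> borel_measurable M" using assms by (simp add: inner_axis)
qed

lemma integrable_mult_bounded:
  fixes w f :: "'a \<Rightarrow> real"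
  assumes "integrable M w" "f \<in> borel_measurable M" "\<And>x. x \<in> space M \<Longrightarrow> \<bar>f x\<bar> \<le> K"
  shows "integrable M (\<lambda>x. w x * f x)"
proof (rule Bochner_Integration.integrable_bound)
  show "integrable M (\<lambda>x. K * \<bar>w x\<bar>)" using assms(1) by auto
  show "(\<lambda>x. w x * f x) \<in> borel_measurable M" using assms(1,2) by simp
  show "AE x in M. norm (w x * f x) \<le> norm (K * \<bar>w x\<bar>)"
  proof (rule AE_I2)
    fix x assume x: "x \<in> space M"
    have "0 \<le> K" using assms(3)[OF x] by linarith
    then show "norm (w x * f x) \<le> norm (K * \<bar>w x\<bar>)"
      using mult_left_mono[OF assms(3)[OF x], of "\<bar>w x\<bar>"] by (simp add: abs_mult mult.commute)
  qed
qed

text \<open>The weights \<open>w1\<close> and \<open>w2\<close> may change sign, so the argument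
  uses only linear combinations, uniform limits and dominated limits of test functions. Values in a
  compact cube make the polynomials dense.\<close>

locale moment_problem =
  fixes M1 :: "'a measure" and J :: "'j set" and M2 :: "'j \<Rightarrow> 'b measure" and w1 w2
    and U1 :: "'a \<Rightarrow> real ^ 'v" and U2 :: "'j \<Rightarrow> 'b \<Rightarrow> real ^ 'v"
  assumes finite_J: "finite J"
    and int1: "integrable M1 w1" and int2: "j \<in> J \<Longrightarrow> integrable (M2 j) (w2 j)"
    and meas1: "U1 \<in> borel_measurable M1" and meas2: "j \<in> J \<Longrightarrow> U2 j \<in> borel_measurable (M2 j)"
    and range1: "x \<in> space M1 \<Longrightarrow> U1 x \<in> {u. \<forall>v. 0 \<le> u $ v \<and> u $ v \<le> 1}"
    and range2: "j \<in> J \<Longrightarrow> y \<in> space (M2 j) \<Longrightarrow> U2 j y \<in> {u. \<forall>v. 0 \<le> u $ v \<and> u $ v \<le> 1}"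
    and moments: "(\<integral>x. w1 x * (\<Prod>v\<in>UNIV. U1 x $ v ^ n v) \<partial>M1) =
      (\<Sum>j\<in>J. \<integral>x. w2 j x * (\<Prod>v\<in>UNIV. U2 j x $ v ^ n v) \<partial>M2 j)"
begin

definition cube :: "(real ^ 'v) set" where
  "cube = {u. \<forall>v. 0 \<le> u $ v \<and> u $ v \<le> 1}"

lemma compact_cube: "compact cube"
proof -
  have "cube = cbox 0 1" by (auto simp: cube_def mem_box_cart)
  then show ?thesis using compact_cbox by metis
qed

definition tame :: "(real ^ 'v \<Rightarrow> real) \<Rightarrow> bool" where
  "tame f \<longleftrightarrow> f \<in> borel_measurable borel \<and> (\<exists>K. \<forall>u\<in>cube. \<bar>f u\<bar> \<le> K)"

definition agree :: "(real ^ 'v \<Rightarrow> real) \<Rightarrow> bool" where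
  "agree f \<longleftrightarrow> (\<integral>x. w1 x * f (U1 x) \<partial>M1) = (\<Sum>j\<in>J. \<integral>x. w2 j x * f (U2 j x) \<partial>M2 j)"

lemma in_cube1: "x \<in> space M1 \<Longrightarrow> U1 x \<in> cube"
  using range1 by (auto simp: cube_def)

lemma in_cube2: "j \<in> J \<Longrightarrow> y \<in> space (M2 j) \<Longrightarrow> U2 j y \<in> cube"
  using range2 by (auto simp: cube_def)

lemma tame_integrable:
  assumes "tame f"
  shows "integrable M1 (\<lambda>x. w1 x * f (U1 x))"
    and "j \<in> J \<Longrightarrow> integrable (M2 j) (\<lambda>x. w2 j x * f (U2 j x))"
proof -
  obtain K where K: "\<And>u. u \<in> cube \<Longrightarrow> \<bar>f u\<bar> \<le> K" and f: "f \<in> borel_measurable borel"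
    using assms unfolding tame_def by auto
  show "integrable M1 (\<lambda>x. w1 x * f (U1 x))"
    by (rule integrable_mult_bounded[OF int1 measurable_compose[OF meas1 f], of K]) (use K in_cube1 in auto)
  show "integrable (M2 j) (\<lambda>x. w2 j x * f (U2 j x))" if "j \<in> J"
    by (rule integrable_mult_bounded[OF int2[OF that] measurable_compose[OF meas2[OF that] f], of K])
      (use K in_cube2[OF that] in auto)
qed

lemma tame_add: "tame f \<Longrightarrow> tame g \<Longrightarrow> tame (\<lambda>u. f u + g u)"
proof -
  assume fg: "tame f" "tame g"
  then obtain K L where "\<And>u. u \<in> cube \<Longrightarrow> \<bar>f u\<bar> \<le> K" "\<And>u. u \<in> cube \<Longrightarrow> \<bar>g u\<bar> \<le> L"
    unfolding tame_def by auto
  then have "\<And>u. u \<in> cube \<Longrightarrow> \<bar>f u + g u\<bar> \<le> K + L" by (metis abs_triangle_ineq add_mono order_trans)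
  then show ?thesis using fg unfolding tame_def by auto
qed

lemma tame_const: "tame (\<lambda>u. c)"
  unfolding tame_def by auto

lemma tame_cmult: "tame f \<Longrightarrow> tame (\<lambda>u. c * f u)"
proof -
  assume f: "tame f"
  then obtain K where "\<And>u. u \<in> cube \<Longrightarrow> \<bar>f u\<bar> \<le> K" unfolding tame_def by auto
  then have "\<And>u. u \<in> cube \<Longrightarrow> \<bar>c * f u\<bar> \<le> \<bar>c\<bar> * K" by (simp add: abs_mult mult_left_mono)
  then show ?thesis using f unfolding tame_def by auto
qed

lemma tame_sum: "(\<And>i. i \<in> I \<Longrightarrow> tame (f i)) \<Longrightarrow> tame (\<lambda>u. \<Sum>i\<in>I. f i u)"
  by (induction I rule: infinite_finite_induct) (simp_all add: tame_const tame_add)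

lemma tame_continuous:
  assumes "continuous_on UNIV f"
  shows "tame f"
proof -
  have "bounded (f ` cube)"
    using compact_continuous_image[OF continuous_on_subset[OF assms] compact_cube] compact_imp_bounded by auto
  then obtain K where "\<forall>u\<in>cube. \<bar>f u\<bar> \<le> K" unfolding bounded_iff by auto
  then show ?thesis unfolding tame_def using borel_measurable_continuous_onI[OF assms] by auto
qed

lemma agree_add: "tame f \<Longrightarrow> tame g \<Longrightarrow> agree f \<Longrightarrow> agree g \<Longrightarrow> agree (\<lambda>u. f u + g u)"
  using tame_integrable[of f] tame_integrable[of g] unfolding agree_def
  by (simp add: distrib_left sum.distrib)

lemma agree_cmult: "agree f \<Longrightarrow> agree (\<lambda>u. c * f u)"
proof -
  have "(\<integral>x. w1 x * (c * f (U1 x)) \<partial>M1) = c * (\<integral>x. w1 x * f (U1 x) \<partial>M1)"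
    "(\<integral>x. w2 j x * (c * f (U2 j x)) \<partial>M2 j) = c * (\<integral>x. w2 j x * f (U2 j x) \<partial>M2 j)" for j
    unfolding integral_mult_right_zero[symmetric] by (simp_all add: mult.left_commute)
  then show "agree f \<Longrightarrow> agree (\<lambda>u. c * f u)" unfolding agree_def by (simp add: sum_distrib_left)
qed

lemma agree_sum:
  "(\<And>i. i \<in> I \<Longrightarrow> tame (f i)) \<Longrightarrow> (\<And>i. i \<in> I \<Longrightarrow> agree (f i)) \<Longrightarrow> agree (\<lambda>u. \<Sum>i\<in>I. f i u)"
proof (induction I rule: infinite_finite_induct)
  case (insert i I)
  then show ?case using agree_add[of "f i" "\<lambda>u. \<Sum>i\<in>I. f i u"] tame_sum[of I f] by simp
qed (simp_all add: agree_def)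

lemma agree_uniform:
  assumes f: "tame f" and approx: "\<And>e. e > 0 \<Longrightarrow> \<exists>g. tame g \<and> agree g \<and> (\<forall>u\<in>cube. \<bar>f u - g u\<bar> \<le> e)"
  shows "agree f"
proof -
  let ?I1 = "\<lambda>f. \<integral>x. w1 x * f (U1 x) \<partial>M1" and ?I2 = "\<lambda>j f. \<integral>x. w2 j x * f (U2 j x) \<partial>M2 j"
  \<comment> \<open>The total variation of all the weights. It converts uniform closeness of test
    functions into closeness of integrals.\<close>
  let ?W = "(\<integral>x. \<bar>w1 x\<bar> \<partial>M1) + (\<Sum>j\<in>J. \<integral>x. \<bar>w2 j x\<bar> \<partial>M2 j)"
  have W0: "0 \<le> ?W" by (intro add_nonneg_nonneg sum_nonneg) (simp_all add: integral_nonneg_AE)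
  have bnd: "\<bar>?I1 f - (\<Sum>j\<in>J. ?I2 j f)\<bar> \<le> e * ?W" if e: "e > 0" for e
  proof -
    obtain g where g: "tame g" "agree g" and fg: "\<And>u. u \<in> cube \<Longrightarrow> \<bar>f u - g u\<bar> \<le> e"
      using approx[OF e] by blast
    have est: "\<bar>w * a - w * b\<bar> \<le> e * \<bar>w\<bar>" if "\<bar>a - b\<bar> \<le> e" for w a b :: real
    proof -
      have "w * a - w * b = w * (a - b)" by (simp add: right_diff_distrib)
      then show ?thesis using mult_left_mono[OF that, of "\<bar>w\<bar>"] by (simp add: abs_mult mult.commute)
    qed
    have "\<bar>?I1 f - ?I1 g\<bar> \<le> (\<integral>x. e * \<bar>w1 x\<bar> \<partial>M1)"
    proof -
      have "?I1 f - ?I1 g = (\<integral>x. w1 x * f (U1 x) - w1 x * g (U1 x) \<partial>M1)"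
        using tame_integrable[OF f] tame_integrable[OF g(1)] by simp
      also have "\<bar>\<dots>\<bar> \<le> (\<integral>x. e * \<bar>w1 x\<bar> \<partial>M1)"
        using tame_integrable[OF f] tame_integrable[OF g(1)] int1 fg in_cube1 est
        by (intro integral_abs_bound[THEN order_trans] integral_mono) auto
      finally show ?thesis .
    qed
    moreover have "\<bar>?I2 j f - ?I2 j g\<bar> \<le> (\<integral>x. e * \<bar>w2 j x\<bar> \<partial>M2 j)" if j: "j \<in> J" for j
    proof -
      have "?I2 j f - ?I2 j g = (\<integral>x. w2 j x * f (U2 j x) - w2 j x * g (U2 j x) \<partial>M2 j)"
        using tame_integrable(2)[OF f j] tame_integrable(2)[OF g(1) j] by simp
      also have "\<bar>\<dots>\<bar> \<le> (\<integral>x. e * \<bar>w2 j x\<bar> \<partial>M2 j)"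
        using tame_integrable(2)[OF f j] tame_integrable(2)[OF g(1) j] int2[OF j] fg in_cube2[OF j] est
        by (intro integral_abs_bound[THEN order_trans] integral_mono) auto
      finally show ?thesis .
    qed
    then have "\<bar>(\<Sum>j\<in>J. ?I2 j f) - (\<Sum>j\<in>J. ?I2 j g)\<bar> \<le> (\<Sum>j\<in>J. \<integral>x. e * \<bar>w2 j x\<bar> \<partial>M2 j)"
      unfolding sum_subtractf[symmetric] by (intro sum_abs[THEN order_trans] sum_mono)
    moreover have "?I1 g = (\<Sum>j\<in>J. ?I2 j g)" using g(2) unfolding agree_def .
    ultimately have "\<bar>?I1 f - (\<Sum>j\<in>J. ?I2 j f)\<bar> \<le>
        (\<integral>x. e * \<bar>w1 x\<bar> \<partial>M1) + (\<Sum>j\<in>J. \<integral>x. e * \<bar>w2 j x\<bar> \<partial>M2 j)" by linarith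
    also have "\<dots> = e * ?W" by (simp add: distrib_left sum_distrib_left)
    finally show ?thesis .
  qed
  have "\<bar>?I1 f - (\<Sum>j\<in>J. ?I2 j f)\<bar> \<le> 0 + d" if d: "d > 0" for d
  proof -
    \<comment> \<open>The tolerance is divided by \<open>?W + 1\<close> because \<open>?W\<close>
      may be zero.\<close>
    have "\<bar>?I1 f - (\<Sum>j\<in>J. ?I2 j f)\<bar> \<le> d / (?W + 1) * ?W" using bnd[of "d / (?W + 1)"] W0 d by simp
    also have "d / (W + 1) * W \<le> d" if "0 \<le> W" for W using that d by (simp add: field_simps)
    note this[OF W0]
    finally show ?thesis by simp
  qed
  then have "\<bar>?I1 f - (\<Sum>j\<in>J. ?I2 j f)\<bar> \<le> 0" by (rule field_le_epsilon)
  then show ?thesis unfolding agree_def by simp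
qed

definition mono_fun :: "('v \<Rightarrow> nat) \<Rightarrow> real ^ 'v \<Rightarrow> real" where
  "mono_fun n u = (\<Prod>v\<in>UNIV. u $ v ^ n v)"

lemma continuous_mono_fun: "continuous_on UNIV (mono_fun n)"
  unfolding mono_fun_def by (intro continuous_intros)

lemma mono_fun_Suc: "u $ v * mono_fun n u = mono_fun (n(v := Suc (n v))) u"
proof -
  have "mono_fun m u = u $ v ^ m v * (\<Prod>v'\<in>UNIV - {v}. u $ v' ^ m v')" for m
    unfolding mono_fun_def by (rule prod.remove) auto
  moreover have "(\<Prod>v'\<in>UNIV - {v}. u $ v' ^ (n(v := Suc (n v))) v') = (\<Prod>v'\<in>UNIV - {v}. u $ v' ^ n v')"
    by (rule prod.cong) auto
  ultimately show ?thesis by simp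
qed

text \<open>\<open>h\<close> accumulates the factors already treated, and the hypothesis speaks of
  all monomials at once. A linear map is a combination of coordinates, which the monomial absorbs;
  in a product the first factor moves into \<open>h\<close> before the second is treated.\<close>

lemma agree_polynomial:
  assumes "real_polynomial_function g"
  shows "continuous_on UNIV h \<Longrightarrow> (\<And>n. agree (\<lambda>u. h u * mono_fun n u)) \<Longrightarrow> agree (\<lambda>u. h u * g u * mono_fun n u)"
  using assms
proof (induction g arbitrary: h n rule: real_polynomial_function.induct)
  case (linear f)
  have expand: "h u * f u * mono_fun n u = (\<Sum>v\<in>UNIV. f (axis v 1) * (h u * mono_fun (n(v := Suc (n v))) u))" for u
  proof -
    have "f u = f (\<Sum>v\<in>UNIV. (u $ v) *\<^sub>R axis v 1)"
      using basis_expansion[of u] by (simp add: scalar_mult_eq_scaleR)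
    also have "\<dots> = (\<Sum>v\<in>UNIV. u $ v * f (axis v 1))"
      using linear(1) by (simp add: linear_sum[OF bounded_linear.linear] linear_scale[OF bounded_linear.linear])
    finally show ?thesis
      by (simp add: sum_distrib_left sum_distrib_right mono_fun_Suc[symmetric] mult_ac)
  qed
  have c: "continuous_on UNIV (\<lambda>u. h u * mono_fun m u)" for m
    by (intro continuous_intros linear continuous_mono_fun)
  show ?case unfolding expand
    by (intro agree_sum tame_cmult tame_continuous c agree_cmult linear(3))
next
  case (const c)
  show ?case using agree_cmult[OF const(2)[of n], of c] by (simp add: mult_ac)
next
  case (add f g)
  have cont: "continuous_on UNIV f" "continuous_on UNIV g"
    using add(1,2) continuous_on_polymonial_function[of f] continuous_on_polymonial_function[of g]
    by (auto simp: real_polynomial_function_eq)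
  have "agree (\<lambda>u. h u * f u * mono_fun n u + h u * g u * mono_fun n u)"
    by (intro agree_add tame_continuous add.IH add.prems continuous_intros cont continuous_mono_fun)
  then show ?case by (simp add: distrib_left distrib_right)
next
  case (mult f g)
  have cont: "continuous_on UNIV f"
    using mult(1) continuous_on_polymonial_function[of f] by (auto simp: real_polynomial_function_eq)
  have "agree (\<lambda>u. (h u * f u) * g u * mono_fun n u)"
    by (rule mult.IH(2)) (auto intro!: continuous_intros mult.prems cont mult.IH(1))
  then show ?case by (simp add: mult.assoc)
qed

lemma agree_continuous:
  assumes "continuous_on UNIV f"
  shows "agree f"
proof (rule agree_uniform[OF tame_continuous[OF assms]])
  fix e :: real assume "e > 0"
  then obtain g where g: "real_polynomial_function g" "\<And>u. u \<in> cube \<Longrightarrow> \<bar>f u - g u\<bar> < e"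
    using Stone_Weierstrass_real_polynomial_function[OF compact_cube continuous_on_subset[OF assms]] by auto
  have "agree (\<lambda>u. 1 * g u * mono_fun (\<lambda>_. 0) u)"
    by (rule agree_polynomial[OF g(1)]) (auto simp: agree_def mono_fun_def moments)
  then have "agree g" by (simp add: mono_fun_def)
  moreover have "tame g"
    using g(1) continuous_on_polymonial_function[of g] by (auto simp: real_polynomial_function_eq intro!: tame_continuous)
  ultimately show "\<exists>g. tame g \<and> agree g \<and> (\<forall>u\<in>cube. \<bar>f u - g u\<bar> \<le> e)"
    using g(2) by (intro exI[of _ g]) (auto intro: less_imp_le)
qed

lemma agree_limit:
  assumes "\<And>k. tame (f k)" "\<And>k. agree (f k)" "g \<in> borel_measurable borel" "\<And>k u. \<bar>f k u\<bar> \<le> 1"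
    and lim: "\<And>u. (\<lambda>k. f k u) \<longlonglongrightarrow> g u"
  shows "agree g"
proof -
  have "(\<lambda>k. \<integral>x. w1 x * f k (U1 x) \<partial>M1) \<longlonglongrightarrow> (\<integral>x. w1 x * g (U1 x) \<partial>M1)"
  proof (rule integral_dominated_convergence[where w="\<lambda>x. \<bar>w1 x\<bar>"])
    show "(\<lambda>x. w1 x * g (U1 x)) \<in> borel_measurable M1" "\<And>k. (\<lambda>x. w1 x * f k (U1 x)) \<in> borel_measurable M1"
      using measurable_compose[OF meas1 assms(3)] int1 tame_integrable(1)[OF assms(1)] by auto
    show "AE x in M1. norm (w1 x * f k (U1 x)) \<le> \<bar>w1 x\<bar>" for k
      using assms(4) by (simp add: abs_mult mult_left_le)
  qed (use int1 lim in \<open>auto intro!: tendsto_intros\<close>)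
  moreover have "(\<lambda>k. \<integral>x. w2 j x * f k (U2 j x) \<partial>M2 j) \<longlonglongrightarrow> (\<integral>x. w2 j x * g (U2 j x) \<partial>M2 j)"
    if j: "j \<in> J" for j
  proof (rule integral_dominated_convergence[where w="\<lambda>x. \<bar>w2 j x\<bar>"])
    show "(\<lambda>x. w2 j x * g (U2 j x)) \<in> borel_measurable (M2 j)" "\<And>k. (\<lambda>x. w2 j x * f k (U2 j x)) \<in> borel_measurable (M2 j)"
      using measurable_compose[OF meas2[OF j] assms(3)] int2[OF j] tame_integrable(2)[OF assms(1) j] by auto
    show "AE x in M2 j. norm (w2 j x * f k (U2 j x)) \<le> \<bar>w2 j x\<bar>" for k
      using assms(4) by (simp add: abs_mult mult_left_le)
  qed (use int2[OF j] lim in \<open>auto intro!: tendsto_intros\<close>)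
  then have "(\<lambda>k. \<Sum>j\<in>J. \<integral>x. w2 j x * f k (U2 j x) \<partial>M2 j) \<longlonglongrightarrow> (\<Sum>j\<in>J. \<integral>x. w2 j x * g (U2 j x) \<partial>M2 j)"
    by (rule tendsto_sum)
  ultimately show ?thesis
    using assms(2) unfolding agree_def by (auto intro: LIMSEQ_unique)
qed

lemma agree_closed:
  assumes "closed A"
  shows "agree (indicator A)"
\<comment> \<open>The distance to the empty set is 0 by convention, so the approximating functions
  would converge to 1 instead of the indicator.\<close>
proof (cases "A = {}")
  case False
  let ?f = "\<lambda>k u. max 0 (1 - real k * infdist u A)"
  have cont: "continuous_on UNIV (?f k)" for k by (intro continuous_intros)
  show ?thesis
  proof (rule agree_limit[of ?f])
    show "tame (?f k)" "agree (?f k)" for k using cont by (auto intro: tame_continuous agree_continuous)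
    show "\<bar>?f k u\<bar> \<le> 1" for k u using infdist_nonneg[of u A] by auto
    show "indicator A \<in> borel_measurable borel" using assms by auto
    show "(\<lambda>k. ?f k u) \<longlonglongrightarrow> indicator A u" for u
    proof (cases "u \<in> A")
      case True
      then show ?thesis by simp
    next
      case u: False
      then have pos: "infdist u A > 0" using assms False by (metis in_closed_iff_infdist_zero infdist_nonneg less_eq_real_def)
      obtain k0 :: nat where k0: "1 / infdist u A < real k0" using reals_Archimedean2 by blast
      have "?f k u = 0" if "k \<ge> k0" for k
      proof -
        have "1 < real k0 * infdist u A" using k0 pos by (simp add: divide_less_eq)
        also have "\<dots> \<le> real k * infdist u A" using that pos by simp
        finally show ?thesis by simp
      qed
      then have "eventually (\<lambda>k. ?f k u = 0) sequentially" by (auto simp: eventually_sequentially)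
      then show ?thesis using u by (simp add: tendsto_eventually)
    qed
  qed
qed (simp add: agree_def)

lemma tame_indicator: "A \<in> sets borel \<Longrightarrow> tame (indicator A)"
  unfolding tame_def by (auto intro!: exI[of _ 1] simp: indicator_def)

lemma agree_indicator:
  assumes "A \<in> sets borel"
  shows "agree (indicator A)"
proof -
  have S: "sigma_sets UNIV (Collect closed) = sets (borel :: (real ^ 'v) measure)"
    by (simp add: borel_eq_closed sets_measure_of)
  have "Int_stable (Collect closed :: (real ^ 'v) set set)" by (auto simp: Int_stable_def)
  moreover have "Collect closed \<subseteq> Pow (UNIV :: (real ^ 'v) set)" by simp
  moreover have "A \<in> sigma_sets UNIV (Collect closed)" using assms by (simp add: S)
  ultimately show ?thesis
  proof (induction A rule: sigma_sets_induct_disjoint)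
    case (compl A)
    have "agree (\<lambda>u. 1 + (- 1) * indicator A u)"
      by (intro agree_add agree_cmult tame_cmult compl tame_const tame_indicator agree_continuous) (use compl S in auto)
    moreover have "(\<lambda>u. 1 + (- 1) * indicator A u) = (indicator (UNIV - A) :: _ \<Rightarrow> real)"
      by (auto simp: indicator_def fun_eq_iff)
    ultimately show ?case by simp
  next
    case (union A)
    let ?f = "\<lambda>k u. \<Sum>i<k. indicator (A i) u :: real"
    have f: "?f k u = indicator (\<Union>i<k. A i) u" for k u
      using union(1) by (subst indicator_UN_disjoint) (auto simp: disjoint_family_on_def)
    have As: "A i \<in> sets borel" for i using union(2) S by auto
    show ?case
    proof (rule agree_limit[of ?f])
      show "tame (?f k)" "agree (?f k)" for k
        by (intro tame_sum agree_sum tame_indicator union As)+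
      show "\<bar>?f k u\<bar> \<le> 1" for k u unfolding f by (simp add: indicator_def)
      show "indicator (\<Union> (range A)) \<in> borel_measurable borel" using As by auto
      show "(\<lambda>k. ?f k u) \<longlonglongrightarrow> indicator (\<Union> (range A)) u" for u
        unfolding f by (rule LIMSEQ_indicator_UN)
    qed
  qed (auto simp: agree_def intro: agree_closed[unfolded agree_def])
qed

text \<open>Rounding \<open>F\<close> down to multiples of \<open>e\<close> is uniformly accurate up
  to \<open>e\<close>. Boundedness confines the multiples to a finite range, so the rounded function
  is a finite combination of indicators.\<close>

lemma agree_bounded:
  assumes F: "F \<in> borel_measurable borel" and K: "\<And>u. \<bar>F u\<bar> \<le> K"
  shows "agree F"
proof (rule agree_uniform)
  show "tame F" using assms unfolding tame_def by auto
  fix e :: real assume e: "e > 0"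
  define N where "N = \<lceil>K / e\<rceil> + 1"
  let ?A = "\<lambda>j. {u. \<lfloor>F u / e\<rfloor> = j}"
  let ?g = "\<lambda>u. \<Sum>j\<in>{-N..N}. (real_of_int j * e) * indicator (?A j) u"
  have A: "?A j \<in> sets borel" for j using F by measurable
  have g: "?g u = real_of_int \<lfloor>F u / e\<rfloor> * e" for u
  proof -
    have "F u / e \<le> K / e" "- (K / e) \<le> F u / e"
      using K[of u] e by (simp_all add: abs_le_iff field_simps)
    then have "F u / e \<le> real_of_int \<lceil>K / e\<rceil>" "- real_of_int \<lceil>K / e\<rceil> \<le> F u / e"
      using le_of_int_ceiling[of "K / e"] by linarith+
    then have "\<lfloor>F u / e\<rfloor> \<le> \<lceil>K / e\<rceil>" "- \<lceil>K / e\<rceil> \<le> \<lfloor>F u / e\<rfloor>"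
      by (simp_all add: floor_le_iff le_floor_iff)
    then have "\<lfloor>F u / e\<rfloor> \<in> {-N..N}" unfolding N_def by simp
    moreover have "?g u = (\<Sum>j\<in>{-N..N}. if j = \<lfloor>F u / e\<rfloor> then real_of_int j * e else 0)"
      by (intro sum.cong) (auto simp: indicator_def)
    ultimately show ?thesis by (simp add: sum.delta)
  qed
  have "\<bar>F u - ?g u\<bar> \<le> e" for u
  proof -
    have "F u - ?g u = (F u / e - real_of_int \<lfloor>F u / e\<rfloor>) * e" unfolding g using e by (simp add: field_simps)
    moreover have "0 \<le> F u / e - real_of_int \<lfloor>F u / e\<rfloor>" "F u / e - real_of_int \<lfloor>F u / e\<rfloor> \<le> 1"
      by linarith+
    ultimately show ?thesis using e by (simp add: abs_mult mult_left_le_one_le)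
  qed
  moreover have "tame ?g" "agree ?g"
    by (intro tame_sum agree_sum tame_cmult agree_cmult tame_indicator agree_indicator A)+
  ultimately show "\<exists>g. tame g \<and> agree g \<and> (\<forall>u\<in>cube. \<bar>F u - g u\<bar> \<le> e)" by blast
qed

end

theorem laplace_transform_determines:
  fixes Y1 :: "'a \<Rightarrow> real ^ 'v" and Y2 :: "'j \<Rightarrow> 'b \<Rightarrow> real ^ 'v" and F :: "real ^ 'v \<Rightarrow> real"
  assumes J: "finite J"
    and int: "integrable M1 w1" "\<And>j. j \<in> J \<Longrightarrow> integrable (M2 j) (w2 j)"
    and meas: "Y1 \<in> borel_measurable M1" "\<And>j. j \<in> J \<Longrightarrow> Y2 j \<in> borel_measurable (M2 j)"
    and nonneg: "\<And>x v. x \<in> space M1 \<Longrightarrow> 0 \<le> Y1 x $ v" "\<And>j y v. j \<in> J \<Longrightarrow> y \<in> space (M2 j) \<Longrightarrow> 0 \<le> Y2 j y $ v"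
    and laplace: "\<And>n :: 'v \<Rightarrow> nat. (\<integral>x. w1 x * exp (- (\<Sum>v\<in>UNIV. real (n v) * Y1 x $ v)) \<partial>M1) =
      (\<Sum>j\<in>J. \<integral>x. w2 j x * exp (- (\<Sum>v\<in>UNIV. real (n v) * Y2 j x $ v)) \<partial>M2 j)"
    and F: "F \<in> borel_measurable borel" "bounded (range F)"
  shows "(\<integral>x. w1 x * F (Y1 x) \<partial>M1) = (\<Sum>j\<in>J. \<integral>x. w2 j x * F (Y2 j x) \<partial>M2 j)"
proof -
  let ?T = "\<lambda>y :: real ^ 'v. \<chi> v. exp (- (y $ v))"
  have T: "?T \<in> borel_measurable borel"
    by (intro borel_measurable_continuous_onI continuous_intros)
  have prod: "(\<Prod>v\<in>UNIV. ?T y $ v ^ n v) = exp (- (\<Sum>v\<in>UNIV. real (n v) * y $ v))" for y n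
    by (simp add: exp_of_nat_mult[symmetric] exp_sum[symmetric] sum_negf[symmetric])
  interpret moment_problem M1 J M2 w1 w2 "\<lambda>x. ?T (Y1 x)" "\<lambda>j x. ?T (Y2 j x)"
  proof
    show "(\<lambda>x. ?T (Y1 x)) \<in> borel_measurable M1" using measurable_compose[OF meas(1) T] .
    show "(\<lambda>x. ?T (Y2 j x)) \<in> borel_measurable (M2 j)" if "j \<in> J" for j
      using measurable_compose[OF meas(2)[OF that] T] .
    show "(\<integral>x. w1 x * (\<Prod>v\<in>UNIV. ?T (Y1 x) $ v ^ n v) \<partial>M1) =
      (\<Sum>j\<in>J. \<integral>x. w2 j x * (\<Prod>v\<in>UNIV. ?T (Y2 j x) $ v ^ n v) \<partial>M2 j)" for n
      unfolding prod by (rule laplace)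
  qed (use J int nonneg in auto)
  \<comment> \<open>This undoes the exponential substitution on vectors with positive entries, where
    all the values lie; elsewhere only its measurability matters.\<close>
  let ?L = "\<lambda>u :: real ^ 'v. \<chi> v. - ln (u $ v)"
  have "?L \<in> borel_measurable borel"
  proof (rule borel_measurable_vec_lambda)
    fix v
    have "(\<lambda>u :: real ^ 'v. u $ v) \<in> borel_measurable borel"
      by (intro borel_measurable_continuous_onI continuous_intros)
    then show "(\<lambda>u :: real ^ 'v. - ln (u $ v)) \<in> borel_measurable borel" by measurable
  qed
  then have "(\<lambda>u. F (?L u)) \<in> borel_measurable borel" using F(1) by (rule measurable_compose)
  moreover obtain K where "\<And>u. \<bar>F u\<bar> \<le> K" using F(2) by (auto simp: bounded_iff)
  ultimately have "agree (\<lambda>u. F (?L u))" by (intro agree_bounded) auto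
  then show ?thesis unfolding agree_def by simp
qed

section \<open>The Laplacian of the network\<close>

context electrical_network
begin

abbreviation "rate \<equiv> total_rate E C \<kappa>"

definition cond :: "'v \<Rightarrow> 'v \<Rightarrow> real" where
  "cond x y = (if {x, y} \<in> E then C x y else 0)"

lemma cond_sym: "cond x y = cond y x"
  using conductance_sym[of x y] by (auto simp: cond_def insert_commute)

lemma cond_nonneg: "0 \<le> cond x y"
  using conductance_pos[of x y] by (auto simp: cond_def)

lemma sum_edges: "(\<Sum>y | {x, y} \<in> E. C x y * f y) = (\<Sum>y\<in>UNIV. cond x y * f y)"
proof -
  have "(\<Sum>y\<in>UNIV. cond x y * f y) = (\<Sum>y\<in>UNIV. if {x, y} \<in> E then C x y * f y else 0)"
    by (intro sum.cong) (auto simp: cond_def)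
  then show ?thesis using sum.inter_filter[of UNIV "\<lambda>y. C x y * f y" "\<lambda>y. {x, y} \<in> E"] by simp
qed

lemma rate_eq: "rate x = \<kappa> x + (\<Sum>y\<in>UNIV. cond x y)"
  using sum_edges[of x "\<lambda>_. 1"] by (simp add: total_rate_def)

text \<open>Minus the generator of the killed process.\<close>

definition lap :: "('v \<Rightarrow> real) \<Rightarrow> 'v \<Rightarrow> real" where
  "lap f x = rate x * f x - (\<Sum>y\<in>UNIV. cond x y * f y)"

text \<open>The Dirichlet form with killing. The double sum meets every edge in both orders, hence
  the factor one half.\<close>

definition form :: "('v \<Rightarrow> real) \<Rightarrow> real" where
  "form f = (\<Sum>x\<in>UNIV. \<kappa> x * (f x)\<^sup>2) + 1/2 * (\<Sum>x\<in>UNIV. \<Sum>y\<in>UNIV. cond x y * (f y - f x)\<^sup>2)"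

lemma form_eq: "(\<Sum>x\<in>UNIV. f x * lap f x) = form f"
proof -
  let ?a = "\<Sum>x\<in>UNIV. \<Sum>y\<in>UNIV. cond x y * (f x)\<^sup>2" and ?b = "\<Sum>x\<in>UNIV. \<Sum>y\<in>UNIV. cond x y * (f x * f y)"
  have 1: "f x * lap f x = \<kappa> x * (f x)\<^sup>2 + (\<Sum>y\<in>UNIV. cond x y * (f x)\<^sup>2) - (\<Sum>y\<in>UNIV. cond x y * (f x * f y))" for x
    by (simp add: lap_def rate_eq algebra_simps sum_distrib_left sum_distrib_right power2_eq_square)
  have "(\<Sum>x\<in>UNIV. \<Sum>y\<in>UNIV. cond x y * (f y)\<^sup>2) = ?a"
    by (subst sum.swap) (simp add: cond_sym)
  moreover have "(\<Sum>x\<in>UNIV. \<Sum>y\<in>UNIV. cond x y * (f y - f x)\<^sup>2) =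
      (\<Sum>x\<in>UNIV. \<Sum>y\<in>UNIV. cond x y * (f y)\<^sup>2) + ?a - 2 * ?b"
    unfolding sum_distrib_left sum.distrib[symmetric] sum_subtractf[symmetric]
    by (intro sum.cong refl) (simp add: power2_eq_square algebra_simps)
  ultimately have "1/2 * (\<Sum>x\<in>UNIV. \<Sum>y\<in>UNIV. cond x y * (f y - f x)\<^sup>2) = ?a - ?b" by simp
  then show ?thesis unfolding form_def 1 by (simp add: sum.distrib sum_subtractf)
qed

lemma form_nonneg: "0 \<le> form f"
  unfolding form_def by (intro add_nonneg_nonneg mult_nonneg_nonneg sum_nonneg) (auto simp: killing_nonneg cond_nonneg)

text \<open>Vanishing edge terms make \<open>f\<close> constant along edges and, by connectedness,
  constant. A vertex with nonzero killing forces the constant to be 0.\<close>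

lemma form_zero:
  assumes "form f = 0"
  shows "f x = 0"
proof -
  have k: "0 \<le> \<kappa> x * (f x)\<^sup>2" and c: "0 \<le> cond x y * (f y - f x)\<^sup>2" for x y
    by (simp_all add: killing_nonneg cond_nonneg)
  have "(\<Sum>x\<in>UNIV. \<kappa> x * (f x)\<^sup>2) \<ge> 0" "(\<Sum>x\<in>UNIV. \<Sum>y\<in>UNIV. cond x y * (f y - f x)\<^sup>2) \<ge> 0"
    by (intro sum_nonneg k c)+
  then have z: "(\<Sum>x\<in>UNIV. \<kappa> x * (f x)\<^sup>2) = 0" "(\<Sum>x\<in>UNIV. \<Sum>y\<in>UNIV. cond x y * (f y - f x)\<^sup>2) = 0"
    using assms unfolding form_def by linarith+
  have fk: "\<kappa> x * (f x)\<^sup>2 = 0" for x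
    using z(1) sum_nonneg_eq_0_iff[of UNIV "\<lambda>x. \<kappa> x * (f x)\<^sup>2"] k by simp
  have "(\<Sum>y\<in>UNIV. cond x y * (f y - f x)\<^sup>2) = 0" for x
    using z(2) sum_nonneg_eq_0_iff[of UNIV "\<lambda>x. \<Sum>y\<in>UNIV. cond x y * (f y - f x)\<^sup>2"] c by (simp add: sum_nonneg)
  then have fc: "cond x y * (f y - f x)\<^sup>2 = 0" for x y
    using sum_nonneg_eq_0_iff[of UNIV "\<lambda>y. cond x y * (f y - f x)\<^sup>2"] c by simp
  have edge: "f y = f x" if "{x, y} \<in> E" for x y
    using fc[of x y] conductance_pos[OF that] that by (simp add: cond_def)
  have const: "f y = f x" for x y
    using connected[of x y] by (induction rule: rtrancl_induct) (use edge in auto)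
  obtain x0 where "\<kappa> x0 \<noteq> 0" using killing_nonzero by blast
  then have "f x0 = 0" using fk[of x0] by simp
  then show ?thesis using const[of x x0] by simp
qed

lemma form_scale: "form (\<lambda>x. a * f x) = a\<^sup>2 * form f"
proof -
  have "(a * f y - a * f x)\<^sup>2 = a\<^sup>2 * (f y - f x)\<^sup>2" for x y
    by (simp add: right_diff_distrib[symmetric] power_mult_distrib)
  then show ?thesis
    unfolding form_def by (simp add: power_mult_distrib sum_distrib_left distrib_left mult_ac)
qed

text \<open>The form has a positive minimum on the compact unit sphere and is homogeneous of degree
  two. The constant later bounds the Gaussian weight by a product of one-dimensional ones.\<close>

lemma form_coercive: "\<exists>c>0. \<forall>f. c * (\<Sum>x\<in>UNIV. (f x)\<^sup>2) \<le> form f"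
proof -
  let ?q = "\<lambda>u :: real ^ 'v. form (\<lambda>x. u $ x)"
  have cont: "continuous_on (sphere 0 1) ?q" unfolding form_def by (intro continuous_intros)
  have ne: "sphere (0 :: real ^ 'v) 1 \<noteq> {}" by simp
  obtain u0 where u0: "u0 \<in> sphere 0 1" "\<And>u. u \<in> sphere 0 1 \<Longrightarrow> ?q u0 \<le> ?q u"
    using continuous_attains_inf[OF compact_sphere ne cont] by blast
  have "?q u0 \<noteq> 0"
  proof
    assume "?q u0 = 0"
    then have "u0 = 0" using form_zero by (metis vec_eq_iff zero_index)
    then show False using u0(1) by simp
  qed
  then have pos: "?q u0 > 0" using form_nonneg[of "\<lambda>x. u0 $ x"] by linarith
  have "?q u0 * (\<Sum>x\<in>UNIV. (f x)\<^sup>2) \<le> form f" for f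
  proof (cases "f = (\<lambda>_. 0)")
    case True
    then show ?thesis using form_nonneg[of f] by simp
  next
    case False
    let ?u = "\<chi> x. f x"
    have n: "(norm ?u)\<^sup>2 = (\<Sum>x\<in>UNIV. (f x)\<^sup>2)"
      by (simp add: norm_vec_def L2_set_def sum_nonneg)
    have "?u \<noteq> 0" using False by (auto simp: vec_eq_iff)
    then have "norm ?u > 0" by simp
    then have "?q u0 \<le> ?q ((1 / norm ?u) *\<^sub>R ?u)" by (intro u0(2)) simp
    also have "\<dots> = (1 / norm ?u)\<^sup>2 * form f"
      using form_scale[of "1 / norm ?u" f] by simp
    finally have "?q u0 * (norm ?u)\<^sup>2 \<le> form f"
      using \<open>norm ?u > 0\<close> by (simp add: power_divide field_simps)
    then show ?thesis by (simp add: n)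
  qed
  then show ?thesis using pos by blast
qed

text \<open>The solution is the mean lifetime of the process as a function of its starting point.
  Definiteness of the form makes the linear system solvable, and a minimum principle gives
  positivity. It will dominate all Green functions.\<close>

lemma lap_solution: "\<exists>u. (\<forall>x. lap u x = 1) \<and> (\<forall>x. 0 < u x)"
proof -
  let ?A = "\<chi> x y. (if x = y then rate x else 0) - cond x y"
  have A: "(?A *v v) $ x = lap (\<lambda>y. v $ y) x" for v x
  proof -
    have "(?A *v v) $ x = (\<Sum>y\<in>UNIV. (if x = y then rate x * v $ y else 0) - cond x y * v $ y)"
      unfolding matrix_vector_mult_def by (auto simp: left_diff_distrib intro!: sum.cong)
    then show ?thesis by (simp add: lap_def sum_subtractf)
  qed
  have "inj ((*v) ?A)"
  proof (rule linear_injective_0[THEN iffD2, rule_format])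
    show "linear ((*v) ?A)" by simp
    fix v assume "?A *v v = 0"
    then have "lap (\<lambda>y. v $ y) x = 0" for x using A[of v x] by simp
    then have "form (\<lambda>y. v $ y) = 0" using form_eq[of "\<lambda>y. v $ y"] by simp
    then show "v = 0" using form_zero by (metis vec_eq_iff zero_index)
  qed
  then obtain A' where "A' ** ?A = mat 1" using matrix_left_invertible_injective[of ?A] by blast
  then have "?A ** A' = mat 1" using matrix_left_right_inverse by blast
  then have "?A *v (A' *v (\<chi> _. 1)) = (\<chi> _. 1)" by (simp add: matrix_vector_mul_assoc)
  then obtain v where v: "?A *v v = (\<chi> _. 1)" by blast
  let ?u = "\<lambda>x. v $ x"
  have lap1: "lap ?u x = 1" for x using A[of v x] v by simp
  obtain x0 where x0: "\<And>y. ?u x0 \<le> ?u y"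
  proof -
    have "Min (range ?u) \<in> range ?u" by (rule Min_in) auto
    then obtain x0 where "?u x0 = Min (range ?u)" by (metis imageE)
    moreover have "Min (range ?u) \<le> ?u y" for y by (rule Min_le) auto
    ultimately show ?thesis using that by metis
  qed
  \<comment> \<open>At a minimum the differences towards the neighbours are nonpositive, so the
    killing term alone must be at least 1.\<close>
  have "1 = \<kappa> x0 * ?u x0 + (\<Sum>y\<in>UNIV. cond x0 y * (?u x0 - ?u y))"
    using lap1[of x0] by (simp add: lap_def rate_eq algebra_simps sum_distrib_left sum_distrib_right sum_subtractf)
  also have "\<dots> \<le> \<kappa> x0 * ?u x0"
    using x0 cond_nonneg by (simp add: sum_nonpos mult_nonneg_nonpos)
  finally have "0 < \<kappa> x0 * ?u x0" by simp
  then have "0 < ?u x0" using killing_nonneg[of x0] by (simp add: zero_less_mult_iff)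
  then have "0 < ?u x" for x using x0[of x] by linarith
  then show ?thesis using lap1 by blast
qed

text \<open>A vertex of total rate 0 would have neither neighbours nor killing, and the form would
  vanish on its indicator function.\<close>

lemma rate_pos: "0 < rate x"
proof (rule ccontr)
  assume "\<not> 0 < rate x"
  moreover have "0 \<le> (\<Sum>y\<in>UNIV. cond x y)" by (intro sum_nonneg cond_nonneg)
  ultimately have "rate x = 0" using killing_nonneg[of x] by (simp add: rate_eq)
  then have "\<kappa> x = 0" "(\<Sum>y\<in>UNIV. cond x y) = 0"
    using killing_nonneg[of x] \<open>0 \<le> (\<Sum>y\<in>UNIV. cond x y)\<close> by (auto simp: rate_eq)
  then have c0: "cond x y = 0" for y
    using sum_nonneg_eq_0_iff[of UNIV "cond x"] cond_nonneg by simp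
  then have c1: "cond y x = 0" for y using cond_sym[of y x] by simp
  note c = c0 c1
  let ?f = "\<lambda>y. if y = x then 1 else 0 :: real"
  have "form ?f = 0"
  proof -
    have "\<kappa> z * (?f z)\<^sup>2 = 0" for z using \<open>\<kappa> x = 0\<close> by (cases "z = x") simp_all
    moreover have "cond z y * (?f y - ?f z)\<^sup>2 = 0" for y z
      using c by (cases "z = x"; cases "y = x") simp_all
    ultimately show ?thesis unfolding form_def by (simp only: sum.neutral_const)
  qed
  then show False using form_zero[of ?f x] by simp
qed

lemma form_gff_energy:
  "2 * gff_energy E C \<kappa> (\<lambda>a. a\<^sup>2) f = form f"
proof -
  have "(\<Sum>y | {x, y} \<in> E. C x y * (f y - f x)\<^sup>2) = (\<Sum>y\<in>UNIV. cond x y * (f y - f x)\<^sup>2)" for x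
    by (rule sum_edges)
  then show ?thesis by (simp add: gff_energy_def form_def)
qed

end

section \<open>The jump process and its Green function\<close>

lemma nn_integral_exp_decay:
  assumes "s > 0"
  shows "(\<integral>\<^sup>+t. ennreal (if 0 \<le> t then exp (- s * t) else 0) \<partial>lborel) = ennreal (1 / s)"
proof -
  interpret prob_space "density lborel (exponential_density s)"
    using prob_space_exponential_density[OF assms] .
  have "1 = (\<integral>\<^sup>+t. ennreal (exponential_density s t) \<partial>lborel)"
    using emeasure_space_1 by (simp add: emeasure_density cong: nn_integral_cong)
  also have "\<dots> = (\<integral>\<^sup>+t. ennreal s * ennreal (if 0 \<le> t then exp (- s * t) else 0) \<partial>lborel)"
    using assms by (intro nn_integral_cong) (auto simp: exponential_density_def ennreal_mult[symmetric] mult.commute)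
  also have "\<dots> = ennreal s * (\<integral>\<^sup>+t. ennreal (if 0 \<le> t then exp (- s * t) else 0) \<partial>lborel)"
    by (rule nn_integral_cmult) measurable
  finally have e: "ennreal s * (\<integral>\<^sup>+t. ennreal (if 0 \<le> t then exp (- s * t) else 0) \<partial>lborel) = 1" ..
  have "(\<integral>\<^sup>+t. ennreal (if 0 \<le> t then exp (- s * t) else 0) \<partial>lborel) =
      ennreal (1 / s) * (ennreal s * (\<integral>\<^sup>+t. ennreal (if 0 \<le> t then exp (- s * t) else 0) \<partial>lborel))"
    using assms by (simp add: mult.assoc[symmetric] ennreal_mult[symmetric])
  then show ?thesis unfolding e by simp
qed

lemma nn_integral_exp_tail:
  assumes "0 \<le> a"
  shows "(\<integral>\<^sup>+u. ennreal (if a < u then exp (- u) else 0) \<partial>lborel) = ennreal (exp (- a))"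
proof -
  have "(\<integral>\<^sup>+u. ennreal (if a < u then exp (- u) else 0) \<partial>lborel) =
      (\<integral>\<^sup>+u. ennreal (if a < a + 1 * u then exp (- (a + 1 * u)) else 0) \<partial>lborel)"
  proof -
    have m: "(\<lambda>u. ennreal (if a < u then exp (- u) else 0)) \<in> borel_measurable borel" by measurable
    have "(\<integral>\<^sup>+u. ennreal (if a < u then exp (- u) else 0) \<partial>lborel) =
        ennreal \<bar>1\<bar> * (\<integral>\<^sup>+u. ennreal (if a < a + 1 * u then exp (- (a + 1 * u)) else 0) \<partial>lborel)"
      by (rule nn_integral_real_affine[OF m]) simp
    then show ?thesis by (simp only: abs_one ennreal_1 mult_1_left)
  qed
  also have "\<dots> = (\<integral>\<^sup>+u. ennreal (exp (- a)) * ennreal (if 0 \<le> u then exp (- 1 * u) else 0) \<partial>lborel)"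
  proof (rule nn_integral_cong_AE, rule AE_mp[OF AE_lborel_singleton[of 0]], rule AE_I2, rule impI)
    fix u :: real assume "u \<noteq> 0"
    then consider "u > 0" | "u < 0" by linarith
    then show "ennreal (if a < a + 1 * u then exp (- (a + 1 * u)) else 0) =
        ennreal (exp (- a)) * ennreal (if 0 \<le> u then exp (- 1 * u) else 0)"
    proof cases
      case 1
      have "exp (- (a + 1 * u)) = exp (- a) * exp (- 1 * u)" by (simp only: exp_add[symmetric]) simp
      then show ?thesis using 1 by (simp add: ennreal_mult)
    qed simp
  qed
  also have "\<dots> = ennreal (exp (- a)) * (\<integral>\<^sup>+u. ennreal (if 0 \<le> u then exp (- 1 * u) else 0) \<partial>lborel)"
    by (rule nn_integral_cmult) measurable
  finally show ?thesis by (simp add: nn_integral_exp_decay[of 1])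
qed

section \<open>Measurability of the process and its decomposition at the first jump\<close>

context electrical_network
begin

abbreviation "exp_law \<equiv> density lborel (\<lambda>s. ennreal (exponential_density 1 s))"
abbreviation "jump_law \<equiv> measure_pmf (Pi_pmf UNIV None (jump_pmf E C \<kappa>))"
abbreviation "driver \<equiv> driver_measure E C \<kappa>"
abbreviation chain :: "'v \<Rightarrow> 'v driver \<Rightarrow> nat \<Rightarrow> 'v option" where "chain \<equiv> jump_chain"
abbreviation "jtime \<equiv> jump_time E C \<kappa>"
abbreviation "proc \<equiv> jump_process E C \<kappa>"

definition step_measure :: "(('v \<Rightarrow> 'v option) \<times> real) measure" where
  "step_measure = jump_law \<Otimes>\<^sub>M exp_law"

lemma driver_eq: "driver = stream_space step_measure"
  by (simp add: driver_measure_def step_measure_def)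

lemma prob_exp_law: "prob_space exp_law"
  using prob_space_exponential_density[of 1] by simp

lemma prob_step: "prob_space step_measure"
proof -
  interpret T: prob_space exp_law by (rule prob_exp_law)
  interpret pair_prob_space jump_law exp_law ..
  show ?thesis unfolding step_measure_def by (rule P.prob_space_axioms)
qed

lemma prob_driver: "prob_space driver"
  unfolding driver_eq using prob_space.prob_space_stream_space[OF prob_step] .

lemma space_step: "space step_measure = UNIV"
  by (simp add: step_measure_def space_pair_measure)

lemma space_driver: "space driver = UNIV"
  by (simp add: driver_eq space_stream_space space_step)

lemma measurable_snth_driver [measurable]: "(\<lambda>\<omega>. \<omega> !! n) \<in> measurable driver step_measure"
  unfolding driver_eq by measurable

lemma measurable_snd_step [measurable]: "snd \<in> borel_measurable step_measure"
proof -
  have "measurable step_measure exp_law = measurable step_measure borel"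
    by (rule measurable_cong_sets) simp_all
  moreover have "snd \<in> measurable step_measure exp_law" unfolding step_measure_def by (rule measurable_snd)
  ultimately show ?thesis by simp
qed

lemma measurable_fst_step [measurable]: "(\<lambda>s. fst s v) \<in> measurable step_measure (count_space UNIV)"
proof -
  have "fst \<in> measurable step_measure jump_law" unfolding step_measure_def by (rule measurable_fst)
  moreover have "(\<lambda>f. f v) \<in> measurable jump_law (count_space UNIV)" by simp
  ultimately show ?thesis by (rule measurable_compose)
qed

lemma chain_measurable [measurable]: "(\<lambda>\<omega>. chain x \<omega> n) \<in> measurable driver (count_space UNIV)"
proof (induction n)
  case (Suc n)
  have "(\<lambda>\<omega>. fst (\<omega> !! n) v) \<in> measurable driver (count_space UNIV)" for v
    using measurable_compose[OF measurable_snth_driver measurable_fst_step] .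
  then have "(\<lambda>\<omega>. case i of None \<Rightarrow> None | Some v \<Rightarrow> fst (\<omega> !! n) v) \<in> measurable driver (count_space UNIV)" for i
    by (cases i) auto
  from measurable_compose_countable[OF this Suc] show ?case by simp
qed simp

lemma holding_measurable [measurable]: "(\<lambda>\<omega>. holding_time E C \<kappa> x \<omega> n) \<in> borel_measurable driver"
proof -
  have "(\<lambda>\<omega>. snd (\<omega> !! n)) \<in> borel_measurable driver"
    using measurable_compose[OF measurable_snth_driver measurable_snd_step] .
  then have "(\<lambda>\<omega>. case i of None \<Rightarrow> 0 | Some v \<Rightarrow> snd (\<omega> !! n) / rate v) \<in> borel_measurable driver" for i
    by (cases i) auto
  from measurable_compose_countable[OF this chain_measurable] show ?thesis by (simp add: holding_time_def)
qed

lemma jtime_measurable [measurable]: "(\<lambda>\<omega>. jtime x \<omega> n) \<in> borel_measurable driver"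
  unfolding jump_time_def by measurable

lemma proc_measurable [measurable]:
  "(\<lambda>z. proc x (fst z) (snd z)) \<in> measurable (borel \<Otimes>\<^sub>M driver) (count_space UNIV)"
proof -
  have [measurable]: "(\<lambda>z. jtime x (snd z) n) \<in> borel_measurable (borel \<Otimes>\<^sub>M driver)" for n
    using measurable_compose[OF measurable_snd jtime_measurable] .
  have c: "(\<lambda>z. chain x (snd z) n) \<in> measurable (borel \<Otimes>\<^sub>M driver) (count_space UNIV)" for n
    using measurable_compose[OF measurable_snd chain_measurable] .
  have P: "Measurable.pred (borel \<Otimes>\<^sub>M driver) (\<lambda>z. fst z < jtime x (snd z) (Suc n))" for n
    by measurable
  have "(\<lambda>z. LEAST n. fst z < jtime x (snd z) (Suc n)) \<in> measurable (borel \<Otimes>\<^sub>M driver) (count_space UNIV)"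
    using P by (rule measurable_Least)
  from measurable_compose_countable[OF c this]
  have [measurable]: "(\<lambda>z. chain x (snd z) (LEAST n. fst z < jtime x (snd z) (Suc n))) \<in> measurable (borel \<Otimes>\<^sub>M driver) (count_space UNIV)" .
  show ?thesis unfolding jump_process_def by measurable
qed

lemma proc_measurable1: "proc x t \<in> measurable driver (count_space UNIV)"
proof -
  have "(\<lambda>\<omega>. (t, \<omega>)) \<in> measurable driver (borel \<Otimes>\<^sub>M driver)" by measurable
  from measurable_compose[OF this proc_measurable] show ?thesis by simp
qed

lemma proc_measurable2: "(\<lambda>t. proc x t \<omega>) \<in> measurable borel (count_space UNIV)"
proof -
  have "(\<lambda>t. (t, \<omega>)) \<in> measurable borel (borel \<Otimes>\<^sub>M driver)"
    by (rule measurable_Pair2') (simp add: space_driver)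
  from measurable_compose[OF this proc_measurable] show ?thesis by simp
qed

text \<open>The prescribed weights are nonnegative and sum to 1 by the definition of the total rate,
  which is what makes \<open>embed_pmf\<close> return them.\<close>

lemma jump_pmf_Some: "pmf (jump_pmf E C \<kappa> x) (Some y) = cond x y / rate x"
proof -
  let ?f = "\<lambda>z. case z of None \<Rightarrow> \<kappa> x / rate x | Some y \<Rightarrow> if {x, y} \<in> E then C x y / rate x else 0"
  have f: "?f = (\<lambda>z. case z of None \<Rightarrow> \<kappa> x / rate x | Some y \<Rightarrow> cond x y / rate x)"
    by (auto simp: fun_eq_iff cond_def split: option.split)
  have nn: "0 \<le> ?f z" for z
    unfolding f using killing_nonneg cond_nonneg rate_pos[of x] by (auto split: option.split)
  have "(\<integral>\<^sup>+z. ennreal (?f z) \<partial>count_space UNIV) = (\<Sum>z\<in>UNIV. ennreal (?f z))"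
    by (rule nn_integral_count_space_finite) simp
  also have "\<dots> = ennreal (\<Sum>z\<in>UNIV. ?f z)" using nn by (simp add: sum_ennreal)
  also have "(\<Sum>z\<in>UNIV. ?f z) = \<kappa> x / rate x + (\<Sum>y\<in>UNIV. cond x y / rate x)"
    unfolding f UNIV_option_conv by (simp add: sum.reindex)
  also have "\<dots> = 1"
    using rate_pos[of x] by (simp add: rate_eq[of x] sum_divide_distrib[symmetric] add_divide_distrib[symmetric])
  finally have "pmf (embed_pmf ?f) (Some y) = ?f (Some y)"
    using pmf_embed_pmf[of ?f "Some y"] nn by simp
  then show ?thesis by (simp add: jump_pmf_def cond_def)
qed

text \<open>Prepending one pair to the stream expresses the Markov property at the first jump:
  afterwards the chain is driven by the remaining stream from its new state.\<close>

lemma chain_shift: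
  fixes \<omega> :: "'v driver"
  shows
  "chain x ((g, \<tau>) ## \<omega>) (Suc n) = (case g x of None \<Rightarrow> None | Some z \<Rightarrow> chain z \<omega> n)"
  by (induction n) (auto split: option.splits)

lemma holding_shift:
  "holding_time E C \<kappa> x ((g, \<tau>) ## \<omega>) 0 = \<tau> / rate x"
  "holding_time E C \<kappa> x ((g, \<tau>) ## \<omega>) (Suc n) = (case g x of None \<Rightarrow> 0 | Some z \<Rightarrow> holding_time E C \<kappa> z \<omega> n)"
  unfolding holding_time_def chain_shift by (auto split: option.splits)

lemma jtime_shift:
  "jtime x ((g, \<tau>) ## \<omega>) (Suc n) = \<tau> / rate x + (case g x of None \<Rightarrow> 0 | Some z \<Rightarrow> jtime z \<omega> n)"
  unfolding jump_time_def sum.lessThan_Suc_shift holding_shift by (auto split: option.splits)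

text \<open>One of the first \<open>N\<close> jump times exceeds \<open>t\<close>. Truncating at
  \<open>N\<close> jumps turns the decomposition at the first jump into a recursion on
  \<open>N\<close>.\<close>

definition alive :: "nat \<Rightarrow> 'v \<Rightarrow> real \<Rightarrow> 'v driver \<Rightarrow> bool" where
  "alive N x t \<omega> \<longleftrightarrow> (\<exists>n<N. t < jtime x \<omega> (Suc n))"

context
  fixes x :: 'v and g :: "'v \<Rightarrow> 'v option" and \<tau> h :: real and \<omega> :: "'v driver"
  assumes h: "h = \<tau> / rate x"
begin

lemma proc_before: "t < h \<Longrightarrow> proc x t ((g, \<tau>) ## \<omega>) = Some x"
proof -
  assume t: "t < h"
  let ?P = "\<lambda>n. t < jtime x ((g, \<tau>) ## \<omega>) (Suc n)"
  have 0: "jtime x ((g, \<tau>) ## \<omega>) (Suc 0) = h"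
    unfolding jtime_shift h by (simp add: jump_time_def split: option.splits)
  then have "?P 0" using t by simp
  then have "(LEAST n. ?P n) = 0" by (rule Least_eq_0)
  then show ?thesis using \<open>?P 0\<close> unfolding jump_process_def by auto
qed

lemma proc_killed: "\<not> t < h \<Longrightarrow> g x = None \<Longrightarrow> proc x t ((g, \<tau>) ## \<omega>) = None"
  unfolding jump_process_def jtime_shift h by simp

lemma proc_after:
  assumes t: "\<not> t < h" and z: "g x = Some z"
  shows "proc x t ((g, \<tau>) ## \<omega>) = proc z (t - h) \<omega>"
proof -
  let ?P = "\<lambda>n. t < jtime x ((g, \<tau>) ## \<omega>) (Suc n)" and ?Q = "\<lambda>n. t - h < jtime z \<omega> (Suc n)"
  have P0: "\<not> ?P 0" using t unfolding jtime_shift h[symmetric] z by (simp add: jump_time_def)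
  have PS: "?P (Suc n) \<longleftrightarrow> ?Q n" for n unfolding jtime_shift[of x g \<tau> \<omega> "Suc n"] h[symmetric] z by auto
  have ex: "(\<exists>n. ?P n) \<longleftrightarrow> (\<exists>n. ?Q n)" using P0 PS by (metis not0_implies_Suc)
  have least: "(LEAST n. ?P n) = Suc (LEAST n. ?Q n)" if "?P n" for n
    using Least_Suc[of ?P, OF that P0] unfolding PS .
  show ?thesis
  proof (cases "\<exists>n. ?Q n")
    case True
    then obtain n where n: "?P n" using ex by blast
    have "proc x t ((g, \<tau>) ## \<omega>) = chain x ((g, \<tau>) ## \<omega>) (LEAST n. ?P n)"
      using ex True by (simp only: jump_process_def if_True)
    also have "\<dots> = chain z \<omega> (LEAST n. ?Q n)"
      by (simp only: least[OF n] chain_shift z option.case)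
    also have "\<dots> = proc z (t - h) \<omega>" using True by (simp only: jump_process_def if_True)
    finally show ?thesis .
  next
    case False
    then show ?thesis by (simp only: jump_process_def ex if_False)
  qed
qed

lemma alive_shift:
  "alive (Suc N) x t ((g, \<tau>) ## \<omega>) \<longleftrightarrow> t < h \<or> (\<exists>z. g x = Some z \<and> alive N z (t - h) \<omega>)"
proof -
  have 0: "jtime z \<omega> 0 = 0" for z by (simp add: jump_time_def)
  have "alive (Suc N) x t ((g, \<tau>) ## \<omega>) \<longleftrightarrow> (\<exists>n<Suc N. t < h + (case g x of None \<Rightarrow> 0 | Some z \<Rightarrow> jtime z \<omega> n))"
    unfolding alive_def jtime_shift h ..
  also have "\<dots> \<longleftrightarrow> t < h \<or> (\<exists>z. g x = Some z \<and> alive N z (t - h) \<omega>)"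
  proof (cases "g x")
    case None
    then show ?thesis by auto
  next
    case (Some z)
    have *: "(\<exists>n<Suc N. t < h + jtime z \<omega> n) \<longleftrightarrow> t < h + jtime z \<omega> 0 \<or> (\<exists>n<N. t < h + jtime z \<omega> (Suc n))"
      by (auto simp: less_Suc_eq_0_disj)
    have lt: "t - h < r \<longleftrightarrow> t < h + r" for r :: real by linarith
    have "(\<exists>n<Suc N. t < h + (case g x of None \<Rightarrow> 0 | Some z \<Rightarrow> jtime z \<omega> n)) \<longleftrightarrow> t < h \<or> alive N z (t - h) \<omega>"
      unfolding alive_def lt Some option.case * 0 by simp
    then show ?thesis using Some by auto
  qed
  finally show ?thesis .
qed

end

text \<open>With a half-open time interval the split at the first jump is a disjoint union of
  intervals of the same kind.\<close>

definition occ :: "'v \<Rightarrow> real \<Rightarrow> 'v driver \<Rightarrow> 'v \<Rightarrow> real" where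
  "occ x t \<omega> v = measure lborel {s \<in> {0..<t}. proc x s \<omega> = Some v}"

lemma occ_set: "{s \<in> {a..<t}. proc x s \<omega> = Some v} \<in> sets borel"
proof -
  have "(\<lambda>s. proc x s \<omega>) -` {Some v} \<inter> space borel \<in> sets borel"
    by (rule measurable_sets[OF proc_measurable2]) simp
  then have "{a..<t} \<inter> ((\<lambda>s. proc x s \<omega>) -` {Some v}) \<in> sets borel" by auto
  moreover have "{a..<t} \<inter> ((\<lambda>s. proc x s \<omega>) -` {Some v}) = {s \<in> {a..<t}. proc x s \<omega> = Some v}" by auto
  ultimately show ?thesis by simp
qed

lemma occ_finite: "emeasure lborel {s \<in> {a..<t}. proc x s \<omega> = Some v} \<noteq> \<infinity>"
proof -
  have "emeasure lborel {s \<in> {a..<t}. proc x s \<omega> = Some v} \<le> emeasure lborel {a..t}"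
    by (rule emeasure_mono) auto
  also have "\<dots> < \<infinity>" by (simp add: emeasure_lborel_Icc_eq)
  finally show ?thesis by simp
qed

lemma occ_before:
  assumes "h = \<tau> / rate x" "0 \<le> t" "t \<le> h"
  shows "occ x t ((g, \<tau>) ## \<omega>) v = (if v = x then t else 0)"
proof -
  have "{s \<in> {0..<t}. proc x s ((g, \<tau>) ## \<omega>) = Some v} = (if v = x then {0..<t} else {})"
    using proc_before[OF assms(1)] assms(3) by auto
  then show ?thesis using assms(2) by (simp add: occ_def)
qed

lemma occ_after:
  assumes h: "h = \<tau> / rate x" "0 \<le> h" "h \<le> t" and z: "g x = Some z"
  shows "occ x t ((g, \<tau>) ## \<omega>) v = (if v = x then h else 0) + occ z (t - h) \<omega> v"
proof -
  let ?w = "(g, \<tau>) ## \<omega>"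
  let ?A = "{s \<in> {0..<h}. proc x s ?w = Some v}" and ?B = "{s \<in> {h..<t}. proc x s ?w = Some v}"
  have "{s \<in> {0..<t}. proc x s ?w = Some v} = ?A \<union> ?B" using h by auto
  then have "occ x t ?w v = measure lborel (?A \<union> ?B)" by (simp add: occ_def)
  also have "\<dots> = measure lborel ?A + measure lborel ?B"
    using occ_set occ_finite by (intro measure_Union) auto
  also have "measure lborel ?A = (if v = x then h else 0)"
    using occ_before[OF h(1,2) order_refl] by (simp add: occ_def)
  \<comment> \<open>Translation by \<open>h\<close> carries the times of the restarted process to
    the times after the first jump and preserves Lebesgue measure.\<close>
  also have "measure lborel ?B = measure (distr lborel borel ((+) h)) ?B"
    by (simp only: lborel_distr_plus)
  also have "\<dots> = measure lborel ((+) h -` ?B \<inter> space lborel)"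
    by (rule measure_distr) (simp, rule occ_set)
  also have "(+) h -` ?B \<inter> space lborel = {s \<in> {0..<t - h}. proc z s \<omega> = Some v}"
    using proc_after[where x = x and g = g and z = z, OF h(1) _ z] by auto
  finally show ?thesis by (simp add: occ_def)
qed

lemma occ_measurable [measurable]: "(\<lambda>z. occ x (fst z) (snd z) v) \<in> borel_measurable (borel \<Otimes>\<^sub>M driver)"
proof -
  have "(\<lambda>p. (snd p, snd (fst p))) \<in> measurable ((borel \<Otimes>\<^sub>M driver) \<Otimes>\<^sub>M lborel) (borel \<Otimes>\<^sub>M driver)"
    by measurable
  from measurable_compose[OF this proc_measurable]
  have [measurable]: "(\<lambda>p. proc x (snd p) (snd (fst p))) \<in> measurable ((borel \<Otimes>\<^sub>M driver) \<Otimes>\<^sub>M lborel) (count_space UNIV)"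
    by simp
  have [measurable]: "Measurable.pred ((borel \<Otimes>\<^sub>M driver) \<Otimes>\<^sub>M lborel) (\<lambda>p. proc x (snd p) (snd (fst p)) = Some v)"
    by measurable
  have "(\<lambda>p. if 0 \<le> snd p \<and> snd p < fst (fst p) \<and> proc x (snd p) (snd (fst p)) = Some v then 1 else 0 :: ennreal)
      \<in> borel_measurable ((borel \<Otimes>\<^sub>M driver) \<Otimes>\<^sub>M lborel)"
    by measurable
  then have "(\<lambda>z. \<integral>\<^sup>+s. (if 0 \<le> s \<and> s < fst z \<and> proc x s (snd z) = Some v then 1 else 0) \<partial>lborel) \<in> borel_measurable (borel \<Otimes>\<^sub>M driver)"
    using sigma_finite_measure.borel_measurable_nn_integral[OF sigma_finite_lborel,
        of "\<lambda>z s. if 0 \<le> s \<and> s < fst z \<and> proc x s (snd z) = Some v then 1 else 0" "borel \<Otimes>\<^sub>M driver"]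
    by (simp add: case_prod_unfold)
  moreover have "occ x (fst z) (snd z) v = enn2real (\<integral>\<^sup>+s. (if 0 \<le> s \<and> s < fst z \<and> proc x s (snd z) = Some v then 1 else 0) \<partial>lborel)" for z
  proof -
    have "(\<integral>\<^sup>+s. (if 0 \<le> s \<and> s < fst z \<and> proc x s (snd z) = Some v then 1 else 0) \<partial>lborel) =
        (\<integral>\<^sup>+s. indicator {s \<in> {0..<fst z}. proc x s (snd z) = Some v} s \<partial>lborel)"
      by (intro nn_integral_cong) (auto simp: indicator_def)
    also have "\<dots> = emeasure lborel {s \<in> {0..<fst z}. proc x s (snd z) = Some v}"
      by (rule nn_integral_indicator) (simp only: sets_lborel occ_set)
    finally show ?thesis by (simp add: occ_def measure_def)
  qed
  ultimately show ?thesis by simp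
qed

end

section \<open>The Green function discounted by the occupation field\<close>

context electrical_network
begin

context
  fixes lam :: "'v \<Rightarrow> real"
  assumes lam: "\<And>v. 0 \<le> lam v"
begin

text \<open>The conditional probability, given the path, of surviving an additional killing at rate
  \<open>lam\<close> up to time \<open>t\<close>.\<close>

definition discount :: "'v \<Rightarrow> real \<Rightarrow> 'v driver \<Rightarrow> real" where
  "discount x t \<omega> = exp (- (\<Sum>v\<in>UNIV. lam v * occ x t \<omega> v))"

lemma discount_nonneg: "0 \<le> discount x t \<omega>"
  by (simp add: discount_def)

definition visit :: "'v \<Rightarrow> 'v \<Rightarrow> real \<Rightarrow> 'v driver \<Rightarrow> ennreal" where
  "visit x y t \<omega> = (if 0 \<le> t \<and> proc x t \<omega> = Some y then ennreal (discount x t \<omega>) else 0)"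

definition visit_upto :: "nat \<Rightarrow> 'v \<Rightarrow> 'v \<Rightarrow> real \<Rightarrow> 'v driver \<Rightarrow> ennreal" where
  "visit_upto N x y t \<omega> = (if alive N x t \<omega> then visit x y t \<omega> else 0)"

lemma visit_measurable [measurable]: "(\<lambda>z. visit x y (fst z) (snd z)) \<in> borel_measurable (borel \<Otimes>\<^sub>M driver)"
proof -
  have [measurable]: "(\<lambda>z. discount x (fst z) (snd z)) \<in> borel_measurable (borel \<Otimes>\<^sub>M driver)"
    unfolding discount_def by measurable
  show ?thesis unfolding visit_def by measurable
qed

lemma visit_upto_measurable [measurable]:
  "(\<lambda>z. visit_upto N x y (fst z) (snd z)) \<in> borel_measurable (borel \<Otimes>\<^sub>M driver)"
proof -
  have [measurable]: "(\<lambda>z. jtime x (snd z) n) \<in> borel_measurable (borel \<Otimes>\<^sub>M driver)" for n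
    using measurable_compose[OF measurable_snd jtime_measurable] .
  have [measurable]: "Measurable.pred (borel \<Otimes>\<^sub>M driver) (\<lambda>z. alive N x (fst z) (snd z))"
    unfolding alive_def by measurable
  show ?thesis unfolding visit_upto_def by measurable
qed

lemma pair_measurable_section1:
  assumes "(\<lambda>z. f (fst z) (snd z)) \<in> borel_measurable (borel \<Otimes>\<^sub>M driver)"
  shows "(\<lambda>t. f t \<omega>) \<in> borel_measurable (borel :: real measure)"
proof -
  have "(\<lambda>t. (t, \<omega>)) \<in> measurable borel (borel \<Otimes>\<^sub>M driver)"
    by (rule measurable_Pair2') (simp add: space_driver)
  from measurable_compose[OF this assms] show ?thesis by simp
qed

lemma pair_measurable_integral1:
  fixes f :: "real \<Rightarrow> 'v driver \<Rightarrow> ennreal"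
  assumes "(\<lambda>z. f (fst z) (snd z)) \<in> borel_measurable (borel \<Otimes>\<^sub>M driver)"
  shows "(\<lambda>\<omega>. \<integral>\<^sup>+t. f t \<omega> \<partial>lborel) \<in> borel_measurable driver"
proof -
  have "(\<lambda>p. (snd p, fst p)) \<in> measurable (driver \<Otimes>\<^sub>M lborel) (borel \<Otimes>\<^sub>M driver)" by measurable
  from measurable_compose[OF this assms] have "(\<lambda>p. f (snd p) (fst p)) \<in> borel_measurable (driver \<Otimes>\<^sub>M lborel)" by simp
  then show ?thesis
    using sigma_finite_measure.borel_measurable_nn_integral[OF sigma_finite_lborel, of "\<lambda>\<omega> t. f t \<omega>" driver]
    by (simp add: case_prod_unfold)
qed

text \<open>During the first sojourn only the starting vertex is seen, with discount
  \<open>exp (- lam x * t)\<close>. After it, the discount is the product of the discount of the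
  whole first sojourn and that of the restarted process.\<close>

lemma visit_upto_shift:
  assumes h: "h = \<tau> / rate x" "0 \<le> h"
  shows "visit_upto (Suc N) x y t ((g, \<tau>) ## \<omega>) =
    ennreal (if 0 \<le> t \<and> t < h \<and> x = y then exp (- lam x * t) else 0) +
    (case g x of None \<Rightarrow> 0 | Some z \<Rightarrow> ennreal (exp (- lam x * h)) * visit_upto N z y (t - h) \<omega>)"
proof (cases "t < h")
  case True
  have "(\<Sum>v\<in>UNIV. lam v * (if v = x then t else 0)) = lam x * t" by (simp add: if_distrib cong: if_cong)
  then have "0 \<le> t \<Longrightarrow> discount x t ((g, \<tau>) ## \<omega>) = exp (- lam x * t)"
    using occ_before[OF h(1)] True by (simp add: discount_def)
  then show ?thesis
    using True proc_before[OF h(1) True] alive_shift[OF h(1)]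
    by (auto simp: visit_upto_def visit_def split: option.split)
next
  case False
  show ?thesis
  proof (cases "g x")
    case None
    then show ?thesis using False proc_killed[OF h(1) False] by (simp add: visit_upto_def visit_def)
  next
    case (Some z)
    have "(\<Sum>v\<in>UNIV. lam v * ((if v = x then h else 0) + occ z (t - h) \<omega> v)) =
        lam x * h + (\<Sum>v\<in>UNIV. lam v * occ z (t - h) \<omega> v)"
    proof -
      have "(\<Sum>v\<in>UNIV. lam v * (if v = x then h else 0)) = lam x * h" by (simp add: if_distrib cong: if_cong)
      then show ?thesis unfolding distrib_left sum.distrib by simp
    qed
    then have "discount x t ((g, \<tau>) ## \<omega>) = exp (- lam x * h) * discount z (t - h) \<omega>"
      using occ_after[where x = x and g = g and z = z, OF h _ Some] False by (simp add: discount_def exp_add[symmetric])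
    moreover have "proc x t ((g, \<tau>) ## \<omega>) = proc z (t - h) \<omega>" using proc_after[OF h(1) False] Some .
    moreover have "alive (Suc N) x t ((g, \<tau>) ## \<omega>) = alive N z (t - h) \<omega>"
      using alive_shift[OF h(1)] False Some by auto
    moreover have "0 \<le> t - h" "0 \<le> t" using False h(2) by auto
    ultimately show ?thesis using False Some
      by (simp add: visit_upto_def visit_def ennreal_mult discount_nonneg)
  qed
qed

definition green_upto :: "nat \<Rightarrow> 'v \<Rightarrow> 'v \<Rightarrow> ennreal" where
  "green_upto N x y = (\<integral>\<^sup>+\<omega>. \<integral>\<^sup>+t. visit_upto N x y t \<omega> \<partial>lborel \<partial>driver)"

lemma integral_visit_upto_shift:
  assumes h: "h = \<tau> / rate x" "0 \<le> h"
  shows "(\<integral>\<^sup>+\<omega>. \<integral>\<^sup>+t. visit_upto (Suc N) x y t ((g, \<tau>) ## \<omega>) \<partial>lborel \<partial>driver) =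
    (\<integral>\<^sup>+t. ennreal (if 0 \<le> t \<and> t < h \<and> x = y then exp (- lam x * t) else 0) \<partial>lborel) +
    (case g x of None \<Rightarrow> 0 | Some z \<Rightarrow> ennreal (exp (- lam x * h)) * green_upto N z y)"
proof -
  interpret D: prob_space driver by (rule prob_driver)
  let ?a = "\<lambda>t. ennreal (if 0 \<le> t \<and> t < h \<and> x = y then exp (- lam x * t) else 0)"
  have a: "?a \<in> borel_measurable lborel" by measurable
  show ?thesis
  proof (cases "g x")
    case None
    then show ?thesis unfolding visit_upto_shift[OF h] by (simp add: D.emeasure_space_1)
  next
    case (Some z)
    have m: "(\<lambda>t. visit_upto N z y t \<omega>) \<in> borel_measurable borel" for \<omega>
      by (rule pair_measurable_section1) measurable
    have shift: "(\<integral>\<^sup>+t. visit_upto N z y (t - h) \<omega> \<partial>lborel) = (\<integral>\<^sup>+t. visit_upto N z y t \<omega> \<partial>lborel)" for \<omega>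
      using nn_integral_real_affine[where c = 1 and t = "- h", OF m] by simp
    have m': "(\<lambda>t. visit_upto N z y (t - h) \<omega>) \<in> borel_measurable borel" for \<omega>
      by (rule measurable_compose[OF _ m]) measurable
    have "(\<integral>\<^sup>+t. visit_upto (Suc N) x y t ((g, \<tau>) ## \<omega>) \<partial>lborel) =
        (\<integral>\<^sup>+t. ?a t \<partial>lborel) + ennreal (exp (- lam x * h)) * (\<integral>\<^sup>+t. visit_upto N z y t \<omega> \<partial>lborel)" for \<omega>
      unfolding visit_upto_shift[OF h] Some option.case shift[symmetric]
      using a m' by (subst nn_integral_add) (auto simp: nn_integral_cmult)
    then show ?thesis
      using pair_measurable_integral1[OF visit_upto_measurable, of N z y]
      by (simp add: Some green_upto_def nn_integral_add nn_integral_cmult D.emeasure_space_1)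
  qed
qed

text \<open>The probability that the first jump or killing, at rate \<open>rate x\<close>, precedes
  an independent exponential clock of rate \<open>lam x\<close>.\<close>

lemma holding_integral:
  "(\<integral>\<^sup>+\<tau>. ennreal (exponential_density 1 \<tau>) * ennreal (exp (- lam x * (\<tau> / rate x))) \<partial>lborel) =
    ennreal (rate x / (rate x + lam x))"
proof -
  have r: "rate x > 0" by (rule rate_pos)
  have "(\<integral>\<^sup>+\<tau>. ennreal (exponential_density 1 \<tau>) * ennreal (exp (- lam x * (\<tau> / rate x))) \<partial>lborel) =
    (\<integral>\<^sup>+\<tau>. ennreal (if 0 \<le> \<tau> then exp (- (1 + lam x / rate x) * \<tau>) else 0) \<partial>lborel)"
    by (intro nn_integral_cong)
      (auto simp: exponential_density_def ennreal_mult[symmetric] exp_add[symmetric] algebra_simps)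
  also have "\<dots> = ennreal (1 / (1 + lam x / rate x))"
    by (rule nn_integral_exp_decay) (use r lam[of x] in \<open>simp add: add_pos_nonneg\<close>)
  also have "1 / (1 + lam x / rate x) = rate x / (rate x + lam x)"
    using r lam[of x] by (simp add: field_simps)
  finally show ?thesis .
qed

text \<open>The mean discounted duration of the first sojourn. Exchanging the two integrals leaves
  the tail of the exponential law at \<open>rate x * t\<close>.\<close>

lemma sojourn_integral:
  "(\<integral>\<^sup>+\<tau>. ennreal (exponential_density 1 \<tau>) *
      (\<integral>\<^sup>+t. ennreal (if 0 \<le> t \<and> t < \<tau> / rate x \<and> x = y then exp (- lam x * t) else 0) \<partial>lborel) \<partial>lborel) =
    ennreal (of_bool (x = y) / (rate x + lam x))"
proof (cases "x = y")
  case True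
  have r: "rate x > 0" by (rule rate_pos)
  let ?f = "\<lambda>\<tau> t. ennreal (if 0 \<le> t \<and> rate x * t < \<tau> then exp (- lam x * t) * exp (- \<tau>) else 0)"
  have "(\<integral>\<^sup>+\<tau>. ennreal (exponential_density 1 \<tau>) *
      (\<integral>\<^sup>+t. ennreal (if 0 \<le> t \<and> t < \<tau> / rate x \<and> x = y then exp (- lam x * t) else 0) \<partial>lborel) \<partial>lborel) =
     (\<integral>\<^sup>+\<tau>. \<integral>\<^sup>+t. ?f \<tau> t \<partial>lborel \<partial>lborel)"
  proof (rule nn_integral_cong)
    fix \<tau> :: real
    have "(\<integral>\<^sup>+t. ?f \<tau> t \<partial>lborel) = (\<integral>\<^sup>+t. ennreal (exponential_density 1 \<tau>) *
        ennreal (if 0 \<le> t \<and> t < \<tau> / rate x \<and> x = y then exp (- lam x * t) else 0) \<partial>lborel)"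
    proof (rule nn_integral_cong)
      fix t :: real
      have "t < \<tau> / rate x \<longleftrightarrow> rate x * t < \<tau>" using r by (simp add: pos_less_divide_eq mult.commute)
      moreover have "0 \<le> t \<Longrightarrow> rate x * t < \<tau> \<Longrightarrow> 0 \<le> \<tau>" using r by (smt (verit) mult_nonneg_nonneg)
      ultimately show "?f \<tau> t = ennreal (exponential_density 1 \<tau>) *
        ennreal (if 0 \<le> t \<and> t < \<tau> / rate x \<and> x = y then exp (- lam x * t) else 0)"
        using True by (auto simp: exponential_density_def ennreal_mult[symmetric] mult.commute)
    qed
    then show "ennreal (exponential_density 1 \<tau>) *
      (\<integral>\<^sup>+t. ennreal (if 0 \<le> t \<and> t < \<tau> / rate x \<and> x = y then exp (- lam x * t) else 0) \<partial>lborel) = (\<integral>\<^sup>+t. ?f \<tau> t \<partial>lborel)"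
      by (simp add: nn_integral_cmult)
  qed
  also have "\<dots> = (\<integral>\<^sup>+t. \<integral>\<^sup>+\<tau>. ?f \<tau> t \<partial>lborel \<partial>lborel)"
    by (rule lborel_pair.Fubini') measurable
  also have "\<dots> = (\<integral>\<^sup>+t. ennreal (if 0 \<le> t then exp (- (lam x + rate x) * t) else 0) \<partial>lborel)"
  proof (rule nn_integral_cong)
    fix t :: real
    have "(\<integral>\<^sup>+\<tau>. ?f \<tau> t \<partial>lborel) = (\<integral>\<^sup>+\<tau>. ennreal (if 0 \<le> t then exp (- lam x * t) else 0) *
        ennreal (if rate x * t < \<tau> then exp (- \<tau>) else 0) \<partial>lborel)"
      by (intro nn_integral_cong) (auto simp: ennreal_mult[symmetric])
    also have "\<dots> = ennreal (if 0 \<le> t then exp (- lam x * t) else 0) *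
        (\<integral>\<^sup>+\<tau>. ennreal (if rate x * t < \<tau> then exp (- \<tau>) else 0) \<partial>lborel)"
      by (rule nn_integral_cmult) measurable
    also have "\<dots> = ennreal (if 0 \<le> t then exp (- (lam x + rate x) * t) else 0)"
      using nn_integral_exp_tail[of "rate x * t"] r
      by (auto simp: ennreal_mult[symmetric] exp_add[symmetric] algebra_simps)
    finally show "(\<integral>\<^sup>+\<tau>. ?f \<tau> t \<partial>lborel) = ennreal (if 0 \<le> t then exp (- (lam x + rate x) * t) else 0)" .
  qed
  also have "\<dots> = ennreal (1 / (lam x + rate x))"
    by (rule nn_integral_exp_decay) (use r lam[of x] in linarith)
  finally show ?thesis using True by (simp add: add.commute)
qed simp

text \<open>Of the independent family \<open>g\<close> only the component at the current vertex
  enters, and its marginal law is the jump law of that vertex.\<close>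

lemma jump_integral:
  "(\<integral>\<^sup>+g. (case g x of None \<Rightarrow> 0 | Some z \<Rightarrow> k z) \<partial>jump_law) = (\<Sum>z\<in>UNIV. ennreal (cond x z / rate x) * k z)"
proof -
  have "(\<integral>\<^sup>+g. (case g x of None \<Rightarrow> 0 | Some z \<Rightarrow> k z) \<partial>jump_law) =
     (\<integral>\<^sup>+w. (case w of None \<Rightarrow> 0 | Some z \<Rightarrow> k z) \<partial>measure_pmf (map_pmf (\<lambda>f. f x) (Pi_pmf UNIV None (jump_pmf E C \<kappa>))))"
    by simp
  also have "map_pmf (\<lambda>f. f x) (Pi_pmf UNIV None (jump_pmf E C \<kappa>)) = jump_pmf E C \<kappa> x"
    by (subst Pi_pmf_component) auto
  also have "(\<integral>\<^sup>+w. (case w of None \<Rightarrow> 0 | Some z \<Rightarrow> k z) \<partial>measure_pmf (jump_pmf E C \<kappa> x)) =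
     (\<Sum>w\<in>UNIV. ennreal (pmf (jump_pmf E C \<kappa> x) w) * (case w of None \<Rightarrow> 0 | Some z \<Rightarrow> k z))"
    by (simp add: nn_integral_measure_pmf nn_integral_count_space_finite)
  also have "\<dots> = (\<Sum>z\<in>UNIV. ennreal (cond x z / rate x) * k z)"
    unfolding UNIV_option_conv by (simp add: sum.reindex jump_pmf_Some)
  finally show ?thesis .
qed

lemma green_upto_Suc:
  "green_upto (Suc N) x y = ennreal (of_bool (x = y) / (rate x + lam x)) +
    ennreal (rate x / (rate x + lam x)) * (\<Sum>z\<in>UNIV. ennreal (cond x z / rate x) * green_upto N z y)"
proof -
  interpret T: prob_space exp_law by (rule prob_exp_law)
  interpret S: prob_space step_measure by (rule prob_step)
  let ?\<Psi> = "\<lambda>\<omega>. \<integral>\<^sup>+t. visit_upto (Suc N) x y t \<omega> \<partial>lborel"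
  have m: "?\<Psi> \<in> borel_measurable (stream_space step_measure)"
    using pair_measurable_integral1[OF visit_upto_measurable, of "Suc N" x y] by (simp add: driver_eq)
  interpret SS: prob_space "stream_space step_measure" by (rule S.prob_space_stream_space)
  have "(\<lambda>p. fst p ## snd p) \<in> measurable (step_measure \<Otimes>\<^sub>M stream_space step_measure) (stream_space step_measure)"
    by measurable
  from measurable_compose[OF this m]
  have m2: "(\<lambda>s. \<integral>\<^sup>+\<omega>. ?\<Psi> (s ## \<omega>) \<partial>stream_space step_measure) \<in> borel_measurable step_measure"
    using SS.borel_measurable_nn_integral[of "\<lambda>s \<omega>. ?\<Psi> (s ## \<omega>)" step_measure] by (simp add: case_prod_unfold)
  define F where "F s = (\<integral>\<^sup>+\<omega>. ?\<Psi> (s ## \<omega>) \<partial>driver)" for s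
  have mF: "F \<in> borel_measurable (jump_law \<Otimes>\<^sub>M exp_law)"
    using m2 unfolding F_def[abs_def] driver_eq step_measure_def .
  have mFg: "(\<lambda>\<tau>. F (g, \<tau>)) \<in> borel_measurable borel" for g
  proof -
    have "(\<lambda>\<tau>. (g, \<tau>)) \<in> measurable borel (jump_law \<Otimes>\<^sub>M exp_law)" by measurable
    from measurable_compose[OF this mF] show ?thesis .
  qed
  let ?K = "\<lambda>g :: 'v \<Rightarrow> 'v option. case g x of None \<Rightarrow> 0 | Some z \<Rightarrow> green_upto N z y"
  let ?a = "\<lambda>\<tau>. \<integral>\<^sup>+t. ennreal (if 0 \<le> t \<and> t < \<tau> / rate x \<and> x = y then exp (- lam x * t) else 0) \<partial>lborel"
  let ?b = "\<lambda>\<tau>. ennreal (exp (- lam x * (\<tau> / rate x)))"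
  let ?d = "\<lambda>\<tau>. ennreal (exponential_density 1 \<tau>)"
  have ma: "?a \<in> borel_measurable borel"
  proof -
    have "(\<lambda>(\<tau>, t). ennreal (if 0 \<le> t \<and> t < \<tau> / rate x \<and> x = y then exp (- lam x * t) else 0)) \<in> borel_measurable (borel \<Otimes>\<^sub>M lborel)"
      by measurable
    from sigma_finite_measure.borel_measurable_nn_integral[OF sigma_finite_lborel this] show ?thesis .
  qed
  have inner: "(\<integral>\<^sup>+\<tau>. F (g, \<tau>) \<partial>exp_law) =
      ennreal (of_bool (x = y) / (rate x + lam x)) + ennreal (rate x / (rate x + lam x)) * ?K g" for g
  proof -
    have "(\<integral>\<^sup>+\<tau>. F (g, \<tau>) \<partial>exp_law) = (\<integral>\<^sup>+\<tau>. ?d \<tau> * F (g, \<tau>) \<partial>lborel)"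
      using mFg by (subst nn_integral_density) auto
    also have "\<dots> = (\<integral>\<^sup>+\<tau>. ?d \<tau> * ?a \<tau> + (?d \<tau> * ?b \<tau>) * ?K g \<partial>lborel)"
    proof (rule nn_integral_cong)
      fix \<tau> :: real
      show "?d \<tau> * F (g, \<tau>) = ?d \<tau> * ?a \<tau> + (?d \<tau> * ?b \<tau>) * ?K g"
      \<comment> \<open>The shift identity is available for nonnegative holding times only; negative
        ones have density zero.\<close>
      proof (cases "\<tau> < 0")
        case True
        then show ?thesis by (simp add: exponential_density_def)
      next
        case False
        then have "0 \<le> \<tau> / rate x" using rate_pos[of x] by simp
        from integral_visit_upto_shift[OF refl this, of N y g]
        have "F (g, \<tau>) = ?a \<tau> + ?b \<tau> * ?K g" unfolding F_def by (auto split: option.split)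
        then show ?thesis by (simp add: distrib_left mult.assoc)
      qed
    qed
    also have "\<dots> = (\<integral>\<^sup>+\<tau>. ?d \<tau> * ?a \<tau> \<partial>lborel) + (\<integral>\<^sup>+\<tau>. ?d \<tau> * ?b \<tau> \<partial>lborel) * ?K g"
      using ma by (subst nn_integral_add) (auto simp: nn_integral_multc)
    finally show ?thesis unfolding sojourn_integral holding_integral .
  qed
  have "green_upto (Suc N) x y = (\<integral>\<^sup>+s. F s \<partial>step_measure)"
    unfolding green_upto_def driver_eq F_def by (rule S.nn_integral_stream_space[OF m])
  also have "\<dots> = (\<integral>\<^sup>+g. \<integral>\<^sup>+\<tau>. F (g, \<tau>) \<partial>exp_law \<partial>jump_law)"
    unfolding step_measure_def using T.nn_integral_fst[OF mF] by simp
  also have "\<dots> = (\<integral>\<^sup>+g. ennreal (of_bool (x = y) / (rate x + lam x)) + ennreal (rate x / (rate x + lam x)) * ?K g \<partial>jump_law)"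
    unfolding inner ..
  also have "\<dots> = ennreal (of_bool (x = y) / (rate x + lam x)) + ennreal (rate x / (rate x + lam x)) * (\<integral>\<^sup>+g. ?K g \<partial>jump_law)"
    by (subst nn_integral_add) (auto simp: nn_integral_cmult measure_pmf.emeasure_space_1[simplified])
  finally show ?thesis unfolding jump_integral .
qed

text \<open>A positive function with \<open>lap u = 1\<close> is a supersolution of the recursion
  for every target \<open>y\<close> and every \<open>lam\<close>, so the bound passes through the
  induction and is uniform in \<open>N\<close>.\<close>

lemma green_upto_bound:
  assumes u: "\<And>x. lap u x = 1" "\<And>x. 0 < u x"
  shows "green_upto N x y \<le> ennreal (u x)"
proof (induction N arbitrary: x)
  case 0
  then show ?case by (simp add: green_upto_def visit_upto_def alive_def)
next
  case (Suc N)
  have r: "0 < rate x" "0 < rate x + lam x" using rate_pos[of x] lam[of x] by linarith+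
  have "green_upto (Suc N) x y \<le> ennreal (of_bool (x = y) / (rate x + lam x)) +
    ennreal (rate x / (rate x + lam x)) * (\<Sum>z\<in>UNIV. ennreal (cond x z / rate x) * ennreal (u z))"
    unfolding green_upto_Suc by (intro add_left_mono mult_left_mono sum_mono Suc.IH) auto
  also have "\<dots> = ennreal (of_bool (x = y) / (rate x + lam x) +
      rate x / (rate x + lam x) * (\<Sum>z\<in>UNIV. cond x z / rate x * u z))"
    using r cond_nonneg less_imp_le[OF u(2)]
    by (simp add: ennreal_mult[symmetric] sum_ennreal ennreal_plus[symmetric] sum_nonneg del: ennreal_plus)
  also have "\<dots> \<le> ennreal (u x)"
  proof (rule ennreal_leI)
    have "(\<Sum>z\<in>UNIV. cond x z / rate x * u z) = (\<Sum>z\<in>UNIV. cond x z * u z) / rate x"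
      by (simp add: sum_divide_distrib)
    then have "of_bool (x = y) / (rate x + lam x) + rate x / (rate x + lam x) * (\<Sum>z\<in>UNIV. cond x z / rate x * u z) =
       (of_bool (x = y) + (\<Sum>z\<in>UNIV. cond x z * u z)) / (rate x + lam x)"
      using r by (simp add: add_divide_distrib)
    also have "\<dots> \<le> (1 + (\<Sum>z\<in>UNIV. cond x z * u z)) / (rate x + lam x)"
      using r by (intro divide_right_mono) auto
    also have "1 + (\<Sum>z\<in>UNIV. cond x z * u z) = rate x * u x" using u(1)[of x] by (simp add: lap_def)
    also have "rate x * u x / (rate x + lam x) \<le> u x"
      using r lam[of x] u(2)[of x] by (simp add: divide_le_eq mult.commute mult_left_mono distrib_left)
    finally show "of_bool (x = y) / (rate x + lam x) + rate x / (rate x + lam x) * (\<Sum>z\<in>UNIV. cond x z / rate x * u z) \<le> u x" .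
  qed
  finally show ?case .
qed

definition green :: "'v \<Rightarrow> 'v \<Rightarrow> ennreal" where
  "green x y = (\<integral>\<^sup>+\<omega>. \<integral>\<^sup>+t. visit x y t \<omega> \<partial>lborel \<partial>driver)"

lemma visit_upto_incseq: "incseq (\<lambda>N. visit_upto N x y t \<omega>)"
  unfolding incseq_def visit_upto_def alive_def by (auto intro: order_less_le_trans)

text \<open>If the process is at \<open>y\<close> at time \<open>t\<close>, some jump time exceeds
  \<open>t\<close>, so the visit is counted from some \<open>N\<close> on; beyond all jump times the
  process is in the cemetery by definition. The rest is monotone convergence.\<close>

lemma green_sup: "green x y = (SUP N. green_upto N x y)"
proof -
  have sup: "visit x y t \<omega> = (SUP N. visit_upto N x y t \<omega>)" for t \<omega>
  proof (cases "proc x t \<omega> = Some y")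
    case True
    then have "\<exists>n. t < jtime x \<omega> (Suc n)" unfolding jump_process_def by (auto split: if_splits)
    then obtain n where "alive (Suc n) x t \<omega>" unfolding alive_def by blast
    then have "visit x y t \<omega> \<le> (SUP N. visit_upto N x y t \<omega>)"
      by (intro SUP_upper2[of "Suc n"]) (auto simp: visit_upto_def)
    moreover have "(SUP N. visit_upto N x y t \<omega>) \<le> visit x y t \<omega>"
      by (intro SUP_least) (simp add: visit_upto_def)
    ultimately show ?thesis by (rule antisym)
  next
    case False
    then have "visit_upto N x y t \<omega> = 0" "visit x y t \<omega> = 0" for N by (simp_all add: visit_def visit_upto_def)
    then show ?thesis by simp
  qed
  have m: "(\<lambda>t. visit_upto N x y t \<omega>) \<in> borel_measurable lborel" for N \<omega>
    using pair_measurable_section1[OF visit_upto_measurable] by simp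
  have "green x y = (\<integral>\<^sup>+\<omega>. (SUP N. \<integral>\<^sup>+t. visit_upto N x y t \<omega> \<partial>lborel) \<partial>driver)"
    unfolding green_def sup
    by (intro nn_integral_cong nn_integral_monotone_convergence_SUP m)
      (use visit_upto_incseq in \<open>auto simp: incseq_def le_fun_def\<close>)
  also have "\<dots> = (SUP N. green_upto N x y)"
    unfolding green_upto_def
    by (intro nn_integral_monotone_convergence_SUP pair_measurable_integral1 visit_upto_measurable)
      (use visit_upto_incseq in \<open>auto simp: incseq_def le_fun_def intro!: nn_integral_mono\<close>)
  finally show ?thesis .
qed

lemma green_finite: "green x y < \<infinity>"
proof -
  obtain u where u: "\<forall>x. lap u x = 1" "\<forall>x. 0 < u x" using lap_solution by blast
  have "green x y \<le> ennreal (u x)" unfolding green_sup by (rule SUP_least) (use green_upto_bound u in auto)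
  then show ?thesis using ennreal_less_top order_le_less_trans by (metis infinity_ennreal_def)
qed

text \<open>The limit of the recursion in \<open>N\<close>. Finiteness of the Green function is what
  permits the passage from extended nonnegative values to the reals, where terms can be
  subtracted.\<close>

lemma green_equation:
  "(rate x + lam x) * enn2real (green x y) - (\<Sum>z\<in>UNIV. cond x z * enn2real (green z y)) = of_bool (x = y)"
proof -
  have r: "0 < rate x" "0 < rate x + lam x" using rate_pos[of x] lam[of x] by linarith+
  have inc: "incseq (\<lambda>N. green_upto N z y)" for z
    unfolding incseq_def green_upto_def
    using visit_upto_incseq by (auto simp: incseq_def intro!: nn_integral_mono)
  have lim: "(\<lambda>N. green_upto N z y) \<longlonglongrightarrow> green z y" for z
    unfolding green_sup by (rule LIMSEQ_SUP[OF inc])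
  have "(\<lambda>N. ennreal (of_bool (x = y) / (rate x + lam x)) +
      ennreal (rate x / (rate x + lam x)) * (\<Sum>z\<in>UNIV. ennreal (cond x z / rate x) * green_upto N z y)) \<longlonglongrightarrow>
     ennreal (of_bool (x = y) / (rate x + lam x)) +
      ennreal (rate x / (rate x + lam x)) * (\<Sum>z\<in>UNIV. ennreal (cond x z / rate x) * green z y)"
    by (intro tendsto_add tendsto_const ennreal_tendsto_cmult tendsto_sum lim) auto
  then have "(\<lambda>N. green_upto (Suc N) x y) \<longlonglongrightarrow>
     ennreal (of_bool (x = y) / (rate x + lam x)) +
      ennreal (rate x / (rate x + lam x)) * (\<Sum>z\<in>UNIV. ennreal (cond x z / rate x) * green z y)"
    unfolding green_upto_Suc .
  moreover have "(\<lambda>N. green_upto (Suc N) x y) \<longlonglongrightarrow> green x y" using lim[of x] by (rule LIMSEQ_Suc)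
  ultimately have eq: "green x y = ennreal (of_bool (x = y) / (rate x + lam x)) +
      ennreal (rate x / (rate x + lam x)) * (\<Sum>z\<in>UNIV. ennreal (cond x z / rate x) * green z y)"
    by (rule LIMSEQ_unique[rotated])
  define G where "G z = enn2real (green z y)" for z
  have G: "green z y = ennreal (G z)" "0 \<le> G z" for z using green_finite[of z y] by (simp_all add: G_def)
  have "ennreal (G x) = ennreal (of_bool (x = y) / (rate x + lam x) +
      rate x / (rate x + lam x) * (\<Sum>z\<in>UNIV. cond x z / rate x * G z))"
    using eq r cond_nonneg G(2) unfolding G(1)
    by (simp add: ennreal_mult[symmetric] sum_ennreal ennreal_plus[symmetric] sum_nonneg del: ennreal_plus)
  moreover have "0 \<le> (\<Sum>z\<in>UNIV. cond x z / rate x * G z)"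
    by (intro sum_nonneg mult_nonneg_nonneg divide_nonneg_nonneg) (use r cond_nonneg G(2) in auto)
  then have "0 \<le> of_bool (x = y) / (rate x + lam x) + rate x / (rate x + lam x) * (\<Sum>z\<in>UNIV. cond x z / rate x * G z)"
    using r lam[of x] by (intro add_nonneg_nonneg mult_nonneg_nonneg divide_nonneg_nonneg) auto
  ultimately have "G x = of_bool (x = y) / (rate x + lam x) + rate x / (rate x + lam x) * (\<Sum>z\<in>UNIV. cond x z / rate x * G z)"
    using ennreal_inj[OF G(2)] by blast
  also have "(\<Sum>z\<in>UNIV. cond x z / rate x * G z) = (\<Sum>z\<in>UNIV. cond x z * G z) / rate x"
    by (simp add: sum_divide_distrib)
  also have "of_bool (x = y) / (rate x + lam x) + rate x / (rate x + lam x) * ((\<Sum>z\<in>UNIV. cond x z * G z) / rate x) =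
      (of_bool (x = y) + (\<Sum>z\<in>UNIV. cond x z * G z)) / (rate x + lam x)"
    using r by (simp add: add_divide_distrib)
  finally have "(rate x + lam x) * G x = of_bool (x = y) + (\<Sum>z\<in>UNIV. cond x z * G z)"
    using r by simp
  then show ?thesis by (simp add: G_def)
qed

end

end

section \<open>Path measures\<close>

lemma path_space_fst [measurable]: "fst \<in> borel_measurable path_space"
  unfolding path_space_def by (rule measurable_restrict_space1) (rule measurable_fst)

lemma path_space_eval: "(\<lambda>\<gamma>. snd \<gamma> s) \<in> measurable (path_space :: 'v::finite path measure) (count_space UNIV)"
proof -
  have "(\<lambda>\<gamma>. snd \<gamma> s) \<in> measurable (borel \<Otimes>\<^sub>M (\<Pi>\<^sub>M s\<in>UNIV. count_space UNIV)) (count_space (UNIV :: 'v set))"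
    by (rule measurable_compose[OF measurable_snd measurable_component_singleton]) simp
  then show ?thesis unfolding path_space_def by (rule measurable_restrict_space1)
qed

lemma path_space_right_continuous:
  assumes "\<gamma> \<in> space (path_space :: 'v::finite path measure)" "0 \<le> s" "s < fst \<gamma>"
  obtains \<epsilon> where "\<epsilon> > 0" "\<And>u. s \<le> u \<Longrightarrow> u < s + \<epsilon> \<Longrightarrow> u \<le> fst \<gamma> \<Longrightarrow> snd \<gamma> u = snd \<gamma> s"
proof -
  have "\<gamma> \<in> {(T, \<gamma>). 0 \<le> T \<and> \<gamma> \<in> extensional {0..T} \<and>
       (\<forall>s. 0 \<le> s \<and> s < T \<longrightarrow> (\<exists>\<epsilon>>0. \<forall>u. s \<le> u \<and> u < s + \<epsilon> \<and> u \<le> T \<longrightarrow> \<gamma> u = \<gamma> s))}"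
    using assms(1) unfolding path_space_def space_restrict_space by (rule IntD1)
  then have "\<forall>s. 0 \<le> s \<and> s < fst \<gamma> \<longrightarrow>
      (\<exists>\<epsilon>>0. \<forall>u. s \<le> u \<and> u < s + \<epsilon> \<and> u \<le> fst \<gamma> \<longrightarrow> snd \<gamma> u = snd \<gamma> s)"
    unfolding mem_Collect_eq case_prod_unfold by (elim conjE)
  from this[rule_format, OF conjI[OF assms(2,3)]]
  obtain \<epsilon> where e: "\<epsilon> > 0" "\<forall>u. s \<le> u \<and> u < s + \<epsilon> \<and> u \<le> fst \<gamma> \<longrightarrow> snd \<gamma> u = snd \<gamma> s"
    by (elim exE conjE)
  show ?thesis by (rule that[OF e(1)]) (rule e(2)[rule_format], intro conjI, assumption+)
qed

text \<open>A grid point strictly to the right of \<open>t\<close> and at distance at most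
  \<open>1 / real (Suc n)\<close>. Paths are only right-continuous, so they must be sampled from the
  right.\<close>

definition grid :: "nat \<Rightarrow> real \<Rightarrow> real" where
  "grid n t = (of_int \<lfloor>t * real (Suc n)\<rfloor> + 1) / real (Suc n)"

lemma grid_bounds: "t < grid n t" "grid n t \<le> t + 1 / real (Suc n)"
proof -
  define d where "d = real (Suc n)"
  have d: "d > 0" by (simp add: d_def)
  have fl: "t * d < of_int \<lfloor>t * d\<rfloor> + 1" "of_int \<lfloor>t * d\<rfloor> \<le> t * d" by linarith+
  show "t < grid n t" unfolding grid_def d_def[symmetric] using fl(1) d by (simp add: pos_less_divide_eq)
  have "of_int \<lfloor>t * d\<rfloor> / d \<le> t" using fl(2) d by (simp add: pos_divide_le_eq)
  then show "grid n t \<le> t + 1 / real (Suc n)" unfolding grid_def d_def[symmetric] add_divide_distrib by simp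
qed

text \<open>At a time before the lifetime the path is constant for a while to the right, and grid
  points eventually fall into this stretch. At the lifetime itself there is no room to the right,
  hence the half-open interval.\<close>

lemma occupation_integrand_limit:
  assumes \<gamma>: "\<gamma> \<in> space (path_space :: 'v::finite path measure)"
  shows "(\<lambda>n. indicator {0..<fst \<gamma>} t * indicator {x} (snd \<gamma> (grid n t)) :: real) \<longlonglongrightarrow>
     indicator {0..<fst \<gamma>} t * indicator {x} (snd \<gamma> t)"
proof (cases "t \<in> {0..<fst \<gamma>}")
  case True
  then obtain \<epsilon> where e: "\<epsilon> > 0" "\<And>u. t \<le> u \<Longrightarrow> u < t + \<epsilon> \<Longrightarrow> u \<le> fst \<gamma> \<Longrightarrow> snd \<gamma> u = snd \<gamma> t"
    using path_space_right_continuous[OF \<gamma>, of t] by auto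
  define d where "d = min \<epsilon> (fst \<gamma> - t)"
  have "d > 0" using e(1) True by (simp add: d_def)
  then obtain n0 where n0: "1 / real (Suc n0) < d"
    using reals_Archimedean[of d] by (auto simp: inverse_eq_divide)
  have "snd \<gamma> (grid n t) = snd \<gamma> t" if "n \<ge> n0" for n
  proof -
    have "1 / real (Suc n) \<le> 1 / real (Suc n0)" using that by (intro divide_left_mono) auto
    then have "grid n t < t + d" using grid_bounds(2)[of n t] n0 by linarith
    then show ?thesis using grid_bounds(1)[of t n] by (intro e(2)) (auto simp: d_def)
  qed
  then have "eventually (\<lambda>n. indicator {0..<fst \<gamma>} t * indicator {x} (snd \<gamma> (grid n t)) =
      (indicator {0..<fst \<gamma>} t * indicator {x} (snd \<gamma> t) :: real)) sequentially"
    unfolding eventually_sequentially by (intro exI[of _ n0]) simp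
  then show ?thesis by (rule tendsto_eventually)
qed simp

text \<open>The product sigma-algebra controls evaluations at single times only. Each approximation
  involves countably many of them, one per grid point, and is therefore measurable; the limit
  inherits this.\<close>

lemma occupation_integrand_measurable:
  "(\<lambda>p. indicator {0..<fst (fst p)} (snd p) * indicator {x} (snd (fst p) (snd p)) :: real)
     \<in> borel_measurable ((path_space :: 'v::finite path measure) \<Otimes>\<^sub>M lborel)"
proof (rule borel_measurable_LIMSEQ_real[where u="\<lambda>n p. indicator {0..<fst (fst p)} (snd p) * indicator {x} (snd (fst p) (grid n (snd p)))"])
  fix p :: "'v path \<times> real" assume "p \<in> space (path_space \<Otimes>\<^sub>M lborel)"
  then show "(\<lambda>n. indicator {0..<fst (fst p)} (snd p) * indicator {x} (snd (fst p) (grid n (snd p))) :: real)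
      \<longlonglongrightarrow> indicator {0..<fst (fst p)} (snd p) * indicator {x} (snd (fst p) (snd p))"
    by (intro occupation_integrand_limit) (auto simp: space_pair_measure)
next
  fix n
  have f: "(\<lambda>p. indicator {x} (snd (fst p) ((of_int i + 1) / real (Suc n))) :: real)
      \<in> borel_measurable ((path_space :: 'v path measure) \<Otimes>\<^sub>M lborel)" for i :: int
  proof -
    have "(\<lambda>\<gamma>. snd \<gamma> ((of_int i + 1) / real (Suc n))) \<in> measurable (path_space :: 'v path measure) (count_space UNIV)"
      by (rule path_space_eval)
    from measurable_compose[OF measurable_fst this]
    have "(\<lambda>p. snd (fst p) ((of_int i + 1) / real (Suc n))) \<in> measurable ((path_space :: 'v path measure) \<Otimes>\<^sub>M lborel) (count_space UNIV)" .
    then show ?thesis by (rule measurable_compose) simp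
  qed
  have "(\<lambda>p. \<lfloor>snd p * real (Suc n)\<rfloor>) \<in> measurable ((path_space :: 'v path measure) \<Otimes>\<^sub>M lborel) (count_space UNIV)"
    by measurable
  from measurable_compose_countable[OF f this]
  have [measurable]: "(\<lambda>p. indicator {x} (snd (fst p) (grid n (snd p))) :: real)
      \<in> borel_measurable ((path_space :: 'v path measure) \<Otimes>\<^sub>M lborel)" unfolding grid_def .
  have [measurable]: "(\<lambda>p. fst (fst p)) \<in> borel_measurable ((path_space :: 'v path measure) \<Otimes>\<^sub>M lborel)"
    by (rule measurable_compose[OF measurable_fst path_space_fst])
  have [measurable]: "(\<lambda>p. indicator {0..<fst (fst p)} (snd p) :: real) \<in> borel_measurable ((path_space :: 'v path measure) \<Otimes>\<^sub>M lborel)"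
    unfolding indicator_def atLeastLessThan_iff by measurable
  show "(\<lambda>p. indicator {0..<fst (fst p)} (snd p) * indicator {x} (snd (fst p) (grid n (snd p))) :: real)
      \<in> borel_measurable ((path_space :: 'v path measure) \<Otimes>\<^sub>M lborel)"
    by measurable
qed

lemma occupation_eq:
  assumes \<gamma>: "\<gamma> \<in> space (path_space :: 'v::finite path measure)"
  shows "occupation \<gamma> $ x = (\<integral>t. indicator {0..<fst \<gamma>} t * indicator {x} (snd \<gamma> t) \<partial>lborel)"
proof -
  have [measurable]: "(\<lambda>t. indicator {0..<fst \<gamma>} t * indicator {x} (snd \<gamma> t) :: real) \<in> borel_measurable lborel"
    using measurable_compose[OF measurable_Pair1'[OF \<gamma>, of lborel] occupation_integrand_measurable[of x]] by simp
  \<comment> \<open>The closed and the half-open interval differ only at the lifetime. Written as a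
    sum, the closed version is measurable as well, and the correction vanishes almost
    everywhere.\<close>
  have eq: "indicator {0..fst \<gamma>} t *\<^sub>R indicator {x} (snd \<gamma> t) =
      (indicator {0..<fst \<gamma>} t * indicator {x} (snd \<gamma> t) :: real) +
        indicator {fst \<gamma>} t * (indicator {0..fst \<gamma>} (fst \<gamma>) * indicator {x} (snd \<gamma> (fst \<gamma>)))" for t
    by (auto simp: indicator_def)
  have "(\<integral>t. indicator {0..fst \<gamma>} t *\<^sub>R (indicator {x} (snd \<gamma> t) :: real) \<partial>lborel) =
     (\<integral>t. indicator {0..<fst \<gamma>} t * indicator {x} (snd \<gamma> t) \<partial>lborel)"
  proof (rule integral_cong_AE)
    show "(\<lambda>t. indicator {0..fst \<gamma>} t *\<^sub>R indicator {x} (snd \<gamma> t) :: real) \<in> borel_measurable lborel"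
      unfolding eq by measurable
    show "AE t in lborel. indicator {0..fst \<gamma>} t *\<^sub>R indicator {x} (snd \<gamma> t) =
        (indicator {0..<fst \<gamma>} t * indicator {x} (snd \<gamma> t) :: real)"
      unfolding eq using AE_lborel_singleton[of "fst \<gamma>"] by eventually_elim (simp add: indicator_def)
  qed measurable
  then show ?thesis by (simp add: occupation_def set_lebesgue_integral_def)
qed

lemma occupation_measurable: "occupation \<in> borel_measurable (path_space :: 'v::finite path measure)"
proof -
  have "(\<lambda>\<gamma>. occupation \<gamma> $ x) \<in> borel_measurable (path_space :: 'v path measure)" for x
  proof -
    have "(\<lambda>\<gamma>. \<integral>t. (indicator {0..<fst \<gamma>} t * indicator {x} (snd \<gamma> t) :: real) \<partial>lborel) \<in> borel_measurable (path_space :: 'v path measure)"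
      using sigma_finite_measure.borel_measurable_lebesgue_integral[OF sigma_finite_lborel,
          of "\<lambda>\<gamma> t. indicator {0..<fst \<gamma>} t * indicator {x} (snd \<gamma> t) :: real" path_space]
        occupation_integrand_measurable[of x] by (simp add: case_prod_unfold)
    then show ?thesis by (subst measurable_cong[OF occupation_eq])
  qed
  then have "(\<lambda>\<gamma>. \<chi> x. occupation \<gamma> $ x) \<in> borel_measurable (path_space :: 'v path measure)"
    by (rule borel_measurable_vec_lambda)
  then show ?thesis by simp
qed

lemma occupation_nonneg: "0 \<le> occupation \<gamma> $ x"
  by (simp add: occupation_def set_lebesgue_integral_def)

section \<open>The path measure as an image of time and driver\<close>

context electrical_network
begin

definition path_of :: "'v \<Rightarrow> real \<Rightarrow> 'v driver \<Rightarrow> 'v path" where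
  "path_of x t \<omega> = (t, \<lambda>s\<in>{0..t}. the (proc x s \<omega>))"

definition path_event :: "'v \<Rightarrow> 'v \<Rightarrow> (real \<times> 'v driver) set" where
  "path_event x y = {z. 0 \<le> fst z \<and> proc x (fst z) (snd z) = Some y}"

lemma path_event_sets: "path_event x y \<in> sets (borel \<Otimes>\<^sub>M driver)"
proof -
  have "{z \<in> space (borel \<Otimes>\<^sub>M driver). 0 \<le> fst z \<and> proc x (fst z) (snd z) = Some y} \<in> sets (borel \<Otimes>\<^sub>M driver)"
    by measurable
  moreover have "space (borel \<Otimes>\<^sub>M driver) = (UNIV :: (real \<times> 'v driver) set)" by (simp add: space_pair_measure space_driver)
  ultimately show ?thesis by (simp add: path_event_def)
qed

text \<open>The state persists up to the next jump time, and beyond all jump times it remains the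
  cemetery.\<close>

lemma proc_right_continuous: "\<exists>\<epsilon>>0. \<forall>u. s \<le> u \<and> u < s + \<epsilon> \<longrightarrow> proc x u \<omega> = proc x s \<omega>"
proof (cases "\<exists>n. s < jtime x \<omega> (Suc n)")
  case True
  define n where "n = (LEAST n. s < jtime x \<omega> (Suc n))"
  have n: "s < jtime x \<omega> (Suc n)" unfolding n_def using True by (rule LeastI_ex)
  have less: "\<not> s < jtime x \<omega> (Suc m)" if "m < n" for m using not_less_Least that unfolding n_def by blast
  have "proc x u \<omega> = proc x s \<omega>" if u: "s \<le> u" "u < s + (jtime x \<omega> (Suc n) - s)" for u
  proof -
    have un: "u < jtime x \<omega> (Suc n)" using u by simp
    then have ex: "\<exists>n. u < jtime x \<omega> (Suc n)" by blast
    have L: "(LEAST n. u < jtime x \<omega> (Suc n)) = n"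
    proof (rule Least_equality)
      show "u < jtime x \<omega> (Suc n)" by (rule un)
      fix m assume "u < jtime x \<omega> (Suc m)"
      then have "s < jtime x \<omega> (Suc m)" using u(1) by simp
      then show "n \<le> m" using less by (meson not_le)
    qed
    have "proc x u \<omega> = chain x \<omega> n" unfolding jump_process_def by (simp only: ex if_True L)
    moreover have "proc x s \<omega> = chain x \<omega> n" unfolding jump_process_def n_def by (simp only: True if_True)
    ultimately show ?thesis by simp
  qed
  note eq = this
  show ?thesis
  proof (intro exI[of _ "jtime x \<omega> (Suc n) - s"] conjI allI impI)
    show "0 < jtime x \<omega> (Suc n) - s" using n by simp
    fix u assume u: "s \<le> u \<and> u < s + (jtime x \<omega> (Suc n) - s)"
    show "proc x u \<omega> = proc x s \<omega>" by (rule eq[OF conjunct1[OF u] conjunct2[OF u]])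
  qed
next
  case False
  have none: "proc x u \<omega> = None" if "s \<le> u" for u
  proof -
    have "\<not> (\<exists>n. u < jtime x \<omega> (Suc n))" using False that by (meson order_le_less_trans)
    then show ?thesis unfolding jump_process_def by (rule if_not_P)
  qed
  show ?thesis
    by (intro exI[of _ 1] conjI allI impI) (simp, simp only: none order_refl)
qed

lemma path_measurableI:
  assumes "f \<in> measurable M (borel \<Otimes>\<^sub>M (\<Pi>\<^sub>M s\<in>UNIV. count_space (UNIV :: 'v set)))"
    and "\<And>z. z \<in> space M \<Longrightarrow> f z \<in> space path_space"
  shows "f \<in> measurable M path_space"
  unfolding path_space_def
  by (rule measurable_restrict_space2[OF _ assms(1)])
    (rule funcsetI, rule IntD1[OF assms(2)[unfolded path_space_def space_restrict_space]])

lemma path_of_in_space: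
  assumes t: "0 \<le> t"
  shows "path_of x t \<omega> \<in> space path_space"
proof -
  define f where "f = (\<lambda>s\<in>{0..t}. the (proc x s \<omega>))"
  have key: "\<exists>\<epsilon>>0. \<forall>u. s \<le> u \<and> u < s + \<epsilon> \<and> u \<le> t \<longrightarrow> f u = f s" if s: "0 \<le> s" "s < t" for s
  proof -
    obtain \<epsilon> where e: "\<epsilon> > 0" "\<forall>u. s \<le> u \<and> u < s + \<epsilon> \<longrightarrow> proc x u \<omega> = proc x s \<omega>"
      using proc_right_continuous by blast
    show ?thesis
    proof (intro exI[of _ \<epsilon>] conjI allI impI)
      show "0 < \<epsilon>" by (rule e(1))
      fix u assume u: "s \<le> u \<and> u < s + \<epsilon> \<and> u \<le> t"
      then have p: "proc x u \<omega> = proc x s \<omega>" by (intro e(2)[rule_format]) simp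
      have "u \<in> {0..t}" "s \<in> {0..t}" using u s by auto
      then show "f u = f s" unfolding f_def by (simp only: restrict_apply if_True p)
    qed
  qed
  have "(t, f) \<in> {(T, \<gamma>). 0 \<le> T \<and> \<gamma> \<in> extensional {0..T} \<and>
       (\<forall>s. 0 \<le> s \<and> s < T \<longrightarrow> (\<exists>\<epsilon>>0. \<forall>u. s \<le> u \<and> u < s + \<epsilon> \<and> u \<le> T \<longrightarrow> \<gamma> u = \<gamma> s))}"
    unfolding mem_Collect_eq case_prod_conv
  proof (intro conjI allI impI)
    show "f \<in> extensional {0..t}" unfolding f_def by (rule restrict_extensional)
    fix s assume s: "0 \<le> s \<and> s < t"
    show "\<exists>\<epsilon>>0. \<forall>u. s \<le> u \<and> u < s + \<epsilon> \<and> u \<le> t \<longrightarrow> f u = f s"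
      by (rule key[OF conjunct1[OF s] conjunct2[OF s]])
  qed (rule t)
  moreover have "(t, f) \<in> space (borel \<Otimes>\<^sub>M (\<Pi>\<^sub>M s\<in>UNIV. count_space (UNIV :: 'v set)))"
    by (auto simp: space_pair_measure space_PiM PiE_def)
  ultimately show ?thesis unfolding path_of_def f_def[symmetric] path_space_def space_restrict_space by (rule IntI)
qed

lemma path_of_measurable:
  "(\<lambda>z. path_of x (fst z) (snd z)) \<in> measurable (borel \<Otimes>\<^sub>M driver) (borel \<Otimes>\<^sub>M (\<Pi>\<^sub>M s\<in>UNIV. count_space UNIV))"
  unfolding path_of_def
proof (rule measurable_Pair)
  show "(\<lambda>z. fst z) \<in> measurable (borel \<Otimes>\<^sub>M driver) borel" by (rule measurable_fst)
  show "(\<lambda>z. \<lambda>s\<in>{0..fst z}. the (proc x s (snd z))) \<in> measurable (borel \<Otimes>\<^sub>M driver) (\<Pi>\<^sub>M s\<in>UNIV. count_space UNIV)"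
  proof (rule measurable_PiM_single')
    fix s :: real
    have "(\<lambda>z. proc x s (snd z)) \<in> measurable (borel \<Otimes>\<^sub>M driver) (count_space UNIV)"
      by (rule measurable_compose[OF measurable_snd proc_measurable1])
    then have [measurable]: "(\<lambda>z. the (proc x s (snd z))) \<in> measurable (borel \<Otimes>\<^sub>M driver) (count_space UNIV)"
      by (rule measurable_compose) simp
    show "(\<lambda>z. (\<lambda>s\<in>{0..fst z}. the (proc x s (snd z))) s) \<in> measurable (borel \<Otimes>\<^sub>M driver) (count_space UNIV)"
      unfolding restrict_def atLeastAtMost_iff by measurable
  qed (auto simp: PiE_def)
qed

text \<open>Multiplication by the transition probability undoes the conditioning. If that
  probability is 0, both sides vanish whatever the conditioned law is.\<close>

lemma emeasure_bridge:
  assumes t: "0 \<le> t" and A: "A \<in> sets path_space"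
  shows "emeasure (bridge_law E C \<kappa> t x y) A * ennreal (trans_prob E C \<kappa> t x y) =
    emeasure driver {\<omega>. proc x t \<omega> = Some y \<and> path_of x t \<omega> \<in> A}"
proof -
  interpret D: prob_space driver by (rule prob_driver)
  let ?E = "{\<omega> \<in> space driver. proc x t \<omega> = Some y}"
  have "proc x t -` {Some y} \<inter> space driver \<in> sets driver"
    by (rule measurable_sets[OF proc_measurable1]) simp
  moreover have "proc x t -` {Some y} \<inter> space driver = ?E" by auto
  ultimately have E: "?E \<in> sets driver" by (simp only:)
  have "(\<lambda>\<omega>. (t, \<omega>)) \<in> measurable driver (borel \<Otimes>\<^sub>M driver)" by measurable
  from measurable_compose[OF this path_of_measurable[of x]]
  have "path_of x t \<in> measurable driver (borel \<Otimes>\<^sub>M (\<Pi>\<^sub>M s\<in>UNIV. count_space UNIV))" by simp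
  then have m: "path_of x t \<in> measurable driver path_space"
    by (rule path_measurableI) (rule path_of_in_space[OF t])
  have m': "path_of x t \<in> measurable (uniform_measure driver ?E) path_space" using m by (simp cong: measurable_cong_sets)
  let ?F = "path_of x t -` A \<inter> space driver"
  have F: "?F \<in> sets driver" using m A by (rule measurable_sets)
  have "bridge_law E C \<kappa> t x y = distr (uniform_measure driver ?E) path_space (path_of x t)"
    unfolding bridge_law_def path_of_def[abs_def] ..
  then have "emeasure (bridge_law E C \<kappa> t x y) A = emeasure (uniform_measure driver ?E) ?F"
    using emeasure_distr[OF m' A] by simp
  also have "\<dots> = emeasure driver (?E \<inter> ?F) / emeasure driver ?E"
    by (rule emeasure_uniform_measure[OF E F])
  finally have "emeasure (bridge_law E C \<kappa> t x y) A * ennreal (trans_prob E C \<kappa> t x y) =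
      emeasure driver (?E \<inter> ?F) / emeasure driver ?E * emeasure driver ?E"
    unfolding trans_prob_def by (simp add: D.emeasure_eq_measure)
  also have "\<dots> = emeasure driver (?E \<inter> ?F)"
  proof (cases "emeasure driver ?E = 0")
    case True
    then have "emeasure driver (?E \<inter> ?F) = 0" using emeasure_mono[OF Int_lower1 E, of ?F] by simp
    then show ?thesis using True by simp
  next
    case False
    then have "emeasure driver ?E / emeasure driver ?E = 1"
      by (intro ennreal_divide_self) (simp_all add: D.emeasure_eq_measure)
    then show ?thesis unfolding ennreal_divide_times by simp
  qed
  also have "?E \<inter> ?F = {\<omega>. proc x t \<omega> = Some y \<and> path_of x t \<omega> \<in> A}" by (auto simp: space_driver)
  finally show ?thesis .
qed

lemma sets_lborel_driver: "sets ((lborel :: real measure) \<Otimes>\<^sub>M driver) = sets (borel \<Otimes>\<^sub>M driver)"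
  by (intro sets_pair_measure_cong) simp_all

lemma path_of_measurable_event:
  "(\<lambda>z. path_of x (fst z) (snd z)) \<in> measurable (restrict_space (lborel \<Otimes>\<^sub>M driver) (path_event x y)) path_space"
proof -
  have "sets (lborel \<Otimes>\<^sub>M driver) = sets (borel \<Otimes>\<^sub>M driver)" by (intro sets_pair_measure_cong) simp_all
  then have "(\<lambda>z. path_of x (fst z) (snd z)) \<in> measurable (lborel \<Otimes>\<^sub>M driver) (borel \<Otimes>\<^sub>M (\<Pi>\<^sub>M s\<in>UNIV. count_space UNIV))"
    using path_of_measurable by (simp cong: measurable_cong_sets)
  then have "(\<lambda>z. path_of x (fst z) (snd z)) \<in> measurable (restrict_space (lborel \<Otimes>\<^sub>M driver) (path_event x y))
      (borel \<Otimes>\<^sub>M (\<Pi>\<^sub>M s\<in>UNIV. count_space UNIV))"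
    by (rule measurable_restrict_space1)
  then show ?thesis
    by (rule path_measurableI) (rule path_of_in_space, simp add: space_restrict_space path_event_def)
qed

text \<open>With the conditioning undone, the integral over \<open>t\<close> is the measure of a set
  in the product of time and driver space. This also shows that the set function defining
  \<open>path_measure\<close> is countably additive.\<close>

lemma path_measure_eq:
  "path_measure E C \<kappa> x y =
    distr (restrict_space (lborel \<Otimes>\<^sub>M driver) (path_event x y)) path_space (\<lambda>z. path_of x (fst z) (snd z))"
    (is "_ = ?R")
proof -
  interpret D: prob_space driver by (rule prob_driver)
  have ev: "path_event x y \<in> sets (lborel \<Otimes>\<^sub>M driver)"
    using path_event_sets[of x y] by (simp only: sets_lborel_driver)
  have sp: "space (lborel \<Otimes>\<^sub>M driver) = (UNIV :: (real \<times> 'v driver) set)"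
    by (simp add: space_pair_measure space_driver)
  have eq: "(\<integral>\<^sup>+t\<in>{0..}. (emeasure (bridge_law E C \<kappa> t x y) A * ennreal (trans_prob E C \<kappa> t x y)) \<partial>lborel) = emeasure ?R A"
    if A: "A \<in> sets path_space" for A
  proof -
    let ?G = "{z \<in> path_event x y. path_of x (fst z) (snd z) \<in> A}"
    have G: "(\<lambda>z. path_of x (fst z) (snd z)) -` A \<inter> space (restrict_space (lborel \<Otimes>\<^sub>M driver) (path_event x y)) = ?G"
      by (auto simp: space_restrict_space sp)
    have "?G \<in> sets (restrict_space (lborel \<Otimes>\<^sub>M driver) (path_event x y))"
      using measurable_sets[OF path_of_measurable_event[of x y] A] unfolding G .
    then have Gs: "?G \<in> sets (lborel \<Otimes>\<^sub>M driver)" using ev by (simp add: sets_restrict_space_iff sp)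
    have "emeasure ?R A = emeasure (restrict_space (lborel \<Otimes>\<^sub>M driver) (path_event x y)) ?G"
      using emeasure_distr[OF path_of_measurable_event[of x y] A] unfolding G .
    also have "\<dots> = emeasure (lborel \<Otimes>\<^sub>M driver) ?G"
      by (rule emeasure_restrict_space) (use ev in \<open>auto simp: sp\<close>)
    also have "\<dots> = (\<integral>\<^sup>+t. emeasure driver (Pair t -` ?G) \<partial>lborel)"
      by (rule D.emeasure_pair_measure_alt[OF Gs])
    also have "\<dots> = (\<integral>\<^sup>+t\<in>{0..}. (emeasure (bridge_law E C \<kappa> t x y) A * ennreal (trans_prob E C \<kappa> t x y)) \<partial>lborel)"
    proof (rule nn_integral_cong)
      fix t :: real
      show "emeasure driver (Pair t -` ?G) =
          emeasure (bridge_law E C \<kappa> t x y) A * ennreal (trans_prob E C \<kappa> t x y) * indicator {0..} t"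
      proof (cases "0 \<le> t")
        case True
        have "Pair t -` ?G = {\<omega>. proc x t \<omega> = Some y \<and> path_of x t \<omega> \<in> A}"
          using True by (auto simp: path_event_def)
        then show ?thesis using emeasure_bridge[OF True A] True by simp
      next
        case False
        then have "Pair t -` ?G = {}" by (auto simp: path_event_def)
        then show ?thesis using False by (simp only: emeasure_empty) (simp add: indicator_def)
      qed
    qed
    finally show ?thesis ..
  qed
  have "path_measure E C \<kappa> x y = measure_of (space path_space) (sets path_space) (emeasure ?R)"
    unfolding path_measure_def
    by (rule measure_of_eq) (use eq sets.space_closed in \<open>auto simp: sets.sigma_sets_eq\<close>)
  also have "\<dots> = measure_of (space ?R) (sets ?R) (emeasure ?R)" by simp
  also have "\<dots> = ?R" by (rule measure_of_of_measure)
  finally show ?thesis .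
qed

lemma sets_path_measure [simp]: "sets (path_measure E C \<kappa> x y) = sets path_space"
  by (simp add: path_measure_eq)

text \<open>The cemetery is absorbing for the jump chain and the number of jumps made grows with
  time. Consequently a path ending at \<open>y\<close> never applies \<open>the\<close> to
  \<open>None\<close> within its lifetime.\<close>

lemma proc_mono_alive:
  assumes "proc x t \<omega> = Some y" "s \<le> t"
  shows "proc x s \<omega> \<noteq> None"
proof -
  have ex: "\<exists>n. t < jtime x \<omega> (Suc n)" and ch: "chain x \<omega> (LEAST n. t < jtime x \<omega> (Suc n)) = Some y"
    using assms(1) unfolding jump_process_def by (auto split: if_splits)
  define n where "n = (LEAST n. t < jtime x \<omega> (Suc n))"
  have "t < jtime x \<omega> (Suc n)" unfolding n_def using ex by (rule LeastI_ex)
  then have sn: "s < jtime x \<omega> (Suc n)" using assms(2) by simp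
  then have le: "(LEAST n. s < jtime x \<omega> (Suc n)) \<le> n" by (rule Least_le)
  have pers: "chain x \<omega> k = None \<Longrightarrow> chain x \<omega> (k + d) = None" for k d by (induction d) auto
  obtain d where d: "n = (LEAST n. s < jtime x \<omega> (Suc n)) + d" using le le_Suc_ex by blast
  have "chain x \<omega> n = Some y" using ch unfolding n_def .
  then have "chain x \<omega> (LEAST n. s < jtime x \<omega> (Suc n)) \<noteq> None" using pers unfolding d by (metis option.distinct(1))
  then show ?thesis using sn unfolding jump_process_def by auto
qed

lemma occupation_path_of:
  assumes t: "0 \<le> t" and y: "proc x t \<omega> = Some y"
  shows "occupation (path_of x t \<omega>) $ v = occ x t \<omega> v"
proof -
  have "(\<integral>s. (indicator {0..<t} s * indicator {v} (snd (path_of x t \<omega>) s) :: real) \<partial>lborel) =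
     (\<integral>s. indicator {s \<in> {0..<t}. proc x s \<omega> = Some v} s \<partial>lborel)"
  proof (rule Bochner_Integration.integral_cong[OF refl])
    fix s
    show "indicator {0..<t} s * indicator {v} (snd (path_of x t \<omega>) s) =
        (indicator {s \<in> {0..<t}. proc x s \<omega> = Some v} s :: real)"
      using proc_mono_alive[OF y, of s] by (auto simp: path_of_def indicator_def)
  qed
  also have "\<dots> = occ x t \<omega> v" using occ_set by (simp add: occ_def)
  finally have c: "(\<integral>s. (indicator {0..<t} s * indicator {v} (snd (path_of x t \<omega>) s) :: real) \<partial>lborel) = occ x t \<omega> v" .
  have "fst (path_of x t \<omega>) = t" by (simp add: path_of_def)
  then show ?thesis unfolding occupation_eq[OF path_of_in_space[OF t]] by (simp only: c)
qed

text \<open>Pulled back to time and driver, the exponential of the occupation field restricted to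
  the endpoint event is exactly \<open>visit\<close>, and exchanging the integrals gives the Green
  function.\<close>

lemma nn_integral_path_measure:
  assumes lam: "\<And>v. 0 \<le> lam v"
  shows "(\<integral>\<^sup>+\<gamma>. ennreal (exp (- (\<Sum>v\<in>UNIV. lam v * occupation \<gamma> $ v))) \<partial>path_measure E C \<kappa> x y) = green lam x y"
proof -
  interpret D: prob_space driver by (rule prob_driver)
  interpret LD: pair_sigma_finite lborel driver ..
  let ?f = "\<lambda>\<gamma> :: 'v path. ennreal (exp (- (\<Sum>v\<in>UNIV. lam v * occupation \<gamma> $ v)))"
  have [measurable]: "(\<lambda>\<gamma>. occupation \<gamma> $ v) \<in> borel_measurable (path_space :: 'v path measure)" for v
    by (rule measurable_compose[OF occupation_measurable])
      (intro borel_measurable_continuous_onI continuous_intros)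
  have f: "?f \<in> borel_measurable path_space" by measurable
  have ev: "path_event x y \<in> sets (lborel \<Otimes>\<^sub>M driver)"
    using path_event_sets[of x y] by (simp only: sets_lborel_driver)
  have "(\<integral>\<^sup>+\<gamma>. ?f \<gamma> \<partial>path_measure E C \<kappa> x y) =
     (\<integral>\<^sup>+z. ?f (path_of x (fst z) (snd z)) \<partial>restrict_space (lborel \<Otimes>\<^sub>M driver) (path_event x y))"
    unfolding path_measure_eq by (rule nn_integral_distr[OF path_of_measurable_event]) (use f in simp)
  also have "\<dots> = (\<integral>\<^sup>+z. ?f (path_of x (fst z) (snd z)) * indicator (path_event x y) z \<partial>(lborel \<Otimes>\<^sub>M driver))"
    using ev by (intro nn_integral_restrict_space) simp
  also have "\<dots> = (\<integral>\<^sup>+z. visit lam x y (fst z) (snd z) \<partial>(lborel \<Otimes>\<^sub>M driver))"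
  proof (rule nn_integral_cong)
    fix z :: "real \<times> 'v driver"
    show "?f (path_of x (fst z) (snd z)) * indicator (path_event x y) z = visit lam x y (fst z) (snd z)"
      using occupation_path_of[of "fst z" x "snd z" y]
      by (auto simp: visit_def[where lam=lam, OF lam] discount_def[where lam=lam, OF lam] path_event_def indicator_def)
  qed
  also have "\<dots> = (\<integral>\<^sup>+\<omega>. \<integral>\<^sup>+t. visit lam x y t \<omega> \<partial>lborel \<partial>driver)"
  proof -
    have "(\<lambda>z. visit lam x y (fst z) (snd z)) \<in> borel_measurable (lborel \<Otimes>\<^sub>M driver)"
      using visit_measurable[where lam=lam, OF lam, of x y] sets_pair_measure_cong[OF sets_lborel refl, of driver]
      by (simp cong: measurable_cong_sets)
    from LD.nn_integral_snd[of "\<lambda>z. visit lam x y (fst z) (snd z)", OF this] show ?thesis by simp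
  qed
  finally show ?thesis unfolding green_def[where lam=lam, OF lam] .
qed

text \<open>The total mass is the Green function without discount.\<close>

lemma finite_path_measure: "finite_measure (path_measure E C \<kappa> x y)"
proof
  have "emeasure (path_measure E C \<kappa> x y) (space (path_measure E C \<kappa> x y)) =
      (\<integral>\<^sup>+\<gamma>. ennreal (exp (- (\<Sum>v\<in>UNIV. 0 * occupation \<gamma> $ v))) \<partial>path_measure E C \<kappa> x y)"
    by simp
  also have "\<dots> = green (\<lambda>_. 0) x y" by (rule nn_integral_path_measure[where lam="\<lambda>_. 0"]) simp
  also have "\<dots> < \<infinity>" by (rule green_finite) simp
  finally show "emeasure (path_measure E C \<kappa> x y) (space (path_measure E C \<kappa> x y)) \<noteq> \<infinity>" by simp
qed

definition path_green :: "('v \<Rightarrow> real) \<Rightarrow> 'v \<Rightarrow> 'v \<Rightarrow> real" where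
  "path_green lam x y = (\<integral>\<gamma>. exp (- (\<Sum>v\<in>UNIV. lam v * occupation \<gamma> $ v)) \<partial>path_measure E C \<kappa> x y)"

lemma path_green_integrable:
  assumes "\<And>v. 0 \<le> lam v"
  shows "integrable (path_measure E C \<kappa> x y) (\<lambda>\<gamma>. exp (- (\<Sum>v\<in>UNIV. lam v * occupation \<gamma> $ v)))"
proof -
  interpret finite_measure "path_measure E C \<kappa> x y" by (rule finite_path_measure)
  have [measurable]: "(\<lambda>\<gamma>. occupation \<gamma> $ v) \<in> borel_measurable (path_measure E C \<kappa> x y)" for v
    using measurable_compose[OF occupation_measurable borel_measurable_continuous_onI[OF continuous_on_component[OF continuous_on_id]], of v]
    by (simp cong: measurable_cong_sets)
  show ?thesis
  proof (rule integrable_const_bound[where B=1])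
    show "AE \<gamma> in path_measure E C \<kappa> x y. norm (exp (- (\<Sum>v\<in>UNIV. lam v * occupation \<gamma> $ v))) \<le> 1"
    proof (rule AE_I2)
      fix \<gamma>
      have "0 \<le> (\<Sum>v\<in>UNIV. lam v * occupation \<gamma> $ v)"
        by (intro sum_nonneg mult_nonneg_nonneg assms occupation_nonneg)
      then show "norm (exp (- (\<Sum>v\<in>UNIV. lam v * occupation \<gamma> $ v))) \<le> 1" by simp
    qed
  qed measurable
qed

theorem path_green_equation:
  assumes lam: "\<And>v. 0 \<le> lam v"
  shows "(rate x + lam x) * path_green lam x y - (\<Sum>z\<in>UNIV. cond x z * path_green lam z y) = of_bool (x = y)"
proof -
  have "path_green lam z y = enn2real (green lam z y)" for z
    unfolding path_green_def nn_integral_path_measure[where lam=lam, OF lam, symmetric]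
    by (rule integral_eq_nn_integral) (use path_green_integrable[where lam=lam, OF lam] in auto)
  then show ?thesis using green_equation[where lam=lam, OF lam] by simp
qed

end

section \<open>Gaussian integration by parts\<close>

lemma finite_pairings:
  assumes "finite K"
  shows "finite (pairings K)"
  by (rule finite_subset[of _ "Pow (Pow K)"]) (use assms in \<open>auto simp: pairings_def partition_on_def\<close>)

lemma finite_pairing: "p \<in> pairings K \<Longrightarrow> finite K \<Longrightarrow> finite p"
  using pairingsD(1) finite_UnionD by metis

lemma pairings_empty: "pairings {} = {{}}"
  by (auto simp: pairings_def partition_on_def)

text \<open>Sorting the pairings by the partner of \<open>a\<close> gives the recursion satisfied by
  Gaussian moments.\<close>

lemma sum_pairings_split:
  fixes g :: "nat set \<Rightarrow> 'b::comm_semiring_1"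
  assumes K: "finite K" "a \<in> K"
  shows "(\<Sum>p\<in>pairings K. \<Prod>e\<in>p. g e) =
    (\<Sum>c\<in>K - {a}. g {a, c} * (\<Sum>p\<in>pairings (K - {a, c}). \<Prod>e\<in>p. g e))"
proof -
  have new: "{a, c} \<notin> p" if "p \<in> pairings (K - {a, c})" for c p
    using pairingsD(1)[OF that] by auto
  have ins: "insert {a, c} p \<in> pairings K" if "c \<in> K - {a}" "p \<in> pairings (K - {a, c})" for c p
  proof -
    have "\<Union>(insert {a, c} p) = K" using pairingsD(1)[OF that(2)] that(1) K(2) by auto
    moreover have "disjoint (insert {a, c} p)" "{} \<notin> insert {a, c} p"
      using that(2) unfolding pairings_def partition_on_def by (auto simp: disjoint_def)
    ultimately show ?thesis
      using that unfolding pairings_def partition_on_def by auto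
  qed
  have del: "p - {{a, partner p a}} \<in> pairings (K - {a, partner p a})" if p: "p \<in> pairings K" for p
  proof -
    note pp = partner_pair(1)[OF p K(2)]
    have "\<Union>(p - {{a, partner p a}}) = K - {a, partner p a}"
      using pairingsD(1)[OF p] pairingsD(3)[OF p _ pp] by auto
    then show ?thesis using p unfolding pairings_def partition_on_def by (auto simp: disjoint_def)
  qed
  have "(\<Sum>p\<in>pairings K. \<Prod>e\<in>p. g e) =
    (\<Sum>(c, p)\<in>(SIGMA c:K - {a}. pairings (K - {a, c})). g {a, c} * (\<Prod>e\<in>p. g e))"
  proof (rule sum.reindex_bij_witness[of _ "\<lambda>(c, p). insert {a, c} p" "\<lambda>p. (partner p a, p - {{a, partner p a}})"])
    fix p assume p: "p \<in> pairings K"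
    note pp = partner_pair[OF p K(2)]
    show "(case (partner p a, p - {{a, partner p a}}) of (c, p) \<Rightarrow> insert {a, c} p) = p"
      using pp(1) by auto
    show "(partner p a, p - {{a, partner p a}}) \<in> (SIGMA c:K - {a}. pairings (K - {a, c}))"
      using pp(2) partner_eq(2)[OF p pp(1)] del[OF p] by auto
    show "(case (partner p a, p - {{a, partner p a}}) of (c, p) \<Rightarrow> g {a, c} * (\<Prod>e\<in>p. g e)) = (\<Prod>e\<in>p. g e)"
      using prod.remove[OF finite_pairing[OF p K(1)] pp(1), of g] by simp
  next
    fix b assume "b \<in> (SIGMA c:K - {a}. pairings (K - {a, c}))"
    then obtain c p where b: "b = (c, p)" "c \<in> K - {a}" "p \<in> pairings (K - {a, c})" by auto
    note i = ins[OF b(2,3)]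
    have pa: "partner (insert {a, c} p) a = c" using partner_eq(1)[OF i, of a c] by simp
    show "(case b of (c, p) \<Rightarrow> insert {a, c} p) \<in> pairings K" using i b(1) by simp
    show "(partner (case b of (c, p) \<Rightarrow> insert {a, c} p) a,
        (case b of (c, p) \<Rightarrow> insert {a, c} p) - {{a, partner (case b of (c, p) \<Rightarrow> insert {a, c} p) a}}) = b"
      using pa new[OF b(3)] b(1) by auto
  qed
  also have "\<dots> = (\<Sum>c\<in>K - {a}. \<Sum>p\<in>pairings (K - {a, c}). g {a, c} * (\<Prod>e\<in>p. g e))"
    using K(1) by (subst sum.Sigma) (auto intro: finite_pairings)
  finally show ?thesis by (simp add: sum_distrib_left)
qed

text \<open>For \<open>\<bar>y\<bar>\<close> at least 1 the power is bounded by a multiple of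
  \<open>z ^ m\<close> with \<open>z = c / 2 * y ^ 2\<close>, which reduces the claim to the decay
  of \<open>z ^ m / exp z\<close>.\<close>

lemma gaussian_power_tendsto_0:
  fixes c :: real
  assumes "c > 0"
  shows "((\<lambda>y. \<bar>y\<bar> ^ m * exp (- c * y\<^sup>2 / 2)) \<longlongrightarrow> 0) at_infinity"
proof -
  have "filterlim (\<lambda>y :: real. \<bar>y\<bar>) at_top at_infinity"
  proof -
    have "(norm :: real \<Rightarrow> real) = abs" by (rule ext) simp
    then show ?thesis using filterlim_norm_at_top[where 'a=real] by metis
  qed
  then have a: "filterlim (\<lambda>y :: real. c / 2 * \<bar>y\<bar> ^ 2) at_top at_infinity"
    using assms by (intro filterlim_tendsto_pos_mult_at_top[OF tendsto_const] filterlim_pow_at_top) auto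
  have "((\<lambda>y. (2 / c) ^ m * ((c / 2 * \<bar>y\<bar>\<^sup>2) ^ m / exp (c / 2 * \<bar>y\<bar>\<^sup>2))) \<longlongrightarrow> (2 / c) ^ m * 0) at_infinity"
    by (intro tendsto_mult tendsto_const filterlim_compose[OF tendsto_power_div_exp_0 a])
  then have lim: "((\<lambda>y. (2 / c) ^ m * ((c / 2 * \<bar>y\<bar>\<^sup>2) ^ m / exp (c / 2 * \<bar>y\<bar>\<^sup>2))) \<longlongrightarrow> 0) at_infinity" by simp
  have "\<bar>y\<bar> ^ m * exp (- c * y\<^sup>2 / 2) \<le> (2 / c) ^ m * ((c / 2 * \<bar>y\<bar>\<^sup>2) ^ m / exp (c / 2 * \<bar>y\<bar>\<^sup>2))" if "1 \<le> norm y" for y :: real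
  proof -
    have "\<bar>y\<bar> ^ m \<le> (\<bar>y\<bar>\<^sup>2) ^ m" using that self_le_power[of "\<bar>y\<bar>" 2] by (intro power_mono) auto
    also have "\<dots> = (2 / c) ^ m * (c / 2 * \<bar>y\<bar>\<^sup>2) ^ m" using assms by (simp add: power_mult_distrib[symmetric])
    finally have "\<bar>y\<bar> ^ m * exp (- (c / 2 * \<bar>y\<bar>\<^sup>2)) \<le> (2 / c) ^ m * (c / 2 * \<bar>y\<bar>\<^sup>2) ^ m * exp (- (c / 2 * \<bar>y\<bar>\<^sup>2))"
      by (rule mult_right_mono) simp
    moreover have "X * Z * exp (- z) = X * (Z / exp z)" for X Z z :: real
      by (simp add: exp_minus divide_inverse)
    moreover have "- c * y\<^sup>2 / 2 = - (c / 2 * \<bar>y\<bar>\<^sup>2)" by simp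
    ultimately show ?thesis by (simp only:)
  qed
  then have "eventually (\<lambda>y. \<bar>y\<bar> ^ m * exp (- c * y\<^sup>2 / 2) \<le> (2 / c) ^ m * ((c / 2 * \<bar>y\<bar>\<^sup>2) ^ m / exp (c / 2 * \<bar>y\<bar>\<^sup>2))) at_infinity"
    unfolding eventually_at_infinity by blast
  then show ?thesis
    by (intro tendsto_sandwich[OF _ _ tendsto_const lim]) auto
qed

lemma gaussian_power_integrable:
  fixes c :: real
  assumes "c > 0"
  shows "integrable lborel (\<lambda>y. \<bar>y\<bar> ^ m * exp (- c * y\<^sup>2 / 2))"
proof -
  define \<sigma> where "\<sigma> = 1 / sqrt c"
  have s: "\<sigma>\<^sup>2 = 1 / c" using assms by (simp add: \<sigma>_def power_divide)
  have "integrable lborel (\<lambda>y. sqrt (2 * pi * \<sigma>\<^sup>2) * (normal_density 0 \<sigma> y * \<bar>y - 0\<bar> ^ m))"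
    by (intro integrable_mult_right integrable_normal_moment_abs) (use assms in \<open>simp add: \<sigma>_def\<close>)
  moreover have "sqrt (2 * pi * \<sigma>\<^sup>2) * (normal_density 0 \<sigma> y * \<bar>y - 0\<bar> ^ m) = \<bar>y\<bar> ^ m * exp (- c * y\<^sup>2 / 2)" for y
    using assms by (simp add: normal_density_def s field_simps)
  ultimately show ?thesis by (simp only:)
qed

text \<open>The integrand is the derivative of \<open>A * y ^ m\<close> times the Gaussian factor,
  and this product vanishes at both ends. The hypothesis \<open>dom\<close> is what remains of
  coercivity when the other coordinates are frozen; freezing them creates the linear and the
  constant term.\<close>

lemma gaussian_integration_by_parts_1d:
  fixes A b c e q :: real
  assumes c: "c > 0" and dom: "\<And>y. c * y\<^sup>2 \<le> q * y\<^sup>2 + 2 * b * y + e"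
  shows "(\<integral>y. (real m * A * y ^ (m - 1) - A * y ^ m * (q * y + b)) * exp (- (q * y\<^sup>2 + 2 * b * y + e) / 2) \<partial>lborel) = 0"
    (is "integral\<^sup>L lborel ?f = 0")
proof (cases "integrable lborel ?f")
  case True
  let ?F = "\<lambda>y. A * y ^ m * exp (- (q * y\<^sup>2 + 2 * b * y + e) / 2)"
  have lim: "(?F \<longlongrightarrow> 0) at_infinity"
  proof (rule Lim_null_comparison)
    show "eventually (\<lambda>y. norm (?F y) \<le> \<bar>A\<bar> * (\<bar>y\<bar> ^ m * exp (- c * y\<^sup>2 / 2))) at_infinity"
    proof (rule always_eventually, rule allI)
      fix y
      have "exp (- (q * y\<^sup>2 + 2 * b * y + e) / 2) \<le> exp (- c * y\<^sup>2 / 2)" using dom[of y] by simp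
      then show "norm (?F y) \<le> \<bar>A\<bar> * (\<bar>y\<bar> ^ m * exp (- c * y\<^sup>2 / 2))"
        by (simp add: abs_mult power_abs mult.assoc mult_left_mono)
    qed
    show "((\<lambda>y. \<bar>A\<bar> * (\<bar>y\<bar> ^ m * exp (- c * y\<^sup>2 / 2))) \<longlongrightarrow> 0) at_infinity"
      using tendsto_mult[OF tendsto_const gaussian_power_tendsto_0[OF c], of "\<bar>A\<bar>"] by simp
  qed
  have "(LBINT y=-\<infinity>..\<infinity>. ?f y) = 0 - 0"
  proof (rule interval_integral_FTC_integrable)
    show "(?F has_vector_derivative ?f y) (at y)" for y
      unfolding has_real_derivative_iff_has_vector_derivative[symmetric]
    proof -
      define X where "X y = - (q * y\<^sup>2 + 2 * b * y + e) / 2" for y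
      have "(X has_real_derivative - (q * y + b)) (at y)"
        unfolding X_def by (auto intro!: derivative_eq_intros simp: field_simps)
      moreover have "((\<lambda>y. A * y ^ m) has_real_derivative real m * A * y ^ (m - 1)) (at y)"
        by (auto intro!: derivative_eq_intros)
      ultimately have "((\<lambda>y. A * y ^ m * exp (X y)) has_real_derivative
          (real m * A * y ^ (m - 1)) * exp (X y) + (exp (X y) * - (q * y + b)) * (A * y ^ m)) (at y)"
        by (intro DERIV_mult DERIV_fun_exp)
      then have "((\<lambda>y. A * y ^ m * exp (X y)) has_real_derivative
          (real m * A * y ^ (m - 1) - A * y ^ m * (q * y + b)) * exp (X y)) (at y)"
        by (rule DERIV_cong) (simp add: algebra_simps)
      then show "(?F has_real_derivative ?f y) (at y)" unfolding X_def .
    qed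
    show "isCont ?f y" for y by (intro continuous_intros) auto
    show "set_integrable lborel (einterval (-\<infinity>) \<infinity>) ?f" using True by (simp add: set_integrable_def)
    have "(?F \<longlongrightarrow> 0) at_top" "(?F \<longlongrightarrow> 0) at_bot"
      using lim at_top_le_at_infinity at_bot_le_at_infinity by (auto intro: tendsto_mono)
    then show "((?F \<circ> real_of_ereal) \<longlongrightarrow> 0) (at_right (-\<infinity>))" "((?F \<circ> real_of_ereal) \<longlongrightarrow> 0) (at_left \<infinity>)"
      by (simp_all add: ereal_tendsto_simps)
  qed simp
  then show ?thesis by (simp add: interval_lebesgue_integral_def set_lebesgue_integral_def)
\<comment> \<open>The Bochner integral of a non-integrable function is 0 by convention, so this case
  agrees with the claim.\<close>
qed (rule not_integrable_integral_eq)

lemma product_sigma_finite_lborel: "product_sigma_finite (\<lambda>_. lborel :: real measure)"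
  by standard

text \<open>\<open>Q\<close> is the precision matrix of the Gaussian vector and \<open>G\<close> its
  inverse, the covariance. Coercivity is carried with an explicit constant because it provides the
  integrable majorants.\<close>

locale gaussian_field =
  fixes I :: "'i set" and Q G :: "'i \<Rightarrow> 'i \<Rightarrow> real" and c :: real
  assumes finite_I: "finite I"
    and sym: "i \<in> I \<Longrightarrow> j \<in> I \<Longrightarrow> Q i j = Q j i"
    and c_pos: "c > 0"
    and coercive: "c * (\<Sum>i\<in>I. (\<phi> i)\<^sup>2) \<le> (\<Sum>i\<in>I. \<Sum>j\<in>I. Q i j * \<phi> i * \<phi> j)"
    and inverse: "i \<in> I \<Longrightarrow> j \<in> I \<Longrightarrow> (\<Sum>k\<in>I. G i k * Q k j) = (if i = j then 1 else 0)"
begin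

definition quad :: "('i \<Rightarrow> real) \<Rightarrow> real" where
  "quad \<phi> = (\<Sum>i\<in>I. \<Sum>j\<in>I. Q i j * \<phi> i * \<phi> j)"

definition weight :: "('i \<Rightarrow> real) \<Rightarrow> real" where
  "weight \<phi> = exp (- quad \<phi> / 2)"

abbreviation "D \<equiv> Pi\<^sub>M I (\<lambda>_. lborel :: real measure)"

lemma weight_measurable [measurable]: "weight \<in> borel_measurable D"
proof -
  have [measurable]: "(\<lambda>\<phi>. \<phi> i) \<in> borel_measurable D" if "i \<in> I" for i
    using measurable_component_singleton[OF that, of "\<lambda>_. lborel"] by simp
  show ?thesis unfolding weight_def[abs_def] quad_def by measurable
qed

text \<open>Coercivity bounds the weight by a product of one-dimensional Gaussian factors. The
  monomial is a product of powers of coordinates with the multiplicities \<open>?m\<close>, so the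
  bound factorises.\<close>

lemma monomial_integrable:
  assumes "finite K" "s ` K \<subseteq> I"
  shows "integrable D (\<lambda>\<phi>. (\<Prod>k\<in>K. \<phi> (s k)) * weight \<phi>)"
proof (rule Bochner_Integration.integrable_bound)
  interpret product_sigma_finite "\<lambda>_ :: 'i. lborel :: real measure" by (rule product_sigma_finite_lborel)
  let ?m = "\<lambda>i. card {k \<in> K. s k = i}"
  show "integrable D (\<lambda>\<phi>. \<Prod>i\<in>I. \<bar>\<phi> i\<bar> ^ ?m i * exp (- c * (\<phi> i)\<^sup>2 / 2))"
    by (intro product_integrable_prod finite_I gaussian_power_integrable c_pos)
  have [measurable]: "(\<lambda>\<phi>. \<phi> (s k)) \<in> borel_measurable D" if "k \<in> K" for k
    using measurable_component_singleton[of "s k" I "\<lambda>_. lborel"] assms(2) that by auto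
  show "(\<lambda>\<phi>. (\<Prod>k\<in>K. \<phi> (s k)) * weight \<phi>) \<in> borel_measurable D" by measurable
  show "AE \<phi> in D. norm ((\<Prod>k\<in>K. \<phi> (s k)) * weight \<phi>) \<le> norm (\<Prod>i\<in>I. \<bar>\<phi> i\<bar> ^ ?m i * exp (- c * (\<phi> i)\<^sup>2 / 2))"
  proof (rule AE_I2)
    fix \<phi>
    have "(\<Prod>i\<in>I. exp (- c * (\<phi> i)\<^sup>2 / 2)) = exp (- (c * (\<Sum>i\<in>I. (\<phi> i)\<^sup>2)) / 2)"
      using finite_I by (simp add: exp_sum[symmetric] sum_distrib_left sum_negf sum_divide_distrib)
    then have "weight \<phi> \<le> (\<Prod>i\<in>I. exp (- c * (\<phi> i)\<^sup>2 / 2))"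
      using coercive[of \<phi>] by (simp add: weight_def quad_def)
    moreover have "\<bar>\<Prod>k\<in>K. \<phi> (s k)\<bar> = (\<Prod>i\<in>I. \<bar>\<phi> i\<bar> ^ ?m i)"
    proof -
      have "(\<Prod>i\<in>I. \<Prod>k\<in>{k \<in> K. s k = i}. \<bar>\<phi> (s k)\<bar>) = (\<Prod>k\<in>K. \<bar>\<phi> (s k)\<bar>)"
        by (rule prod.group[OF assms(1) finite_I assms(2)])
      moreover have "(\<Prod>k\<in>{k \<in> K. s k = i}. \<bar>\<phi> (s k)\<bar>) = \<bar>\<phi> i\<bar> ^ ?m i" for i by simp
      ultimately show ?thesis by (simp add: abs_prod)
    qed
    ultimately show "norm ((\<Prod>k\<in>K. \<phi> (s k)) * weight \<phi>) \<le> norm (\<Prod>i\<in>I. \<bar>\<phi> i\<bar> ^ ?m i * exp (- c * (\<phi> i)\<^sup>2 / 2))"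
    proof -
      assume w: "weight \<phi> \<le> (\<Prod>i\<in>I. exp (- c * (\<phi> i)\<^sup>2 / 2))"
        and m: "\<bar>\<Prod>k\<in>K. \<phi> (s k)\<bar> = (\<Prod>i\<in>I. \<bar>\<phi> i\<bar> ^ ?m i)"
      have "norm ((\<Prod>k\<in>K. \<phi> (s k)) * weight \<phi>) = (\<Prod>i\<in>I. \<bar>\<phi> i\<bar> ^ ?m i) * weight \<phi>"
        unfolding real_norm_def abs_mult m by (simp add: weight_def)
      also have "\<dots> \<le> (\<Prod>i\<in>I. \<bar>\<phi> i\<bar> ^ ?m i) * (\<Prod>i\<in>I. exp (- c * (\<phi> i)\<^sup>2 / 2))"
        by (intro mult_left_mono w prod_nonneg) simp
      also have "\<dots> = norm (\<Prod>i\<in>I. \<bar>\<phi> i\<bar> ^ ?m i * exp (- c * (\<phi> i)\<^sup>2 / 2))"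
        unfolding prod.distrib[symmetric] real_norm_def by (subst abs_of_nonneg) (auto intro!: prod_nonneg)
      finally show ?thesis .
    qed
  qed
qed

lemma weight_integrable: "integrable D weight"
  using monomial_integrable[of "{}"] by simp

text \<open>On every line in direction \<open>i\<close> the derivative of monomial times weight
  integrates to zero. Differentiating the weight produces row \<open>i\<close> of \<open>Q\<close>,
  differentiating the monomial removes one factor with index \<open>i\<close>.\<close>

lemma integration_by_parts:
  assumes K: "finite K" "s ` K \<subseteq> I" and i: "i \<in> I"
  shows "(\<Sum>j\<in>I. Q i j * (\<integral>\<phi>. \<phi> j * (\<Prod>k\<in>K. \<phi> (s k)) * weight \<phi> \<partial>D)) =
    (\<Sum>k\<in>K. if s k = i then (\<integral>\<phi>. (\<Prod>l\<in>K - {k}. \<phi> (s l)) * weight \<phi> \<partial>D) else 0)"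
proof -
  interpret product_sigma_finite "\<lambda>_ :: 'i. lborel :: real measure" by (rule product_sigma_finite_lborel)
  define J where "J = I - {i}"
  have IJ: "I = insert i J" "i \<notin> J" "finite J" using i finite_I by (auto simp: J_def)
  let ?d1 = "\<lambda>\<phi>. \<Sum>k\<in>K. if s k = i then (\<Prod>l\<in>K - {k}. \<phi> (s l)) * weight \<phi> else 0"
  let ?d2 = "\<lambda>\<phi>. \<Sum>j\<in>I. Q i j * (\<phi> j * (\<Prod>k\<in>K. \<phi> (s k)) * weight \<phi>)"
  have i1: "integrable D (\<lambda>\<phi>. (\<Prod>l\<in>K - {k}. \<phi> (s l)) * weight \<phi>)" for k
    by (rule monomial_integrable) (use K in auto)
  have i2: "integrable D (\<lambda>\<phi>. \<phi> j * (\<Prod>k\<in>K. \<phi> (s k)) * weight \<phi>)" if "j \<in> I" for j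
  proof -
    \<comment> \<open>The additional factor with index \<open>j\<close> is given the new position
      \<open>None\<close>, so that the product is again a monomial over an index set.\<close>
    have "(\<Prod>k\<in>insert None (Some ` K). \<phi> ((\<lambda>x. case x of None \<Rightarrow> j | Some k \<Rightarrow> s k) k)) = \<phi> j * (\<Prod>k\<in>K. \<phi> (s k))" for \<phi> :: "'i \<Rightarrow> real"
      using K(1) by (subst prod.insert) (auto simp: prod.reindex)
    moreover have "integrable D (\<lambda>\<phi>. (\<Prod>k\<in>insert None (Some ` K). \<phi> ((\<lambda>x. case x of None \<Rightarrow> j | Some k \<Rightarrow> s k) k)) * weight \<phi>)"
      by (rule monomial_integrable) (use K that in auto)
    ultimately show ?thesis by simp
  qed
  have i3: "integrable D (\<lambda>\<phi>. if s k = i then (\<Prod>l\<in>K - {k}. \<phi> (s l)) * weight \<phi> else 0)" for k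
    using i1[of k] by (cases "s k = i") simp_all
  have int: "integrable D (\<lambda>\<phi>. ?d1 \<phi> - ?d2 \<phi>)"
    by (intro Bochner_Integration.integrable_diff Bochner_Integration.integrable_sum integrable_mult_right i2 i3)
  let ?m = "card {k \<in> K. s k = i}"
  have inner: "(\<integral>y. ?d1 (x(i := y)) - ?d2 (x(i := y)) \<partial>lborel) = 0" for x
  proof -
    \<comment> \<open>On the line through \<open>x\<close> in direction \<open>i\<close>,
      \<open>A\<close> collects the factors of the other coordinates, \<open>2 * b\<close> is the
      linear coefficient of the quadratic form and \<open>e\<close> its constant term.\<close>
    define A where "A = (\<Prod>k\<in>{k \<in> K. s k \<noteq> i}. x (s k))"
    define b where "b = (\<Sum>j\<in>J. Q i j * x j)"
    define e where "e = (\<Sum>j\<in>J. \<Sum>l\<in>J. Q j l * x j * x l)"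
    have xj: "(x(i := y)) j = x j" if "j \<in> J" for j y using that IJ by auto
    have lin: "(\<Sum>j\<in>I. Q i j * (x(i := y)) j) = Q i i * y + b" for y
    proof -
      have "(\<Sum>j\<in>J. Q i j * (x(i := y)) j) = b" unfolding b_def using xj by (intro sum.cong) auto
      then show ?thesis unfolding IJ(1) using IJ(2,3) by simp
    qed
    have quad: "quad (x(i := y)) = Q i i * y\<^sup>2 + 2 * b * y + e" for y
    proof -
      define f where "f = x(i := y)"
      have f: "f i = y" "\<And>j. j \<in> J \<Longrightarrow> f j = x j" using xj by (auto simp: f_def)
      have "quad f = Q i i * f i * f i + (\<Sum>l\<in>J. Q i l * f i * f l) +
          ((\<Sum>j\<in>J. Q j i * f j * f i) + (\<Sum>j\<in>J. \<Sum>l\<in>J. Q j l * f j * f l))"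
        unfolding quad_def unfolding IJ(1) using IJ(2,3) by (simp add: sum.distrib)
      also have "(\<Sum>j\<in>J. Q j i * f j * f i) = b * y"
        unfolding b_def sum_distrib_right using sym IJ f by (intro sum.cong) auto
      also have "(\<Sum>l\<in>J. Q i l * f i * f l) = b * y"
        unfolding b_def sum_distrib_right using f by (intro sum.cong) auto
      also have "(\<Sum>j\<in>J. \<Sum>l\<in>J. Q j l * f j * f l) = e"
        unfolding e_def using f by (intro sum.cong) auto
      finally have fe: "quad f = Q i i * y * y + b * y + (b * y + e)" unfolding f(1) .
      show ?thesis unfolding f_def[symmetric] fe by (simp add: power2_eq_square algebra_simps)
    qed
    have dom: "c * y\<^sup>2 \<le> Q i i * y\<^sup>2 + 2 * b * y + e" for y
    proof -
      have "y\<^sup>2 \<le> (\<Sum>j\<in>I. ((x(i := y)) j)\<^sup>2)"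
        using member_le_sum[of i I "\<lambda>j. ((x(i := y)) j)\<^sup>2"] i finite_I by simp
      then have "c * y\<^sup>2 \<le> c * (\<Sum>j\<in>I. ((x(i := y)) j)\<^sup>2)" using c_pos by simp
      also have "\<dots> \<le> quad (x(i := y))" unfolding quad_def by (rule coercive)
      finally show ?thesis by (simp add: quad)
    qed
    have mon: "(\<Prod>k\<in>L. (x(i := y)) (s k)) = (\<Prod>k\<in>{k \<in> L. s k \<noteq> i}. x (s k)) * y ^ card {k \<in> L. s k = i}"
      if "finite L" for L y
    proof -
      have "L = {k \<in> L. s k \<noteq> i} \<union> {k \<in> L. s k = i}" by auto
      then have "(\<Prod>k\<in>L. (x(i := y)) (s k)) = (\<Prod>k\<in>{k \<in> L. s k \<noteq> i}. (x(i := y)) (s k)) * (\<Prod>k\<in>{k \<in> L. s k = i}. (x(i := y)) (s k))"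
        using that by (metis (no_types, lifting) prod.union_disjoint finite_Un disjoint_iff mem_Collect_eq)
      then show ?thesis by simp
    qed
    have d1: "?d1 (x(i := y)) = real ?m * A * y ^ (?m - 1) * weight (x(i := y))" for y
    proof -
      have "(\<Prod>l\<in>K - {k}. (x(i := y)) (s l)) = A * y ^ (?m - 1)" if "k \<in> K" "s k = i" for k
      proof -
        have "{l \<in> K - {k}. s l \<noteq> i} = {l \<in> K. s l \<noteq> i}" "{l \<in> K - {k}. s l = i} = {l \<in> K. s l = i} - {k}"
          using that by auto
        moreover have "card ({l \<in> K. s l = i} - {k}) = ?m - 1" using that K(1) by simp
        ultimately show ?thesis using mon[of "K - {k}" y] K(1) by (simp add: A_def)
      qed
      then have "?d1 (x(i := y)) = (\<Sum>k\<in>K. if s k = i then A * y ^ (?m - 1) * weight (x(i := y)) else 0)"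
        by (intro sum.cong) auto
      also have "\<dots> = (\<Sum>k\<in>{k \<in> K. s k = i}. A * y ^ (?m - 1) * weight (x(i := y)))"
        using K(1) by (subst sum.inter_filter[symmetric]) auto
      finally show ?thesis by simp
    qed
    have d2: "?d2 (x(i := y)) = A * y ^ ?m * (Q i i * y + b) * weight (x(i := y))" for y
    proof -
      have "?d2 (x(i := y)) = (\<Sum>j\<in>I. Q i j * (x(i := y)) j) * (\<Prod>k\<in>K. (x(i := y)) (s k)) * weight (x(i := y))"
        by (simp add: sum_distrib_right mult.assoc)
      then show ?thesis unfolding lin mon[OF K(1)] by (simp add: A_def mult_ac)
    qed
    have "(\<integral>y. ?d1 (x(i := y)) - ?d2 (x(i := y)) \<partial>lborel) =
      (\<integral>y. (real ?m * A * y ^ (?m - 1) - A * y ^ ?m * (Q i i * y + b)) * exp (- (Q i i * y\<^sup>2 + 2 * b * y + e) / 2) \<partial>lborel)"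
      unfolding d1 d2 unfolding weight_def quad by (simp only: left_diff_distrib)
    also have "\<dots> = 0" by (rule gaussian_integration_by_parts_1d[OF c_pos dom])
    finally show ?thesis .
  qed
  have "(\<integral>\<phi>. ?d1 \<phi> - ?d2 \<phi> \<partial>D) = 0"
    using product_integral_insert[OF IJ(3,2), of "\<lambda>\<phi>. ?d1 \<phi> - ?d2 \<phi>"] int inner unfolding IJ(1)[symmetric] by simp
  moreover have "(\<integral>\<phi>. ?d1 \<phi> - ?d2 \<phi> \<partial>D) = (\<integral>\<phi>. ?d1 \<phi> \<partial>D) - (\<integral>\<phi>. ?d2 \<phi> \<partial>D)"
    by (intro Bochner_Integration.integral_diff Bochner_Integration.integrable_sum integrable_mult_right i2 i3)
  moreover have "(\<integral>\<phi>. ?d1 \<phi> \<partial>D) = (\<Sum>k\<in>K. if s k = i then (\<integral>\<phi>. (\<Prod>l\<in>K - {k}. \<phi> (s l)) * weight \<phi> \<partial>D) else 0)"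
    by (subst Bochner_Integration.integral_sum) (auto intro: i3 intro!: sum.cong)
  moreover have "(\<integral>\<phi>. ?d2 \<phi> \<partial>D) = (\<Sum>j\<in>I. Q i j * (\<integral>\<phi>. \<phi> j * (\<Prod>k\<in>K. \<phi> (s k)) * weight \<phi> \<partial>D))"
    by (subst Bochner_Integration.integral_sum) (auto intro: i2)
  ultimately show ?thesis by simp
qed

text \<open>Multiplying the integration by parts formulas by row \<open>i\<close> of
  \<open>G\<close> and summing inverts \<open>Q\<close> on the left-hand side.\<close>

lemma wick_step:
  assumes K: "finite K" "s ` K \<subseteq> I" and i: "i \<in> I"
  shows "(\<integral>\<phi>. \<phi> i * (\<Prod>k\<in>K. \<phi> (s k)) * weight \<phi> \<partial>D) =
    (\<Sum>k\<in>K. G i (s k) * (\<integral>\<phi>. (\<Prod>l\<in>K - {k}. \<phi> (s l)) * weight \<phi> \<partial>D))"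
proof -
  let ?m = "\<lambda>j. \<integral>\<phi>. \<phi> j * (\<Prod>k\<in>K. \<phi> (s k)) * weight \<phi> \<partial>D"
  let ?r = "\<lambda>k. \<integral>\<phi>. (\<Prod>l\<in>K - {k}. \<phi> (s l)) * weight \<phi> \<partial>D"
  have "?m i = (\<Sum>j\<in>I. if i = j then ?m j else 0)" using i finite_I by (simp only: sum.delta' if_True)
  also have "\<dots> = (\<Sum>j\<in>I. (if i = j then 1 else 0) * ?m j)" by (intro sum.cong) auto
  also have "\<dots> = (\<Sum>j\<in>I. (\<Sum>l\<in>I. G i l * Q l j) * ?m j)" using inverse[OF i] by simp
  also have "\<dots> = (\<Sum>l\<in>I. G i l * (\<Sum>j\<in>I. Q l j * ?m j))"
    unfolding sum_distrib_left sum_distrib_right by (subst sum.swap) (simp add: mult.assoc)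
  also have "\<dots> = (\<Sum>l\<in>I. G i l * (\<Sum>k\<in>K. if s k = l then ?r k else 0))"
    using integration_by_parts[OF K] by simp
  also have "\<dots> = (\<Sum>k\<in>K. \<Sum>l\<in>I. if s k = l then G i l * ?r k else 0)"
    unfolding sum_distrib_left by (subst sum.swap) (simp add: if_distrib cong: if_cong)
  also have "\<dots> = (\<Sum>k\<in>K. G i (s k) * ?r k)"
    using K(2) finite_I by (intro sum.cong refl) (auto simp: sum.delta)
  finally show ?thesis .
qed

text \<open>The recursion removes the least index. It is then the minimum of its pair, so it lands
  in the first argument of \<open>G\<close>, as the convention with \<open>Min\<close> and
  \<open>Max\<close> demands.\<close>

theorem wick:
  fixes K :: "nat set"
  assumes "finite K" "s ` K \<subseteq> I"
  shows "(\<integral>\<phi>. (\<Prod>k\<in>K. \<phi> (s k)) * weight \<phi> \<partial>D) =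
    (\<integral>\<phi>. weight \<phi> \<partial>D) * (\<Sum>p\<in>pairings K. \<Prod>e\<in>p. G (s (Min e)) (s (Max e)))"
  using assms
proof (induction "card K" arbitrary: K rule: less_induct)
  case less
  show ?case
  proof (cases "K = {}")
    case True
    then show ?thesis by (simp add: pairings_empty)
  next
    case False
    define a where "a = Min K"
    have a: "a \<in> K" "\<And>c. c \<in> K \<Longrightarrow> a \<le> c" using False less.prems(1) by (auto simp: a_def)
    let ?g = "\<lambda>e. G (s (Min e)) (s (Max e))"
    have ac: "?g {a, c} = G (s a) (s c)" if "c \<in> K - {a}" for c
      using a(2)[of c] that by (simp add: min_def max_def)
    have IH: "(\<integral>\<phi>. (\<Prod>l\<in>K - {a} - {c}. \<phi> (s l)) * weight \<phi> \<partial>D) =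
       (\<integral>\<phi>. weight \<phi> \<partial>D) * (\<Sum>p\<in>pairings (K - {a, c}). \<Prod>e\<in>p. ?g e)" if "c \<in> K - {a}" for c
    proof -
      have e: "K - {a} - {c} = K - {a, c}" by auto
      have "card (K - {a, c}) < card K" using a(1) less.prems(1) by (intro psubset_card_mono) auto
      then show ?thesis unfolding e by (rule less.hyps) (use less.prems in auto)
    qed
    have "(\<Prod>k\<in>K. \<phi> (s k)) = \<phi> (s a) * (\<Prod>k\<in>K - {a}. \<phi> (s k))" for \<phi> :: "'i \<Rightarrow> real"
      by (rule prod.remove[OF less.prems(1) a(1)])
    then have "(\<integral>\<phi>. (\<Prod>k\<in>K. \<phi> (s k)) * weight \<phi> \<partial>D) =
        (\<integral>\<phi>. \<phi> (s a) * (\<Prod>k\<in>K - {a}. \<phi> (s k)) * weight \<phi> \<partial>D)" by simp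
    also have "\<dots> = (\<Sum>c\<in>K - {a}. G (s a) (s c) * (\<integral>\<phi>. (\<Prod>l\<in>K - {a} - {c}. \<phi> (s l)) * weight \<phi> \<partial>D))"
      by (rule wick_step) (use less.prems a(1) in auto)
    also have "\<dots> = (\<integral>\<phi>. weight \<phi> \<partial>D) * (\<Sum>c\<in>K - {a}. ?g {a, c} * (\<Sum>p\<in>pairings (K - {a, c}). \<Prod>e\<in>p. ?g e))"
      unfolding sum_distrib_left[of "\<integral>\<phi>. weight \<phi> \<partial>D"] using IH ac by (intro sum.cong) (auto simp del: Min_insert Max_insert)
    finally show ?thesis by (simp only: sum_pairings_split[OF less.prems(1) a(1)])
  qed
qed

text \<open>A strictly positive function with zero integral would make every set null, including the
  unit cube.\<close>

lemma weight_integral_pos: "(\<integral>\<phi>. weight \<phi> \<partial>D) > 0"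
proof -
  interpret product_sigma_finite "\<lambda>_ :: 'i. lborel :: real measure" by (rule product_sigma_finite_lborel)
  have "(\<integral>\<phi>. weight \<phi> \<partial>D) \<noteq> 0"
  proof
    assume z: "(\<integral>\<phi>. weight \<phi> \<partial>D) = 0"
    have "AE \<phi> in D. 0 \<le> weight \<phi>" by (simp add: weight_def)
    from integral_nonneg_eq_0_iff_AE[OF weight_integrable this] z have "AE \<phi> in D. weight \<phi> = 0" by blast
    then have "AE \<phi> in D. False" by (simp add: weight_def)
    then have "AE \<phi> in D. \<not> \<phi> \<in> Pi\<^sub>E I (\<lambda>_. {0..1})" by (rule AE_mp) simp
    then have "emeasure D {\<phi> \<in> space D. \<phi> \<in> Pi\<^sub>E I (\<lambda>_. {0..1})} = 0" by (rule emeasure_eq_0_AE)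
    moreover have "{\<phi> \<in> space D. \<phi> \<in> Pi\<^sub>E I (\<lambda>_. {0..1})} = Pi\<^sub>E I (\<lambda>_. {0..1})"
      by (auto simp: space_PiM PiE_iff extensional_def)
    ultimately have "emeasure D (Pi\<^sub>E I (\<lambda>_. {0..1})) = 0" by (simp only:)
    moreover have "emeasure D (Pi\<^sub>E I (\<lambda>_. {0..1})) = 1"
      using finite_I by (subst emeasure_PiM) auto
    ultimately show False by simp
  qed
  moreover have "(\<integral>\<phi>. weight \<phi> \<partial>D) \<ge> 0" by (simp add: weight_def)
  ultimately show ?thesis by linarith
qed

end

section \<open>The Gaussian free field in coordinates\<close>

lemma orthonormal_basis_exists:
  fixes S :: "'a::euclidean_space set"
  assumes "subspace S"
  shows "\<exists>B. orthonormal_basis_of S B"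
proof -
  obtain B where "B \<subseteq> S" "pairwise orthogonal B" "\<And>x. x \<in> B \<Longrightarrow> norm x = 1" "span B = S"
    using orthonormal_basis_subspace[OF assms] by metis
  then show ?thesis unfolding orthonormal_basis_of_def by blast
qed

text \<open>The same \<open>SOME\<close> as in the definition of Lebesgue measure on a subspace, so
  that the latter unfolds to coordinates in this basis.\<close>

definition chosen_basis :: "'a::euclidean_space set \<Rightarrow> 'a set" where
  "chosen_basis S = (SOME B. orthonormal_basis_of S B)"

lemma chosen_basis: "subspace S \<Longrightarrow> orthonormal_basis_of S (chosen_basis S)"
  unfolding chosen_basis_def by (rule someI_ex) (rule orthonormal_basis_exists)

definition assemble :: "'a::euclidean_space set \<Rightarrow> ('a \<Rightarrow> real) \<Rightarrow> 'a" where
  "assemble B c = (\<Sum>b\<in>B. c b *\<^sub>R b)"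

lemma lborel_subspace_eq:
  "lborel_subspace S = distr (Pi\<^sub>M (chosen_basis S) (\<lambda>_. lborel)) borel (assemble (chosen_basis S))"
  unfolding lborel_subspace_def chosen_basis_def orthonormal_basis_of_def Let_def assemble_def[abs_def] ..

lemma assemble_measurable [measurable]: "assemble B \<in> borel_measurable (Pi\<^sub>M B (\<lambda>_. lborel))"
proof -
  have [measurable]: "(\<lambda>c. c b) \<in> borel_measurable (Pi\<^sub>M B (\<lambda>_. lborel :: real measure))" if "b \<in> B" for b
    using measurable_component_singleton[OF that, of "\<lambda>_. lborel"] by simp
  show ?thesis unfolding assemble_def[abs_def] by measurable
qed

lemma assemble_inner:
  assumes B: "orthonormal_basis_of S B" and "b \<in> B"
  shows "inner (assemble B c) b = c b"
  unfolding assemble_def inner_sum_left using orthonormal_basis_finite[OF B] assms(2)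
  by (simp add: orthonormal_inner[OF B _ assms(2)] if_distrib cong: if_cong)

lemma assemble_norm:
  assumes B: "orthonormal_basis_of S B"
  shows "inner (assemble B c) (assemble B c) = (\<Sum>b\<in>B. (c b)\<^sup>2)"
proof -
  have "inner (assemble B c) (assemble B c) = (\<Sum>b\<in>B. c b * inner (assemble B c) b)"
    by (subst (2) assemble_def) (simp add: inner_sum_right)
  then show ?thesis using assemble_inner[OF B] by (simp add: power2_eq_square)
qed

lemma assemble_in:
  assumes B: "orthonormal_basis_of S B"
  shows "assemble B c \<in> S"
proof -
  have "assemble B c \<in> span B" unfolding assemble_def by (intro span_sum span_scale span_base)
  then show ?thesis using B unfolding orthonormal_basis_of_def by simp
qed

text \<open>A coordinate is bounded by the norm, so the preimage of a ball lies in a box of finite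
  volume.\<close>

lemma sigma_finite_lborel_subspace:
  assumes S: "subspace S"
  shows "sigma_finite_measure (lborel_subspace S)"
proof
  interpret product_sigma_finite "\<lambda>_. lborel :: real measure" by (rule product_sigma_finite_lborel)
  define B where "B = chosen_basis S"
  have B: "orthonormal_basis_of S B" unfolding B_def by (rule chosen_basis[OF S])
  note fin = orthonormal_basis_finite[OF B]
  have "emeasure (lborel_subspace S) (cball 0 (real n)) \<noteq> \<infinity>" for n
  proof -
    have "emeasure (lborel_subspace S) (cball 0 (real n)) =
        emeasure (Pi\<^sub>M B (\<lambda>_. lborel)) (assemble B -` cball 0 (real n) \<inter> space (Pi\<^sub>M B (\<lambda>_. lborel)))"
      unfolding lborel_subspace_eq B_def[symmetric] by (rule emeasure_distr) auto
    also have "\<dots> \<le> emeasure (Pi\<^sub>M B (\<lambda>_. lborel)) (Pi\<^sub>E B (\<lambda>_. {- real n..real n}))"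
    proof (rule emeasure_mono)
      show "assemble B -` cball 0 (real n) \<inter> space (Pi\<^sub>M B (\<lambda>_. lborel)) \<subseteq> Pi\<^sub>E B (\<lambda>_. {- real n..real n})"
      proof
        fix c assume c: "c \<in> assemble B -` cball 0 (real n) \<inter> space (Pi\<^sub>M B (\<lambda>_. lborel))"
        have "c b \<in> {- real n..real n}" if "b \<in> B" for b
        proof -
          have "\<bar>c b\<bar> \<le> norm (assemble B c) * norm b"
            using Cauchy_Schwarz_ineq2[of "assemble B c" b] assemble_inner[OF B that] by simp
          also have "\<dots> \<le> real n" using c B that unfolding orthonormal_basis_of_def by auto
          finally show ?thesis by auto
        qed
        then show "c \<in> Pi\<^sub>E B (\<lambda>_. {- real n..real n})" using c by (auto simp: space_PiM PiE_iff)
      qed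
      show "Pi\<^sub>E B (\<lambda>_. {- real n..real n}) \<in> sets (Pi\<^sub>M B (\<lambda>_. lborel))"
        using fin by (intro sets_PiM_I_finite) auto
    qed
    also have "\<dots> < \<infinity>" using fin by (subst emeasure_PiM) (auto simp: ennreal_power)
    finally show ?thesis by simp
  qed
  moreover have "(\<Union>n. cball (0 :: 'a) (real n)) = UNIV" by (auto simp: real_arch_simple)
  ultimately show "\<exists>A. countable A \<and> A \<subseteq> sets (lborel_subspace S) \<and> \<Union>A = space (lborel_subspace S) \<and>
      (\<forall>a\<in>A. emeasure (lborel_subspace S) a \<noteq> \<infinity>)"
    by (intro exI[of _ "range (\<lambda>n :: nat. cball 0 (real n))"]) (auto simp: lborel_subspace_eq)
qed

lemma sets_lborel_subspace [simp]: "sets (lborel_subspace S) = sets borel"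
  by (simp add: lborel_subspace_eq)

lemma space_lborel_subspace [simp]: "space (lborel_subspace S) = UNIV"
  by (simp add: lborel_subspace_eq)

definition field_of :: "'a::euclidean_space set \<Rightarrow> ('v \<times> 'a \<Rightarrow> real) \<Rightarrow> 'v \<Rightarrow> 'a" where
  "field_of B \<phi> x = assemble B (\<lambda>b. \<phi> (x, b))"

text \<open>Both product measures are images of the nested product over vertices and then basis elements.\<close>

lemma product_lborel_subspace:
  fixes S :: "'a::euclidean_space set" and f :: "('v::finite \<Rightarrow> 'a) \<Rightarrow> 'f::{banach, second_countable_topology}"
  assumes S: "subspace S" and f: "f \<in> borel_measurable (Pi\<^sub>M UNIV (\<lambda>_. borel))"
  shows "(\<integral>M. f M \<partial>(\<Pi>\<^sub>M x\<in>UNIV. lborel_subspace S)) =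
      (\<integral>\<phi>. f (field_of (chosen_basis S) \<phi>) \<partial>(\<Pi>\<^sub>M i\<in>UNIV \<times> chosen_basis S. lborel))"
    and "(\<lambda>\<phi>. f (field_of (chosen_basis S) \<phi>)) \<in> borel_measurable (\<Pi>\<^sub>M i\<in>UNIV \<times> chosen_basis S. lborel)"
proof -
  define B where "B = chosen_basis S"
  have B: "orthonormal_basis_of S B" unfolding B_def by (rule chosen_basis[OF S])
  note fin = orthonormal_basis_finite[OF B]
  define L where "L = (\<lambda>_ :: 'v. Pi\<^sub>M B (\<lambda>_. lborel :: real measure))"
  interpret l: product_sigma_finite "\<lambda>_ :: 'a. lborel :: real measure" by (rule product_sigma_finite_lborel)
  interpret lv: product_sigma_finite "\<lambda>_ :: 'v \<times> 'a. lborel :: real measure" by (rule product_sigma_finite_lborel)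
  interpret s: product_sigma_finite "\<lambda>_ :: 'v. lborel_subspace S"
    by (simp add: product_sigma_finite_def sigma_finite_lborel_subspace[OF S])
  interpret n: product_sigma_finite L
    unfolding L_def product_sigma_finite_def using l.sigma_finite[OF fin] by simp
  let ?N = "Pi\<^sub>M UNIV L" and ?M = "Pi\<^sub>M UNIV (\<lambda>_ :: 'v. lborel_subspace S)"
    and ?D = "Pi\<^sub>M (UNIV \<times> B) (\<lambda>_ :: 'v \<times> 'a. lborel :: real measure)"
  let ?h = "\<lambda>(c :: 'v \<Rightarrow> 'a \<Rightarrow> real) x. assemble B (c x)"
  let ?u = "\<lambda>c :: 'v \<Rightarrow> 'a \<Rightarrow> real. \<lambda>i\<in>UNIV \<times> B. c (fst i) (snd i)"
  have comp: "(\<lambda>c. c x) \<in> measurable ?N (Pi\<^sub>M B (\<lambda>_. lborel))" for x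
    using measurable_component_singleton[of x UNIV L] by (simp add: L_def)
  have mh: "?h \<in> measurable ?N ?M"
  proof (rule measurable_PiM_single')
    show "(\<lambda>c. assemble B (c i)) \<in> measurable ?N (lborel_subspace S)" for i
      using measurable_compose[OF comp[of i] assemble_measurable]
      by (simp cong: measurable_cong_sets)
  qed (auto simp: PiE_def)
  have mu: "?u \<in> measurable ?N ?D"
  proof (rule measurable_restrict)
    fix i :: "'v \<times> 'a" assume i: "i \<in> UNIV \<times> B"
    have "(\<lambda>c. c (snd i)) \<in> measurable (Pi\<^sub>M B (\<lambda>_. lborel :: real measure)) lborel"
      using i by (intro measurable_component_singleton) auto
    from measurable_compose[OF comp this] show "(\<lambda>c. c (fst i) (snd i)) \<in> measurable ?N lborel" .
  qed
  have M: "distr ?N ?M ?h = ?M"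
  proof (rule s.PiM_eqI)
    fix A :: "'v \<Rightarrow> 'a set" assume A: "\<And>i. i \<in> UNIV \<Longrightarrow> A i \<in> sets (lborel_subspace S)"
    have "emeasure (distr ?N ?M ?h) (Pi\<^sub>E UNIV A) = emeasure ?N (?h -` Pi\<^sub>E UNIV A \<inter> space ?N)"
      using A by (intro emeasure_distr mh sets_PiM_I_finite) auto
    also have "?h -` Pi\<^sub>E UNIV A \<inter> space ?N = Pi\<^sub>E UNIV (\<lambda>x. assemble B -` A x \<inter> space (L x))"
      by (auto simp: space_PiM PiE_iff L_def)
    also have "emeasure ?N \<dots> = (\<Prod>x\<in>UNIV. emeasure (L x) (assemble B -` A x \<inter> space (L x)))"
      using A by (intro n.emeasure_PiM) (auto simp: L_def intro!: measurable_sets[OF assemble_measurable])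
    also have "\<dots> = (\<Prod>x\<in>UNIV. emeasure (lborel_subspace S) (A x))"
      using A by (intro prod.cong refl)
        (auto simp: lborel_subspace_eq B_def[symmetric] L_def emeasure_distr[OF assemble_measurable])
    finally show "emeasure (distr ?N ?M ?h) (Pi\<^sub>E UNIV A) = (\<Prod>x\<in>UNIV. emeasure (lborel_subspace S) (A x))" .
  qed simp_all
  have D: "distr ?N ?D ?u = ?D"
  proof (rule lv.PiM_eqI)
    fix A :: "'v \<times> 'a \<Rightarrow> real set" assume A: "\<And>i. i \<in> UNIV \<times> B \<Longrightarrow> A i \<in> sets lborel"
    have "emeasure (distr ?N ?D ?u) (Pi\<^sub>E (UNIV \<times> B) A) = emeasure ?N (?u -` Pi\<^sub>E (UNIV \<times> B) A \<inter> space ?N)"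
      using A fin by (intro emeasure_distr mu sets_PiM_I_finite) auto
    also have "?u -` Pi\<^sub>E (UNIV \<times> B) A \<inter> space ?N = Pi\<^sub>E UNIV (\<lambda>x. Pi\<^sub>E B (\<lambda>b. A (x, b)))"
      by (auto simp: space_PiM PiE_iff L_def restrict_def extensional_def)
    also have "emeasure ?N \<dots> = (\<Prod>x\<in>UNIV. emeasure (L x) (Pi\<^sub>E B (\<lambda>b. A (x, b))))"
      using A fin by (intro n.emeasure_PiM) (auto simp: L_def intro!: sets_PiM_I_finite)
    also have "\<dots> = (\<Prod>x\<in>UNIV. \<Prod>b\<in>B. emeasure lborel (A (x, b)))"
      using A fin unfolding L_def by (intro prod.cong refl l.emeasure_PiM) auto
    also have "\<dots> = (\<Prod>i\<in>UNIV \<times> B. emeasure lborel (A i))"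
      by (simp add: prod.cartesian_product)
    finally show "emeasure (distr ?N ?D ?u) (Pi\<^sub>E (UNIV \<times> B) A) = (\<Prod>i\<in>UNIV \<times> B. emeasure lborel (A i))" .
  qed (use fin in simp_all)
  have "sets ?M = sets (Pi\<^sub>M UNIV (\<lambda>_ :: 'v. borel))" by (intro sets_PiM_cong) simp_all
  then have fh: "f \<in> borel_measurable ?M" using f by (simp cong: measurable_cong_sets)
  have "(\<lambda>\<phi>. f (field_of B \<phi>)) \<in> borel_measurable ?D"
  proof (rule measurable_compose[OF _ f])
    show "field_of B \<in> measurable ?D (Pi\<^sub>M UNIV (\<lambda>_. borel))"
    proof (rule measurable_PiM_single'[where f="\<lambda>x \<phi>. field_of B \<phi> x", simplified])
      fix x :: 'v
      have [measurable]: "(\<lambda>\<phi>. \<phi> (x, b)) \<in> borel_measurable ?D" if "b \<in> B" for b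
        using measurable_component_singleton[of "(x, b)" "UNIV \<times> B" "\<lambda>_. lborel"] that by simp
      show "(\<lambda>\<phi>. field_of B \<phi> x) \<in> borel_measurable ?D"
        unfolding field_of_def assemble_def by measurable
    qed (auto simp: PiE_def)
  qed
  then show m: "(\<lambda>\<phi>. f (field_of (chosen_basis S) \<phi>)) \<in> borel_measurable (\<Pi>\<^sub>M i\<in>UNIV \<times> chosen_basis S. lborel)"
    unfolding B_def .
  have "(\<integral>M. f M \<partial>?M) = (\<integral>c. f (?h c) \<partial>?N)"
    by (subst M[symmetric]) (rule integral_distr[OF mh fh])
  also have "\<dots> = (\<integral>c. f (field_of B (?u c)) \<partial>?N)"
  proof -
    have "field_of B (?u c) = ?h c" for c
      by (auto simp: field_of_def assemble_def fun_eq_iff intro!: sum.cong)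
    then show ?thesis by simp
  qed
  also have "\<dots> = (\<integral>\<phi>. f (field_of B \<phi>) \<partial>?D)"
    by (subst D[symmetric]) (rule integral_distr[symmetric, OF mu], use m in \<open>simp add: B_def\<close>)
  finally show "(\<integral>M. f M \<partial>(\<Pi>\<^sub>M x\<in>UNIV. lborel_subspace S)) =
      (\<integral>\<phi>. f (field_of (chosen_basis S) \<phi>) \<partial>(\<Pi>\<^sub>M i\<in>UNIV \<times> chosen_basis S. lborel))"
    unfolding B_def .
qed

section \<open>The isomorphism\<close>

lemma Min_Max_pair:
  assumes "p \<in> pairings K" "e \<in> p"
  shows "e = {Min e, Max e}" "partner p (Min e) = Max e" "Min e \<in> e" "Max e \<in> e"
proof -
  obtain a b where e: "e = {a, b}" "a \<noteq> b" using pairingsD(2)[OF assms] by (auto simp: card_2_iff)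
  show 1: "e = {Min e, Max e}" unfolding e(1) by (auto simp: min_def max_def)
  show "partner p (Min e) = Max e" by (rule partner_eq(1)[OF assms(1)]) (use 1 assms(2) in simp)
  show "Min e \<in> e" "Max e \<in> e" using 1 by blast+
qed

text \<open>The path measures number the pairs by increasing minimum, whereas Wick's formula
  multiplies over the unordered set of pairs; \<open>Min\<close> is the bijection between the
  two.\<close>

lemma prod_pairs:
  fixes g :: "nat \<Rightarrow> nat \<Rightarrow> 'b::comm_monoid_mult"
  assumes p: "p \<in> pairings K" and K: "finite K"
  shows "(\<Prod>i<card p. g (pair_fst p i) (pair_snd p i)) = (\<Prod>e\<in>p. g (Min e) (Max e))"
proof -
  note fin = finite_pairing[OF p K]
  have inj: "inj_on Min p"
  proof (rule inj_onI)
    fix e e' assume e: "e \<in> p" "e' \<in> p" "Min e = Min e'"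
    then show "e = e'" using pairingsD(3)[OF p, of e e' "Min e"] Min_Max_pair(3)[OF p] by metis
  qed
  let ?xs = "sorted_list_of_set (Min ` p)"
  have len: "length ?xs = card p" using fin by (simp add: card_image[OF inj])
  have "bij_betw ((!) ?xs) {..<card p} (Min ` p)"
    using bij_betw_nth[of ?xs "{..<card p}" "Min ` p"] fin len by simp
  then have "(\<Prod>i<card p. g (?xs ! i) (partner p (?xs ! i))) = (\<Prod>a\<in>Min ` p. g a (partner p a))"
    by (rule prod.reindex_bij_betw)
  also have "\<dots> = (\<Prod>e\<in>p. g (Min e) (Max e))"
    using Min_Max_pair(2)[OF p] by (simp add: prod.reindex[OF inj])
  finally show ?thesis unfolding pair_fst_def pair_snd_def .
qed

text \<open>Slots are expanded one at a time. The values \<open>m\<close> outside \<open>L\<close>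
  stay arbitrary, so that a slot already expanded can hold its basis element in the induction
  hypothesis.\<close>

lemma multilinear_expansion:
  fixes T :: "(nat \<Rightarrow> 'm::real_vector) \<Rightarrow> 'f::real_vector"
  assumes L: "finite L" "finite B" and lin: "\<And>k m. k \<in> L \<Longrightarrow> linear (\<lambda>X. T (m(k := X)))"
  shows "T (\<lambda>k. if k \<in> L then \<Sum>b\<in>B. c k b *\<^sub>R b else m k) =
    (\<Sum>\<beta>\<in>Pi\<^sub>E L (\<lambda>_. B). (\<Prod>k\<in>L. c k (\<beta> k)) *\<^sub>R T (\<lambda>k. if k \<in> L then \<beta> k else m k))"
  using L(1) lin
proof (induction L arbitrary: m rule: finite_induct)
  case (insert a L)
  let ?z = "\<lambda>k. \<Sum>b\<in>B. c k b *\<^sub>R b"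
  have l: "linear (\<lambda>X. T ((\<lambda>k. if k \<in> L then ?z k else m k)(a := X)))" by (rule insert.prems) simp
  have "T (\<lambda>k. if k \<in> insert a L then ?z k else m k) = T ((\<lambda>k. if k \<in> L then ?z k else m k)(a := ?z a))"
    using insert.hyps by (intro arg_cong[where f=T]) auto
  also have "\<dots> = (\<Sum>b\<in>B. c a b *\<^sub>R T ((\<lambda>k. if k \<in> L then ?z k else m k)(a := b)))"
    unfolding linear_sum[OF l] linear_scale[OF l] ..
  also have "\<dots> = (\<Sum>b\<in>B. c a b *\<^sub>R (\<Sum>\<beta>\<in>Pi\<^sub>E L (\<lambda>_. B). (\<Prod>k\<in>L. c k (\<beta> k)) *\<^sub>R T (\<lambda>k. if k \<in> L then \<beta> k else (m(a := b)) k)))"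
  proof (intro sum.cong refl arg_cong[where f="\<lambda>y. c a _ *\<^sub>R y"])
    fix b
    have "T ((\<lambda>k. if k \<in> L then ?z k else m k)(a := b)) = T (\<lambda>k. if k \<in> L then ?z k else (m(a := b)) k)"
      using insert.hyps by (intro arg_cong[where f=T]) auto
    also have "\<dots> = (\<Sum>\<beta>\<in>Pi\<^sub>E L (\<lambda>_. B). (\<Prod>k\<in>L. c k (\<beta> k)) *\<^sub>R T (\<lambda>k. if k \<in> L then \<beta> k else (m(a := b)) k))"
      by (rule insert.IH) (use insert.prems in auto)
    finally show "T ((\<lambda>k. if k \<in> L then ?z k else m k)(a := b)) =
      (\<Sum>\<beta>\<in>Pi\<^sub>E L (\<lambda>_. B). (\<Prod>k\<in>L. c k (\<beta> k)) *\<^sub>R T (\<lambda>k. if k \<in> L then \<beta> k else (m(a := b)) k))" .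
  qed
  also have "\<dots> = (\<Sum>\<beta>\<in>Pi\<^sub>E L (\<lambda>_. B). \<Sum>b\<in>B. (\<Prod>k\<in>insert a L. c k ((\<beta>(a := b)) k)) *\<^sub>R
      T (\<lambda>k. if k \<in> insert a L then (\<beta>(a := b)) k else m k))"
  proof (unfold scaleR_sum_right, subst sum.swap, intro sum.cong refl)
    fix b \<beta>
    have "(\<Prod>k\<in>insert a L. c k ((\<beta>(a := b)) k)) = c a b * (\<Prod>k\<in>L. c k (\<beta> k))"
      using insert.hyps by (subst prod.insert) (auto intro!: prod.cong)
    moreover have "(\<lambda>k. if k \<in> insert a L then (\<beta>(a := b)) k else m k) = (\<lambda>k. if k \<in> L then \<beta> k else (m(a := b)) k)"
      using insert.hyps by auto
    ultimately show "c a b *\<^sub>R (\<Prod>k\<in>L. c k (\<beta> k)) *\<^sub>R T (\<lambda>k. if k \<in> L then \<beta> k else (m(a := b)) k) =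
      (\<Prod>k\<in>insert a L. c k ((\<beta>(a := b)) k)) *\<^sub>R T (\<lambda>k. if k \<in> insert a L then (\<beta>(a := b)) k else m k)"
      by simp
  qed
  also have "\<dots> = (\<Sum>\<beta>\<in>Pi\<^sub>E (insert a L) (\<lambda>_. B). (\<Prod>k\<in>insert a L. c k (\<beta> k)) *\<^sub>R
      T (\<lambda>k. if k \<in> insert a L then \<beta> k else m k))"
    by (rule sum_PiE_insert[OF insert.hyps(2,1) L(2), symmetric])
  finally show ?case .
qed simp

text \<open>The Kronecker deltas select the assignments that are constant on each pair, and these
  correspond to assignments of one basis element to each pair.\<close>

lemma sum_paired_indices:
  fixes T :: "(nat \<Rightarrow> 'm) \<Rightarrow> 'f::real_vector"
  assumes p: "p \<in> pairings K" and K: "finite K" and B: "finite B"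
    and dep: "\<And>m m'. (\<And>k. k \<in> K \<Longrightarrow> m k = m' k) \<Longrightarrow> T m = T m'"
  shows "(\<Sum>\<beta>\<in>Pi\<^sub>E K (\<lambda>_. B). (\<Prod>e\<in>p. of_bool (\<beta> (Min e) = \<beta> (Max e)) :: real) *\<^sub>R T \<beta>) =
    (\<Sum>b\<in>Pi\<^sub>E p (\<lambda>_. B). T (\<lambda>k. b {k, partner p k}))"
proof -
  note fin = finite_pairing[OF p K]
  have U: "\<Union>p = K" by (rule pairingsD(1)[OF p])
  let ?ok = "\<lambda>\<beta>. \<forall>e\<in>p. \<beta> (Min e) = \<beta> (Max e)"
  have "(\<Prod>e\<in>p. of_bool (\<beta> (Min e) = \<beta> (Max e)) :: real) = of_bool (?ok \<beta>)" for \<beta> :: "nat \<Rightarrow> 'm"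
    using fin by (induction p rule: finite_induct) auto
  then have "(\<Sum>\<beta>\<in>Pi\<^sub>E K (\<lambda>_. B). (\<Prod>e\<in>p. of_bool (\<beta> (Min e) = \<beta> (Max e)) :: real) *\<^sub>R T \<beta>) =
      (\<Sum>\<beta>\<in>Pi\<^sub>E K (\<lambda>_. B). if ?ok \<beta> then T \<beta> else 0)"
    by (intro sum.cong) auto
  also have "\<dots> = (\<Sum>\<beta>\<in>{\<beta> \<in> Pi\<^sub>E K (\<lambda>_. B). ?ok \<beta>}. T \<beta>)"
    using K B by (intro sum.inter_filter[symmetric] finite_PiE) auto
  also have "\<dots> = (\<Sum>b\<in>Pi\<^sub>E p (\<lambda>_. B). T (\<lambda>k. b {k, partner p k}))"
  proof (rule sum.reindex_bij_witness[of _ "\<lambda>b. \<lambda>k\<in>K. b {k, partner p k}" "\<lambda>\<beta>. \<lambda>e\<in>p. \<beta> (Min e)"])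
    fix \<beta> assume \<beta>: "\<beta> \<in> {\<beta> \<in> Pi\<^sub>E K (\<lambda>_. B). ?ok \<beta>}"
    have eq: "\<beta> (Min {k, partner p k}) = \<beta> k" if k: "k \<in> K" for k
    proof -
      let ?e = "{k, partner p k}"
      have e: "?e \<in> p" using partner_pair(1)[OF p k] .
      then have "k = Min ?e \<or> k = Max ?e" using Min_Max_pair(1)[OF p e] by blast
      moreover have "\<beta> (Min ?e) = \<beta> (Max ?e)" using \<beta> e by blast
      ultimately show ?thesis by metis
    qed
    show "(\<lambda>k\<in>K. (\<lambda>e\<in>p. \<beta> (Min e)) {k, partner p k}) = \<beta>"
    proof
      fix k show "(\<lambda>k\<in>K. (\<lambda>e\<in>p. \<beta> (Min e)) {k, partner p k}) k = \<beta> k"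
      proof (cases "k \<in> K")
        case True
        then show ?thesis using eq[OF True] partner_pair(1)[OF p True] by (simp only: restrict_apply if_True)
      next
        case False
        then show ?thesis using \<beta> by (auto simp: PiE_iff extensional_def)
      qed
    qed
    have "Min e \<in> K" "Max e \<in> K" if "e \<in> p" for e using Min_Max_pair(3,4)[OF p that] U that by blast+
    then show "(\<lambda>e\<in>p. \<beta> (Min e)) \<in> Pi\<^sub>E p (\<lambda>_. B)" using \<beta> by (auto simp: PiE_iff)
    show "T (\<lambda>k. (\<lambda>e\<in>p. \<beta> (Min e)) {k, partner p k}) = T \<beta>"
      by (rule dep) (use eq partner_pair(1)[OF p] in \<open>simp only: restrict_apply if_True\<close>)
  next
    fix b assume b: "b \<in> Pi\<^sub>E p (\<lambda>_. B)"
    have me: "{Min e, partner p (Min e)} = e" "{Max e, partner p (Max e)} = e" "Min e \<in> K" "Max e \<in> K" if e: "e \<in> p" for e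
    proof -
      note m = Min_Max_pair[OF p e]
      show "{Min e, partner p (Min e)} = e" using m(1,2) by simp
      show K: "Min e \<in> K" "Max e \<in> K" using m(3,4) U e by blast+
      have "partner p (Max e) = Min e" using partner_pair(3)[OF p K(1)] m(2) by simp
      then show "{Max e, partner p (Max e)} = e" using m(1) by (simp add: insert_commute)
    qed
    show "(\<lambda>e\<in>p. (\<lambda>k\<in>K. b {k, partner p k}) (Min e)) = b"
    proof
      fix e show "(\<lambda>e\<in>p. (\<lambda>k\<in>K. b {k, partner p k}) (Min e)) e = b e"
      proof (cases "e \<in> p")
        case True
        then show ?thesis by (simp only: restrict_apply if_True me)
      next
        case False
        then show ?thesis using b by (auto simp: PiE_iff extensional_def)
      qed
    qed
    have "(\<lambda>k\<in>K. b {k, partner p k}) \<in> Pi\<^sub>E K (\<lambda>_. B)"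
      using b partner_pair(1)[OF p] by (auto simp: PiE_iff)
    moreover have "?ok (\<lambda>k\<in>K. b {k, partner p k})"
      by (intro ballI) (simp only: restrict_apply if_True me)
    ultimately show "(\<lambda>k\<in>K. b {k, partner p k}) \<in> {\<beta> \<in> Pi\<^sub>E K (\<lambda>_. B). ?ok \<beta>}" by blast
  qed
  finally show ?thesis .
qed

section \<open>The components of the field as a Gaussian vector\<close>

context electrical_network
begin

definition lap_entry :: "('v \<Rightarrow> real) \<Rightarrow> 'v \<Rightarrow> 'v \<Rightarrow> real" where
  "lap_entry lam x y = (if x = y then rate x + lam x else 0) - cond x y"

lemma lap_entry_sum: "(\<Sum>y\<in>UNIV. lap_entry lam x y * f y) = lap f x + lam x * f x"
proof -
  have "(\<Sum>y\<in>UNIV. lap_entry lam x y * f y) = (\<Sum>y\<in>UNIV. (if x = y then (rate x + lam x) * f y else 0) - cond x y * f y)"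
    unfolding lap_entry_def by (intro sum.cong) (auto simp: left_diff_distrib)
  then show ?thesis by (simp add: sum_subtractf lap_def distrib_right)
qed

text \<open>The equation of the Green function says that it is a right inverse of the matrix; for
  finite square matrices it is then also a left inverse.\<close>

lemma green_left_inverse:
  assumes lam: "\<And>v. 0 \<le> lam v"
  shows "(\<Sum>z\<in>UNIV. path_green lam x z * lap_entry lam z y) = of_bool (x = y)"
proof -
  let ?A = "\<chi> x y. lap_entry lam x y" and ?G = "\<chi> x y. path_green lam x y"
  have "?A ** ?G = mat 1"
  proof -
    have "(\<Sum>z\<in>UNIV. lap_entry lam x z * path_green lam z y) = of_bool (x = y)" for x y
      using path_green_equation[where lam=lam, OF lam, of x y] by (simp add: lap_entry_sum lap_def distrib_right)
    then show ?thesis by (simp add: matrix_matrix_mult_def mat_def vec_eq_iff)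
  qed
  then have "?G ** ?A = mat 1" by (simp add: matrix_left_right_inverse)
  then have "(?G ** ?A) $ x $ y = (mat 1 :: real ^ 'v ^ 'v) $ x $ y" by simp
  then show ?thesis by (simp add: matrix_matrix_mult_def mat_def)
qed

text \<open>Different basis elements give uncorrelated copies of one scalar field, so precision and
  covariance are block diagonal.\<close>

definition block :: "('v \<Rightarrow> 'v \<Rightarrow> real) \<Rightarrow> 'v \<times> 'a \<Rightarrow> 'v \<times> 'a \<Rightarrow> real" where
  "block M i j = (if snd i = snd j then M (fst i) (fst j) else 0)"

lemma block_quad:
  assumes "finite B"
  shows "(\<Sum>i\<in>UNIV \<times> B. \<Sum>j\<in>UNIV \<times> B. block (lap_entry lam) i j * \<phi> i * \<phi> j) =
    (\<Sum>b\<in>B. form (\<lambda>x. \<phi> (x, b)) + (\<Sum>x\<in>UNIV. lam x * (\<phi> (x, b))\<^sup>2))"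
proof -
  have key: "(\<Sum>y\<in>UNIV. lap_entry lam x y * \<phi> (y, b)) = lap (\<lambda>x. \<phi> (x, b)) x + lam x * \<phi> (x, b)" for x b
    by (rule lap_entry_sum)
  have "(\<Sum>i\<in>UNIV \<times> B. \<Sum>j\<in>UNIV \<times> B. block (lap_entry lam) i j * \<phi> i * \<phi> j) =
     (\<Sum>x\<in>UNIV. \<Sum>b\<in>B. \<Sum>y\<in>UNIV. \<Sum>b'\<in>B. if b' = b then lap_entry lam x y * \<phi> (x, b) * \<phi> (y, b') else 0)"
    unfolding sum.cartesian_product' by (intro sum.cong refl) (simp add: block_def)
  also have "\<dots> = (\<Sum>x\<in>UNIV. \<Sum>b\<in>B. \<phi> (x, b) * (lap (\<lambda>x. \<phi> (x, b)) x + lam x * \<phi> (x, b)))"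
    unfolding key[symmetric] sum_distrib_left
    using assms by (intro sum.cong refl) (simp add: sum.delta mult_ac)
  also have "\<dots> = (\<Sum>b\<in>B. \<Sum>x\<in>UNIV. \<phi> (x, b) * lap (\<lambda>x. \<phi> (x, b)) x + lam x * (\<phi> (x, b))\<^sup>2)"
    by (subst sum.swap) (simp add: distrib_left power2_eq_square mult_ac)
  finally show ?thesis unfolding sum.distrib form_eq .
qed

text \<open>The coercivity constant of the form without additional killing serves for every
  \<open>lam\<close>, because the additional terms are nonnegative.\<close>

lemma gaussian_field_block:
  assumes B: "finite B" and lam: "\<And>v. 0 \<le> lam v"
  shows "\<exists>c. gaussian_field (UNIV \<times> B) (block (lap_entry lam)) (block (path_green lam)) c"
proof -
  obtain c where c: "c > 0" "\<And>f. c * (\<Sum>x\<in>UNIV. (f x)\<^sup>2) \<le> form f" using form_coercive by blast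
  have "gaussian_field (UNIV \<times> B) (block (lap_entry lam)) (block (path_green lam)) c"
  proof
    show "finite ((UNIV :: 'v set) \<times> B)" using B by simp
    show "0 < c" by fact
    fix i j :: "'v \<times> 'a" assume ij: "i \<in> UNIV \<times> B" "j \<in> UNIV \<times> B"
    show "block (lap_entry lam) i j = block (lap_entry lam) j i"
      by (simp add: block_def lap_entry_def cond_sym)
    have "(\<Sum>k\<in>UNIV \<times> B. block (path_green lam) i k * block (lap_entry lam) k j) =
      (\<Sum>z\<in>UNIV. \<Sum>b\<in>B. if b = snd i then (if b = snd j then path_green lam (fst i) z * lap_entry lam z (fst j) else 0) else 0)"
      unfolding sum.cartesian_product' by (intro sum.cong refl) (auto simp: block_def)
    also have "\<dots> = (\<Sum>z\<in>UNIV. if snd i = snd j then path_green lam (fst i) z * lap_entry lam z (fst j) else 0)"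
      using B ij by (intro sum.cong refl) (auto simp: sum.delta)
    also have "\<dots> = (if snd i = snd j then of_bool (fst i = fst j) else 0)"
      using green_left_inverse[where lam=lam, OF lam] by simp
    also have "\<dots> = (if i = j then 1 else 0)" by (auto simp: prod_eq_iff)
    finally show "(\<Sum>k\<in>UNIV \<times> B. block (path_green lam) i k * block (lap_entry lam) k j) = (if i = j then 1 else 0)" .
  next
    fix \<phi> :: "'v \<times> 'a \<Rightarrow> real"
    have "c * (\<Sum>i\<in>UNIV \<times> B. (\<phi> i)\<^sup>2) = (\<Sum>b\<in>B. c * (\<Sum>x\<in>UNIV. (\<phi> (x, b))\<^sup>2))"
      unfolding sum.cartesian_product' by (subst sum.swap) (simp add: sum_distrib_left)
    also have "\<dots> \<le> (\<Sum>b\<in>B. form (\<lambda>x. \<phi> (x, b)) + (\<Sum>x\<in>UNIV. lam x * (\<phi> (x, b))\<^sup>2))"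
    proof (rule sum_mono)
      fix b
      have "0 \<le> (\<Sum>x\<in>UNIV. lam x * (\<phi> (x, b))\<^sup>2)" by (intro sum_nonneg) (simp add: lam)
      then show "c * (\<Sum>x\<in>UNIV. (\<phi> (x, b))\<^sup>2) \<le> form (\<lambda>x. \<phi> (x, b)) + (\<Sum>x\<in>UNIV. lam x * (\<phi> (x, b))\<^sup>2)"
        using c(2)[of "\<lambda>x. \<phi> (x, b)"] by simp
    qed
    finally show "c * (\<Sum>i\<in>UNIV \<times> B. (\<phi> i)\<^sup>2) \<le> (\<Sum>i\<in>UNIV \<times> B. \<Sum>j\<in>UNIV \<times> B. block (lap_entry lam) i j * \<phi> i * \<phi> j)"
      unfolding block_quad[OF B] .
  qed
  then show ?thesis ..
qed

definition gweight :: "('v \<Rightarrow> real) \<Rightarrow> 'a set \<Rightarrow> ('v \<times> 'a \<Rightarrow> real) \<Rightarrow> real" where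
  "gweight lam B \<phi> = exp (- (\<Sum>b\<in>B. form (\<lambda>x. \<phi> (x, b)) + (\<Sum>x\<in>UNIV. lam x * (\<phi> (x, b))\<^sup>2)) / 2)"

definition sq_field :: "'a set \<Rightarrow> ('v \<times> 'a \<Rightarrow> real) \<Rightarrow> real ^ 'v" where
  "sq_field B \<phi> = (\<chi> v. (\<Sum>b\<in>B. (\<phi> (v, b))\<^sup>2) / 2)"

abbreviation gspace :: "'a set \<Rightarrow> ('v \<times> 'a \<Rightarrow> real) measure" where
  "gspace B \<equiv> Pi\<^sub>M (UNIV \<times> B) (\<lambda>_. lborel)"

definition gmass :: "'a set \<Rightarrow> real" where
  "gmass B = (\<integral>\<phi>. gweight (\<lambda>_. 0) B \<phi> \<partial>gspace B)"

lemma gweight_weight: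
  assumes "finite B" "gaussian_field (UNIV \<times> B) (block (lap_entry lam)) (block (path_green lam)) c"
  shows "gaussian_field.weight (UNIV \<times> B) (block (lap_entry lam)) = gweight lam B"
proof -
  interpret gaussian_field "UNIV \<times> B" "block (lap_entry lam)" "block (path_green lam)" c by fact
  show ?thesis by (simp add: fun_eq_iff weight_def quad_def gweight_def block_quad[OF assms(1)])
qed

text \<open>The factor one half in \<open>sq_field\<close> matches the one in the Gaussian exponent,
  so that exponential tilting amounts to adding \<open>lam\<close> to the killing rates.\<close>

lemma gweight_laplace:
  "gweight (\<lambda>_. 0) B \<phi> * exp (- (\<Sum>v\<in>UNIV. lam v * sq_field B \<phi> $ v)) = gweight lam B \<phi>"
proof -
  have "(\<Sum>v\<in>UNIV. lam v * sq_field B \<phi> $ v) = (\<Sum>b\<in>B. \<Sum>x\<in>UNIV. lam x * (\<phi> (x, b))\<^sup>2) / 2"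
    unfolding sq_field_def by (subst sum.swap) (simp add: sum_distrib_left sum_divide_distrib)
  then show ?thesis
    by (simp add: gweight_def exp_add[symmetric] sum.distrib add_divide_distrib)
qed

lemma gweight_integrable:
  assumes B: "finite B" and lam: "\<And>v. 0 \<le> lam v" and K: "finite K" "s ` K \<subseteq> UNIV \<times> B"
  shows "integrable (gspace B) (\<lambda>\<phi>. (\<Prod>k\<in>K. \<phi> (s k)) * gweight lam B \<phi>)"
proof -
  obtain c where g: "gaussian_field (UNIV \<times> B) (block (lap_entry lam)) (block (path_green lam)) c"
    using gaussian_field_block[where lam=lam, OF B lam] by blast
  show ?thesis using gaussian_field.monomial_integrable[OF g K] unfolding gweight_weight[OF B g] .
qed

lemma gmass_pos: "finite B \<Longrightarrow> 0 < gmass B"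
proof -
  assume B: "finite B"
  obtain c where g: "gaussian_field (UNIV \<times> B) (block (lap_entry (\<lambda>_. 0))) (block (path_green (\<lambda>_. 0))) c"
    using gaussian_field_block[OF B, of "\<lambda>_. 0"] by auto
  show ?thesis using gaussian_field.weight_integral_pos[OF g] unfolding gweight_weight[OF B g] gmass_def .
qed

lemma gweight_wick:
  fixes K :: "nat set"
  assumes B: "finite B" and lam: "\<And>v. 0 \<le> lam v" and K: "finite K" "\<beta> ` K \<subseteq> B"
  shows "(\<integral>\<phi>. (\<Prod>k\<in>K. \<phi> (x k, \<beta> k)) * gweight lam B \<phi> \<partial>gspace B) =
    (\<integral>\<phi>. gweight lam B \<phi> \<partial>gspace B) * (\<Sum>p\<in>pairings K. (\<Prod>e\<in>p. of_bool (\<beta> (Min e) = \<beta> (Max e))) *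
      (\<Prod>e\<in>p. path_green lam (x (Min e)) (x (Max e))))"
proof -
  obtain c where g: "gaussian_field (UNIV \<times> B) (block (lap_entry lam)) (block (path_green lam)) c"
    using gaussian_field_block[where lam=lam, OF B lam] by blast
  have s: "(\<lambda>k. (x k, \<beta> k)) ` K \<subseteq> UNIV \<times> B" using K(2) by auto
  have "(\<Prod>e\<in>p. block (path_green lam) (x (Min e), \<beta> (Min e)) (x (Max e), \<beta> (Max e))) =
      (\<Prod>e\<in>p. of_bool (\<beta> (Min e) = \<beta> (Max e))) * (\<Prod>e\<in>p. path_green lam (x (Min e)) (x (Max e)))" for p
    unfolding prod.distrib[symmetric] by (intro prod.cong refl) (simp add: block_def)
  then show ?thesis
    using gaussian_field.wick[OF g K(1) s] unfolding gweight_weight[OF B g] by simp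
qed

lemma sq_field_measurable [measurable]: "sq_field B \<in> borel_measurable (gspace B)"
proof -
  have "(\<lambda>\<phi>. (\<Sum>b\<in>B. (\<phi> (v, b))\<^sup>2) / 2) \<in> borel_measurable (gspace B)" for v
  proof -
    have [measurable]: "(\<lambda>\<phi>. \<phi> (v, b)) \<in> borel_measurable (gspace B)" if "b \<in> B" for b
      using measurable_component_singleton[of "(v, b)" "UNIV \<times> B" "\<lambda>_. lborel"] that by simp
    show ?thesis by measurable
  qed
  then show ?thesis unfolding sq_field_def[abs_def] by (rule borel_measurable_vec_lambda)
qed

lemma sq_field_nonneg: "0 \<le> sq_field B \<phi> $ v"
  by (simp add: sq_field_def sum_nonneg)

lemma product_sigma_finite_path: "product_sigma_finite (\<lambda>i. path_measure E C \<kappa> (f i) (g i))"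
  unfolding product_sigma_finite_def using finite_path_measure finite_measure.axioms(1) by blast

lemma finite_pairing_measure: "finite_measure (pairing_measure E C \<kappa> x p)"
proof
  interpret product_sigma_finite "\<lambda>i. path_measure E C \<kappa> (x (pair_fst p i)) (x (pair_snd p i))"
    by (rule product_sigma_finite_path)
  have "emeasure (pairing_measure E C \<kappa> x p) (space (pairing_measure E C \<kappa> x p)) =
      (\<Prod>i<card p. emeasure (path_measure E C \<kappa> (x (pair_fst p i)) (x (pair_snd p i)))
         (space (path_measure E C \<kappa> (x (pair_fst p i)) (x (pair_snd p i)))))"
    unfolding pairing_measure_def space_PiM by (rule emeasure_PiM) (auto simp del: sets_path_measure)
  also have "\<dots> < \<infinity>"
    using finite_measure.emeasure_finite[OF finite_path_measure]
    by (auto simp: ennreal_prod_eq_top less_top[symmetric])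
  finally show "emeasure (pairing_measure E C \<kappa> x p) (space (pairing_measure E C \<kappa> x p)) \<noteq> \<infinity>" by simp
qed

definition total_occupation :: "nat set set \<Rightarrow> (nat \<Rightarrow> 'v path) \<Rightarrow> real ^ 'v" where
  "total_occupation p \<gamma> = (\<Sum>i<card p. occupation (\<gamma> i))"

lemma total_occupation_measurable [measurable]:
  "total_occupation p \<in> borel_measurable (pairing_measure E C \<kappa> x p)"
proof -
  have "(\<lambda>\<gamma>. occupation (\<gamma> i)) \<in> borel_measurable (pairing_measure E C \<kappa> x p)" if "i < card p" for i
  proof -
    have "(\<lambda>\<gamma>. \<gamma> i) \<in> measurable (pairing_measure E C \<kappa> x p) (path_measure E C \<kappa> (x (pair_fst p i)) (x (pair_snd p i)))"
      unfolding pairing_measure_def by (rule measurable_component_singleton) (use that in simp)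
    moreover have "occupation \<in> borel_measurable (path_measure E C \<kappa> (x (pair_fst p i)) (x (pair_snd p i)))"
      using occupation_measurable by (simp cong: measurable_cong_sets)
    ultimately show ?thesis by (rule measurable_compose)
  qed
  then show ?thesis unfolding total_occupation_def[abs_def] by (intro borel_measurable_sum) auto
qed

text \<open>Under the product measure the paths are independent, so the transform of their total
  occupation factorises over the pairs.\<close>

lemma pairing_laplace:
  assumes p: "p \<in> pairings K" "finite K" and lam: "\<And>v. 0 \<le> lam v"
  shows "(\<integral>\<gamma>. exp (- (\<Sum>v\<in>UNIV. lam v * total_occupation p \<gamma> $ v)) \<partial>pairing_measure E C \<kappa> x p) =
    (\<Prod>e\<in>p. path_green lam (x (Min e)) (x (Max e)))"
proof -
  interpret product_sigma_finite "\<lambda>i. path_measure E C \<kappa> (x (pair_fst p i)) (x (pair_snd p i))"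
    by (rule product_sigma_finite_path)
  have split: "exp (- (\<Sum>v\<in>UNIV. lam v * total_occupation p \<gamma> $ v)) =
      (\<Prod>i<card p. exp (- (\<Sum>v\<in>UNIV. lam v * occupation (\<gamma> i) $ v)))" for \<gamma> :: "nat \<Rightarrow> 'v path"
  proof -
    have "(\<Sum>v\<in>UNIV. lam v * total_occupation p \<gamma> $ v) = (\<Sum>i<card p. \<Sum>v\<in>UNIV. lam v * occupation (\<gamma> i) $ v)"
      unfolding total_occupation_def by (subst sum.swap) (simp add: sum_distrib_left)
    then show ?thesis by (simp add: exp_sum[symmetric] sum_negf)
  qed
  have "(\<integral>\<gamma>. exp (- (\<Sum>v\<in>UNIV. lam v * total_occupation p \<gamma> $ v)) \<partial>pairing_measure E C \<kappa> x p) =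
     (\<Prod>i<card p. path_green lam (x (pair_fst p i)) (x (pair_snd p i)))"
    unfolding split pairing_measure_def path_green_def
    by (rule product_integral_prod[where f="\<lambda>_ \<gamma>. exp (- (\<Sum>v\<in>UNIV. lam v * occupation \<gamma> $ v))"])
      (simp, rule path_green_integrable[where lam=lam, OF lam])
  then show ?thesis using prod_pairs[OF p, of "\<lambda>a b. path_green lam (x a) (x b)"] by simp
qed

text \<open>Both transforms equal \<open>?Z\<close>, the Gaussian mass with the additional killing,
  times the same sum over pairings. On the left this is Wick's formula for the tilted weight; on the
  right the independent field and paths contribute \<open>?Z\<close> and the Green functions
  separately. No normalisation is performed, so the two occurrences of \<open>?Z\<close> match
  exactly.\<close>

theorem gaussian_isomorphism:
  fixes K :: "nat set" and F :: "real ^ 'v \<Rightarrow> real"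
  assumes B: "finite B" and K: "finite K" "\<beta> ` K \<subseteq> B"
    and F: "F \<in> borel_measurable borel" "bounded (range F)"
  shows "(\<integral>\<phi>. (\<Prod>k\<in>K. \<phi> (x k, \<beta> k)) * gweight (\<lambda>_. 0) B \<phi> * F (sq_field B \<phi>) \<partial>gspace B) =
    (\<Sum>p\<in>pairings K. (\<Prod>e\<in>p. of_bool (\<beta> (Min e) = \<beta> (Max e))) *
      (\<integral>\<gamma>. (\<integral>\<phi>. gweight (\<lambda>_. 0) B \<phi> * F (sq_field B \<phi> + total_occupation p \<gamma>) \<partial>gspace B) \<partial>pairing_measure E C \<kappa> x p))"
proof -
  let ?D = "gspace B" and ?P = "\<lambda>p. pairing_measure E C \<kappa> x p" and ?w = "gweight (\<lambda>_. 0) B"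
  let ?d = "\<lambda>p. (\<Prod>e\<in>p. of_bool (\<beta> (Min e) = \<beta> (Max e))) :: real"
  interpret L: product_sigma_finite "\<lambda>_ :: 'v \<times> 'a. lborel :: real measure" by (rule product_sigma_finite_lborel)
  interpret D: sigma_finite_measure ?D by (rule L.sigma_finite) (use B in simp)
  have w: "integrable ?D ?w" using gweight_integrable[OF B, of "\<lambda>_. 0" "{}"] by simp
  have w0: "0 \<le> ?w \<phi>" for \<phi> by (simp add: gweight_def)
  have fub: "integrable (?P p \<Otimes>\<^sub>M ?D) (\<lambda>z. ?w (snd z) * h z)"
      "(\<integral>z. ?w (snd z) * h z \<partial>(?P p \<Otimes>\<^sub>M ?D)) = (\<integral>\<gamma>. (\<integral>\<phi>. ?w \<phi> * h (\<gamma>, \<phi>) \<partial>?D) \<partial>?P p)"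
    if h: "h \<in> borel_measurable (?P p \<Otimes>\<^sub>M ?D)" "\<And>z. \<bar>h z\<bar> \<le> c" for p h c
  proof -
    interpret P: finite_measure "?P p" by (rule finite_pairing_measure)
    interpret PD: pair_sigma_finite "?P p" ?D ..
    have "integrable (?P p \<Otimes>\<^sub>M ?D) (\<lambda>z. ?w (snd z))"
    proof (rule PD.Fubini_integrable)
      show "(\<lambda>z. ?w (snd z)) \<in> borel_measurable (?P p \<Otimes>\<^sub>M ?D)"
        by (rule measurable_compose[OF measurable_snd]) (use w in auto)
    qed (use w in auto)
    then show i: "integrable (?P p \<Otimes>\<^sub>M ?D) (\<lambda>z. ?w (snd z) * h z)"
      using h by (intro integrable_mult_bounded) auto
    show "(\<integral>z. ?w (snd z) * h z \<partial>(?P p \<Otimes>\<^sub>M ?D)) = (\<integral>\<gamma>. (\<integral>\<phi>. ?w \<phi> * h (\<gamma>, \<phi>) \<partial>?D) \<partial>?P p)"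
      using PD.integral_fst'[OF i] by simp
  qed
  have Y2: "(\<lambda>z. sq_field B (snd z) + total_occupation p (fst z)) \<in> borel_measurable (?P p \<Otimes>\<^sub>M ?D)" for p
    using measurable_compose[OF measurable_fst total_occupation_measurable]
      measurable_compose[OF measurable_snd sq_field_measurable] by measurable
  have occ0: "0 \<le> total_occupation p \<gamma> $ v" for p \<gamma> v
    unfolding total_occupation_def by (simp add: sum_nonneg occupation_nonneg)
  obtain c where c: "\<And>u. \<bar>F u\<bar> \<le> c" using F(2) by (auto simp: bounded_iff)
  have "(\<integral>\<phi>. ((\<Prod>k\<in>K. \<phi> (x k, \<beta> k)) * ?w \<phi>) * F (sq_field B \<phi>) \<partial>?D) =
    (\<Sum>p\<in>pairings K. \<integral>z. (?d p * ?w (snd z)) * F (sq_field B (snd z) + total_occupation p (fst z)) \<partial>(?P p \<Otimes>\<^sub>M ?D))"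
  proof (rule laplace_transform_determines[OF finite_pairings[OF K(1)] _ _ sq_field_measurable Y2 _ _ _ F])
    show "integrable ?D (\<lambda>\<phi>. (\<Prod>k\<in>K. \<phi> (x k, \<beta> k)) * ?w \<phi>)"
      by (rule gweight_integrable[OF B _ K(1)]) (use K(2) in auto)
    show "integrable (?P p \<Otimes>\<^sub>M ?D) (\<lambda>z. ?d p * ?w (snd z))" for p
      using fub(1)[of "\<lambda>_. 1" p 1] by (intro integrable_mult_right) simp
    show "0 \<le> sq_field B \<phi> $ v" for \<phi> v by (rule sq_field_nonneg)
    show "0 \<le> (sq_field B (snd z) + total_occupation p (fst z)) $ v" for p z v
      using sq_field_nonneg[of B "snd z" v] occ0 by simp
    fix n :: "'v \<Rightarrow> nat"
    \<comment> \<open>An integer argument of the Laplace transform is a nonnegative vector, hence an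
      admissible additional killing rate.\<close>
    let ?lam = "\<lambda>v. real (n v)"
    have lam: "0 \<le> ?lam v" for v by simp
    let ?Z = "\<integral>\<phi>. gweight ?lam B \<phi> \<partial>?D"
    have "(\<integral>\<phi>. ((\<Prod>k\<in>K. \<phi> (x k, \<beta> k)) * ?w \<phi>) * exp (- (\<Sum>v\<in>UNIV. ?lam v * sq_field B \<phi> $ v)) \<partial>?D) =
      ?Z * (\<Sum>p\<in>pairings K. ?d p * (\<Prod>e\<in>p. path_green ?lam (x (Min e)) (x (Max e))))"
      unfolding mult.assoc gweight_laplace by (rule gweight_wick[where lam="?lam", OF B lam K])
    also have "\<dots> = (\<Sum>p\<in>pairings K. \<integral>z. (?d p * ?w (snd z)) *
        exp (- (\<Sum>v\<in>UNIV. ?lam v * (sq_field B (snd z) + total_occupation p (fst z)) $ v)) \<partial>(?P p \<Otimes>\<^sub>M ?D))"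
      unfolding sum_distrib_left
    proof (rule sum.cong[OF refl])
      fix p assume p: "p \<in> pairings K"
      let ?h = "\<lambda>z. exp (- (\<Sum>v\<in>UNIV. ?lam v * (sq_field B (snd z) + total_occupation p (fst z)) $ v))"
      have "(\<lambda>u :: real ^ 'v. exp (- (\<Sum>v\<in>UNIV. ?lam v * u $ v))) \<in> borel_measurable borel"
        by (intro borel_measurable_continuous_onI continuous_intros)
      from measurable_compose[OF Y2 this] have hm: "?h \<in> borel_measurable (?P p \<Otimes>\<^sub>M ?D)" .
      have hb: "\<bar>?h z\<bar> \<le> 1" for z
      proof -
        have "0 \<le> (sq_field B (snd z) + total_occupation p (fst z)) $ v" for v
          using sq_field_nonneg[of B "snd z" v] occ0[of p "fst z" v] by simp
        then have "0 \<le> (\<Sum>v\<in>UNIV. ?lam v * (sq_field B (snd z) + total_occupation p (fst z)) $ v)"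
          by (intro sum_nonneg mult_nonneg_nonneg lam)
        then show ?thesis by simp
      qed
      \<comment> \<open>For fixed paths the part of the exponential that contains the field is
        absorbed into the weight, and the rest is a constant.\<close>
      have split: "?w \<phi> * ?h (\<gamma>, \<phi>) = exp (- (\<Sum>v\<in>UNIV. ?lam v * total_occupation p \<gamma> $ v)) * gweight ?lam B \<phi>" for \<gamma> \<phi>
      proof -
        have s: "?h (\<gamma>, \<phi>) = exp (- (\<Sum>v\<in>UNIV. ?lam v * sq_field B \<phi> $ v)) * exp (- (\<Sum>v\<in>UNIV. ?lam v * total_occupation p \<gamma> $ v))"
          by (simp add: exp_add[symmetric] distrib_left sum.distrib)
        show ?thesis unfolding s gweight_laplace[where lam="?lam" and B=B and \<phi>=\<phi>, symmetric] by (simp only: mult_ac)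
      qed
      have "(\<integral>z. (?d p * ?w (snd z)) * ?h z \<partial>(?P p \<Otimes>\<^sub>M ?D)) = ?d p * (\<integral>z. ?w (snd z) * ?h z \<partial>(?P p \<Otimes>\<^sub>M ?D))"
        by (simp only: mult.assoc integral_mult_right_zero)
      also have "(\<integral>z. ?w (snd z) * ?h z \<partial>(?P p \<Otimes>\<^sub>M ?D)) = (\<integral>\<gamma>. (\<integral>\<phi>. ?w \<phi> * ?h (\<gamma>, \<phi>) \<partial>?D) \<partial>?P p)"
        by (rule fub(2)[OF hm hb])
      also have "\<dots> = (\<integral>\<gamma>. exp (- (\<Sum>v\<in>UNIV. ?lam v * total_occupation p \<gamma> $ v)) * ?Z \<partial>?P p)"
        by (simp only: split integral_mult_right_zero)
      also have "\<dots> = (\<Prod>e\<in>p. path_green ?lam (x (Min e)) (x (Max e))) * ?Z"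
        by (simp only: integral_mult_left_zero pairing_laplace[where lam="?lam", OF p K(1) lam])
      finally show "?Z * (?d p * (\<Prod>e\<in>p. path_green ?lam (x (Min e)) (x (Max e)))) =
          (\<integral>z. (?d p * ?w (snd z)) * ?h z \<partial>(?P p \<Otimes>\<^sub>M ?D))" by (simp only: mult_ac)
    qed
    finally show "(\<integral>\<phi>. ((\<Prod>k\<in>K. \<phi> (x k, \<beta> k)) * ?w \<phi>) * exp (- (\<Sum>v\<in>UNIV. ?lam v * sq_field B \<phi> $ v)) \<partial>?D) =
      (\<Sum>p\<in>pairings K. \<integral>z. (?d p * ?w (snd z)) *
        exp (- (\<Sum>v\<in>UNIV. ?lam v * (sq_field B (snd z) + total_occupation p (fst z)) $ v)) \<partial>(?P p \<Otimes>\<^sub>M ?D))" .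
  qed
  also have "\<dots> = (\<Sum>p\<in>pairings K. ?d p *
      (\<integral>\<gamma>. (\<integral>\<phi>. ?w \<phi> * F (sq_field B \<phi> + total_occupation p \<gamma>) \<partial>?D) \<partial>?P p))"
  proof (rule sum.cong[OF refl])
    fix p
    have hm: "(\<lambda>z. F (sq_field B (snd z) + total_occupation p (fst z))) \<in> borel_measurable (?P p \<Otimes>\<^sub>M ?D)"
      by (rule measurable_compose[OF Y2 F(1)])
    show "(\<integral>z. (?d p * ?w (snd z)) * F (sq_field B (snd z) + total_occupation p (fst z)) \<partial>(?P p \<Otimes>\<^sub>M ?D)) =
        ?d p * (\<integral>\<gamma>. (\<integral>\<phi>. ?w \<phi> * F (sq_field B \<phi> + total_occupation p \<gamma>) \<partial>?D) \<partial>?P p)"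
      using fub(2)[OF hm c] by (simp add: mult.assoc)
  qed
  finally show ?thesis .
qed

end

section \<open>Multilinearity and measurability of the vertex traces\<close>

lemma bounded_bilinear_matrix_mult:
  "bounded_bilinear ((**) :: 'a::{real_algebra_1,euclidean_space} ^ 'n ^ 'n \<Rightarrow> 'a ^ 'n ^ 'n \<Rightarrow> 'a ^ 'n ^ 'n)"
  unfolding bilinear_conv_bounded_bilinear[symmetric] bilinear_def
  by (intro conjI allI linearI)
    (simp_all add: matrix_matrix_mult_def vec_eq_iff sum.distrib algebra_simps scaleR_sum_right)

lemmas linear_matrix_mult =
  bounded_linear.linear[OF bounded_bilinear.bounded_linear_left[OF bounded_bilinear_matrix_mult]]
  bounded_linear.linear[OF bounded_bilinear.bounded_linear_right[OF bounded_bilinear_matrix_mult]]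

text \<open>The label \<open>k\<close> occurs only once in \<open>ks\<close>, so exactly one factor
  of the product depends on \<open>X\<close>.\<close>

lemma linear_foldr_matrix:
  fixes m D :: "nat \<Rightarrow> 'a::{real_algebra_1,euclidean_space} ^ 'n ^ 'n"
  assumes "distinct ks" "k \<in> set ks"
  shows "linear (\<lambda>X. foldr (\<lambda>i M. (m(k := X)) i ** D i ** M) ks (mat 1))"
  using assms
proof (induction ks)
  case (Cons a ks)
  show ?case
  proof (cases "k = a")
    case True
    have "foldr (\<lambda>i M. (m(k := X)) i ** D i ** M) ks (mat 1) = foldr (\<lambda>i M. m i ** D i ** M) ks (mat 1)" for X
      using Cons.prems True by (intro foldr_cong) auto
    then have "(\<lambda>X. foldr (\<lambda>i M. (m(k := X)) i ** D i ** M) (a # ks) (mat 1)) =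
        (\<lambda>Z. Z ** foldr (\<lambda>i M. m i ** D i ** M) ks (mat 1)) \<circ> (\<lambda>X. X ** D a)"
      using True by (simp add: fun_eq_iff)
    then show ?thesis by (simp only:) (rule linear_compose[OF linear_matrix_mult(1) linear_matrix_mult(1)])
  next
    case False
    have l: "linear (\<lambda>X. foldr (\<lambda>i M. (m(k := X)) i ** D i ** M) ks (mat 1))"
      by (rule Cons.IH) (use Cons.prems False in auto)
    have "(\<lambda>X. foldr (\<lambda>i M. (m(k := X)) i ** D i ** M) (a # ks) (mat 1)) =
        (\<lambda>Z. (m a ** D a) ** Z) \<circ> (\<lambda>X. foldr (\<lambda>i M. (m(k := X)) i ** D i ** M) ks (mat 1))"
      using False by (simp add: fun_eq_iff)
    then show ?thesis by (simp only:) (rule linear_compose[OF l linear_matrix_mult(2)])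
  qed
qed simp

lemma vertex_prod_relabel: "vertex_prod \<nu> x \<Phi> A l = vertex_prod \<nu> (\<lambda>k. k) (\<lambda>k. \<Phi> (x k)) A l"
  by (simp add: vertex_prod_def)

lemma vertex_prod_cong:
  assumes "\<And>k. psum \<nu> l < k \<Longrightarrow> k \<le> psum \<nu> (Suc l) \<Longrightarrow> m k = m' k"
  shows "vertex_prod \<nu> (\<lambda>k. k) m A l = vertex_prod \<nu> (\<lambda>k. k) m' A l"
  unfolding vertex_prod_def by (intro foldr_cong) (use assms in auto)

lemma vertex_prod_measurable:
  fixes A :: "nat \<Rightarrow> nat \<Rightarrow> 'a::{real_algebra_1,euclidean_space} ^ 'n ^ 'n" and x :: "nat \<Rightarrow> 'v"
  shows "(\<lambda>\<Phi>. vertex_prod \<nu> x \<Phi> A l) \<in> borel_measurable (Pi\<^sub>M UNIV (\<lambda>_. borel))"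
proof -
  have mult: "(\<lambda>\<Phi>. f \<Phi> ** g \<Phi>) \<in> borel_measurable M"
    if "f \<in> borel_measurable M" "g \<in> borel_measurable M"
    for M :: "('v \<Rightarrow> 'a ^ 'n ^ 'n) measure" and f g :: "('v \<Rightarrow> 'a ^ 'n ^ 'n) \<Rightarrow> 'a ^ 'n ^ 'n"
    by (rule borel_measurable_continuous_Pair[OF that])
      (intro bounded_bilinear.continuous_on[OF bounded_bilinear_matrix_mult] continuous_intros)
  have "(\<lambda>\<Phi>. foldr (\<lambda>k M. \<Phi> (x k) ** A k (next_label \<nu> k) ** M) ks (mat 1)) \<in> borel_measurable (Pi\<^sub>M UNIV (\<lambda>_. borel))" for ks
    by (induction ks) (auto intro!: mult measurable_component_singleton)
  then show ?thesis unfolding vertex_prod_def .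
qed

context ribbon_vertices
begin

lemma vertex_traces_cong:
  assumes "\<And>k. k \<in> labels \<Longrightarrow> m k = m' k"
  shows "(\<Prod>l<length \<nu>. tr (vertex_prod \<nu> (\<lambda>k. k) m A l)) = (\<Prod>l<length \<nu>. tr (vertex_prod \<nu> (\<lambda>k. k) m' A l))"
proof (rule prod.cong[OF refl], rule arg_cong[where f=tr], rule vertex_prod_cong)
  fix l k assume l: "l \<in> {..<length \<nu>}" and k: "psum \<nu> l < k" "k \<le> psum \<nu> (Suc l)"
  have "psum \<nu> (Suc l) \<le> sum_list \<nu>" using psum_mono[of "Suc l" "length \<nu>" \<nu>] l by simp
  then show "m k = m' k" using k by (intro assms) simp
qed

text \<open>Every label belongs to exactly one vertex, so only one factor depends on it.\<close>

lemma linear_vertex_traces: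
  fixes A :: "nat \<Rightarrow> nat \<Rightarrow> 'a::{real_algebra_1,euclidean_space} ^ 'n ^ 'n" and tr :: "'a ^ 'n ^ 'n \<Rightarrow> 'f::real_normed_field"
  assumes tr: "linear tr" and k: "k \<in> labels"
  shows "linear (\<lambda>X. \<Prod>l<length \<nu>. tr (vertex_prod \<nu> (\<lambda>k. k) (m(k := X)) A l))"
proof -
  obtain l where l: "l < length \<nu>" "psum \<nu> l < k" "k \<le> psum \<nu> (Suc l)" using vertex_exists[OF k] by blast
  have lin: "linear (\<lambda>X. vertex_prod \<nu> (\<lambda>k. k) (m(k := X)) A l)"
    unfolding vertex_prod_def using l(2,3) by (intro linear_foldr_matrix) auto
  have other: "vertex_prod \<nu> (\<lambda>k. k) (m(k := X)) A l' = vertex_prod \<nu> (\<lambda>k. k) m A l'" if "l' \<noteq> l" for X l'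
    by (rule vertex_prod_cong) (use vertex_of_eq[OF l(2,3)] vertex_of_eq[of l' k] that in auto)
  have "(\<lambda>X. \<Prod>l<length \<nu>. tr (vertex_prod \<nu> (\<lambda>k. k) (m(k := X)) A l)) =
      (\<lambda>z. z * (\<Prod>l'\<in>{..<length \<nu>} - {l}. tr (vertex_prod \<nu> (\<lambda>k. k) m A l'))) \<circ> (tr \<circ> (\<lambda>X. vertex_prod \<nu> (\<lambda>k. k) (m(k := X)) A l))"
  proof
    fix X
    have "(\<Prod>l'\<in>{..<length \<nu>} - {l}. tr (vertex_prod \<nu> (\<lambda>k. k) (m(k := X)) A l')) =
        (\<Prod>l'\<in>{..<length \<nu>} - {l}. tr (vertex_prod \<nu> (\<lambda>k. k) m A l'))"
      by (intro prod.cong refl) (simp add: other)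
    then show "(\<Prod>l<length \<nu>. tr (vertex_prod \<nu> (\<lambda>k. k) (m(k := X)) A l)) =
      ((\<lambda>z. z * (\<Prod>l'\<in>{..<length \<nu>} - {l}. tr (vertex_prod \<nu> (\<lambda>k. k) m A l'))) \<circ> (tr \<circ> (\<lambda>X. vertex_prod \<nu> (\<lambda>k. k) (m(k := X)) A l))) X"
      using prod.remove[of "{..<length \<nu>}" l "\<lambda>l. tr (vertex_prod \<nu> (\<lambda>k. k) (m(k := X)) A l)"] l(1) by simp
  qed
  moreover have "linear (\<lambda>z :: 'f. z * c)" for c
    by (rule bounded_linear.linear) (rule bounded_linear_mult_left)
  ultimately show ?thesis by (simp only:) (intro linear_compose lin tr)
qed

end

lemma card_pairing:
  assumes p: "p \<in> pairings K" and K: "finite K"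
  shows "card K = 2 * card p"
  using card_partition[of p 2] finite_pairing[OF p K] K pairingsD[OF p] by (metis disjoint_iff)

section \<open>From the components to the matrix-valued field\<close>

context electrical_network
begin

text \<open>On \<open>S\<close> the function \<open>q\<close> is the squared norm, a sum of squares
  in orthonormal coordinates, and differences of field values have the differences of coordinates.
  Hence the energy is the sum of the scalar energies of the components.\<close>

lemma gff_energy_field_of:
  fixes q :: "'a::euclidean_space \<Rightarrow> real"
  assumes B: "orthonormal_basis_of S B" and q: "\<forall>M\<in>S. q M = inner M M"
  shows "exp (- gff_energy E C \<kappa> q (field_of B \<phi>)) = gweight (\<lambda>_. 0) B \<phi>"
    "(\<chi> v. q (field_of B \<phi> v) / 2) = sq_field B \<phi>"
proof -
  have qa: "q (assemble B c) = (\<Sum>b\<in>B. (c b)\<^sup>2)" for c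
    using q[rule_format, OF assemble_in[OF B]] assemble_norm[OF B] by simp
  have d: "field_of B \<phi> y - field_of B \<phi> x = assemble B (\<lambda>b. \<phi> (y, b) - \<phi> (x, b))" for x y
    by (simp add: field_of_def assemble_def scaleR_left_diff_distrib sum_subtractf)
  have f: "q (field_of B \<phi> x) = (\<Sum>b\<in>B. (\<phi> (x, b))\<^sup>2)" for x by (simp add: field_of_def qa)
  then show "(\<chi> v. q (field_of B \<phi> v) / 2) = sq_field B \<phi>" by (simp add: sq_field_def)
  have s1: "(\<Sum>x\<in>UNIV. \<kappa> x * (\<Sum>b\<in>B. (\<phi> (x, b))\<^sup>2)) = (\<Sum>b\<in>B. \<Sum>x\<in>UNIV. \<kappa> x * (\<phi> (x, b))\<^sup>2)"
    unfolding sum_distrib_left by (rule sum.swap)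
  have "(\<Sum>x\<in>UNIV. \<Sum>y | {x, y} \<in> E. C x y * (\<Sum>b\<in>B. (\<phi> (y, b) - \<phi> (x, b))\<^sup>2)) =
      (\<Sum>x\<in>UNIV. \<Sum>b\<in>B. \<Sum>y | {x, y} \<in> E. C x y * (\<phi> (y, b) - \<phi> (x, b))\<^sup>2)"
    unfolding sum_distrib_left by (intro sum.cong refl) (rule sum.swap)
  also have "\<dots> = (\<Sum>b\<in>B. \<Sum>x\<in>UNIV. \<Sum>y | {x, y} \<in> E. C x y * (\<phi> (y, b) - \<phi> (x, b))\<^sup>2)" by (rule sum.swap)
  finally have s2: "(\<Sum>x\<in>UNIV. \<Sum>y | {x, y} \<in> E. C x y * (\<Sum>b\<in>B. (\<phi> (y, b) - \<phi> (x, b))\<^sup>2)) = \<dots>" .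
  have "gff_energy E C \<kappa> q (field_of B \<phi>) = (\<Sum>b\<in>B. gff_energy E C \<kappa> (\<lambda>a. a\<^sup>2) (\<lambda>x. \<phi> (x, b)))"
    unfolding gff_energy_def d qa f s1 s2 by (simp add: sum.distrib sum_distrib_left)
  also have "\<dots> = (\<Sum>b\<in>B. form (\<lambda>x. \<phi> (x, b)) / 2)" by (intro sum.cong refl) (simp flip: form_gff_energy)
  finally show "exp (- gff_energy E C \<kappa> q (field_of B \<phi>)) = gweight (\<lambda>_. 0) B \<phi>"
    by (simp add: gweight_def sum_divide_distrib)
qed

lemma gff_integral:
  fixes S :: "'a::euclidean_space set" and f :: "('v \<Rightarrow> 'a) \<Rightarrow> 'f::{banach, second_countable_topology}"
  assumes S: "subspace S" and q: "q \<in> borel_measurable borel" "\<forall>M\<in>S. q M = inner M M"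
    and f: "f \<in> borel_measurable (Pi\<^sub>M UNIV (\<lambda>_. borel))"
  shows "(\<integral>M. f M \<partial>gff E C \<kappa> S q) =
    (\<integral>\<phi>. (gweight (\<lambda>_. 0) (chosen_basis S) \<phi> / gmass (chosen_basis S)) *\<^sub>R f (field_of (chosen_basis S) \<phi>)
      \<partial>gspace (chosen_basis S))"
proof -
  define B where "B = chosen_basis S"
  have B: "orthonormal_basis_of S B" unfolding B_def by (rule chosen_basis[OF S])
  note fin = orthonormal_basis_finite[OF B]
  note e = gff_energy_field_of[where q=q, OF B q(2)]
  let ?P = "Pi\<^sub>M UNIV (\<lambda>_ :: 'v. borel :: 'a measure)" and ?N = "\<Pi>\<^sub>M x\<in>UNIV :: 'v set. lborel_subspace S"
  have [measurable]: "(\<lambda>M. M x) \<in> borel_measurable ?P" for x by (rule measurable_component_singleton) simp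
  note [measurable] = q(1) f
  have w [measurable]: "(\<lambda>M. exp (- gff_energy E C \<kappa> q M)) \<in> borel_measurable ?P"
    unfolding gff_energy_def by measurable
  have sets: "sets ?N = sets ?P" by (intro sets_PiM_cong) simp_all
  have Z: "(\<integral>M. exp (- gff_energy E C \<kappa> q M) \<partial>?N) = gmass B"
    unfolding product_lborel_subspace(1)[OF S w] gmass_def B_def[symmetric] e(1) ..
  have pos: "0 < gmass B" by (rule gmass_pos[OF fin])
  have "(\<integral>M. f M \<partial>gff E C \<kappa> S q) = (\<integral>M. (exp (- gff_energy E C \<kappa> q M) / gmass B) *\<^sub>R f M \<partial>?N)"
    unfolding gff_def Let_def Z
    by (rule integral_density) (use pos in \<open>auto simp: measurable_cong_sets[OF sets refl]\<close>)
  also have "\<dots> = (\<integral>\<phi>. (gweight (\<lambda>_. 0) B \<phi> / gmass B) *\<^sub>R f (field_of B \<phi>) \<partial>gspace B)"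
    by (subst product_lborel_subspace(1)[OF S]) (simp_all add: B_def[symmetric] e(1))
  finally show ?thesis unfolding B_def .
qed

text \<open>By multilinearity the traces are combinations of monomials in the components. The
  covariance pairs equal basis elements only, so the sum over the basis reduces to one element per
  pair, which is the situation of the contraction formula.\<close>

theorem trace_isomorphism:
  fixes S :: "('a::{real_algebra_1,euclidean_space} ^ 'n ^ 'n) set" and tr :: "'a ^ 'n ^ 'n \<Rightarrow> 'f::{real_normed_field, banach, second_countable_topology}"
    and F :: "real ^ 'v \<Rightarrow> real" and x :: "nat \<Rightarrow> 'v"
  assumes S: "subspace S" and q: "q \<in> borel_measurable borel" "\<forall>M\<in>S. q M = inner M M"
    and tr: "linear tr" and alg: "trace_algebra tr adj (chosen_basis S) u u' v"
    and \<nu>: "\<forall>k\<in>set \<nu>. 0 < k" and F: "F \<in> borel_measurable borel" "bounded (range F)"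
  shows "(\<integral>\<Phi>. (\<Prod>l<length \<nu>. tr (vertex_prod \<nu> x \<Phi> A l)) * of_real (F (\<chi> v. q (\<Phi> v) / 2)) \<partial>gff E C \<kappa> S q) =
    (\<Sum>\<rho>\<in>ribbon_pairings \<nu>. u ^ card (fst \<rho> - snd \<rho>) * u' ^ card (snd \<rho>) *
       v powi (int (card (boundary_cycles \<nu> \<rho>)) - int (length \<nu>)) *
       (\<Prod>t\<in>trails \<nu> \<rho>. tr (word_prod adj A (SOME w. w \<in> t))) *
       of_real (\<integral>\<gamma>. (\<integral>\<Phi>. F ((\<chi> v. q (\<Phi> v) / 2) + (\<Sum>i<sum_list \<nu> div 2. occupation (\<gamma> i))) \<partial>gff E C \<kappa> S q)
         \<partial>pairing_measure E C \<kappa> x (fst \<rho>)))"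
proof -
  interpret ribbon_traces \<nu> tr adj "chosen_basis S" u u' v A
    by (intro ribbon_traces.intro ribbon_vertices.intro alg \<nu>)
  define B where "B = chosen_basis S"
  have B: "orthonormal_basis_of S B" unfolding B_def by (rule chosen_basis[OF S])
  note fin = orthonormal_basis_finite[OF B]
  note e = gff_energy_field_of(2)[where q=q, OF B q(2)]
  define T where "T m = (\<Prod>l<length \<nu>. tr (vertex_prod \<nu> (\<lambda>k. k) m A l))" for m
  have T_cong: "T m = T m'" if "\<And>k. k \<in> {1..sum_list \<nu>} \<Longrightarrow> m k = m' k" for m m'
    unfolding T_def by (rule vertex_traces_cong) (rule that)
  let ?w = "gweight (\<lambda>_. 0) B" and ?Z = "gmass B" and ?D = "gspace B :: ('v \<times> ('a ^ 'n ^ 'n) \<Rightarrow> real) measure"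
  let ?I = "\<lambda>p. \<integral>\<gamma>. (\<integral>\<phi>. ?w \<phi> * F (sq_field B \<phi> + total_occupation p \<gamma>) \<partial>?D) \<partial>pairing_measure E C \<kappa> x p"
  have tr_meas: "tr \<in> borel_measurable borel"
    by (rule borel_measurable_continuous_onI)
      (rule linear_continuous_on, rule linear_conv_bounded_linear[THEN iffD1, OF tr])
  have comp [measurable]: "(\<lambda>M. M x) \<in> borel_measurable (Pi\<^sub>M UNIV (\<lambda>_ :: 'v. borel :: ('a ^ 'n ^ 'n) measure))" for x
    by (rule measurable_component_singleton) simp
  have half: "(\<lambda>\<Phi>. \<chi> v :: 'v. q (\<Phi> v) / 2) \<in> borel_measurable (Pi\<^sub>M UNIV (\<lambda>_. borel))"
    by (rule borel_measurable_vec_lambda) (use q(1) in measurable)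
  have Fm: "(\<lambda>\<Phi>. F ((\<chi> v. q (\<Phi> v) / 2) + c)) \<in> borel_measurable (Pi\<^sub>M UNIV (\<lambda>_. borel))" for c
    by (rule measurable_compose[OF _ F(1)]) (use half in measurable)
  have fm: "(\<lambda>\<Phi>. T (\<lambda>k. \<Phi> (x k)) * of_real (F (\<chi> v. q (\<Phi> v) / 2))) \<in> borel_measurable (Pi\<^sub>M UNIV (\<lambda>_. borel))"
  proof (intro borel_measurable_times)
    show "(\<lambda>\<Phi>. T (\<lambda>k. \<Phi> (x k))) \<in> borel_measurable (Pi\<^sub>M UNIV (\<lambda>_. borel))"
      unfolding T_def vertex_prod_relabel[of \<nu> x, symmetric]
      by (intro borel_measurable_prod measurable_compose[OF vertex_prod_measurable tr_meas])
    show "(\<lambda>\<Phi>. of_real (F (\<chi> v. q (\<Phi> v) / 2)) :: 'f) \<in> borel_measurable (Pi\<^sub>M UNIV (\<lambda>_. borel))"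
    proof -
      have "(of_real :: real \<Rightarrow> 'f) \<in> borel_measurable borel"
        by (intro borel_measurable_continuous_onI continuous_intros)
      from measurable_compose[OF Fm[of 0] this] show ?thesis by simp
    qed
  qed
  have expand: "T (\<lambda>k. field_of B \<phi> (x k)) = (\<Sum>\<beta>\<in>Pi\<^sub>E {1..sum_list \<nu>} (\<lambda>_. B). (\<Prod>k\<in>{1..sum_list \<nu>}. \<phi> (x k, \<beta> k)) *\<^sub>R T \<beta>)" for \<phi>
  proof -
    \<comment> \<open>\<open>T\<close> depends only on the labels carried by the vertices, so the
      default value 0 elsewhere is harmless.\<close>
    have "T (\<lambda>k. field_of B \<phi> (x k)) = T (\<lambda>k. if k \<in> {1..sum_list \<nu>} then \<Sum>b\<in>B. \<phi> (x k, b) *\<^sub>R b else 0)"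
      by (rule T_cong) (simp add: field_of_def assemble_def)
    also have "\<dots> = (\<Sum>\<beta>\<in>Pi\<^sub>E {1..sum_list \<nu>} (\<lambda>_. B). (\<Prod>k\<in>{1..sum_list \<nu>}. \<phi> (x k, \<beta> k)) *\<^sub>R T (\<lambda>k. if k \<in> {1..sum_list \<nu>} then \<beta> k else 0))"
    proof (rule multilinear_expansion[where T=T and c="\<lambda>k b. \<phi> (x k, b)" and m="\<lambda>_. 0"])
      show "finite {1..sum_list \<nu>}" "finite B" by (simp_all add: fin)
      fix k m assume k: "k \<in> {1..sum_list \<nu>}"
      show "linear (\<lambda>X. T (m(k := X)))" unfolding T_def by (rule linear_vertex_traces[OF tr k])
    qed
    also have "\<dots> = (\<Sum>\<beta>\<in>Pi\<^sub>E {1..sum_list \<nu>} (\<lambda>_. B). (\<Prod>k\<in>{1..sum_list \<nu>}. \<phi> (x k, \<beta> k)) *\<^sub>R T \<beta>)"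
      by (intro sum.cong refl arg_cong[where f="\<lambda>y. _ *\<^sub>R y"] T_cong) simp
    finally show ?thesis .
  qed
  define G where "G \<rho> = u ^ card (fst \<rho> - snd \<rho>) * u' ^ card (snd \<rho>) *
       v powi (int (card (boundary_cycles \<nu> \<rho>)) - int (length \<nu>)) *
       (\<Prod>t\<in>trails \<nu> \<rho>. tr (word_prod adj A (SOME w. w \<in> t))) * of_real (?I (fst \<rho>) / ?Z)" for \<rho>
  obtain c where c: "\<And>y. \<bar>F y\<bar> \<le> c" using F(2) unfolding bounded_iff by auto
  have int: "integrable ?D (\<lambda>\<phi>. (\<Prod>k\<in>{1..sum_list \<nu>}. \<phi> (x k, \<beta> k)) * ?w \<phi> * F (sq_field B \<phi>))"
    if "\<beta> \<in> Pi\<^sub>E {1..sum_list \<nu>} (\<lambda>_. B)" for \<beta>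
  proof -
    have i: "integrable ?D (\<lambda>\<phi>. (\<Prod>k\<in>{1..sum_list \<nu>}. \<phi> (x k, \<beta> k)) * ?w \<phi>)"
      by (rule gweight_integrable[OF fin, where s="\<lambda>k. (x k, \<beta> k)"]) (use that in auto)
    show ?thesis
    proof (rule Bochner_Integration.integrable_bound[OF integrable_mult_left[OF i, of c]])
      have "(\<lambda>\<phi>. F (sq_field B \<phi>)) \<in> borel_measurable ?D" by (rule measurable_compose[OF sq_field_measurable F(1)])
      then show "(\<lambda>\<phi>. (\<Prod>k\<in>{1..sum_list \<nu>}. \<phi> (x k, \<beta> k)) * ?w \<phi> * F (sq_field B \<phi>)) \<in> borel_measurable ?D"
        by (intro borel_measurable_times[OF borel_measurable_integrable[OF i]])
      have "\<bar>F y\<bar> \<le> \<bar>c\<bar>" for y using c[of y] by linarith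
      then show "AE \<phi> in ?D. norm ((\<Prod>k\<in>{1..sum_list \<nu>}. \<phi> (x k, \<beta> k)) * ?w \<phi> * F (sq_field B \<phi>)) \<le>
          norm ((\<Prod>k\<in>{1..sum_list \<nu>}. \<phi> (x k, \<beta> k)) * ?w \<phi> * c)"
        by (intro AE_I2) (simp add: abs_mult mult_left_mono)
    qed
  qed
  have "(\<integral>\<Phi>. (\<Prod>l<length \<nu>. tr (vertex_prod \<nu> x \<Phi> A l)) * of_real (F (\<chi> v. q (\<Phi> v) / 2)) \<partial>gff E C \<kappa> S q) =
      (\<integral>\<Phi>. T (\<lambda>k. \<Phi> (x k)) * of_real (F (\<chi> v. q (\<Phi> v) / 2)) \<partial>gff E C \<kappa> S q)"
    unfolding T_def vertex_prod_relabel[of \<nu> x, symmetric] ..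
  also have "\<dots> = (\<integral>\<phi>. (?w \<phi> / ?Z) *\<^sub>R (T (\<lambda>k. field_of B \<phi> (x k)) * of_real (F (sq_field B \<phi>))) \<partial>?D)"
    unfolding gff_integral[OF S q fm] unfolding B_def[symmetric] e ..
  also have "\<dots> = (\<integral>\<phi>. (\<Sum>\<beta>\<in>Pi\<^sub>E {1..sum_list \<nu>} (\<lambda>_. B). ((\<Prod>k\<in>{1..sum_list \<nu>}. \<phi> (x k, \<beta> k)) * ?w \<phi> * F (sq_field B \<phi>)) *\<^sub>R (T \<beta> /\<^sub>R ?Z)) \<partial>?D)"
    unfolding expand sum_distrib_right scaleR_sum_right
    by (intro Bochner_Integration.integral_cong sum.cong refl)
      (simp add: scaleR_conv_of_real divide_inverse mult_ac)
  also have "\<dots> = (\<Sum>\<beta>\<in>Pi\<^sub>E {1..sum_list \<nu>} (\<lambda>_. B). (\<integral>\<phi>. (\<Prod>k\<in>{1..sum_list \<nu>}. \<phi> (x k, \<beta> k)) * ?w \<phi> * F (sq_field B \<phi>) \<partial>?D) *\<^sub>R (T \<beta> /\<^sub>R ?Z))"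
    using int by (subst Bochner_Integration.integral_sum) (auto intro!: sum.cong)
  also have "\<dots> = (\<Sum>\<beta>\<in>Pi\<^sub>E {1..sum_list \<nu>} (\<lambda>_. B). (\<Sum>p\<in>pairings {1..sum_list \<nu>}. (\<Prod>e\<in>p. of_bool (\<beta> (Min e) = \<beta> (Max e))) * ?I p) *\<^sub>R (T \<beta> /\<^sub>R ?Z))"
  proof (intro sum.cong refl arg_cong[where f="\<lambda>y. y *\<^sub>R _"])
    fix \<beta> assume "\<beta> \<in> Pi\<^sub>E {1..sum_list \<nu>} (\<lambda>_. B)"
    then have "\<beta> ` {1..sum_list \<nu>} \<subseteq> B" by auto
    then show "(\<integral>\<phi>. (\<Prod>k\<in>{1..sum_list \<nu>}. \<phi> (x k, \<beta> k)) * ?w \<phi> * F (sq_field B \<phi>) \<partial>?D) =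
        (\<Sum>p\<in>pairings {1..sum_list \<nu>}. (\<Prod>e\<in>p. of_bool (\<beta> (Min e) = \<beta> (Max e))) * ?I p)"
      by (intro gaussian_isomorphism fin F) simp_all
  qed
  also have "\<dots> = (\<Sum>p\<in>pairings {1..sum_list \<nu>}. (?I p / ?Z) *\<^sub>R (\<Sum>\<beta>\<in>Pi\<^sub>E {1..sum_list \<nu>} (\<lambda>_. B). (\<Prod>e\<in>p. of_bool (\<beta> (Min e) = \<beta> (Max e)) :: real) *\<^sub>R T \<beta>))"
    unfolding scaleR_sum_left scaleR_sum_right
    by (subst sum.swap) (simp add: divide_inverse mult_ac)
  also have "\<dots> = (\<Sum>p\<in>pairings {1..sum_list \<nu>}. (?I p / ?Z) *\<^sub>R (\<Sum>b\<in>Pi\<^sub>E p (\<lambda>_. B). T (\<lambda>k. b {k, partner p k})))"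
  proof (intro sum.cong refl arg_cong[where f="\<lambda>y. _ *\<^sub>R y"])
    fix p assume p: "p \<in> pairings {1..sum_list \<nu>}"
    show "(\<Sum>\<beta>\<in>Pi\<^sub>E {1..sum_list \<nu>} (\<lambda>_. B). (\<Prod>e\<in>p. of_bool (\<beta> (Min e) = \<beta> (Max e)) :: real) *\<^sub>R T \<beta>) =
      (\<Sum>b\<in>Pi\<^sub>E p (\<lambda>_. B). T (\<lambda>k. b {k, partner p k}))"
    proof (rule sum_paired_indices[OF p finite_atLeastAtMost fin])
      fix m m' :: "nat \<Rightarrow> 'a ^ 'n ^ 'n"
      assume "\<And>k. k \<in> {1..sum_list \<nu>} \<Longrightarrow> m k = m' k"
      then show "T m = T m'" by (rule T_cong)
    qed
  qed
  also have "\<dots> = (\<Sum>p\<in>pairings {1..sum_list \<nu>}. (?I p / ?Z) *\<^sub>R (\<Sum>T\<in>Pow p. u ^ card (p - T) * u' ^ card T *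
       v powi (int (card (boundary_cycles \<nu> (p, T))) - int (length \<nu>)) *
       (\<Prod>t\<in>trails \<nu> (p, T). tr (word_prod adj A (SOME w. w \<in> t)))))"
    unfolding T_def B_def by (intro sum.cong refl arg_cong[where f="\<lambda>y. _ *\<^sub>R y"] pairing_trace_expansion)
  also have "\<dots> = (\<Sum>p\<in>pairings {1..sum_list \<nu>}. \<Sum>T\<in>Pow p. G (p, T))"
  proof (intro sum.cong refl)
    fix p
    show "(?I p / ?Z) *\<^sub>R (\<Sum>T\<in>Pow p. u ^ card (p - T) * u' ^ card T *
       v powi (int (card (boundary_cycles \<nu> (p, T))) - int (length \<nu>)) *
       (\<Prod>t\<in>trails \<nu> (p, T). tr (word_prod adj A (SOME w. w \<in> t)))) = (\<Sum>T\<in>Pow p. G (p, T))"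
      unfolding scaleR_sum_right
      by (intro sum.cong refl) (simp only: G_def fst_conv snd_conv scaleR_conv_of_real mult.commute)
  qed
  also have "\<dots> = (\<Sum>(p, T)\<in>Sigma (pairings {1..sum_list \<nu>}) Pow. G (p, T))"
    by (rule sum.Sigma) (auto simp: finite_pairings finite_pairing)
  also have "(\<lambda>(p, T). G (p, T)) = G" by simp
  also have "Sigma (pairings {1..sum_list \<nu>}) Pow = ribbon_pairings \<nu>"
    unfolding ribbon_pairings_def pairings_def by auto
  also have "sum G (ribbon_pairings \<nu>) =
    (\<Sum>\<rho>\<in>ribbon_pairings \<nu>. u ^ card (fst \<rho> - snd \<rho>) * u' ^ card (snd \<rho>) *
       v powi (int (card (boundary_cycles \<nu> \<rho>)) - int (length \<nu>)) *
       (\<Prod>t\<in>trails \<nu> \<rho>. tr (word_prod adj A (SOME w. w \<in> t))) *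
       of_real (\<integral>\<gamma>. (\<integral>\<Phi>. F ((\<chi> v. q (\<Phi> v) / 2) + (\<Sum>i<sum_list \<nu> div 2. occupation (\<gamma> i))) \<partial>gff E C \<kappa> S q)
         \<partial>pairing_measure E C \<kappa> x (fst \<rho>)))"
    unfolding G_def
  proof (intro sum.cong refl arg_cong[where f="\<lambda>y. _ * of_real y"])
    fix \<rho> assume "\<rho> \<in> ribbon_pairings \<nu>"
    then have p: "fst \<rho> \<in> pairings {1..sum_list \<nu>}" unfolding ribbon_pairings_def pairings_def by auto
    \<comment> \<open>This identifies the number of paths in the statement with the number of pairs
      over which the total occupation is summed.\<close>
    have card: "card (fst \<rho>) = sum_list \<nu> div 2" using card_pairing[OF p] by simp
    have "(\<integral>\<Phi>. F ((\<chi> v. q (\<Phi> v) / 2) + (\<Sum>i<sum_list \<nu> div 2. occupation (\<gamma> i))) \<partial>gff E C \<kappa> S q) =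
        (\<integral>\<phi>. ?w \<phi> * F (sq_field B \<phi> + total_occupation (fst \<rho>) \<gamma>) \<partial>?D) / ?Z" for \<gamma> :: "nat \<Rightarrow> 'v path"
      unfolding gff_integral[OF S q Fm] unfolding B_def[symmetric] e total_occupation_def card by simp
    then show "?I (fst \<rho>) / ?Z = (\<integral>\<gamma>. (\<integral>\<Phi>. F ((\<chi> v. q (\<Phi> v) / 2) + (\<Sum>i<sum_list \<nu> div 2. occupation (\<gamma> i))) \<partial>gff E C \<kappa> S q)
         \<partial>pairing_measure E C \<kappa> x (fst \<rho>))" by simp
  qed
  finally show ?thesis .
qed

end

section \<open>The ribbon weights and the three values of \<beta>\<close>

lemma linear_trace: "linear (trace :: 'a::{real_algebra_1,euclidean_space} ^ 'n ^ 'n \<Rightarrow> 'a)"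
  by (intro linearI) (simp_all add: trace_def sum.distrib scaleR_sum_right)

lemma linear_qRe_trace: "linear (\<lambda>M :: quat ^ 'n ^ 'n. qRe (trace M))"
proof -
  have "linear qRe" by (intro linearI) (simp_all add: scaleR_quat_def)
  from linear_compose[OF linear_trace this] show ?thesis unfolding o_def .
qed

lemma linear_square_measurable:
  fixes f :: "'a::{real_algebra_1,euclidean_space} ^ 'n ^ 'n \<Rightarrow> real"
  assumes "linear f"
  shows "(\<lambda>M. f (M ** M)) \<in> borel_measurable borel"
proof -
  have "continuous_on UNIV (\<lambda>M :: 'a ^ 'n ^ 'n. M ** M)"
    by (rule bounded_bilinear.continuous_on[OF bounded_bilinear_matrix_mult continuous_on_id continuous_on_id])
  then have "continuous_on UNIV (\<lambda>M. f (M ** M))"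
    by (rule bounded_linear.continuous_on[OF linear_conv_bounded_linear[THEN iffD1, OF assms]])
  then show ?thesis by (rule borel_measurable_continuous_onI)
qed

lemma tr_sq_measurable: "tr_sq \<in> borel_measurable borel"
proof -
  have "linear (\<lambda>M :: complex ^ 'n ^ 'n. Re (trace M))"
    using linear_compose[OF linear_trace bounded_linear.linear[OF bounded_linear_Re]] unfolding o_def .
  from linear_square_measurable[OF this] show ?thesis unfolding tr_sq_def[abs_def] .
qed

lemma qtr_sq_measurable: "qtr_sq \<in> borel_measurable borel"
  using linear_square_measurable[OF linear_qRe_trace] unfolding qtr_sq_def[abs_def] .

lemma ribbon_pairing_cards:
  assumes "\<rho> \<in> ribbon_pairings \<nu>"
  shows "finite (snd \<rho>)" "card (fst \<rho> - snd \<rho>) + card (snd \<rho>) = sum_list \<nu> div 2"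
proof -
  have p: "fst \<rho> \<in> pairings {1..sum_list \<nu>}" and T: "snd \<rho> \<subseteq> fst \<rho>"
    using assms unfolding ribbon_pairings_def pairings_def by auto
  have fin: "finite (fst \<rho>)" using finite_pairing[OF p] by simp
  then show "finite (snd \<rho>)" using T by (rule rev_finite_subset)
  have "card (fst \<rho>) = sum_list \<nu> div 2" using card_pairing[OF p] by simp
  moreover have "card (fst \<rho> - snd \<rho>) = card (fst \<rho>) - card (snd \<rho>)"
    by (rule card_Diff_subset[OF \<open>finite (snd \<rho>)\<close> T])
  moreover have "card (snd \<rho>) \<le> card (fst \<rho>)" by (rule card_mono[OF fin T])
  ultimately show "card (fst \<rho> - snd \<rho>) + card (snd \<rho>) = sum_list \<nu> div 2" by simp
qed

lemma ribbon_weight_1: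
  assumes "\<rho> \<in> ribbon_pairings \<nu>"
  shows "(1/2 :: complex) ^ card (fst \<rho> - snd \<rho>) * (1/2) ^ card (snd \<rho>) = of_real (ribbon_weight \<nu> 1 \<rho>)"
  unfolding power_add[symmetric] ribbon_pairing_cards(2)[OF assms] ribbon_weight_def
  by (simp add: power_int_minus power_one_over inverse_eq_divide)

text \<open>The power \<open>0 ^ card T\<close> is 1 for empty \<open>T\<close> and 0 otherwise,
  which is the indicator of only straight edges.\<close>

lemma ribbon_weight_2:
  assumes "\<rho> \<in> ribbon_pairings \<nu>"
  shows "(1 :: complex) ^ card (fst \<rho> - snd \<rho>) * 0 ^ card (snd \<rho>) = of_real (ribbon_weight \<nu> 2 \<rho>)"
  using ribbon_pairing_cards(1)[OF assms] unfolding ribbon_weight_def by (simp add: power_0_left)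

text \<open>With \<open>f\<close> cycles, \<open>m\<close> vertices and \<open>N\<close> pairs the
  Euler characteristic is \<open>(f - m) + (2 * m - N)\<close>. The second part of the power of -2
  cancels against the power of 2 in the weight up to the sign \<open>(- 1) ^ N\<close>, which is the
  product of the factors -1 of all the pairs.\<close>

lemma ribbon_weight_4:
  assumes "\<rho> \<in> ribbon_pairings \<nu>"
  shows "(- 1 :: real) ^ card (fst \<rho> - snd \<rho>) * (- 1) ^ card (snd \<rho>) *
      (- 2) powi (int (card (boundary_cycles \<nu> \<rho>)) - int (length \<nu>)) = ribbon_weight \<nu> 4 \<rho>"
proof -
  define f m N where "f = card (boundary_cycles \<nu> \<rho>)" and "m = length \<nu>" and "N = sum_list \<nu> div 2"
  have e: "euler_char \<nu> \<rho> = (int f - int m) + (int (2 * m) - int N)"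
    unfolding euler_char_def f_def m_def N_def by simp
  have a: "(- 2 :: real) powi ((int f - int m) + (int (2 * m) - int N)) =
      (- 2) powi (int f - int m) * (- 2) powi (int (2 * m) - int N)"
    by (rule power_int_add) simp
  have b: "(- 2 :: real) powi (int (2 * m) - int N) = (- 2) powi int (2 * m) / (- 2) powi int N"
    by (rule power_int_diff) simp
  have d: "- 2 * int m + int N = int N - int (2 * m)" by simp
  have c: "(2 :: real) powi (int N - int (2 * m)) = 2 powi int N / 2 powi int (2 * m)"
    by (rule power_int_diff) simp
  have sign: "((- 2 :: real) ^ (2 * m) / (- 2) ^ N) * (2 ^ N / 2 ^ (2 * m)) = (- 1) ^ N"
    unfolding power_minus[of 2 N] by (cases "even N") simp_all
  have "ribbon_weight \<nu> 4 \<rho> = (- 2) powi (int f - int m) * (((- 2) ^ (2 * m) / (- 2) ^ N) * (2 ^ N / 2 ^ (2 * m)))"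
    unfolding ribbon_weight_def m_def[symmetric] N_def[symmetric] e a b d c power_int_of_nat by simp
  then show ?thesis
    unfolding power_add[symmetric] ribbon_pairing_cards(2)[OF assms] f_def[symmetric] m_def[symmetric] N_def[symmetric] sign
    by simp
qed

text \<open>For both complex values of \<beta> the parameter \<open>v\<close> is 1, so the number of
  cycles drops out and the weight depends only on the numbers of straight and twisted pairs.\<close>

lemma (in electrical_network) complex_isomorphism:
  fixes A :: "nat \<Rightarrow> nat \<Rightarrow> complex ^ 'n ^ 'n"
  assumes \<beta>: "\<beta> \<in> {1, 2}" and \<nu>: "\<forall>k\<in>set \<nu>. 0 < k" and F: "F \<in> borel_measurable borel" "bounded (range F)"
    and alg: "trace_algebra trace transpose (chosen_basis (herm_space \<beta> :: (complex ^ 'n ^ 'n) set)) u u' 1"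
    and w: "\<And>\<rho>. \<rho> \<in> ribbon_pairings \<nu> \<Longrightarrow> u ^ card (fst \<rho> - snd \<rho>) * u' ^ card (snd \<rho>) = of_real (ribbon_weight \<nu> \<beta> \<rho>)"
  shows "(\<integral>\<Phi>. (\<Prod>l<length \<nu>. trace (vertex_prod \<nu> x \<Phi> A l)) * complex_of_real (F (\<chi> v. tr_sq (\<Phi> v) / 2))
          \<partial>gff E C \<kappa> (herm_space \<beta>) tr_sq)
      = ribbon_integral E C \<kappa> \<nu> \<beta> A x (\<lambda>\<gamma>.
          \<integral>\<Phi>. F ((\<chi> v. tr_sq (\<Phi> v) / 2) + (\<Sum>i<sum_list \<nu> div 2. occupation (\<gamma> i)))
             \<partial>gff E C \<kappa> (herm_space \<beta> :: (complex ^ 'n ^ 'n) set) tr_sq)"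
proof -
  have q: "\<forall>M\<in>(herm_space \<beta> :: (complex ^ 'n ^ 'n) set). tr_sq M = inner M M"
    using \<beta> by (intro ballI herm_space_norm) auto
  note iso = trace_isomorphism[OF subspace_herm_space tr_sq_measurable q linear_trace alg \<nu> F, where x=x and A=A]
  show ?thesis
    unfolding iso ribbon_integral_def lincomb_integral_def trail_prod_def
    by (intro sum.cong refl arg_cong[where f="\<lambda>y. y * of_real _"]) (simp add: w)
qed

theorem theorem3p3:
  fixes E :: "'v::finite set set" and C :: "'v \<Rightarrow> 'v \<Rightarrow> real" and \<kappa> :: "'v \<Rightarrow> real"
    and \<nu> :: "nat list" and x :: "nat \<Rightarrow> 'v" and F :: "real ^ 'v \<Rightarrow> real"
  assumes "electrical_network E C \<kappa>"
    and "\<forall>k\<in>set \<nu>. 0 < k"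
    and "even (sum_list \<nu>)"
    and "F \<in> borel_measurable borel"
    and "bounded (range F)"
  shows "(\<forall>\<beta>\<in>{1, 2}. \<forall>A :: nat \<Rightarrow> nat \<Rightarrow> complex ^ 'n ^ 'n.
      (\<integral>\<Phi>. (\<Prod>l<length \<nu>. trace (vertex_prod \<nu> x \<Phi> A l))
              * complex_of_real (F (\<chi> v. tr_sq (\<Phi> v) / 2))
          \<partial>gff E C \<kappa> (herm_space \<beta>) tr_sq)
      = ribbon_integral E C \<kappa> \<nu> \<beta> A x (\<lambda>\<gamma>.
          \<integral>\<Phi>. F ((\<chi> v. tr_sq (\<Phi> v) / 2) + (\<Sum>i<sum_list \<nu> div 2. occupation (\<gamma> i)))
             \<partial>gff E C \<kappa> (herm_space \<beta> :: (complex ^ 'n ^ 'n) set) tr_sq))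
    \<and> (\<forall>A :: nat \<Rightarrow> nat \<Rightarrow> quat ^ 'n ^ 'n.
      (\<integral>\<Phi>. (\<Prod>l<length \<nu>. qRe (trace (vertex_prod \<nu> x \<Phi> A l)))
              * F (\<chi> v. qtr_sq (\<Phi> v) / 2)
          \<partial>gff E C \<kappa> qherm_space qtr_sq)
      = qribbon_integral E C \<kappa> \<nu> A x (\<lambda>\<gamma>.
          \<integral>\<Phi>. F ((\<chi> v. qtr_sq (\<Phi> v) / 2) + (\<Sum>i<sum_list \<nu> div 2. occupation (\<gamma> i)))
             \<partial>gff E C \<kappa> (qherm_space :: (quat ^ 'n ^ 'n) set) qtr_sq))"
proof -
  interpret electrical_network E C \<kappa> by fact
  note \<nu> = assms(2) and F = assms(4,5)
  show ?thesis
  proof (intro conjI ballI allI)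
    fix \<beta> :: nat and A :: "nat \<Rightarrow> nat \<Rightarrow> complex ^ 'n ^ 'n"
    assume \<beta>: "\<beta> \<in> {1, 2}"
    then consider "\<beta> = 1" | "\<beta> = 2" by blast
    then show "(\<integral>\<Phi>. (\<Prod>l<length \<nu>. trace (vertex_prod \<nu> x \<Phi> A l))
              * complex_of_real (F (\<chi> v. tr_sq (\<Phi> v) / 2))
          \<partial>gff E C \<kappa> (herm_space \<beta>) tr_sq)
      = ribbon_integral E C \<kappa> \<nu> \<beta> A x (\<lambda>\<gamma>.
          \<integral>\<Phi>. F ((\<chi> v. tr_sq (\<Phi> v) / 2) + (\<Sum>i<sum_list \<nu> div 2. occupation (\<gamma> i)))
             \<partial>gff E C \<kappa> (herm_space \<beta> :: (complex ^ 'n ^ 'n) set) tr_sq)"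
    proof cases
      case 1
      show ?thesis unfolding 1
        by (rule complex_isomorphism[where \<beta>=1, OF _ \<nu> F])
          (simp, rule trace_algebra_herm_1[OF chosen_basis[OF subspace_herm_space]], rule ribbon_weight_1)
    next
      case 2
      show ?thesis unfolding 2
        by (rule complex_isomorphism[where \<beta>=2, OF _ \<nu> F])
          (simp, rule trace_algebra_herm_2[OF chosen_basis[OF subspace_herm_space]], rule ribbon_weight_2)
    qed
  next
    fix A :: "nat \<Rightarrow> nat \<Rightarrow> quat ^ 'n ^ 'n"
    have q: "\<forall>M\<in>(qherm_space :: (quat ^ 'n ^ 'n) set). qtr_sq M = inner M M"
      by (intro ballI qherm_space_norm)
    note iso = trace_isomorphism[OF subspace_qherm_space qtr_sq_measurable q linear_qRe_trace
        trace_algebra_qherm[OF chosen_basis[OF subspace_qherm_space]] \<nu> F, where x=x and A=A]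
    show "(\<integral>\<Phi>. (\<Prod>l<length \<nu>. qRe (trace (vertex_prod \<nu> x \<Phi> A l)))
              * F (\<chi> v. qtr_sq (\<Phi> v) / 2)
          \<partial>gff E C \<kappa> qherm_space qtr_sq)
      = qribbon_integral E C \<kappa> \<nu> A x (\<lambda>\<gamma>.
          \<integral>\<Phi>. F ((\<chi> v. qtr_sq (\<Phi> v) / 2) + (\<Sum>i<sum_list \<nu> div 2. occupation (\<gamma> i)))
             \<partial>gff E C \<kappa> (qherm_space :: (quat ^ 'n ^ 'n) set) qtr_sq)"
      using iso unfolding qribbon_integral_def lincomb_integral_def qtrail_prod_def
      by (simp add: ribbon_weight_4 cong: sum.cong)
  qed
qed

end
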